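(* Let $\theta^*\in\mathrm{interior}(D)$ be a contracting zero of $f(\theta)=\mathbb E[F(\theta,U)]$ and suppose that there exist $H\in\mathbb R^{d\times d}$ and $\lambda\in(0,1]$ with $|f(\theta)-H(\theta-\theta^* )|=\mathcal O(|\theta-\theta^*|^{1+\lambda})$ as $\theta\to\theta^*$. Let $M>1$, $\alpha>1/2$ and suppose that $F_1,F_2,\dots$ are approximations for $F$ of order $(\alpha,1)$ with asymptotic variance $\Gamma\in\mathbb R^{d\times d}\setminus\{0\}$ around $\theta^*$ on scale $M$. Let $\varphi,\rho,\psi$ be reals with $$\frac1{2\alpha-1}<\varphi,\qquad \varphi+1<2(\rho+1),\qquad \Bigl(1-\frac{\lambda}{\lambda+1}(\varphi+1)\Bigr)_+<\psi<1,$$ let $(\alpha_k)_{k\in\mathbb N}$ be a sequence as in condition (BIAS$^*$) of the definition of approximations of order $(\alpha,1)$ (see context), and choose an increasing $\mathbb N$-valued sequence $(s_n)_{n\in\mathbb N}$ with $$M^{-\alpha_{s_n}s_n}=o\bigl(n^{-\frac{\varphi+1}2}\sqrt{\log n}\bigr)\qquad\text{and}\qquad \alpha s_n\sim\log_M n^{\frac{\varphi+1}2}.$$ For a parameter $\kappa_K>0$ let $(\bar\theta_n)_{n\in\mathbb N_0}$ be the output of the multilevel stochastic approximation algorithm (see context, with $\beta=1$) with parameters $$\gamma_n=n^{-\psi},\quad K_n=\kappa_K(\varphi+1)n^\varphi,\quad s_n\quad\text{and}\quad b_n=n^\rho.$$ Then on $\{\theta_n\to\theta^*\}$ $$\frac1{\varepsilon_n^{\mathrm{diff}}}(\bar\theta_n-\theta^*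 )\Rightarrow\mathcal N\bigl(0,H^{-1}\Gamma(H^{-1})^\dagger\bigr),$$ where $$\varepsilon_n^{\mathrm{diff}}=\frac1{\sqrt{2\alpha\kappa_K}}\,\frac{\frac{\rho+1}{\varphi+1}}{\sqrt{2\frac{\rho+1}{\varphi+1}-1}}\,n^{-\frac{\varphi+1}2}\sqrt{\log_Mn^{\varphi+1}}.$$ Supposing further that $C_1,C_2,\dots$ are cost functions of scale $M$ with constant $\kappa_C>0$ around $\theta^*$, one has in terms of $\mathrm{cost}_n$, on $\{\theta_n\to\theta^*\}$, $$\varepsilon_n^{\mathrm{diff}}\sim\frac{\sqrt{\kappa_C}}{2\alpha}\,\frac{\frac{\rho+1}{\varphi+1}}{\sqrt{2\frac{\rho+1}{\varphi+1}-1}}\,\frac{\log_M\mathrm{cost}_n}{\sqrt{\mathrm{cost}_n}}.$$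
   Context: Setting: $D\subset\mathbb R^d$ is closed; $U$ is a random variable with values in a measurable space $\mathcal U$; $F:D\times\mathcal U\to\mathbb R^d$ is product measurable such that $f(\theta)=\mathbb E[F(\theta,U)]$ is well-defined for all $\theta\in D$. $\Pi:\mathbb R^d\to D$ is a measurable function that is the identity on $D$ and maps $D^c$ into $\partial D$. Contracting zero: a zero $\theta^*$ of $f$ in the interior of $D$ is contracting if there is a matrix $H\in\mathbb R^{d\times d}$ all of whose eigenvalues have strictly negative real part with $f(\theta)=H(\theta-\theta^* )+o(|\theta-\theta^*|)$ as $\theta\to\theta^*$ (this is the same $H$ as in the claim). Approximations of order $(\alpha,1)$: for every $k\in\mathbb N$ let $F_k:D\times\mathcal U\to\mathbb R^d$ be product measurable with $F_k(\theta,U)$ integrable for every $\theta\in D$; put $F_0:=0$. For $\theta^*\in D$, $\alpha>0$, $M>1$, $\Gamma\in\mathbb R^{d\times d}$, the $F_1,F_2,\dots$ are called approximations for $F$ of order $(\alpha,1)$ with asymptotic variance $\Gamma$ around $\theta^*$ on scale $M$ if (BIAS$^*$) there is a sequence $(\alpha_k)_{k\in\mathbb N}$ tending to $\alpha$ such that $\limsup_{\theta\to\theta^*,k\to\infty}M^{\alpha_kk}|\mathbb E[F_k(\theta,U)]-f(\theta)|<\infty$; (VAR) $\lim_{\theta\to\theta^*,k\to\infty}M^{k}\,\mathrm{cov}(F_k(\theta,U)-F_{k-1}(\theta,U))=\Gamma$; (TAIL) there exist $q>2$, a neighbourhood $D_{\theta^*}$ of $\theta^*$ and a constant $C_{\mathrm{TAIL}}$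 such that for all $\theta\in D_{\theta^*}$ and $k\in\mathbb N$, $\mathbb E\bigl[\|F_k(\theta,U)-F_{k-1}(\theta,U)-\mathbb E[F_k(\theta,U)-F_{k-1}(\theta,U)]\|^q\bigr]^{2/q}\le C_{\mathrm{TAIL}}M^{-k}$. Cost functions: measurable functions $C_k:D\to(0,\infty)$ $(k\in\mathbb N)$ are cost functions of scale $M$ with constant $\kappa_C$ around $\theta^*$ if $\lim_{\theta\to\theta^*,k\to\infty}M^{-k}C_k(\theta)=\kappa_C$ and there are a neighbourhood $D_{\theta^*}$ of $\theta^*$ and a constant $C_{\mathrm{COST}}$ with $C_k(\theta)\le C_{\mathrm{COST}}M^k$ for all $\theta\in D_{\theta^*}$, $k\in\mathbb N$. Multilevel stochastic approximation algorithm (case $\beta=1$) with parameter tuple $((\gamma_n),(K_n),(s_n),(b_n))$, where $(\gamma_n)$ is a monotonically decreasing $(0,\infty)$-valued sequence, $(K_n)$ and $(b_n)$ are $(0,\infty)$-valued and $(s_n)$ is $\mathbb N$-valued: for $K>0$, $k\in\mathbb N$ let $N_k(K)=\lceil KM^{-k}\rceil$, and for $s\in\mathbb N$, a $\mathcal U$-valued family $\mathbf u=(u_{k,l})_{k,l\in\mathbb N}$ and $\theta\in D$ let $$Z(\mathbf u;\theta,s,K)=\sum_{k=1}^s\frac1{N_k(K)}\sum_{l=1}^{N_k(K)}\bigl(F_k(\theta,u_{k,l})-F_{k-1}(\theta,u_{k,l})\bigr).$$ Let $\mathbb U=(U_{k,l})_{k,l\in\mathbb N}$ be a family of independent copies of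 $U$ and $(\mathbb U_n)_{n\in\mathbb N}$ a sequence of independent copies of $\mathbb U$. For given $\theta_0\in D$ define $\theta_n=\Pi(\theta_{n-1}+\gamma_nZ(\mathbb U_n;\theta_{n-1},s_n,K_n))$ for $n\in\mathbb N$. The output is $\bar\theta_n=\frac1{\bar b_n}\sum_{k=1}^nb_k\theta_k$ with $\bar b_n=\sum_{k=1}^nb_k$, and the cost is $\mathrm{cost}_n=\sum_{m=1}^n\sum_{k=1}^{s_m}N_k(K_m)\,C_k(\theta_{m-1})$. Notation: $x_+=\max(x,0)$; $A^\dagger$ is the transpose of $A$; $a_n\sim b_n$ means $a_n/b_n\to1$ (for random sequences on an event: almost surely on it). For an event $A$, "$X_n\Rightarrow\nu$ on $A$" means $\mathbb E[1_Ag(X_n)]\to\mathbb P(A)\int g\,d\nu$ for all bounded continuous $g$ (i.e. convergence in law under $\mathbb P(\cdot|A)$ if $\mathbb P(A)>0$). *)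

theory Defs
  imports "HOL-Probability.Probability" "HOL-Library.Landau_Symbols"
begin

text \<open>
  The index set of levels and of steps is \<open>{1, 2, \<dots>}\<close>. Sequences are functions on \<^typ>\<open>nat\<close>
  whose value at 0 is ignored; only the iterates start at 0. Functions on \<open>D\<close> are total
  functions whose values outside \<open>D\<close> are ignored.
\<close>

subsection \<open>Linear algebra and probability\<close>

definition complex_eigenvalue :: "real^'d^'d \<Rightarrow> complex \<Rightarrow> bool" where
  "complex_eigenvalue H \<mu> \<longleftrightarrow>
     (\<exists>v :: complex^'d. v \<noteq> 0 \<and> map_matrix complex_of_real H *v v = \<mu> *s v)"

definition cov_matrix :: "'w measure \<Rightarrow> ('w \<Rightarrow> real^'d) \<Rightarrow> real^'d^'d" where
  "cov_matrix P X =
     (\<chi> i j. \<integral>\<omega>. (X \<omega> $ i - (\<integral>\<omega>'. X \<omega>' $ i \<partial>P)) * (X \<omega> $ j - (\<integral>\<omega>'. X \<omega>' $ j \<partial>P)) \<partial>P)"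

definition std_gaussian :: "(real^'d) measure" where
  "std_gaussian = density lborel (\<lambda>x. ennreal (\<Prod>i\<in>UNIV. std_normal_density (x $ i)))"

text \<open>
  The normal law \<open>N(m, \<Sigma>)\<close> is the law of \<open>m + A Z\<close> for \<open>Z\<close> standard Gaussian and any square
  matrix \<open>A\<close> with \<open>A A\<^sup>T = \<Sigma>\<close>. Such an \<open>A\<close> exists iff \<open>\<Sigma>\<close> is symmetric and positive
  semidefinite, and the law does not depend on its choice. Singular \<open>\<Sigma>\<close> are allowed.
\<close>
definition gaussian :: "real^'d \<Rightarrow> real^'d^'d \<Rightarrow> (real^'d) measure" where
  "gaussian m \<Sigma> =
     (let A = (SOME A :: real^'d^'d. A ** transpose A = \<Sigma>)
      in distr std_gaussian borel (\<lambda>z. m + A *v z))"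

definition conv_in_law_on ::
  "'w measure \<Rightarrow> 'w set \<Rightarrow> (nat \<Rightarrow> 'w \<Rightarrow> 'a::topological_space) \<Rightarrow> 'a measure \<Rightarrow> bool" where
  "conv_in_law_on P A X \<nu> \<longleftrightarrow>
     (\<forall>g :: 'a \<Rightarrow> real. continuous_on UNIV g \<and> bounded (range g) \<longrightarrow>
        (\<lambda>n. \<integral>\<omega>. indicator A \<omega> * g (X n \<omega>) \<partial>P) \<longlonglongrightarrow> measure P A * (\<integral>x. g x \<partial>\<nu>))"

subsection \<open>The zero of the mean field\<close>

definition param_measurable :: "(real^'d) set \<Rightarrow> 'u measure \<Rightarrow> (real^'d \<Rightarrow> 'u \<Rightarrow> real^'d) \<Rightarrow> bool" where
  "param_measurable D \<U> G \<longleftrightarrow>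
     (\<lambda>(\<theta>, u). G \<theta> u) \<in> borel_measurable (restrict_space borel D \<Otimes>\<^sub>M \<U>)"

definition mean_field ::
  "'w measure \<Rightarrow> ('w \<Rightarrow> 'u) \<Rightarrow> (real^'d \<Rightarrow> 'u \<Rightarrow> real^'d) \<Rightarrow> real^'d \<Rightarrow> real^'d" where
  "mean_field P U G \<theta> = (\<integral>\<omega>. G \<theta> (U \<omega>) \<partial>P)"

definition contracting_zero ::
  "(real^'d) set \<Rightarrow> (real^'d \<Rightarrow> real^'d) \<Rightarrow> real^'d^'d \<Rightarrow> real^'d \<Rightarrow> bool" where
  "contracting_zero D f H \<theta>s \<longleftrightarrow>
     \<theta>s \<in> interior D \<and> f \<theta>s = 0 \<and>
     (\<forall>\<mu>. complex_eigenvalue H \<mu> \<longrightarrow> Re \<mu> < 0) \<and>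
     (\<lambda>\<theta>. norm (f \<theta> - H *v (\<theta> - \<theta>s))) \<in> o[at \<theta>s within D](\<lambda>\<theta>. norm (\<theta> - \<theta>s))"

subsection \<open>Approximations of order \<open>(\<alpha>, 1)\<close> and cost functions\<close>

text \<open>
  The filter for the joint limit \<open>\<theta> \<rightarrow> \<theta>*\<close>, \<open>k \<rightarrow> \<infinity>\<close>, with \<open>\<theta>\<close> in \<open>D\<close>. The value \<open>\<theta> = \<theta>*\<close>
  is not excluded: the iterates may hit \<open>\<theta>*\<close>, so the conditions must cover it.
\<close>
definition joint_limit :: "(real^'d) set \<Rightarrow> real^'d \<Rightarrow> ((real^'d) \<times> nat) filter" where
  "joint_limit D \<theta>s = inf (nhds \<theta>s) (principal D) \<times>\<^sub>F sequentially"

text \<open>The increment \<open>F\<^sub>k - F\<^sub>k\<^sub>-\<^sub>1\<close>, with \<open>F\<^sub>0 = 0\<close>.\<close>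
definition level_diff :: "(nat \<Rightarrow> real^'d \<Rightarrow> 'u \<Rightarrow> real^'d) \<Rightarrow> nat \<Rightarrow> real^'d \<Rightarrow> 'u \<Rightarrow> real^'d" where
  "level_diff Fk k \<theta> u = Fk k \<theta> u - (if k = 1 then 0 else Fk (k - 1) \<theta> u)"

definition bias_condition ::
  "'w measure \<Rightarrow> ('w \<Rightarrow> 'u) \<Rightarrow> (real^'d) set \<Rightarrow> (real^'d \<Rightarrow> 'u \<Rightarrow> real^'d)
   \<Rightarrow> (nat \<Rightarrow> real^'d \<Rightarrow> 'u \<Rightarrow> real^'d) \<Rightarrow> real^'d \<Rightarrow> real \<Rightarrow> real \<Rightarrow> (nat \<Rightarrow> real) \<Rightarrow> bool" where
  "bias_condition P U D F Fk \<theta>s M \<alpha> alphas \<longleftrightarrow>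
     alphas \<longlonglongrightarrow> \<alpha> \<and>
     Limsup (joint_limit D \<theta>s)
       (\<lambda>(\<theta>, k). ereal (M powr (alphas k * real k) * norm (mean_field P U (Fk k) \<theta> - mean_field P U F \<theta>)))
       < \<infinity>"

definition var_condition ::
  "'w measure \<Rightarrow> ('w \<Rightarrow> 'u) \<Rightarrow> (real^'d) set
   \<Rightarrow> (nat \<Rightarrow> real^'d \<Rightarrow> 'u \<Rightarrow> real^'d) \<Rightarrow> real^'d \<Rightarrow> real \<Rightarrow> real^'d^'d \<Rightarrow> bool" where
  "var_condition P U D Fk \<theta>s M \<Gamma> \<longleftrightarrow>
     ((\<lambda>(\<theta>, k). M ^ k *\<^sub>R cov_matrix P (\<lambda>\<omega>. level_diff Fk k \<theta> (U \<omega>))) \<longlongrightarrow> \<Gamma>) (joint_limit D \<theta>s)"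

text \<open>
  Integrability is required explicitly because the Bochner integral of a non-integrable
  function is 0. It also makes the covariances in \<open>var_condition\<close> meaningful near \<open>\<theta>*\<close>.
\<close>
definition tail_condition ::
  "'w measure \<Rightarrow> ('w \<Rightarrow> 'u) \<Rightarrow> (real^'d) set
   \<Rightarrow> (nat \<Rightarrow> real^'d \<Rightarrow> 'u \<Rightarrow> real^'d) \<Rightarrow> real^'d \<Rightarrow> real \<Rightarrow> bool" where
  "tail_condition P U D Fk \<theta>s M \<longleftrightarrow>
     (\<exists>q V CT. q > 2 \<and> open V \<and> \<theta>s \<in> V \<and>
       (\<forall>\<theta>\<in>V \<inter> D. \<forall>k\<ge>1.
          let Y = (\<lambda>\<omega>. norm (level_diff Fk k \<theta> (U \<omega>) - mean_field P U (level_diff Fk k) \<theta>) powr q)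
          in integrable P Y \<and> (\<integral>\<omega>. Y \<omega> \<partial>P) powr (2 / q) \<le> CT * M powr (- real k)))"

definition approximations ::
  "'w measure \<Rightarrow> 'u measure \<Rightarrow> ('w \<Rightarrow> 'u) \<Rightarrow> (real^'d) set \<Rightarrow> (real^'d \<Rightarrow> 'u \<Rightarrow> real^'d)
   \<Rightarrow> (nat \<Rightarrow> real^'d \<Rightarrow> 'u \<Rightarrow> real^'d) \<Rightarrow> real^'d \<Rightarrow> real \<Rightarrow> real \<Rightarrow> real^'d^'d \<Rightarrow> bool" where
  "approximations P \<U> U D F Fk \<theta>s M \<alpha> \<Gamma> \<longleftrightarrow>
     (\<forall>k\<ge>1. param_measurable D \<U> (Fk k) \<and> (\<forall>\<theta>\<in>D. integrable P (\<lambda>\<omega>. Fk k \<theta> (U \<omega>)))) \<and>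
     (\<exists>alphas. bias_condition P U D F Fk \<theta>s M \<alpha> alphas) \<and>
     var_condition P U D Fk \<theta>s M \<Gamma> \<and>
     tail_condition P U D Fk \<theta>s M"

definition cost_functions ::
  "(real^'d) set \<Rightarrow> (nat \<Rightarrow> real^'d \<Rightarrow> real) \<Rightarrow> real^'d \<Rightarrow> real \<Rightarrow> real \<Rightarrow> bool" where
  "cost_functions D C \<theta>s M \<kappa>C \<longleftrightarrow>
     (\<forall>k\<ge>1. C k \<in> borel_measurable (restrict_space borel D) \<and> (\<forall>\<theta>\<in>D. C k \<theta> > 0)) \<and>
     ((\<lambda>(\<theta>, k). M powr (- real k) * C k \<theta>) \<longlongrightarrow> \<kappa>C) (joint_limit D \<theta>s) \<and>
     (\<exists>V CC. open V \<and> \<theta>s \<in> V \<and> (\<forall>\<theta>\<in>V \<inter> D. \<forall>k\<ge>1. C k \<theta> \<le> CC * M ^ k))"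

subsection \<open>The multilevel stochastic approximation algorithm\<close>

definition level_samples :: "real \<Rightarrow> nat \<Rightarrow> real \<Rightarrow> nat" where
  "level_samples M k K = nat \<lceil>K * M powr (- real k)\<rceil>"

definition multilevel_estimator ::
  "(nat \<Rightarrow> real^'d \<Rightarrow> 'u \<Rightarrow> real^'d) \<Rightarrow> real \<Rightarrow> (nat \<Rightarrow> nat \<Rightarrow> 'u) \<Rightarrow> real^'d \<Rightarrow> nat \<Rightarrow> real \<Rightarrow> real^'d" where
  "multilevel_estimator Fk M u \<theta> s K =
     (\<Sum>k=1..s. (1 / real (level_samples M k K)) *\<^sub>R
        (\<Sum>l=1..level_samples M k K. level_diff Fk k \<theta> (u k l)))"

primrec iterate ::
  "(real^'d \<Rightarrow> real^'d) \<Rightarrow> (nat \<Rightarrow> real^'d \<Rightarrow> 'u \<Rightarrow> real^'d) \<Rightarrow> real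
   \<Rightarrow> (nat \<Rightarrow> real) \<Rightarrow> (nat \<Rightarrow> real) \<Rightarrow> (nat \<Rightarrow> nat) \<Rightarrow> real^'d
   \<Rightarrow> (nat \<Rightarrow> nat \<Rightarrow> nat \<Rightarrow> 'w \<Rightarrow> 'u) \<Rightarrow> nat \<Rightarrow> 'w \<Rightarrow> real^'d" where
  "iterate Proj Fk M \<gamma> K s \<theta>0 UU 0 \<omega> = \<theta>0"
| "iterate Proj Fk M \<gamma> K s \<theta>0 UU (Suc n) \<omega> =
     Proj (iterate Proj Fk M \<gamma> K s \<theta>0 UU n \<omega> +
       \<gamma> (Suc n) *\<^sub>R multilevel_estimator Fk M (\<lambda>k l. UU (Suc n) k l \<omega>)
          (iterate Proj Fk M \<gamma> K s \<theta>0 UU n \<omega>) (s (Suc n)) (K (Suc n)))"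

definition averaged_output ::
  "(nat \<Rightarrow> real) \<Rightarrow> (nat \<Rightarrow> 'w \<Rightarrow> real^'d) \<Rightarrow> nat \<Rightarrow> 'w \<Rightarrow> real^'d" where
  "averaged_output b \<theta> n \<omega> = (1 / (\<Sum>k=1..n. b k)) *\<^sub>R (\<Sum>k=1..n. b k *\<^sub>R \<theta> k \<omega>)"

definition algorithm_cost ::
  "(nat \<Rightarrow> real^'d \<Rightarrow> real) \<Rightarrow> real \<Rightarrow> (nat \<Rightarrow> real) \<Rightarrow> (nat \<Rightarrow> nat)
   \<Rightarrow> (nat \<Rightarrow> 'w \<Rightarrow> real^'d) \<Rightarrow> nat \<Rightarrow> 'w \<Rightarrow> real" where
  "algorithm_cost C M K s \<theta> n \<omega> =
     (\<Sum>m=1..n. \<Sum>k=1..s m. real (level_samples M k (K m)) * C k (\<theta> (m - 1) \<omega>))"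

definition eps_diff :: "real \<Rightarrow> real \<Rightarrow> real \<Rightarrow> real \<Rightarrow> real \<Rightarrow> nat \<Rightarrow> real" where
  "eps_diff M \<alpha> \<kappa>K \<phi> \<rho> n =
     1 / sqrt (2 * \<alpha> * \<kappa>K)
     * (((\<rho> + 1) / (\<phi> + 1)) / sqrt (2 * ((\<rho> + 1) / (\<phi> + 1)) - 1))
     * real n powr (- (\<phi> + 1) / 2) * sqrt (log M (real n powr (\<phi> + 1)))"

end

theory Submission
  imports Defs "HOL-Computational_Algebra.Fundamental_Theorem_Algebra" "HOL-Real_Asymp.Real_Asymp"
begin

text \<open>
  In a ball around \<open>\<theta>s\<close> the mean field contracts in a Lyapunov norm \<open>\<bar>S x\<bar>\<close>. For the iterates
  stopped on leaving the ball this gives \<open>E \<bar>\<theta>\<^sub>k - \<theta>s\<bar>\<^sup>2 = O(k powr -p)\<close> for every \<open>p < \<psi> + \<phi>\<close>.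
  Solving the recursion for \<open>H (\<theta>\<^sub>k - \<theta>s)\<close> writes the weighted sum of the errors as \<open>-H\<^sup>-\<^sup>1\<close>
  times a weighted sum of martingale differences, plus the increments of the iterates, the bias and
  the Taylor remainder. The increments are summed by parts and are negligible once
  \<open>p > 2 \<psi> + \<phi> - 1\<close>; the Taylor remainder is negligible once \<open>p (1 + lam) > \<phi> + 1\<close>. The
  hypotheses on \<open>\<psi>\<close> are exactly what makes such a \<open>p\<close> exist.

  Level \<open>k\<close> of step \<open>n\<close> averages about \<open>K\<^sub>n M\<^sup>-\<^sup>k\<close> samples of covariance about \<open>M\<^sup>-\<^sup>k \<Gamma>\<close>, so each
  of the \<open>s\<^sub>n\<close> levels contributes \<open>\<Gamma> / K\<^sub>n\<close> to the variance, and \<open>\<kappa>\<^sub>C K\<^sub>n\<close> to the cost: this is the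
  origin of the logarithms. The noise is treated by conditional characteristic functions. Since
  the limit law is obtained jointly with every event of the past, it also holds on the event of
  convergence, which past events approximate.
\<close>

subsection \<open>Linear algebra\<close>

text \<open>Two obstacles shape the proof. The raw iterates need not have useful moments, since
  nothing is assumed far from \<open>\<theta>s\<close>; and convergence is decided only in the
  infinite future, so conditioning on it would destroy independence. Hence the adapted paths that
  are reset to \<open>\<theta>s\<close>, and a limit law proved jointly with past events. The
  hypotheses fix the scales. Up to n^o(1), M^s_n is n^((\<phi>+1)/(2\<alpha>)); the lower bound on
  \<phi> makes this negligible against K_n. Then rounding up the sample numbers is harmless even on
  the finest level, and the same ratio drives the Lyapunov condition. The bound \<phi> + 1 <
  2(\<rho>+1) makes the accumulated variance diverge, so every initial stretch is forgotten. All
  error terms but one lose a power of n against the noise. The exception is the bias: it is only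
  small against n^(-(\<phi>+1)/2) sqrt(log n), so there the logarithm in the variance is essential.
  The Lyapunov norm is built from the Euler step I + h H: the squared norm is the sum of all |(I + h
  H)^n x|^2.\<close>

lemma matrix_vector_mult_sum_right:
  fixes A :: "'a::comm_semiring_1^'n^'m"
  shows "A *v (\<Sum>i\<in>I. f i) = (\<Sum>i\<in>I. A *v f i)"
  by (induction I rule: infinite_finite_induct) (auto simp: matrix_vector_right_distrib)

section \<open>Polynomials in a matrix acting on one vector, and decay of the powers of I + h
  H\<close>

definition poly_act :: "'a::field^'n^'n \<Rightarrow> 'a poly \<Rightarrow> 'a^'n \<Rightarrow> 'a^'n" where
  "poly_act A p v = (\<Sum>i\<le>degree p. coeff p i *s (((*v) A ^^ i) v))"

lemma poly_act_le:
  assumes "degree p \<le> n"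
  shows "poly_act A p v = (\<Sum>i\<le>n. coeff p i *s (((*v) A ^^ i) v))"
  unfolding poly_act_def using assms
  by (intro sum.mono_neutral_left) (auto simp: coeff_eq_0 not_le)

lemma poly_act_pCons: "poly_act A (pCons a p) v = a *s v + A *v poly_act A p v"
proof -
  have "poly_act A (pCons a p) v = (\<Sum>i\<le>Suc (degree p). coeff (pCons a p) i *s (((*v) A ^^ i) v))"
    by (rule poly_act_le) (rule degree_pCons_le)
  also have "\<dots> = a *s v + (\<Sum>i\<le>degree p. coeff p i *s (A *v (((*v) A ^^ i) v)))"
    by (subst sum.atMost_Suc_shift) simp
  also have "\<dots> = a *s v + A *v poly_act A p v"
    unfolding poly_act_def by (simp add: matrix_vector_mult_sum_right vector_scalar_commute)
  finally show ?thesis .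
qed

lemma poly_act_add: "poly_act A (p + q) v = poly_act A p v + poly_act A q v"
proof -
  let ?n = "max (degree p) (degree q)"
  show ?thesis
    by (simp add: poly_act_le[of _ ?n] degree_add_le sum.distrib[symmetric] vector_sadd_rdistrib)
qed

lemma poly_act_smult: "poly_act A (smult c p) v = c *s poly_act A p v"
  by (simp add: poly_act_le[of "smult c p" "degree p"] poly_act_le[of p "degree p"] degree_smult_le
      vec.scale_sum_right vector_smult_assoc)

lemma funpow_mult_vec_diff:
  fixes A :: "'a::field^'n^'n"
  shows "((*v) A ^^ i) (x - y) = ((*v) A ^^ i) x - ((*v) A ^^ i) y"
  by (induction i) (auto simp: matrix_vector_mult_diff_distrib)

lemma funpow_mult_vec_smult:
  fixes A :: "'a::field^'n^'n"
  shows "((*v) A ^^ i) (c *s x) = c *s ((*v) A ^^ i) x"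
  by (induction i) (auto simp: vector_scalar_commute)

lemma poly_act_vec:
  "poly_act A p (A *v v - c *s v) = A *v poly_act A p v - c *s poly_act A p v"
  unfolding poly_act_def
  by (simp add: funpow_mult_vec_diff funpow_mult_vec_smult matrix_vector_mult_sum_right
      vec.scale_sum_right sum_subtractf[symmetric] vector_scalar_commute funpow_swap1
      vec.scale_right_diff_distrib mult.commute)

lemma poly_act_linear_factor:
  "poly_act A ([:- c, 1:] * p) v = A *v poly_act A p v - c *s poly_act A p v"
proof -
  have "[:- c, 1:] * p = smult (- c) p + pCons 0 p"
    by simp
  then show ?thesis
    by (simp only: poly_act_add poly_act_smult poly_act_pCons) simp
qed

text \<open>In dimension d the d + 1 vectors v, A v, ..., A^d v are linearly dependent, and the
  coefficients of a dependence are those of the polynomial.\<close>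

lemma exists_annihilating_poly:
  fixes A :: "'a::field^'n^'n"
  shows "\<exists>p. p \<noteq> 0 \<and> poly_act A p v = 0"
proof -
  let ?d = "CARD('n)" and ?f = "\<lambda>i. ((*v) A ^^ i) v"
  have "\<exists>c. (\<exists>i\<le>?d. c i \<noteq> 0) \<and> (\<Sum>i\<le>?d. c i *s ?f i) = 0"
  \<comment> \<open>Dependence is a property of a set of vectors and does not see repetitions. If
    two powers agree on v, the coefficients 1 and -1 give the relation directly.\<close>
  proof (cases "inj_on ?f {..?d}")
    case True
    have "card (?f ` {..?d}) = Suc ?d"
      using card_image[OF True] by simp
    then have "vec.dependent (?f ` {..?d})"
      using vec.independent_card_le_dim[of "?f ` {..?d}" UNIV]
      by (auto simp: vec.dim_UNIV vec.dimension_def card_cart_basis)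
    then obtain u where u: "\<exists>x\<in>?f ` {..?d}. u x \<noteq> 0" "(\<Sum>x\<in>?f ` {..?d}. u x *s x) = 0"
      using vec.dependent_finite[of "?f ` {..?d}"] by auto
    then show ?thesis
      using sum.reindex[OF True, of "\<lambda>x. u x *s x"] by (intro exI[of _ "\<lambda>i. u (?f i)"]) auto
  next
    case False
    then obtain i j where ij: "i \<le> ?d" "j \<le> ?d" "i \<noteq> j" "?f i = ?f j"
      unfolding inj_on_def by auto
    let ?c = "\<lambda>k. if k = i then 1 else if k = j then -1 else 0 :: 'a"
    have "(\<Sum>k\<le>?d. ?c k *s ?f k) = (\<Sum>k\<in>{i, j}. ?c k *s ?f k)"
      using ij by (intro sum.mono_neutral_right) auto
    also have "\<dots> = 0"
      using ij by simp
    finally show ?thesis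
      using ij by (intro exI[of _ ?c]) auto
  qed
  then obtain c i where c: "i \<le> ?d" "c i \<noteq> 0" "(\<Sum>i\<le>?d. c i *s ?f i) = 0"
    by blast
  define p where "p = (\<Sum>k\<le>?d. monom (c k) k)"
  have coeff: "coeff p k = (if k \<le> ?d then c k else 0)" for k
    by (simp add: p_def coeff_sum)
  have "degree p \<le> ?d"
    by (rule degree_le) (simp add: coeff)
  then have "poly_act A p v = 0"
    using c by (simp add: poly_act_le[of p ?d] coeff)
  moreover have "p \<noteq> 0"
    using c coeff by (metis coeff_0)
  ultimately show ?thesis by blast
qed

text \<open>If the forcing decays at the same rate as the powers of \<open>\<mu>\<close>, the
  solution is of order n r^n. The rate r' is therefore taken strictly above |\<mu>|; then K can be
  chosen with |C| \<le> K (r' - |\<mu>|), which closes the induction.\<close>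

lemma geometric_recursion_bound:
  fixes a b :: "nat \<Rightarrow> 'a \<Rightarrow> complex"
  assumes "cmod \<mu> < 1" "0 \<le> r" "r < 1"
    and b: "\<And>n i. cmod (b n i) \<le> C * r ^ n"
    and a: "\<And>n i. a (Suc n) i = \<mu> * a n i + b n i" and a0: "\<And>i. cmod (a 0 i) \<le> K0"
  shows "\<exists>C r. 0 \<le> r \<and> r < 1 \<and> (\<forall>n i. cmod (a n i) \<le> C * r ^ n)"
proof -
  define r' where "r' = max r ((1 + cmod \<mu>) / 2)"
  define K where "K = max K0 (\<bar>C\<bar> / (r' - cmod \<mu>))"
  have r': "cmod \<mu> < r'" "r \<le> r'" "r' < 1" "0 \<le> r'"
    using assms by (auto simp: r'_def less_max_iff_disj)
  have K: "\<bar>C\<bar> \<le> K * (r' - cmod \<mu>)"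
    using r' by (simp add: K_def field_simps max_def)
      
  have "cmod (a n i) \<le> K * r' ^ n" for n i
  proof (induction n)
    case 0
    then show ?case using a0[of i] by (simp add: K_def)
  next
    case (Suc n)
    have "C * r ^ n \<le> \<bar>C\<bar> * r' ^ n"
      using assms r' by (intro mult_mono power_mono) auto
    then have "cmod (a (Suc n) i) \<le> cmod \<mu> * (K * r' ^ n) + \<bar>C\<bar> * r' ^ n"
      using norm_triangle_ineq[of "\<mu> * a n i" "b n i"] b[of n i]
        mult_left_mono[OF Suc, of "cmod \<mu>"] by (simp add: a norm_mult)
    also have "\<dots> \<le> cmod \<mu> * (K * r' ^ n) + K * (r' - cmod \<mu>) * r' ^ n"
      using K r' by (intro add_left_mono mult_right_mono) auto
    also have "\<dots> = K * r' ^ Suc n"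
      by (simp add: algebra_simps)
    finally show ?case .
  qed
  then show ?thesis using r' by blast
qed

text \<open>Split off a root, p = (X - \<mu>) q. Either q already annihilates v, or q(H) v is an
  eigenvector for \<mu> and so |1 + h \<mu>| < 1. In the second case q annihilates y = H v - \<mu>
  v, whose iterates decay by induction, and T^(n+1) v = (1 + h \<mu>) T^n v + h T^n y. The
  hypothesis on roots is restricted to eigenvalues because p may have roots that are not.\<close>

lemma geometric_decay_of_annihilated:
  fixes H :: "complex^'n^'n" and h :: complex
  assumes "p \<noteq> 0" "poly_act H p v = 0"
    and "\<And>\<mu> z. poly p \<mu> = 0 \<Longrightarrow> z \<noteq> 0 \<Longrightarrow> H *v z = \<mu> *s z \<Longrightarrow> cmod (1 + h * \<mu>) < 1"
  shows "\<exists>C r. 0 \<le> r \<and> r < 1 \<and> (\<forall>n i. cmod ((((\<lambda>x. x + h *s (H *v x)) ^^ n) v) $ i) \<le> C * r ^ n)"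
  using assms
proof (induction "degree p" arbitrary: p v rule: less_induct)
  case less
  let ?T = "\<lambda>x. x + h *s (H *v x)"
  show ?case
  proof (cases "degree p = 0")
    case True
    then obtain c where c: "p = [:c:]" "c \<noteq> 0"
      using less.prems(1) by (metis degree_eq_zeroE pCons_0_0)
    then have "v = 0"
      using less.prems(2) by (simp add: poly_act_def)
    moreover have "(?T ^^ n) 0 = 0" for n
      by (induction n) auto
    ultimately show ?thesis
      by (intro exI[of _ 0]) auto
  next
    case False
    then obtain \<mu> where "poly p \<mu> = 0"
      using fundamental_theorem_of_algebra constant_degree by metis
    then obtain q where q: "p = [:- \<mu>, 1:] * q"
      by (metis dvdE poly_eq_0_iff_dvd)
    have q0: "q \<noteq> 0" and deg: "degree q < degree p"
      using less.prems(1) degree_mult_eq[of "[:- \<mu>, 1:]" q] unfolding q by (auto simp del: mult_pCons_left)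
    have rt: "\<And>\<nu> z. poly q \<nu> = 0 \<Longrightarrow> z \<noteq> 0 \<Longrightarrow> H *v z = \<nu> *s z \<Longrightarrow> cmod (1 + h * \<nu>) < 1"
      using less.prems(3) q by auto
    let ?z = "poly_act H q v"
    show ?thesis
    proof (cases "?z = 0")
      case True
      show ?thesis
        by (rule less.hyps[OF deg q0 True rt])
    next
      case False
      have z: "H *v ?z = \<mu> *s ?z"
        using less.prems(2) unfolding q poly_act_linear_factor by simp
      then have \<mu>: "cmod (1 + h * \<mu>) < 1"
        using less.prems(3)[of \<mu> ?z] False \<open>poly p \<mu> = 0\<close> by blast
      let ?y = "H *v v - \<mu> *s v"
      have "poly_act H q ?y = 0"
        by (simp add: poly_act_vec z)
      have "\<exists>C r. 0 \<le> r \<and> r < 1 \<and> (\<forall>n i. cmod (((?T ^^ n) ?y) $ i) \<le> C * r ^ n)"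
        by (rule less.hyps[OF deg q0 \<open>poly_act H q ?y = 0\<close> rt])
      then obtain C r where "0 \<le> r \<and> r < 1 \<and> (\<forall>n i. cmod (((?T ^^ n) ?y) $ i) \<le> C * r ^ n)"
        by (elim exE)
      then have Cr: "0 \<le> r" "r < 1" "cmod (((?T ^^ n) ?y) $ i) \<le> C * r ^ n" for n i
        by auto
      have T: "(?T ^^ n) (x + c *s y) = (?T ^^ n) x + c *s (?T ^^ n) y" for n x y c
        by (induction n) (auto simp: matrix_vector_right_distrib vector_scalar_commute
            vector_add_ldistrib vector_smult_assoc mult.commute)
      have step: "(?T ^^ Suc n) v = (1 + h * \<mu>) *s (?T ^^ n) v + h *s (?T ^^ n) ?y" for n
      proof -
        have "?T v = (v + (h * \<mu>) *s v) + h *s ?y"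
          by (simp add: vec.scale_right_diff_distrib vector_smult_assoc)
        then have "(?T ^^ Suc n) v = (?T ^^ n) ((v + (h * \<mu>) *s v) + h *s ?y)"
          unfolding funpow_Suc_right o_apply by (rule arg_cong)
        also have "\<dots> = ((?T ^^ n) v + (h * \<mu>) *s (?T ^^ n) v) + h *s (?T ^^ n) ?y"
          by (simp only: T)
        finally show ?thesis
          by (simp add: vector_sadd_rdistrib)
      qed
      have 1: "((?T ^^ Suc n) v) $ i = (1 + h * \<mu>) * ((?T ^^ n) v) $ i + h * ((?T ^^ n) ?y) $ i" for n i
        by (simp only: step vector_add_component vector_smult_component)
      have 2: "cmod (h * ((?T ^^ n) ?y) $ i) \<le> (cmod h * C) * r ^ n" for n i
        using Cr(3)[of n i] by (simp add: norm_mult mult.assoc mult_left_mono)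
      have 3: "cmod (((?T ^^ 0) v) $ i) \<le> norm v" for i
        by (simp add: Finite_Cartesian_Product.norm_nth_le)
      show ?thesis
        by (rule geometric_recursion_bound[OF \<mu> Cr(1,2), where b = "\<lambda>n i. h * ((?T ^^ n) ?y) $ i"
            and a = "\<lambda>n i. ((?T ^^ n) v) $ i", OF 2 1 3])
    qed
  qed
qed

text \<open>|1 + h \<mu>|^2 = 1 + h (2 Re \<mu> + h |\<mu>|^2), which is below 1 for small h > 0;
  finiteness of R gives a common h.\<close>

lemma exists_contracting_step:
  fixes R :: "complex set"
  assumes "finite R" "\<And>\<mu>. \<mu> \<in> R \<Longrightarrow> Re \<mu> < 0"
  shows "\<exists>h>0. \<forall>\<mu>\<in>R. cmod (1 + of_real h * \<mu>) < 1"
proof -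
  have "eventually (\<lambda>h::real. cmod (1 + of_real h * \<mu>) < 1) (at_right 0)" if "\<mu> \<in> R" for \<mu>
  proof -
    have "eventually (\<lambda>h. h < - 2 * Re \<mu> / (cmod \<mu>)\<^sup>2) (at_right 0)"
      using assms(2)[OF that] by (intro eventually_at_right_less order_tendstoD(2)[OF tendsto_ident_at])
        (use assms(2)[OF that] in \<open>auto intro!: divide_neg_pos\<close>)
    then show ?thesis
      using eventually_at_right_less[of 0]
    proof eventually_elim
      case (elim h)
      have "cmod \<mu> \<noteq> 0" using assms(2)[OF that] by auto
      then have "h * (cmod \<mu>)\<^sup>2 < - 2 * Re \<mu>"
        using elim(1) pos_less_divide_eq[of "(cmod \<mu>)\<^sup>2" h "- 2 * Re \<mu>"] by simp
      then have "h * (h * (cmod \<mu>)\<^sup>2) < h * (- 2 * Re \<mu>)"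
        using elim by (intro mult_strict_left_mono) auto
      then have "(cmod (1 + of_real h * \<mu>))\<^sup>2 < 1"
        unfolding cmod_power2 by (simp add: power2_eq_square algebra_simps)
      then show ?case
        by (simp add: power_less_one_iff abs_square_less_1)
    qed
  qed
  then have "eventually (\<lambda>h::real. \<forall>\<mu>\<in>R. cmod (1 + of_real h * \<mu>) < 1) (at_right 0)"
    using assms(1) by (intro eventually_ball_finite) auto
  then have "eventually (\<lambda>h::real. h > 0 \<and> (\<forall>\<mu>\<in>R. cmod (1 + of_real h * \<mu>) < 1)) (at_right 0)"
    using eventually_at_right_less[of 0] by eventually_elim auto
  then show ?thesis
    using eventually_happens[of _ "at_right (0::real)"] trivial_limit_at_right_real by blast
qed

definition cvec :: "real^'n \<Rightarrow> complex^'n" where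
  "cvec x = (\<chi> i. complex_of_real (x $ i))"

lemma cvec_step:
  "cvec x + of_real h *s (map_matrix complex_of_real H *v cvec x) = cvec (x + h *\<^sub>R (H *v x))"
  by (simp add: cvec_def vec_eq_iff matrix_vector_mult_def map_matrix_def)

lemma real_geometric_decay:
  fixes H :: "real^'n^'n"
  assumes "\<And>\<mu>. complex_eigenvalue H \<mu> \<Longrightarrow> Re \<mu> < 0"
  shows "\<exists>h>0. \<forall>j. \<exists>C r. 0 \<le> r \<and> r < 1 \<and>
    (\<forall>n i. \<bar>(((\<lambda>x. x + h *\<^sub>R (H *v x)) ^^ n) (axis j 1)) $ i\<bar> \<le> C * r ^ n)"
proof -
  let ?H = "map_matrix complex_of_real H"
  have "\<forall>j. \<exists>p. p \<noteq> 0 \<and> poly_act ?H p (cvec (axis j 1)) = 0"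
    by (intro allI exists_annihilating_poly)
  from choice[OF this] obtain p
    where "\<forall>j. p j \<noteq> 0 \<and> poly_act ?H (p j) (cvec (axis j 1)) = 0" ..
  then have p: "p j \<noteq> 0" "poly_act ?H (p j) (cvec (axis j 1)) = 0" for j
    by auto
  \<comment> \<open>One h must serve all basis vectors. Keeping only the eigenvalues that are roots
    of one of the chosen polynomials makes the set visibly finite.\<close>
  define R where "R = {\<mu>. complex_eigenvalue H \<mu> \<and> (\<exists>j. poly (p j) \<mu> = 0)}"
  have "finite (\<Union>j. {\<mu>. poly (p j) \<mu> = 0})"
    using p poly_roots_finite by auto
  then have "finite R"
    by (rule rev_finite_subset) (auto simp: R_def)
  then obtain h where h: "h > 0" "\<forall>\<mu>\<in>R. cmod (1 + of_real h * \<mu>) < 1"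
    using exists_contracting_step[of R] assms unfolding R_def by blast
  have iter: "((\<lambda>x. x + of_real h *s (?H *v x)) ^^ n) (cvec x) = cvec (((\<lambda>x. x + h *\<^sub>R (H *v x)) ^^ n) x)" for n x
    by (induction n) (auto simp: cvec_step)
  have decay: "\<exists>C r. 0 \<le> r \<and> r < 1 \<and>
    (\<forall>n i. cmod ((((\<lambda>x. x + of_real h *s (?H *v x)) ^^ n) (cvec (axis j 1))) $ i) \<le> C * r ^ n)" for j
  proof (rule geometric_decay_of_annihilated[OF p(1)[of j] p(2)[of j]])
    fix \<mu> z assume "poly (p j) \<mu> = 0" "z \<noteq> 0" "?H *v z = \<mu> *s z"
    then have "\<mu> \<in> R" unfolding R_def complex_eigenvalue_def by blast
    then show "cmod (1 + of_real h * \<mu>) < 1" using h by blast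
  qed
  have norm_cvec: "cmod (cvec x $ i) = \<bar>x $ i\<bar>" for x :: "real^'n" and i
    by (simp add: cvec_def)
  show ?thesis
  proof (rule exI[of _ h], intro conjI allI h(1))
    fix j
    show "\<exists>C r. 0 \<le> r \<and> r < 1 \<and>
      (\<forall>n i. \<bar>(((\<lambda>x. x + h *\<^sub>R (H *v x)) ^^ n) (axis j 1)) $ i\<bar> \<le> C * r ^ n)"
      using decay[of j] unfolding iter norm_cvec .
  qed
qed

section \<open>Factorisation of positive semidefinite matrices\<close>

lemma inner_transpose_mult:
  fixes A :: "real^'n^'m"
  shows "x \<bullet> (transpose A *v y) = (A *v x) \<bullet> y"
  by (metis dot_lmul_matrix inner_commute transpose_matrix_vector)

text \<open>With w = G v, the form at v + t w equals 2 t |w|^2 + t^2 (w . G w), because v . G v = 0.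
  Unless w = 0 this is negative for small negative t.\<close>

lemma quadratic_form_zero_imp_zero:
  fixes G :: "real^'n^'n"
  assumes sym: "transpose G = G" and psd: "\<And>x. 0 \<le> x \<bullet> (G *v x)" and 0: "v \<bullet> (G *v v) = 0"
  shows "G *v v = 0"
proof -
  let ?w = "G *v v"
  have swap: "x \<bullet> (G *v y) = (G *v x) \<bullet> y" for x y
    using inner_transpose_mult[of x G y] by (simp add: sym)
  define a where "a = ?w \<bullet> ?w"
  define b where "b = ?w \<bullet> (G *v ?w)"
  have ineq: "0 \<le> 2 * t * a + t\<^sup>2 * b" for t
  proof -
    have "(v + t *\<^sub>R ?w) \<bullet> (G *v (v + t *\<^sub>R ?w)) = 2 * t * a + t\<^sup>2 * b"
      using 0 by (simp add: matrix_vector_right_distrib matrix_vector_mult_scaleR inner_add_left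
          inner_add_right a_def b_def power2_eq_square swap algebra_simps)
    then show ?thesis using psd by metis
  qed
  have "a \<le> 0"
  proof (rule ccontr)
    assume "\<not> a \<le> 0"
    then have a: "a > 0" by simp
    have b: "b \<ge> 0" using psd by (simp add: b_def)
    \<comment> \<open>Any positive t below 2 a / b would do; adding 1 covers b = 0.\<close>
    define t where "t = a / (b + 1)"
    have t: "a = t * (b + 1)" "t > 0" using a b by (auto simp: t_def)
    have "2 * (- t) * a + (- t)\<^sup>2 * b = t\<^sup>2 * (- (b + 2))"
      unfolding t(1) by (simp add: algebra_simps power2_eq_square)
    also have "\<dots> < 0"
      using t b by (intro mult_pos_neg) auto
    finally have "\<not> 0 \<le> 2 * (- t) * a + (- t)\<^sup>2 * b"
      by (simp only: not_le)
    then show False using ineq[of "- t"] by (rule notE)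
  qed
  then have "?w \<bullet> ?w = 0"
    using inner_ge_zero[of ?w] unfolding a_def by (rule antisym)
  then show ?thesis by simp
qed

text \<open>One step of a Cholesky factorisation: with w = G e_j / sqrt(G_jj), subtracting w w^T
  clears row j. If G_jj = 0, then G e_j already vanishes and w = 0 works. Rows that were zero stay
  zero, so the step can be repeated over all indices.\<close>

lemma psd_deflation:
  fixes G :: "real^'n^'n"
  assumes sym: "transpose G = G" and psd: "\<And>x. 0 \<le> x \<bullet> (G *v x)"
  shows "\<exists>w :: real^'n. let G' = (\<chi> i k. G $ i $ k - w $ i * w $ k) in
    transpose G' = G' \<and> (\<forall>x. 0 \<le> x \<bullet> (G' *v x)) \<and> G' $ j = 0 \<and> (\<forall>i. G $ i = 0 \<longrightarrow> G' $ i = 0)"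
proof -
  let ?e = "axis j 1 :: real^'n"
  have Gs: "G $ i $ k = G $ k $ i" for i k
    using arg_cong[OF sym, of "\<lambda>M. M $ k $ i"] by (simp add: transpose_def)
  have Ge: "(G *v ?e) $ i = G $ i $ j" for i
    by (simp add: matrix_vector_mult_basis column_def)
  have swap: "x \<bullet> (G *v y) = (G *v x) \<bullet> y" for x y
    using inner_transpose_mult[of x G y] by (simp add: sym)
  have eGe: "?e \<bullet> (G *v ?e) = G $ j $ j"
    by (simp add: inner_axis' Ge)
  show ?thesis
  proof (cases "G $ j $ j = 0")
    case True
    then have "G *v ?e = 0"
      using quadratic_form_zero_imp_zero[OF sym psd] eGe by metis
    then have "G $ j = 0"
      using Ge Gs by (simp add: vec_eq_iff)
    then show ?thesis
      using assms by (intro exI[of _ 0]) (simp add: vec_lambda_eta)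
  next
    case False
    then have pos: "G $ j $ j > 0"
      using psd[of ?e] eGe by simp
    define w where "w = (1 / sqrt (G $ j $ j)) *\<^sub>R (G *v ?e)"
    define G' where "G' = (\<chi> i k. G $ i $ k - w $ i * w $ k)"
    have w: "w $ i = G $ i $ j / sqrt (G $ j $ j)" for i
      by (simp add: w_def Ge)
    have Gv: "G' *v x = G *v x - (w \<bullet> x) *\<^sub>R w" for x
      by (simp add: vec_eq_iff G'_def matrix_vector_mult_def inner_vec_def left_diff_distrib
          sum_subtractf sum_distrib_left algebra_simps)
    have "G' $ j $ k = 0" for k
    proof -
      have "w $ j * w $ k = G $ k $ j"
        using pos by (simp add: w)
      then show ?thesis
        using Gs[of k j] by (simp add: G'_def)
    qed
    then have row: "G' $ j = 0"
      by (simp add: vec_eq_iff)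
    have "0 \<le> x \<bullet> (G' *v x)" for x
    proof -
      \<comment> \<open>This t minimises the form along x + t e_j, and the minimum is the form of
        the deflated matrix at x.\<close>
      define t where "t = - (x \<bullet> (G *v ?e)) / (G $ j $ j)"
      have "0 \<le> (x + t *\<^sub>R ?e) \<bullet> (G *v (x + t *\<^sub>R ?e))"
        by (rule psd)
      also have "\<dots> = x \<bullet> (G *v x) + 2 * t * (x \<bullet> (G *v ?e)) + t\<^sup>2 * (G $ j $ j)"
        by (simp add: matrix_vector_right_distrib matrix_vector_mult_scaleR inner_add_left
          inner_add_right power2_eq_square eGe algebra_simps) (simp add: swap[of _ x] inner_commute)
      also have "\<dots> = x \<bullet> (G *v x) - (x \<bullet> (G *v ?e))\<^sup>2 / (G $ j $ j)"
        using pos by (simp add: t_def field_simps power2_eq_square)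
      also have "\<dots> = x \<bullet> (G' *v x)"
        using pos by (simp add: Gv inner_diff_right w_def power2_eq_square inner_commute)
      finally show ?thesis .
    qed
    moreover have "transpose G' = G'"
      using Gs by (simp add: transpose_def vec_eq_iff G'_def mult.commute)
    moreover have "G' $ i = 0" if "G $ i = 0" for i
      using that by (simp add: vec_eq_iff G'_def w)
    ultimately show ?thesis
      using row unfolding Let_def G'_def by blast
  qed
qed

text \<open>Deflating along every index leaves the zero matrix. Hence G is a sum of rank-one
  matrices W_j W_j^T, and the W_j are the columns of A.\<close>

lemma psd_factor:
  fixes G :: "real^'n^'n"
  assumes sym: "transpose G = G" and psd: "\<And>x. 0 \<le> x \<bullet> (G *v x)"
  shows "\<exists>A :: real^'n^'n. A ** transpose A = G"
proof -
  have "\<exists>W :: 'n \<Rightarrow> real^'n. let G' = (\<chi> i k. G $ i $ k - (\<Sum>j\<in>S. W j $ i * W j $ k)) in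
     transpose G' = G' \<and> (\<forall>x. 0 \<le> x \<bullet> (G' *v x)) \<and> (\<forall>j\<in>S. G' $ j = 0)" if "finite S" for S
    using that
  proof (induction S)
    case empty
    then show ?case using assms by (simp add: vec_lambda_eta)
  next
    case (insert j S)
    then obtain W where W: "let G' = (\<chi> i k. G $ i $ k - (\<Sum>j\<in>S. W j $ i * W j $ k)) in
     transpose G' = G' \<and> (\<forall>x. 0 \<le> x \<bullet> (G' *v x)) \<and> (\<forall>j\<in>S. G' $ j = 0)" by blast
    define G' where "G' = (\<chi> i k. G $ i $ k - (\<Sum>j\<in>S. W j $ i * W j $ k))"
    have G': "transpose G' = G'" "\<And>x. 0 \<le> x \<bullet> (G' *v x)" "\<And>j. j \<in> S \<Longrightarrow> G' $ j = 0"
      using W unfolding G'_def[symmetric] Let_def by auto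
    obtain w where w: "let G'' = (\<chi> i k. G' $ i $ k - w $ i * w $ k) in
      transpose G'' = G'' \<and> (\<forall>x. 0 \<le> x \<bullet> (G'' *v x)) \<and> G'' $ j = 0 \<and> (\<forall>i. G' $ i = 0 \<longrightarrow> G'' $ i = 0)"
      using psd_deflation[OF G'(1,2)] by blast
    have eq: "(\<chi> i k. G' $ i $ k - w $ i * w $ k) =
      (\<chi> i k. G $ i $ k - (\<Sum>l\<in>insert j S. (W(j := w)) l $ i * (W(j := w)) l $ k))"
    proof -
      have "(\<Sum>l\<in>S. (W(j := w)) l $ i * (W(j := w)) l $ k) = (\<Sum>l\<in>S. W l $ i * W l $ k)" for i k
        using insert by (intro sum.cong) auto
      then show ?thesis
        using insert by (simp add: G'_def algebra_simps)
    qed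
    show ?case
      using w G'(3) unfolding Let_def eq by (intro exI[of _ "W(j := w)"]) auto
  qed
  from this[of UNIV] obtain W :: "'n \<Rightarrow> real^'n" where
    "\<forall>j. (\<chi> i k. G $ i $ k - (\<Sum>j\<in>UNIV. W j $ i * W j $ k)) $ j = 0"
    by (auto simp: Let_def)
  then have "G $ i $ k = (\<Sum>j\<in>UNIV. W j $ i * W j $ k)" for i k
    by (simp add: vec_eq_iff)
  then have "(\<chi> i j. W j $ i) ** transpose (\<chi> i j. W j $ i) = G"
    by (simp add: vec_eq_iff matrix_matrix_mult_def transpose_def)
  then show ?thesis by blast
qed

text \<open>The powers of A = I + h H decay geometrically, so the sum Q of all (A^n)^T A^n converges
  and satisfies x . Q x = |x|^2 + A x . Q A x, the discrete Lyapunov equation. S is a factor of Q,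
  that is Q = S^T S.\<close>

lemma lyapunov_matrix:
  fixes H :: "real^'n^'n"
  assumes "\<And>\<mu>. complex_eigenvalue H \<mu> \<Longrightarrow> Re \<mu> < 0"
  shows "\<exists>(S :: real^'n^'n) c. c > 0 \<and> (\<forall>x. norm x \<le> norm (S *v x)) \<and>
    (\<forall>x. (S *v x) \<bullet> (S *v (H *v x)) \<le> - c * (norm (S *v x))\<^sup>2)"
proof -
  obtain h where h: "h > 0" and "\<forall>j. \<exists>C r. 0 \<le> r \<and> r < 1 \<and>
    (\<forall>n i. \<bar>(((\<lambda>x. x + h *\<^sub>R (H *v x)) ^^ n) (axis j 1)) $ i\<bar> \<le> C * r ^ n)"
    using real_geometric_decay[OF assms] by blast
  then have "\<forall>j. \<exists>Cr. 0 \<le> snd Cr \<and> snd Cr < 1 \<and>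
    (\<forall>n i. \<bar>(((\<lambda>x. x + h *\<^sub>R (H *v x)) ^^ n) (axis j 1)) $ i\<bar> \<le> fst Cr * snd Cr ^ n)"
    unfolding split_paired_Ex fst_conv snd_conv by blast
  from choice[OF this] obtain Cr where "\<forall>j. 0 \<le> snd (Cr j) \<and> snd (Cr j) < 1 \<and>
    (\<forall>n i. \<bar>(((\<lambda>x. x + h *\<^sub>R (H *v x)) ^^ n) (axis j 1)) $ i\<bar> \<le> fst (Cr j) * snd (Cr j) ^ n)" ..
  then have Cr: "0 \<le> snd (Cr j)" "snd (Cr j) < 1"
    "\<bar>(((\<lambda>x. x + h *\<^sub>R (H *v x)) ^^ n) (axis j 1)) $ i\<bar> \<le> fst (Cr j) * snd (Cr j) ^ n" for j n i
    by auto
  define A where "A = mat 1 + h *\<^sub>R H"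
  have A: "A *v x = x + h *\<^sub>R (H *v x)" for x
    by (simp add: A_def matrix_vector_mult_add_rdistrib scaleR_matrix_vector_assoc)
  define Pw where "Pw n = ((\<lambda>B. A ** B) ^^ n) (mat 1)" for n
  have Pw: "Pw n *v x = ((\<lambda>x. x + h *\<^sub>R (H *v x)) ^^ n) x" for n x
    by (induction n) (auto simp: Pw_def A simp flip: matrix_vector_mul_assoc)
  define r where "r = Max (insert 0 ((\<lambda>j. snd (Cr j)) ` UNIV))"
  define C where "C = Max (insert 0 ((\<lambda>j. fst (Cr j)) ` UNIV))"
  have r: "0 \<le> r" "r < 1"
    using Cr(2) by (auto simp: r_def)
  have C: "0 \<le> C" by (simp add: C_def)
  have Pe: "\<bar>Pw n $ i $ j\<bar> \<le> C * r ^ n" for n i j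
  proof -
    have "Pw n $ i $ j = (Pw n *v axis j 1) $ i"
      by (simp add: matrix_vector_mult_basis column_def)
    then have "\<bar>Pw n $ i $ j\<bar> \<le> fst (Cr j) * snd (Cr j) ^ n"
      using Cr(3) by (simp add: Pw)
    also have "\<dots> \<le> C * r ^ n"
    proof (intro mult_mono power_mono)
      show "fst (Cr j) \<le> C" "snd (Cr j) \<le> r"
        unfolding C_def r_def by (intro Max_ge; simp)+
    qed (use Cr(1) C in auto)
    finally show ?thesis .
  qed
  define Q0 where "Q0 n = transpose (Pw n) ** Pw n" for n
  have Q0: "x \<bullet> (Q0 n *v x) = (Pw n *v x) \<bullet> (Pw n *v x)" for n x
    unfolding Q0_def matrix_vector_mul_assoc[symmetric] by (rule inner_transpose_mult)
  have summ: "summable Q0"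
  proof (rule summable_comparison_test')
    show "summable (\<lambda>n. (of_nat CARD('n) ^ 3 * C\<^sup>2) * (r\<^sup>2) ^ n)"
      using r by (intro summable_mult summable_geometric) (simp add: power_less_one_iff abs_square_less_1)
    fix n :: nat
    have entry_le: "\<bar>Q0 n $ i $ j\<bar> \<le> of_nat CARD('n) * C\<^sup>2 * (r\<^sup>2) ^ n" for i j
    proof -
      have "\<bar>Q0 n $ i $ j\<bar> \<le> (\<Sum>k\<in>UNIV. \<bar>Pw n $ k $ i\<bar> * \<bar>Pw n $ k $ j\<bar>)"
        unfolding Q0_def matrix_matrix_mult_def transpose_def
        by (simp add: sum_abs flip: abs_mult)
      also have "\<dots> \<le> (\<Sum>k\<in>(UNIV::'n set). (C * r ^ n) * (C * r ^ n))"
        using C r by (intro sum_mono mult_mono Pe) auto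
      also have "\<dots> = of_nat CARD('n) * C\<^sup>2 * (r\<^sup>2) ^ n"
        by (simp add: power2_eq_square power_mult_distrib algebra_simps)
      finally show ?thesis .
    qed
    then have row: "norm (Q0 n $ i) \<le> of_nat CARD('n) ^ 2 * C\<^sup>2 * (r\<^sup>2) ^ n" for i
    proof -
      have "norm (Q0 n $ i) \<le> (\<Sum>j\<in>UNIV. \<bar>Q0 n $ i $ j\<bar>)"
        using norm_le_l1_cart by blast
      also have "\<dots> \<le> (\<Sum>j\<in>(UNIV::'n set). of_nat CARD('n) * C\<^sup>2 * (r\<^sup>2) ^ n)"
        by (intro sum_mono entry_le)
      finally show ?thesis by (simp add: power2_eq_square mult.assoc)
    qed
    have "norm (Q0 n) \<le> (\<Sum>i\<in>UNIV. norm (Q0 n $ i))"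
      unfolding norm_vec_def by (rule L2_set_le_sum) simp
    also have "\<dots> \<le> (\<Sum>i\<in>(UNIV::'n set). of_nat CARD('n) ^ 2 * C\<^sup>2 * (r\<^sup>2) ^ n)"
      by (intro sum_mono row)
    finally show "norm (Q0 n) \<le> (of_nat CARD('n) ^ 3 * C\<^sup>2) * (r\<^sup>2) ^ n"
      by (simp add: power2_eq_square eval_nat_numeral mult.assoc)
  qed
  define Q where "Q = suminf Q0"
  have form: "(\<lambda>n. x \<bullet> (Q0 n *v y)) sums (x \<bullet> (Q *v y))" for x y
  proof -
    have "linear (\<lambda>M :: real^'n^'n. x \<bullet> (M *v y))"
      by (intro linearI) (auto simp: matrix_vector_mult_add_rdistrib inner_add_right
          simp flip: scaleR_matrix_vector_assoc)
    then have "bounded_linear (\<lambda>M :: real^'n^'n. x \<bullet> (M *v y))"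
      by (simp add: linear_conv_bounded_linear)
    then show ?thesis
      using bounded_linear.sums[OF _ summable_sums[OF summ]] unfolding Q_def by blast
  qed
  have Qsums: "(\<lambda>n. (Pw n *v x) \<bullet> (Pw n *v x)) sums (x \<bullet> (Q *v x))" for x
    using form[of x x] by (simp add: Q0)
  have psd: "0 \<le> x \<bullet> (Q *v x)" for x
    using sums_le[OF _ sums_zero Qsums[of x]] by auto
  have step: "x \<bullet> (Q *v x) = x \<bullet> x + (A *v x) \<bullet> (Q *v (A *v x))" for x
  proof -
    have "Pw (Suc n) *v x = Pw n *v (A *v x)" for n
      by (simp only: Pw A funpow_Suc_right o_apply)
    then have "(\<lambda>n. (Pw (Suc n) *v x) \<bullet> (Pw (Suc n) *v x)) sums ((A *v x) \<bullet> (Q *v (A *v x)))"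
      using Qsums[of "A *v x"] by simp
    then have "(\<lambda>n. (Pw n *v x) \<bullet> (Pw n *v x)) sums ((A *v x) \<bullet> (Q *v (A *v x)) + (Pw 0 *v x) \<bullet> (Pw 0 *v x))"
      by (rule sums_Suc)
    from sums_unique2[OF this Qsums[of x]] show ?thesis
      by (simp add: Pw_def)
  qed
  have sym: "transpose Q = Q"
  proof -
    have sym0: "transpose (Q0 n) = Q0 n" for n
      by (simp add: Q0_def matrix_transpose_mul)
    have *: "Q0 n $ i $ j = Q0 n $ j $ i" for n i j
      using arg_cong[OF sym0, of "\<lambda>M. M $ j $ i"] by (simp add: transpose_def)
    have "axis i 1 \<bullet> (M *v axis j 1) = M $ i $ j" for M :: "real^'n^'n" and i j
      by (simp add: inner_axis' matrix_vector_mult_basis column_def)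
    then have entry: "(\<lambda>n. Q0 n $ i $ j) sums (Q $ i $ j)" for i j
      using form[of "axis i 1" "axis j 1"] by simp
    have "Q $ i $ j = Q $ j $ i" for i j
    proof -
      have "(\<lambda>n. Q0 n $ i $ j) = (\<lambda>n. Q0 n $ j $ i)"
        by (rule ext) (rule *)
      then show ?thesis using sums_unique2[OF entry[of i j]] entry[of j i] by simp
    qed
    then show ?thesis by (simp add: transpose_def vec_eq_iff)
  qed
  obtain B :: "real^'n^'n" where B: "B ** transpose B = Q"
    using psd_factor[OF sym psd] by blast
  define S where "S = transpose B"
  have S: "(norm (S *v x))\<^sup>2 = x \<bullet> (Q *v x)" for x
  proof -
    have "x \<bullet> (Q *v x) = x \<bullet> (B *v (S *v x))"
      by (simp only: B S_def matrix_vector_mul_assoc)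
    also have "\<dots> = (S *v x) \<bullet> (S *v x)"
      using inner_transpose_mult[of x S "S *v x"] by (simp only: S_def transpose_transpose)
    finally show ?thesis by (simp add: power2_norm_eq_inner)
  qed
  have ge: "norm x \<le> norm (S *v x)" for x
  proof (rule power2_le_imp_le)
    show "(norm x)\<^sup>2 \<le> (norm (S *v x))\<^sup>2"
      unfolding S power2_norm_eq_inner[of x] using step[of x] psd[of "A *v x"] by linarith
  qed simp
  obtain K where K: "K > 0" "\<And>x. norm (S *v x) \<le> norm x * K"
    using bounded_linear.pos_bounded[OF matrix_vector_mul_bounded_linear[of S]] by blast
  \<comment> \<open>Expanding |S (x + h H x)|^2 = |S x|^2 - |x|^2 isolates the inner product; the
    term h^2 |S H x|^2 has the right sign and is dropped. The bound |S x| \<le> K |x| then turns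
    -|x|^2 into a multiple of |S x|^2.\<close>
  have "(S *v x) \<bullet> (S *v (H *v x)) \<le> - (1 / (2 * h * K\<^sup>2)) * (norm (S *v x))\<^sup>2" for x
  proof -
    have "(norm (S *v (A *v x)))\<^sup>2 = (norm (S *v x))\<^sup>2 + 2 * h * ((S *v x) \<bullet> (S *v (H *v x))) + h\<^sup>2 * (norm (S *v (H *v x)))\<^sup>2"
      unfolding A matrix_vector_right_distrib matrix_vector_mult_scaleR power2_norm_eq_inner
      by (simp add: inner_add_left inner_add_right inner_commute power2_eq_square algebra_simps)
    moreover have "(norm (S *v (A *v x)))\<^sup>2 = (norm (S *v x))\<^sup>2 - (norm x)\<^sup>2"
      unfolding S power2_norm_eq_inner[of x] using step[of x] by linarith
    ultimately have "2 * h * ((S *v x) \<bullet> (S *v (H *v x))) \<le> - (norm x)\<^sup>2"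
      using zero_le_power2[of "h * norm (S *v (H *v x))"] unfolding power_mult_distrib by linarith
    moreover have "(norm (S *v x))\<^sup>2 / K\<^sup>2 \<le> (norm x)\<^sup>2"
      using K power_mono[OF K(2)[of x], of 2] by (simp add: power_mult_distrib divide_le_eq)
    ultimately have "2 * h * ((S *v x) \<bullet> (S *v (H *v x))) \<le> - ((norm (S *v x))\<^sup>2 / K\<^sup>2)"
      by linarith
    then show ?thesis
      using h K by (simp add: field_simps)
  qed
  then show ?thesis
    using ge h K by (intro exI[of _ S] exI[of _ "1 / (2 * h * K\<^sup>2)"]) auto
qed

subsection \<open>Gaussian laws and convergence by characteristic functions\<close>

lemma measurable_cis [measurable]: "cis \<in> borel_measurable borel"
  by (intro borel_measurable_continuous_onI continuous_intros)

lemma measurable_matrix_vector_mult [measurable]: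
  "f \<in> borel_measurable M \<Longrightarrow> (\<lambda>x. (A :: real^'n^'m) *v f x) \<in> borel_measurable M"
  by (rule measurable_compose[OF _ borel_measurable_continuous_onI])
    (auto intro: linear_continuous_on)

lemma prod_Basis_vec: "(\<Prod>i\<in>UNIV. f (x $ i)) = (\<Prod>b\<in>Basis. f (x \<bullet> b))" for x :: "real^'d"
proof -
  have B: "(Basis :: (real^'d) set) = (\<lambda>i. axis i 1) ` UNIV"
    by (auto simp: Basis_vec_def)
  have inj: "inj (\<lambda>i::'d. axis i (1::real))"
    by (auto simp: inj_on_def axis_eq_axis)
  show ?thesis
    unfolding B prod.reindex[OF inj] by (simp add: cart_eq_inner_axis)
qed

lemma std_gaussian_density_eq:
  "(\<Prod>i\<in>UNIV. std_normal_density (x $ i)) = (1 / sqrt (2 * pi)) ^ CARD('d) * exp (- (norm x)\<^sup>2 / 2)"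
  for x :: "real^'d"
proof -
  have "(\<Prod>i\<in>UNIV. std_normal_density (x $ i)) = (1 / sqrt (2 * pi)) ^ CARD('d) * (\<Prod>i\<in>UNIV. exp (- (x $ i)\<^sup>2 / 2))"
    unfolding std_normal_density_def prod.distrib by simp
  also have "(\<Prod>i\<in>UNIV. exp (- (x $ i)\<^sup>2 / 2)) = exp (\<Sum>i\<in>UNIV. - (x $ i)\<^sup>2 / 2)"
    by (simp add: exp_sum)
  also have "(\<Sum>i\<in>UNIV. - (x $ i)\<^sup>2 / 2) = - (norm x)\<^sup>2 / 2"
    by (simp add: norm_vec_def L2_set_def sum_nonneg sum_negf flip: sum_divide_distrib)
  finally show ?thesis .
qed

lemma prob_space_std_gaussian: "prob_space (std_gaussian :: (real^'d) measure)"
proof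
  have "emeasure (std_gaussian :: (real^'d) measure) (space std_gaussian) =
    (\<integral>\<^sup>+x. (\<Prod>i\<in>UNIV. ennreal (std_normal_density ((x::real^'d) $ i))) \<partial>lborel)"
    by (simp add: std_gaussian_def emeasure_density prod_ennreal)
  also have "\<dots> = (\<integral>\<^sup>+x. (\<Prod>b\<in>Basis. ennreal (std_normal_density ((x::real^'d) \<bullet> b))) \<partial>lborel)"
    by (intro nn_integral_cong prod_Basis_vec)
  also have "\<dots> = (\<Prod>b\<in>(Basis::(real^'d) set). (\<integral>\<^sup>+x. ennreal (std_normal_density x) \<partial>lborel))"
    by (rule nn_integral_lborel_prod) auto
  also have "(\<integral>\<^sup>+x. ennreal (std_normal_density x) \<partial>lborel) = 1"
    by (subst nn_integral_eq_integral) auto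
  finally show "emeasure (std_gaussian :: (real^'d) measure) (space std_gaussian) = 1"
    by simp
qed

lemma sets_std_gaussian [measurable_cong, simp]: "sets std_gaussian = sets borel"
  by (simp add: std_gaussian_def)

lemma space_std_gaussian [simp]: "space std_gaussian = UNIV"
  by (simp add: std_gaussian_def)

lemma integral_std_normal_cis:
  "(\<integral>x. std_normal_density x *\<^sub>R cis (s * x) \<partial>lborel) = complex_of_real (exp (- s\<^sup>2 / 2))"
proof -
  have "char std_normal_distribution s = (\<integral>x. std_normal_density x *\<^sub>R cis (s * x) \<partial>lborel)"
    unfolding char_def cis_conv_exp by (subst integral_density) auto
  then show ?thesis by (simp add: char_std_normal_distribution)
qed

lemma cis_sum: "finite I \<Longrightarrow> cis (\<Sum>i\<in>I. f i) = (\<Prod>i\<in>I. cis (f i))"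
  by (induction I rule: finite_induct) (auto simp: cis_mult[symmetric])

text \<open>Density and exponential both factorise over the coordinates. \<open>lborel_eq\<close>
  presents Lebesgue measure as the image of a product measure, where the integral of a product is
  the product of one-dimensional integrals.\<close>

lemma std_gaussian_char:
  fixes t :: "real^'d"
  shows "(\<integral>z. cis (t \<bullet> z) \<partial>std_gaussian) = complex_of_real (exp (- (norm t)\<^sup>2 / 2))"
proof -
  interpret product_sigma_finite "\<lambda>_::real^'d. lborel :: real measure" ..
  let ?\<phi> = "\<lambda>(b::real^'d) y. std_normal_density y *\<^sub>R cis ((t \<bullet> b) * y)"
  let ?s = "\<lambda>f. \<Sum>b\<in>(Basis :: (real^'d) set). f b *\<^sub>R b"
  have "(\<integral>z. cis (t \<bullet> z) \<partial>std_gaussian) = (\<integral>z. (\<Prod>i\<in>UNIV. std_normal_density (z $ i)) *\<^sub>R cis (t \<bullet> z) \<partial>lborel)"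
    unfolding std_gaussian_def
    by (rule integral_density) (auto intro!: AE_I2 prod_nonneg)
  also have "\<dots> = (\<integral>z. (\<Prod>b\<in>Basis. std_normal_density (z \<bullet> b)) *\<^sub>R cis (t \<bullet> z) \<partial>lborel)"
    by (subst prod_Basis_vec) rule
  also have "\<dots> = (\<integral>f. (\<Prod>b\<in>Basis. std_normal_density (?s f \<bullet> b)) *\<^sub>R cis (t \<bullet> ?s f)
      \<partial>(\<Pi>\<^sub>M b\<in>(Basis :: (real^'d) set). lborel))"
    by (subst lborel_eq, subst integral_distr) auto
  also have "\<dots> = (\<integral>f. (\<Prod>b\<in>Basis. ?\<phi> b (f b)) \<partial>(\<Pi>\<^sub>M b\<in>(Basis :: (real^'d) set). lborel))"
  proof (rule Bochner_Integration.integral_cong[OF refl])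
    fix f :: "real^'d \<Rightarrow> real"
    have "cis (t \<bullet> ?s f) = (\<Prod>b\<in>Basis. cis ((t \<bullet> b) * f b))"
      by (simp add: inner_sum_right mult.commute flip: cis_sum)
    moreover have "(\<Prod>b\<in>Basis. std_normal_density (?s f \<bullet> b)) = (\<Prod>b\<in>(Basis::(real^'d) set). std_normal_density (f b))"
      by (intro prod.cong refl) simp
    ultimately show "(\<Prod>b\<in>Basis. std_normal_density (?s f \<bullet> b)) *\<^sub>R cis (t \<bullet> ?s f) = (\<Prod>b\<in>Basis. ?\<phi> b (f b))"
      by (simp only: scaleR_conv_of_real prod.distrib of_real_prod)
  qed
  also have "\<dots> = (\<Prod>b\<in>Basis. \<integral>y. ?\<phi> b y \<partial>lborel)"
  proof (rule product_integral_prod)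
    fix b :: "real^'d" assume "b \<in> Basis"
    show "integrable lborel (?\<phi> b)"
      by (rule Bochner_Integration.integrable_bound[OF integrable_normal_density[of 1 0]]) auto
  qed simp
  also have "\<dots> = (\<Prod>b\<in>Basis. complex_of_real (exp (- (t \<bullet> b)\<^sup>2 / 2)))"
    by (simp only: integral_std_normal_cis)
  also have "\<dots> = complex_of_real (exp (\<Sum>b\<in>Basis. - (t \<bullet> b)\<^sup>2 / 2))"
    by (simp add: exp_sum)
  also have "(\<Sum>b\<in>Basis. - (t \<bullet> b)\<^sup>2 / 2) = - (norm t)\<^sup>2 / 2"
    unfolding power2_norm_eq_inner by (subst euclidean_inner) (simp add: sum_negf power2_eq_square flip: sum_divide_distrib)
  finally show ?thesis .
qed

lemma prob_space_gaussian: "prob_space (gaussian m \<Sigma>)"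
  unfolding gaussian_def Let_def
  by (rule prob_space.prob_space_distr[OF prob_space_std_gaussian]) measurable

lemma sets_gaussian [simp]: "sets (gaussian m \<Sigma>) = sets borel"
  by (simp add: gaussian_def Let_def)

text \<open>The matrix picked by \<open>SOME\<close> is a factor of \<Sigma> only if a factor
  exists, hence the hypothesis. The characteristic function of A Z at t is that of Z at A^T t, and
  |A^T t|^2 = t . \<Sigma> t.\<close>

lemma gaussian_char:
  fixes \<Sigma> :: "real^'d^'d"
  assumes "\<exists>A :: real^'d^'d. A ** transpose A = \<Sigma>"
  shows "(\<integral>x. cis (t \<bullet> x) \<partial>gaussian 0 \<Sigma>) = complex_of_real (exp (- (t \<bullet> (\<Sigma> *v t)) / 2))"
proof -
  define A where "A = (SOME A :: real^'d^'d. A ** transpose A = \<Sigma>)"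
  have A: "A ** transpose A = \<Sigma>"
    unfolding A_def by (rule someI_ex) (rule assms)
  have adj: "t \<bullet> (A *v z) = (transpose A *v t) \<bullet> z" for z
    by (metis dot_lmul_matrix transpose_matrix_vector)
  have "(\<integral>x. cis (t \<bullet> x) \<partial>gaussian 0 \<Sigma>) = (\<integral>z. cis (t \<bullet> (A *v z)) \<partial>std_gaussian)"
    unfolding gaussian_def Let_def A_def[symmetric]
    by (subst integral_distr) auto
  also have "\<dots> = complex_of_real (exp (- (norm (transpose A *v t))\<^sup>2 / 2))"
    unfolding adj by (rule std_gaussian_char)
  also have "(norm (transpose A *v t))\<^sup>2 = t \<bullet> (\<Sigma> *v t)"
    unfolding power2_norm_eq_inner adj[symmetric] A[symmetric] by (simp only: matrix_vector_mul_assoc)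
  finally show ?thesis .
qed

section \<open>Continuity theorem for characteristic functions of finite measures\<close>

context
  fixes \<mu> :: "nat \<Rightarrow> (real^'d) measure" and \<nu> :: "(real^'d) measure"
  assumes fin: "\<And>n. finite_measure (\<mu> n)" "finite_measure \<nu>"
    and sets [measurable_cong]: "\<And>n. sets (\<mu> n) = sets borel" "sets \<nu> = sets borel"
    and char: "\<And>t. (\<lambda>n. \<integral>x. cis (t \<bullet> x) \<partial>\<mu> n) \<longlonglongrightarrow> (\<integral>x. cis (t \<bullet> x) \<partial>\<nu>)"
begin

lemma mass_converges: "(\<lambda>n. measure (\<mu> n) UNIV) \<longlonglongrightarrow> measure \<nu> UNIV"
proof -
  have sp: "space (\<mu> n) = UNIV" "space \<nu> = UNIV" for n
    using sets_eq_imp_space_eq[OF sets(1)] sets_eq_imp_space_eq[OF sets(2)] by auto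
  show ?thesis
    using tendsto_Re[OF char[of 0]] by (simp add: sp)
qed

lemma mass_bounded: "\<exists>C. \<forall>n. measure (\<mu> n) UNIV \<le> C"
  using convergent_imp_Bseq[OF convergentI[OF mass_converges]] unfolding Bseq_def by auto

lemma integral_bounded_le:
  fixes h :: "real^'d \<Rightarrow> 'b::{banach, second_countable_topology}"
  assumes "finite_measure N" "sets N = sets borel" and h: "h \<in> borel_measurable borel" "\<And>x. norm (h x) \<le> B"
  shows "integrable N h" "norm (\<integral>x. h x \<partial>N) \<le> B * measure N UNIV"
proof -
  interpret N: finite_measure N by fact
  have sp: "space N = UNIV" using sets_eq_imp_space_eq[OF assms(2)] by simp
  have m: "h \<in> borel_measurable N" using h(1) assms(2) by (simp cong: measurable_cong_sets)
  show int: "integrable N h"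
    by (rule N.integrable_const_bound[of _ B]) (use h m in auto)
  have "norm (\<integral>x. h x \<partial>N) \<le> (\<integral>x. B \<partial>N)"
    by (rule Bochner_Integration.integral_norm_bound_integral[OF int]) (use h in auto)
  then show "norm (\<integral>x. h x \<partial>N) \<le> B * measure N UNIV"
    by (simp add: sp mult.commute)
qed

text \<open>A Gaussian bump is itself a Gaussian characteristic function. By Fubini its integral
  against any finite measure is therefore determined by the characteristic function of that
  measure.\<close>

lemma gaussian_bump_eq:
  "complex_of_real (exp (- (\<tau> * norm (x - y))\<^sup>2 / 2)) = (\<integral>z. cis ((\<tau> *\<^sub>R (x - y)) \<bullet> z) \<partial>std_gaussian)"
  for x y :: "real^'d"
  by (simp only: std_gaussian_char norm_scaleR power_mult_distrib power2_abs)

lemma integral_gaussian_bump: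
  fixes y :: "real^'d"
  assumes "finite_measure N" "sets N = sets borel"
  shows "complex_of_real (\<integral>x. exp (- (\<tau> * norm (x - y))\<^sup>2 / 2) \<partial>N) =
    (\<integral>z. cis (- (\<tau> *\<^sub>R z \<bullet> y)) * (\<integral>x. cis ((\<tau> *\<^sub>R z) \<bullet> x) \<partial>N) \<partial>std_gaussian)"
proof -
  interpret N: finite_measure N by fact
  interpret G: prob_space "std_gaussian :: (real^'d) measure" by (rule prob_space_std_gaussian)
  interpret NG: pair_sigma_finite N "std_gaussian :: (real^'d) measure" ..
  note assms(2)[measurable_cong]
  have "complex_of_real (\<integral>x. exp (- (\<tau> * norm (x - y))\<^sup>2 / 2) \<partial>N) =
    (\<integral>x. (\<integral>z. cis ((\<tau> *\<^sub>R (x - y)) \<bullet> z) \<partial>std_gaussian) \<partial>N)"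
    by (simp only: gaussian_bump_eq[symmetric] integral_complex_of_real)
  also have "\<dots> = (\<integral>z. (\<integral>x. cis ((\<tau> *\<^sub>R (x - y)) \<bullet> z) \<partial>N) \<partial>std_gaussian)"
  proof (rule NG.Fubini_integral[symmetric])
    interpret NGf: finite_measure "N \<Otimes>\<^sub>M (std_gaussian :: (real^'d) measure)"
      by (rule finite_measure_pair_measure) unfold_locales
    show "integrable (N \<Otimes>\<^sub>M std_gaussian) (\<lambda>(x, z). cis ((\<tau> *\<^sub>R (x - y)) \<bullet> z))"
      by (rule NGf.integrable_const_bound[of _ 1]) auto
  qed
  also have "\<dots> = (\<integral>z. cis (- (\<tau> *\<^sub>R z \<bullet> y)) * (\<integral>x. cis ((\<tau> *\<^sub>R z) \<bullet> x) \<partial>N) \<partial>std_gaussian)"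
  proof (rule Bochner_Integration.integral_cong[OF refl])
    fix z :: "real^'d"
    have "cis ((\<tau> *\<^sub>R (x - y)) \<bullet> z) = cis (- (\<tau> *\<^sub>R z \<bullet> y)) * cis ((\<tau> *\<^sub>R z) \<bullet> x)" for x
      by (simp add: cis_mult inner_diff_left inner_commute algebra_simps)
    then show "(\<integral>x. cis ((\<tau> *\<^sub>R (x - y)) \<bullet> z) \<partial>N) = cis (- (\<tau> *\<^sub>R z \<bullet> y)) * (\<integral>x. cis ((\<tau> *\<^sub>R z) \<bullet> x) \<partial>N)"
      by simp
  qed
  finally show ?thesis .
qed

text \<open>In the Fubini formula only the characteristic functions depend on n. They converge
  pointwise and are bounded by the total masses, so dominated convergence applies in the Gaussian
  variable.\<close>

lemma bump_converges:
  "(\<lambda>n. \<integral>x. exp (- (\<tau> * norm (x - y))\<^sup>2 / 2) \<partial>\<mu> n) \<longlonglongrightarrow> (\<integral>x. exp (- (\<tau> * norm (x - y))\<^sup>2 / 2) \<partial>\<nu>)"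
proof -
  obtain C where C: "\<And>n. measure (\<mu> n) UNIV \<le> C" using mass_bounded by blast
  interpret G: prob_space "std_gaussian :: (real^'d) measure" by (rule prob_space_std_gaussian)
  have "(\<lambda>n. complex_of_real (\<integral>x. exp (- (\<tau> * norm (x - y))\<^sup>2 / 2) \<partial>\<mu> n)) \<longlonglongrightarrow>
    complex_of_real (\<integral>x. exp (- (\<tau> * norm (x - y))\<^sup>2 / 2) \<partial>\<nu>)"
    unfolding integral_gaussian_bump[OF fin(1) sets(1)] integral_gaussian_bump[OF fin(2) sets(2)]
  proof (rule integral_dominated_convergence[where w = "\<lambda>_. C"])
    interpret N: finite_measure \<nu> by (rule fin)
    have [measurable]: "(\<lambda>z. \<integral>x. cis ((\<tau> *\<^sub>R z) \<bullet> x) \<partial>\<nu>) \<in> borel_measurable borel"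
      by measurable
    show "(\<lambda>z. cis (- (\<tau> *\<^sub>R z \<bullet> y)) * (\<integral>x. cis ((\<tau> *\<^sub>R z) \<bullet> x) \<partial>\<nu>)) \<in> borel_measurable std_gaussian"
      by measurable
    fix n
    interpret Nn: finite_measure "\<mu> n" by (rule fin)
    have [measurable]: "(\<lambda>z. \<integral>x. cis ((\<tau> *\<^sub>R z) \<bullet> x) \<partial>\<mu> n) \<in> borel_measurable borel"
      by measurable
    show "(\<lambda>z. cis (- (\<tau> *\<^sub>R z \<bullet> y)) * (\<integral>x. cis ((\<tau> *\<^sub>R z) \<bullet> x) \<partial>\<mu> n)) \<in> borel_measurable std_gaussian"
      by measurable
    have "norm (\<integral>x. cis ((\<tau> *\<^sub>R z) \<bullet> x) \<partial>\<mu> n) \<le> C" for z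
      using integral_bounded_le(2)[OF fin(1) sets(1), of "\<lambda>x. cis ((\<tau> *\<^sub>R z) \<bullet> x)" 1 n] C[of n] by simp
    then show "AE z in std_gaussian. norm (cis (- (\<tau> *\<^sub>R z \<bullet> y)) * (\<integral>x. cis ((\<tau> *\<^sub>R z) \<bullet> x) \<partial>\<mu> n)) \<le> C"
      by (simp add: norm_mult)
  next
    show "AE z in std_gaussian. (\<lambda>n. cis (- (\<tau> *\<^sub>R z \<bullet> y)) * (\<integral>x. cis ((\<tau> *\<^sub>R z) \<bullet> x) \<partial>\<mu> n)) \<longlonglongrightarrow>
      cis (- (\<tau> *\<^sub>R z \<bullet> y)) * (\<integral>x. cis ((\<tau> *\<^sub>R z) \<bullet> x) \<partial>\<nu>)"
      by (intro AE_I2 tendsto_mult tendsto_const char)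
  qed simp
  then show ?thesis by (rule tendsto_of_real_iff[THEN iffD1])
qed

text \<open>Convolution with a Gaussian bump of width 1/\<tau>, left unnormalised;
  \<open>mollify_eq\<close> supplies the constant.\<close>

definition mollify :: "real \<Rightarrow> (real^'d \<Rightarrow> real) \<Rightarrow> real^'d \<Rightarrow> real" where
  "mollify \<tau> g x = (\<integral>y. g y * exp (- (\<tau> * norm (x - y))\<^sup>2 / 2) \<partial>lborel)"

lemma mollify_converges:
  assumes g: "integrable lborel g"
  shows "(\<lambda>n. \<integral>x. mollify \<tau> g x \<partial>\<mu> n) \<longlonglongrightarrow> (\<integral>x. mollify \<tau> g x \<partial>\<nu>)"
proof -
  obtain C where C: "\<And>n. measure (\<mu> n) UNIV \<le> C" using mass_bounded by blast
  have gm [measurable]: "g \<in> borel_measurable borel"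
    using borel_measurable_integrable[OF g] by simp
  have swap: "(\<integral>x. mollify \<tau> g x \<partial>N) = (\<integral>y. g y * (\<integral>x. exp (- (\<tau> * norm (x - y))\<^sup>2 / 2) \<partial>N) \<partial>lborel)"
    if N: "finite_measure N" "sets N = sets borel" for N :: "(real^'d) measure"
  proof -
    interpret N: finite_measure N by fact
    note N(2)[measurable_cong]
    interpret NL: pair_sigma_finite lborel N ..
    have sp: "space N = UNIV" using sets_eq_imp_space_eq[OF N(2)] by simp
    have "integrable (lborel \<Otimes>\<^sub>M N) (\<lambda>(y, x). g y * exp (- (\<tau> * norm (x - y))\<^sup>2 / 2))"
    proof (rule Bochner_Integration.integrable_bound)
      show "integrable (lborel \<Otimes>\<^sub>M N) (\<lambda>(y, x). g y)"
      proof (rule NL.Fubini_integrable)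
        show "integrable lborel (\<lambda>y. \<integral>x. norm (case (y, x) of (y, x) \<Rightarrow> g y) \<partial>N)"
          using g by simp
      qed auto
      show "AE p in lborel \<Otimes>\<^sub>M N. norm (case p of (y, x) \<Rightarrow> g y * exp (- (\<tau> * norm (x - y))\<^sup>2 / 2)) \<le> norm (case p of (y, x) \<Rightarrow> g y)"
        by (intro AE_I2) (auto simp: abs_mult mult_left_le split: prod.split)
    qed measurable
    from NL.Fubini_integral[OF this] show ?thesis
      by (simp add: mollify_def)
  qed
  show ?thesis
    unfolding swap[OF fin(1) sets(1)] swap[OF fin(2) sets(2)]
  proof (rule integral_dominated_convergence[where w = "\<lambda>y. \<bar>g y\<bar> * C"])
    interpret N: finite_measure \<nu> by (rule fin)
    show "(\<lambda>y. g y * (\<integral>x. exp (- (\<tau> * norm (x - y))\<^sup>2 / 2) \<partial>\<nu>)) \<in> borel_measurable lborel"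
      by measurable
    show "integrable lborel (\<lambda>y. \<bar>g y\<bar> * C)"
      using g by simp
    fix n
    interpret Nn: finite_measure "\<mu> n" by (rule fin)
    show "(\<lambda>y. g y * (\<integral>x. exp (- (\<tau> * norm (x - y))\<^sup>2 / 2) \<partial>\<mu> n)) \<in> borel_measurable lborel"
      by measurable
    have "norm (\<integral>x. exp (- (\<tau> * norm (x - y))\<^sup>2 / 2) \<partial>\<mu> n) \<le> C" for y
      using integral_bounded_le(2)[OF fin(1) sets(1), of "\<lambda>x. exp (- (\<tau> * norm (x - y))\<^sup>2 / 2)" 1 n] C[of n] by simp
    then show "AE y in lborel. norm (g y * (\<integral>x. exp (- (\<tau> * norm (x - y))\<^sup>2 / 2) \<partial>\<mu> n)) \<le> \<bar>g y\<bar> * C"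
      by (intro AE_I2) (simp add: abs_mult mult_left_mono)
  qed (intro AE_I2 tendsto_mult tendsto_const bump_converges)
qed


text \<open>The substitution y = x + z / \<tau> turns the normalised convolution into a Gaussian
  mean of g around x.\<close>

lemma mollify_eq:
  fixes x :: "real^'d"
  assumes \<tau>: "\<tau> > 0" and g: "g \<in> borel_measurable borel"
  shows "(\<integral>z. g (x + (1 / \<tau>) *\<^sub>R z) \<partial>std_gaussian) = (\<tau> / sqrt (2 * pi)) ^ CARD('d) * mollify \<tau> g x"
proof -
  let ?k = "(1 / sqrt (2 * pi)) ^ CARD('d)"
  let ?F = "\<lambda>z. ?k * exp (- (norm z)\<^sup>2 / 2) * g (x + (1 / \<tau>) *\<^sub>R z)"
  note g[measurable]
  have "(\<integral>z. g (x + (1 / \<tau>) *\<^sub>R z) \<partial>std_gaussian) = (\<integral>z. ?F z \<partial>lborel)"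
    unfolding std_gaussian_def
    by (subst integral_density) (auto simp: std_gaussian_density_eq)
  also have "\<dots> = \<bar>\<tau>\<bar> ^ DIM(real^'d) * (\<integral>y. ?F ((- \<tau>) *\<^sub>R x + \<tau> *\<^sub>R y) \<partial>lborel)"
    using \<tau> by (subst lborel_affine[of \<tau> "(- \<tau>) *\<^sub>R x"]) (simp_all add: integral_density integral_distr)
  also have "(\<integral>y. ?F ((- \<tau>) *\<^sub>R x + \<tau> *\<^sub>R y) \<partial>lborel) = (\<integral>y. ?k * (g y * exp (- (\<tau> * norm (x - y))\<^sup>2 / 2)) \<partial>lborel)"
  proof (rule Bochner_Integration.integral_cong[OF refl])
    fix y :: "real^'d"
    have "(- \<tau>) *\<^sub>R x + \<tau> *\<^sub>R y = \<tau> *\<^sub>R (y - x)"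
      by (simp add: scaleR_diff_right)
    moreover have "x + (1 / \<tau>) *\<^sub>R (\<tau> *\<^sub>R (y - x)) = y"
      using \<tau> by simp
    ultimately show "?F ((- \<tau>) *\<^sub>R x + \<tau> *\<^sub>R y) = ?k * (g y * exp (- (\<tau> * norm (x - y))\<^sup>2 / 2))"
      using \<tau> by (simp only: norm_scaleR abs_of_pos norm_minus_commute[of x y] mult_ac)
  qed
  also have "\<dots> = ?k * mollify \<tau> g x"
    by (simp add: mollify_def)
  finally show ?thesis
    using \<tau> by (simp add: power_mult_distrib power_divide)
qed

text \<open>Where |z| < \<delta> m the shift is shorter than \<delta> and uniform continuity
  applies; elsewhere the difference is at most 2 B, on a set of small Gaussian measure.\<close>

lemma gaussian_smoothing_uniform:
  fixes g :: "real^'d \<Rightarrow> real"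
  assumes uc: "uniformly_continuous_on UNIV g" and B: "\<And>x. \<bar>g x\<bar> \<le> B" and \<eta>: "\<eta> > 0"
  shows "\<exists>m::nat. m > 0 \<and> (\<forall>x. \<bar>(\<integral>z. g (x + (1 / real m) *\<^sub>R z) \<partial>std_gaussian) - g x\<bar> \<le> \<eta>)"
proof -
  interpret G: prob_space "std_gaussian :: (real^'d) measure" by (rule prob_space_std_gaussian)
  have B0: "0 \<le> B" using B[of 0] by linarith
  have gm [measurable]: "g \<in> borel_measurable borel"
    by (intro borel_measurable_continuous_onI uniformly_continuous_imp_continuous uc)
  obtain \<delta> where \<delta>: "\<delta> > 0" "\<And>x y. dist y x < \<delta> \<Longrightarrow> dist (g y) (g x) < \<eta> / 2"
    using uc \<eta> unfolding uniformly_continuous_on_def by (metis UNIV_I half_gt_zero)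
  have "(\<lambda>m. \<integral>z. of_bool (norm z \<ge> \<delta> * real m) \<partial>(std_gaussian :: (real^'d) measure)) \<longlonglongrightarrow> (\<integral>z. (0::real) \<partial>(std_gaussian :: (real^'d) measure))"
  proof (rule integral_dominated_convergence[where w = "\<lambda>_. 1"])
    show "AE z in (std_gaussian :: (real^'d) measure). (\<lambda>m. of_bool (norm z \<ge> \<delta> * real m) :: real) \<longlonglongrightarrow> 0"
    proof (rule AE_I2)
      fix z :: "real^'d"
      have "eventually (\<lambda>m. real m > norm z / \<delta>) sequentially"
        using filterlim_real_sequentially unfolding filterlim_at_top_dense by blast
      then have "eventually (\<lambda>m. of_bool (norm z \<ge> \<delta> * real m) = (0::real)) sequentially"
        by eventually_elim (use \<delta>(1) in \<open>simp add: field_simps\<close>)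
      then show "(\<lambda>m. of_bool (norm z \<ge> \<delta> * real m) :: real) \<longlonglongrightarrow> 0"
        by (rule tendsto_eventually)
    qed
  qed auto
  \<comment> \<open>The threshold \<eta> / (4 B + 1) keeps 2 B times the far mass below \<eta> / 2
    and remains meaningful for B = 0.\<close>
  then have "eventually (\<lambda>m. (\<integral>z. of_bool (norm z \<ge> \<delta> * real m) \<partial>(std_gaussian :: (real^'d) measure)) < \<eta> / (4 * B + 1)) sequentially"
    using \<eta> B0 by (intro order_tendstoD(2)[where y = 0]) auto
  moreover have "eventually (\<lambda>m::nat. m > 0) sequentially"
    by (rule eventually_gt_at_top)
  ultimately have "eventually (\<lambda>m. m > 0 \<and> (\<integral>z. of_bool (norm z \<ge> \<delta> * real m) \<partial>(std_gaussian :: (real^'d) measure)) < \<eta> / (4 * B + 1)) sequentially"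
    by eventually_elim auto
  then obtain m :: nat where m: "m > 0"
    "(\<integral>z. of_bool (norm z \<ge> \<delta> * real m) \<partial>(std_gaussian :: (real^'d) measure)) < \<eta> / (4 * B + 1)"
    unfolding eventually_sequentially by blast
  let ?I = "\<lambda>z :: real^'d. of_bool (norm z \<ge> \<delta> * real m) :: real"
  have "\<bar>(\<integral>z. g (x + (1 / real m) *\<^sub>R z) \<partial>std_gaussian) - g x\<bar> \<le> \<eta>" for x
  proof -
    have int: "integrable std_gaussian (\<lambda>z. g (x + (1 / real m) *\<^sub>R z))"
      by (rule G.integrable_const_bound[of _ B]) (use B in auto)
    have intI: "integrable std_gaussian ?I"
      by (rule G.integrable_const_bound[of _ 1]) auto
    have "(\<integral>z. g (x + (1 / real m) *\<^sub>R z) \<partial>std_gaussian) - g x = (\<integral>z. g (x + (1 / real m) *\<^sub>R z) - g x \<partial>std_gaussian)"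
      using int by (simp add: G.prob_space[simplified])
    also have "\<bar>\<dots>\<bar> \<le> (\<integral>z. \<eta> / 2 + 2 * B * ?I z \<partial>std_gaussian)"
    proof (rule Bochner_Integration.integral_norm_bound_integral[where 'b = real, unfolded real_norm_def])
      fix z :: "real^'d"
      show "\<bar>g (x + (1 / real m) *\<^sub>R z) - g x\<bar> \<le> \<eta> / 2 + 2 * B * ?I z"
      proof (cases "norm z \<ge> \<delta> * real m")
        case True
        then show ?thesis using B[of x] B[of "x + (1 / real m) *\<^sub>R z"] \<eta> by simp
      next
        case False
        then have "dist (x + (1 / real m) *\<^sub>R z) x < \<delta>"
          using m(1) by (simp add: dist_norm field_simps)
        from \<delta>(2)[OF this] show ?thesis using False by (simp add: dist_real_def)
      qed
    qed (use int intI in auto)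
    also have "\<dots> = \<eta> / 2 + 2 * B * (\<integral>z. ?I z \<partial>std_gaussian)"
      using intI by (simp add: G.prob_space[simplified])
    also have "\<dots> \<le> \<eta> / 2 + 2 * B * (\<eta> / (4 * B + 1))"
      using m(2) B0 by (intro add_left_mono mult_left_mono) auto
    also have "\<dots> \<le> \<eta>"
      using B0 \<eta> by (simp add: field_simps)
    finally show ?thesis .
  qed
  then show ?thesis using m(1) by blast
qed

text \<open>The mollified function is uniformly close to g, and its integrals converge by
  \<open>mollify_converges\<close>. Bounded support makes g Lebesgue integrable; the masses of all
  measures involved have a common bound, so the uniform error is harmless.\<close>

lemma compact_support_converges:
  fixes g :: "real^'d \<Rightarrow> real"
  assumes uc: "uniformly_continuous_on UNIV g" and B: "\<And>x. \<bar>g x\<bar> \<le> B" and R: "\<And>x. norm x > R \<Longrightarrow> g x = 0"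
  shows "(\<lambda>n. \<integral>x. g x \<partial>\<mu> n) \<longlonglongrightarrow> (\<integral>x. g x \<partial>\<nu>)"
proof (rule LIMSEQ_I)
  fix r :: real assume r: "r > 0"
  interpret G: prob_space "std_gaussian :: (real^'d) measure" by (rule prob_space_std_gaussian)
  have gc: "continuous_on UNIV g" by (rule uniformly_continuous_imp_continuous[OF uc])
  then have gm [measurable]: "g \<in> borel_measurable borel" by (rule borel_measurable_continuous_onI)
  obtain C0 where C0: "\<And>n. measure (\<mu> n) UNIV \<le> C0" using mass_bounded by blast
  define C where "C = max C0 (measure \<nu> UNIV) + 1"
  have "0 \<le> measure \<nu> UNIV" by simp
  then have C: "measure (\<mu> n) UNIV \<le> C" "measure \<nu> UNIV \<le> C" "C > 0" for n
    using C0[of n] unfolding C_def by linarith+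
  define \<eta> where "\<eta> = r / (4 * C)"
  have \<eta>: "\<eta> > 0" using r C(3) by (simp add: \<eta>_def)
  obtain m :: nat where m: "m > 0" "\<And>x. \<bar>(\<integral>z. g (x + (1 / real m) *\<^sub>R z) \<partial>std_gaussian) - g x\<bar> \<le> \<eta>"
    using gaussian_smoothing_uniform[OF uc B \<eta>] by blast
  define k where "k = (real m / sqrt (2 * pi)) ^ CARD('d)"
  let ?h = "\<lambda>x. k * mollify (real m) g x"
  have h: "?h x = (\<integral>z. g (x + (1 / real m) *\<^sub>R z) \<partial>std_gaussian)" for x
    unfolding k_def using m(1) by (intro mollify_eq[symmetric] gm) simp
  have hm [measurable]: "?h \<in> borel_measurable borel"
    unfolding h by measurable
  have hB: "\<bar>?h x\<bar> \<le> B + \<eta>" for x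
    using m(2)[of x] B[of x] unfolding h by linarith
  have close: "\<bar>(\<integral>x. ?h x \<partial>N) - (\<integral>x. g x \<partial>N)\<bar> \<le> \<eta> * C"
    if N: "finite_measure N" "sets N = sets borel" "measure N UNIV \<le> C" for N
  proof -
    have "(\<integral>x. ?h x \<partial>N) - (\<integral>x. g x \<partial>N) = (\<integral>x. ?h x - g x \<partial>N)"
      using integral_bounded_le(1)[OF N(1,2) gm, of B] B
        integral_bounded_le(1)[OF N(1,2) hm, of "B + \<eta>"] hB by simp
    also have "\<bar>\<dots>\<bar> \<le> \<eta> * measure N UNIV"
      using integral_bounded_le(2)[OF N(1,2), of "\<lambda>x. ?h x - g x" \<eta>] m(2) unfolding h[symmetric] by simp
    also have "\<dots> \<le> \<eta> * C"
      using N(3) \<eta> by (intro mult_left_mono) auto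
    finally show ?thesis .
  qed
  have "integrable lborel g"
  proof -
    have "integrable lborel (\<lambda>x. indicator (cball 0 R) x *\<^sub>R g x)"
      by (rule borel_integrable_compact) (auto intro: continuous_on_subset[OF gc])
    moreover have "(\<lambda>x. indicator (cball 0 R) x *\<^sub>R g x) = g"
      using R by (auto simp: fun_eq_iff indicator_def not_le)
    ultimately show ?thesis by simp
  qed
  from mollify_converges[OF this] have "(\<lambda>n. \<integral>x. ?h x \<partial>\<mu> n) \<longlonglongrightarrow> (\<integral>x. ?h x \<partial>\<nu>)"
    by (simp add: tendsto_mult_left)
  then obtain n0 where n0: "\<And>n. n \<ge> n0 \<Longrightarrow> \<bar>(\<integral>x. ?h x \<partial>\<mu> n) - (\<integral>x. ?h x \<partial>\<nu>)\<bar> < r / 2"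
    using LIMSEQ_D[of _ _ "r / 2"] r by (metis half_gt_zero real_norm_def)
  have "\<eta> * C = r / 4" using C(3) by (simp add: \<eta>_def)
  then have "\<bar>(\<integral>x. g x \<partial>\<mu> n) - (\<integral>x. g x \<partial>\<nu>)\<bar> < r" if "n \<ge> n0" for n
    using n0[OF that] close[OF fin(1) sets(1) C(1), of n] close[OF fin(2) sets(2) C(2)] by linarith
  then show "\<exists>n0. \<forall>n\<ge>n0. norm ((\<integral>x. g x \<partial>\<mu> n) - (\<integral>x. g x \<partial>\<nu>)) < r"
    by auto
qed

definition cutoff :: "real \<Rightarrow> real^'d \<Rightarrow> real" where
  "cutoff R x = max 0 (min 1 (R + 1 - norm x))"

text \<open>On the compact ball of radius R + 2 continuity is uniform. Two points at distance below
  1, not both in that ball, lie outside the radius R + 1, where the product vanishes.\<close>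

lemma cutoff_mult_uniformly_continuous:
  fixes g :: "real^'d \<Rightarrow> real"
  assumes g: "continuous_on UNIV g"
  shows "uniformly_continuous_on UNIV (\<lambda>x. cutoff R x * g x)"
proof -
  let ?h = "\<lambda>x. cutoff R x * g x"
  have cont: "continuous_on UNIV ?h"
    unfolding cutoff_def by (intro continuous_intros g)
  have zero: "?h x = 0" if "norm x \<ge> R + 1" for x
    using that by (simp add: cutoff_def)
  have "uniformly_continuous_on (cball 0 (R + 2)) ?h"
    by (intro compact_uniformly_continuous continuous_on_subset[OF cont]) auto
  then have uc: "\<exists>d>0. \<forall>x\<in>cball 0 (R + 2). \<forall>x'\<in>cball 0 (R + 2). dist x' x < d \<longrightarrow> dist (?h x') (?h x) < e" if "e > 0" for e
    using that unfolding uniformly_continuous_on_def by blast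
  show ?thesis
    unfolding uniformly_continuous_on_def
  proof (intro allI impI)
    fix e :: real assume "e > 0"
    then obtain d where d: "d > 0" "\<forall>x\<in>cball 0 (R + 2). \<forall>x'\<in>cball 0 (R + 2). dist x' x < d \<longrightarrow> dist (?h x') (?h x) < e"
      using uc by blast
    show "\<exists>d>0. \<forall>x\<in>UNIV. \<forall>x'\<in>UNIV. dist x' x < d \<longrightarrow> dist (?h x') (?h x) < e"
    proof (intro exI[of _ "min d 1"] conjI ballI impI)
      fix x x' :: "real^'d" assume dist: "dist x' x < min d 1"
      show "dist (?h x') (?h x) < e"
      proof (cases "norm x \<le> R + 2 \<and> norm x' \<le> R + 2")
        case True
        then show ?thesis using d(2) dist by auto
      next
        case False
        then have "norm x \<ge> R + 1" "norm x' \<ge> R + 1"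
          using dist norm_triangle_ineq2[of x x'] norm_triangle_ineq2[of x' x]
          by (auto simp: dist_norm norm_minus_commute)
        then have "?h x = 0" "?h x' = 0"
          by (simp_all only: zero)
        then have "dist (?h x') (?h x) = 0"
          by (simp only: dist_self)
        with \<open>e > 0\<close> show ?thesis by linarith
      qed
    qed (use d in auto)
  qed
qed

text \<open>Tightness comes from the limit: a cutoff carries almost all the mass of \<nu>, its
  integrals converge, and so do the total masses, hence eventually every \<open>\<mu> n\<close> has
  little mass outside.\<close>

lemma weak_convergence_of_char:
  fixes g :: "real^'d \<Rightarrow> real"
  assumes gc: "continuous_on UNIV g" and B: "\<And>x. \<bar>g x\<bar> \<le> B"
  shows "(\<lambda>n. \<integral>x. g x \<partial>\<mu> n) \<longlonglongrightarrow> (\<integral>x. g x \<partial>\<nu>)"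
proof (rule LIMSEQ_I)
  fix r :: real assume r: "r > 0"
  interpret N: finite_measure \<nu> by (rule fin)
  have spN: "space \<nu> = UNIV" using sets_eq_imp_space_eq[OF sets(2)] by simp
  have B0: "0 \<le> B" using B[of 0] by linarith
  have gm [measurable]: "g \<in> borel_measurable borel" by (rule borel_measurable_continuous_onI[OF gc])
  have cm [measurable]: "cutoff R \<in> borel_measurable borel" for R
    unfolding cutoff_def by measurable
  have c01: "0 \<le> cutoff R x" "cutoff R x \<le> 1" for R x
    by (auto simp: cutoff_def)
  have cuc: "uniformly_continuous_on UNIV (cutoff R)" for R
    using cutoff_mult_uniformly_continuous[of "\<lambda>_. 1" R] by simp
  \<comment> \<open>The errors will add up to at most 2 B e + B e + e, which this choice keeps below
    r.\<close>
  define e where "e = r / (4 * B + 4)"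
  have e: "e > 0" using r B0 by (simp add: e_def)
  have "(\<lambda>m. \<integral>x. cutoff (real m) x \<partial>\<nu>) \<longlonglongrightarrow> (\<integral>x. 1 \<partial>\<nu>)"
  proof (rule integral_dominated_convergence[where w = "\<lambda>_. 1"])
    show "AE x in \<nu>. (\<lambda>m. cutoff (real m) x) \<longlonglongrightarrow> 1"
    proof (rule AE_I2)
      fix x :: "real^'d"
      have "eventually (\<lambda>m. real m > norm x) sequentially"
        using filterlim_real_sequentially unfolding filterlim_at_top_dense by blast
      then have "eventually (\<lambda>m. cutoff (real m) x = 1) sequentially"
        by eventually_elim (simp add: cutoff_def)
      then show "(\<lambda>m. cutoff (real m) x) \<longlonglongrightarrow> 1" by (rule tendsto_eventually)
    qed
  qed (use c01 in auto)
  then have "eventually (\<lambda>m. (\<integral>x. cutoff (real m) x \<partial>\<nu>) > measure \<nu> UNIV - e) sequentially"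
    using e by (intro order_tendstoD(1)[where y = "measure \<nu> UNIV"]) (auto simp: spN)
  then obtain m :: nat where m: "(\<integral>x. cutoff (real m) x \<partial>\<nu>) > measure \<nu> UNIV - e"
    unfolding eventually_sequentially by blast
  let ?c = "cutoff (real m)"
  have zero: "norm x > real m + 1 \<Longrightarrow> ?c x = 0" for x
    by (simp add: cutoff_def)
  have 1: "(\<lambda>n. \<integral>x. ?c x \<partial>\<mu> n) \<longlonglongrightarrow> (\<integral>x. ?c x \<partial>\<nu>)"
    by (rule compact_support_converges[OF cuc, of m 1 "real m + 1"]) (use c01 zero in auto)
  have 2: "(\<lambda>n. \<integral>x. ?c x * g x \<partial>\<mu> n) \<longlonglongrightarrow> (\<integral>x. ?c x * g x \<partial>\<nu>)"
  proof (rule compact_support_converges[OF cutoff_mult_uniformly_continuous[OF gc], of m B "real m + 1"])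
    show "\<bar>?c x * g x\<bar> \<le> B" for x
      using mult_mono[OF c01(2)[of m x] B[of x]] c01(1)[of m x] by (simp add: abs_mult)
  qed (use zero in auto)
  have split: "\<bar>(\<integral>x. g x \<partial>L) - (\<integral>x. ?c x * g x \<partial>L)\<bar> \<le> B * (measure L UNIV - (\<integral>x. ?c x \<partial>L))"
    if L: "finite_measure L" "sets L = sets borel" for L
  proof -
    interpret L: finite_measure L by fact
    note L(2)[measurable_cong]
    have spL: "space L = UNIV" using sets_eq_imp_space_eq[OF L(2)] by simp
    have i1: "integrable L g" by (rule integral_bounded_le(1)[OF L gm, of B]) (use B in auto)
    have i2: "integrable L ?c" by (rule integral_bounded_le(1)[OF L cm, of m 1]) (use c01 in auto)
    have i3: "integrable L (\<lambda>x. ?c x * g x)"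
    proof (rule integral_bounded_le(1)[OF L, of _ B])
      show "norm (?c x * g x) \<le> B" for x
        using mult_mono[OF c01(2)[of m x] B[of x]] c01(1)[of m x] by (simp add: abs_mult)
    qed measurable
    have "(\<integral>x. g x \<partial>L) - (\<integral>x. ?c x * g x \<partial>L) = (\<integral>x. g x - ?c x * g x \<partial>L)"
      using i1 i3 by simp
    also have "\<bar>\<dots>\<bar> \<le> (\<integral>x. B * (1 - ?c x) \<partial>L)"
    proof (rule Bochner_Integration.integral_norm_bound_integral[where 'b = real, unfolded real_norm_def])
      fix x
      have "g x - ?c x * g x = g x * (1 - ?c x)"
        by (simp add: algebra_simps)
      then have "\<bar>g x - ?c x * g x\<bar> = \<bar>g x\<bar> * (1 - ?c x)"
        using c01[of m x] by (simp add: abs_mult)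
      then show "\<bar>g x - ?c x * g x\<bar> \<le> B * (1 - ?c x)"
        using B[of x] c01[of m x] by (simp add: mult_right_mono)
    qed (use i1 i2 i3 in auto)
    also have "\<dots> = B * (measure L UNIV - (\<integral>x. ?c x \<partial>L))"
      using i2 by (simp add: spL)
    finally show ?thesis .
  qed
  have "eventually (\<lambda>n. \<bar>(\<integral>x. ?c x \<partial>\<mu> n) - (\<integral>x. ?c x \<partial>\<nu>)\<bar> < e / 2) sequentially"
    using tendstoD[OF 1, of "e / 2"] e by (simp add: dist_real_def)
  moreover have "eventually (\<lambda>n. \<bar>(\<integral>x. ?c x * g x \<partial>\<mu> n) - (\<integral>x. ?c x * g x \<partial>\<nu>)\<bar> < e) sequentially"
    using tendstoD[OF 2, of e] e by (simp add: dist_real_def)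
  moreover have "eventually (\<lambda>n. \<bar>measure (\<mu> n) UNIV - measure \<nu> UNIV\<bar> < e / 2) sequentially"
    using tendstoD[OF mass_converges, of "e / 2"] e by (simp add: dist_real_def)
  ultimately have "eventually (\<lambda>n. \<bar>(\<integral>x. g x \<partial>\<mu> n) - (\<integral>x. g x \<partial>\<nu>)\<bar> < r) sequentially"
  proof eventually_elim
    case (elim n)
    have "B * (measure (\<mu> n) UNIV - (\<integral>x. ?c x \<partial>\<mu> n)) \<le> B * (2 * e)"
      using elim m B0 by (intro mult_left_mono) linarith+
    moreover have "B * (measure \<nu> UNIV - (\<integral>x. ?c x \<partial>\<nu>)) \<le> B * e"
      using m B0 by (intro mult_left_mono) linarith+
    moreover have "B * (2 * e) + B * e + e < r"
    proof -
      have "r = (4 * B + 4) * e"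
        using B0 by (simp add: e_def)
      then have "r = 4 * (B * e) + 4 * e"
        by (simp add: algebra_simps)
      moreover have "0 \<le> B * e"
        using B0 e by simp
      ultimately show ?thesis using e by (simp add: algebra_simps)
    qed
    ultimately show ?case
      using split[OF fin(1) sets(1), of n] split[OF fin(2) sets(2)] elim(2) by linarith
  qed
  then show "\<exists>n0. \<forall>n\<ge>n0. norm ((\<integral>x. g x \<partial>\<mu> n) - (\<integral>x. g x \<partial>\<nu>)) < r"
    unfolding eventually_sequentially by simp
qed

end

text \<open>The law of X_n restricted to A is compared, unnormalised, with P(A) \<nu>. Working with
  finite measures treats an event of probability zero in the same way as any other.\<close>

lemma conv_in_law_onI_char:
  fixes X :: "nat \<Rightarrow> 'w \<Rightarrow> real^'d"
  assumes P: "prob_space P" and A [measurable]: "A \<in> sets P"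
    and X [measurable]: "\<And>n. X n \<in> borel_measurable P"
    and \<nu>: "prob_space \<nu>" "sets \<nu> = sets borel"
    and char: "\<And>t. (\<lambda>n. \<integral>\<omega>. indicator A \<omega> *\<^sub>R cis (t \<bullet> X n \<omega>) \<partial>P) \<longlonglongrightarrow> measure P A *\<^sub>R (\<integral>x. cis (t \<bullet> x) \<partial>\<nu>)"
  shows "conv_in_law_on P A X \<nu>"
proof -
  interpret P: prob_space P by fact
  interpret N: prob_space \<nu> by fact
  note \<nu>(2)[measurable_cong]
  define \<mu> where "\<mu> n = distr (density P (indicator A)) borel (X n)" for n
  define \<mu>' where "\<mu>' = density \<nu> (\<lambda>_. ennreal (measure P A))"
  have \<mu>: "(\<integral>x. h x \<partial>\<mu> n) = (\<integral>\<omega>. indicator A \<omega> *\<^sub>R h (X n \<omega>) \<partial>P)"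
    if [measurable]: "h \<in> borel_measurable borel" for h :: "real^'d \<Rightarrow> 'b::{banach, second_countable_topology}" and n
  proof -
    have ind: "indicator A = (\<lambda>\<omega>. ennreal (indicator A \<omega>))"
      by (auto simp: indicator_def fun_eq_iff)
    have "(\<integral>x. h x \<partial>\<mu> n) = (\<integral>\<omega>. h (X n \<omega>) \<partial>density P (indicator A))"
      unfolding \<mu>_def by (rule integral_distr) auto
    also have "\<dots> = (\<integral>\<omega>. indicator A \<omega> *\<^sub>R h (X n \<omega>) \<partial>P)"
      unfolding ind by (rule integral_density) auto
    finally show ?thesis .
  qed
  have \<mu>': "(\<integral>x. h x \<partial>\<mu>') = measure P A *\<^sub>R (\<integral>x. h x \<partial>\<nu>)"
    if [measurable]: "h \<in> borel_measurable borel" for h :: "real^'d \<Rightarrow> 'b::{banach, second_countable_topology}"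
    unfolding \<mu>'_def by (subst integral_density) auto
  have fin: "finite_measure (\<mu> n)" for n
  proof
    have "emeasure (\<mu> n) (space (\<mu> n)) = emeasure P A"
      unfolding \<mu>_def by (simp add: emeasure_distr emeasure_density P.emeasure_space_1)
    then show "emeasure (\<mu> n) (space (\<mu> n)) \<noteq> \<infinity>" by simp
  qed
  have fin': "finite_measure \<mu>'"
  proof
    show "emeasure \<mu>' (space \<mu>') \<noteq> \<infinity>"
      unfolding \<mu>'_def by (simp add: emeasure_density N.emeasure_space_1)
  qed
  have sets: "sets (\<mu> n) = sets borel" "sets \<mu>' = sets borel" for n
    by (simp_all add: \<mu>_def \<mu>'_def \<nu>)
  show ?thesis
    unfolding conv_in_law_on_def
  proof (intro allI impI, elim conjE)
    fix g :: "real^'d \<Rightarrow> real" assume g: "continuous_on UNIV g" "bounded (range g)"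
    then obtain B where B: "\<And>x. \<bar>g x\<bar> \<le> B" unfolding bounded_iff by auto
    have gm: "g \<in> borel_measurable borel" by (rule borel_measurable_continuous_onI[OF g(1)])
    have "(\<lambda>n. \<integral>x. g x \<partial>\<mu> n) \<longlonglongrightarrow> (\<integral>x. g x \<partial>\<mu>')"
    proof (rule weak_convergence_of_char[OF fin fin' sets _ g(1) B])
      show "(\<lambda>n. \<integral>x. cis (t \<bullet> x) \<partial>\<mu> n) \<longlonglongrightarrow> (\<integral>x. cis (t \<bullet> x) \<partial>\<mu>')" for t
        using char[of t] by (simp add: \<mu> \<mu>')
    qed
    then show "(\<lambda>n. \<integral>\<omega>. indicator A \<omega> * g (X n \<omega>) \<partial>P) \<longlonglongrightarrow> measure P A * (\<integral>x. g x \<partial>\<nu>)"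
      using gm by (simp add: \<mu> \<mu>')
  qed
qed

subsection \<open>Asymptotics of sums and recursions\<close>

text \<open>The finitely many early terms contribute a constant, which is absorbed because the
  comparison sums diverge; all later terms are small against g termwise.\<close>

lemma sum_smallo_sum:
  fixes u g :: "nat \<Rightarrow> real"
  assumes u: "u \<in> o(g)" and g: "\<And>k. k \<ge> 1 \<Longrightarrow> 0 \<le> g k"
    and G: "filterlim (\<lambda>n. \<Sum>k=1..n. g k) at_top sequentially"
  shows "(\<lambda>n. \<Sum>k=1..n. u k) \<in> o(\<lambda>n. \<Sum>k=1..n. g k)"
proof (rule landau_o.smallI)
  fix c :: real assume c: "c > 0"
  have "eventually (\<lambda>k. norm (u k) \<le> (c / 2) * norm (g k)) sequentially"
    using landau_o.smallD[OF u, of "c / 2"] c by simp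
  then obtain k0 where k0: "\<And>k. k \<ge> k0 \<Longrightarrow> \<bar>u k\<bar> \<le> (c / 2) * \<bar>g k\<bar>"
    unfolding eventually_sequentially by auto
  define B where "B = (\<Sum>k\<in>{1..k0}. \<bar>u k\<bar>)"
  have bound: "\<bar>\<Sum>k=1..n. u k\<bar> \<le> B + (c / 2) * (\<Sum>k=1..n. g k)" for n
  proof -
    have "\<bar>\<Sum>k=1..n. u k\<bar> \<le> (\<Sum>k=1..n. \<bar>u k\<bar>)"
      by (rule sum_abs)
    also have "\<dots> \<le> (\<Sum>k=1..n. (if k \<in> {1..k0} then \<bar>u k\<bar> else 0) + (c / 2) * g k)"
    proof (rule sum_mono)
      fix k assume k: "k \<in> {1..n}"
      then have "0 \<le> (c / 2) * g k" using g[of k] c by simp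
      then show "\<bar>u k\<bar> \<le> (if k \<in> {1..k0} then \<bar>u k\<bar> else 0) + (c / 2) * g k"
        using k0[of k] k g[of k] by (cases "k \<le> k0") auto
    qed
    also have "\<dots> = (\<Sum>k=1..n. if k \<in> {1..k0} then \<bar>u k\<bar> else 0) + (c / 2) * (\<Sum>k=1..n. g k)"
      by (simp add: sum.distrib sum_distrib_left)
    also have "(\<Sum>k=1..n. if k \<in> {1..k0} then \<bar>u k\<bar> else 0) = (\<Sum>k\<in>{1..n} \<inter> {1..k0}. \<bar>u k\<bar>)"
      by (rule sum.inter_restrict[symmetric]) simp
    also have "\<dots> \<le> B"
      unfolding B_def by (rule sum_mono2) auto
    finally show ?thesis by simp
  qed
  have "eventually (\<lambda>n. 2 * B / c \<le> (\<Sum>k=1..n. g k)) sequentially"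
    using G unfolding filterlim_at_top by blast
  then show "eventually (\<lambda>n. norm (\<Sum>k=1..n. u k) \<le> c * norm (\<Sum>k=1..n. g k)) sequentially"
  proof eventually_elim
    case (elim n)
    have "0 \<le> (\<Sum>k=1..n. g k)"
      using g by (intro sum_nonneg) auto
    moreover have "B \<le> (c / 2) * (\<Sum>k=1..n. g k)"
      using elim c by (simp add: field_simps)
    ultimately show ?case
      using bound[of n] by simp
  qed
qed

lemma sum_asymp_equiv_sum:
  fixes u g :: "nat \<Rightarrow> real"
  assumes u: "u \<sim>[sequentially] g" and g: "\<And>k. k \<ge> 1 \<Longrightarrow> 0 \<le> g k"
    and G: "filterlim (\<lambda>n. \<Sum>k=1..n. g k) at_top sequentially"
  shows "(\<lambda>n. \<Sum>k=1..n. u k) \<sim>[sequentially] (\<lambda>n. \<Sum>k=1..n. g k)"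
proof -
  have "(\<lambda>k. u k - g k) \<in> o(g)"
    using u by (simp add: asymp_equiv_altdef)
  from sum_smallo_sum[OF this g G] show ?thesis
    by (simp add: asymp_equiv_altdef sum_subtractf)
qed

text \<open>The form in which sums are evaluated: guess a function G whose backward difference is
  equivalent to the summand, which is a mere asymptotic check, and telescope.\<close>

lemma sum_asymp_equiv_antidiff:
  fixes u G :: "nat \<Rightarrow> real"
  assumes u: "u \<sim>[sequentially] (\<lambda>n. G n - G (n - 1))" and mono: "\<And>k. k \<ge> 1 \<Longrightarrow> G (k - 1) \<le> G k"
    and G: "filterlim G at_top sequentially"
  shows "(\<lambda>n. \<Sum>k=1..n. u k) \<sim>[sequentially] G"
proof -
  have tele: "(\<Sum>k=1..n. G k - G (k - 1)) = G n - G 0" for n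
    by (induction n) auto
  then have tele': "(\<lambda>n. \<Sum>k=1..n. G k - G (k - 1)) = (\<lambda>n. G n - G 0)" by (rule ext)
  have lim: "filterlim (\<lambda>n. G n - G 0) at_top sequentially"
    using filterlim_tendsto_add_at_top[OF tendsto_const[of "- G 0"] G] by simp
  have "(\<lambda>n. \<Sum>k=1..n. u k) \<sim>[sequentially] (\<lambda>n. \<Sum>k=1..n. G k - G (k - 1))"
    by (rule sum_asymp_equiv_sum[OF u]) (use mono lim tele' in auto)
  also have "\<dots> = (\<lambda>n. G n - G 0)"
    by (rule tele')
  also have "\<dots> \<sim>[sequentially] G"
  proof -
    have "(\<lambda>n. - G 0) \<in> o(G)"
    proof (rule landau_o.smallI)
      fix c :: real assume "c > 0"
      have "eventually (\<lambda>n. \<bar>G 0\<bar> / c \<le> G n) sequentially"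
        using G unfolding filterlim_at_top by blast
      then show "eventually (\<lambda>n. norm (- G 0) \<le> c * norm (G n)) sequentially"
      proof eventually_elim
        case (elim n)
        then have "\<bar>G 0\<bar> \<le> c * G n"
          using \<open>c > 0\<close> by (simp add: field_simps)
        also have "\<dots> \<le> c * \<bar>G n\<bar>"
          using \<open>c > 0\<close> by simp
        finally show ?case by simp
      qed
    qed
    then show ?thesis by (simp add: asymp_equiv_altdef)
  qed
  finally show ?thesis .
qed

text \<open>The relative change of k^(-p) from k to k + 1 is of order 1/k, hence negligible against
  k^(-\<psi>) as \<psi> < 1. Half of the contraction pays for this change, and the other half
  absorbs the input.\<close>

lemma recursion_rate:
  fixes e :: "nat \<Rightarrow> real"
  assumes \<psi>: "0 < \<psi>" "\<psi> < 1" and p: "0 < p" and c: "0 < c" and C: "0 \<le> C"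
    and e: "\<And>k. 0 \<le> e k"
    and step: "\<And>k. k \<ge> k0 \<Longrightarrow> e (Suc k) \<le> (1 - c * real (Suc k) powr - \<psi>) * e k
        + C * real (Suc k) powr (- \<psi> - p)"
  shows "e \<in> O(\<lambda>k. real k powr - p)"
proof -
  have "eventually (\<lambda>x::real. (1 - c * (x + 1) powr - \<psi>) * x powr - p
      \<le> (1 - c / 2 * (x + 1) powr - \<psi>) * (x + 1) powr - p) at_top"
    using \<psi> p c by real_asymp
  moreover have "eventually (\<lambda>x::real. 0 \<le> 1 - c * (x + 1) powr - \<psi>) at_top"
    using \<psi> c by real_asymp
  ultimately have "eventually (\<lambda>k. (1 - c * (real k + 1) powr - \<psi>) * real k powr - p
      \<le> (1 - c / 2 * (real k + 1) powr - \<psi>) * (real k + 1) powr - p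
      \<and> 0 \<le> 1 - c * (real k + 1) powr - \<psi>) sequentially"
    using eventually_conj filterlim_real_sequentially
    unfolding filterlim_iff by blast
  then obtain k1 where k1: "\<And>k. k \<ge> k1 \<Longrightarrow> (1 - c * (real k + 1) powr - \<psi>) * real k powr - p
      \<le> (1 - c / 2 * (real k + 1) powr - \<psi>) * (real k + 1) powr - p
      \<and> 0 \<le> 1 - c * (real k + 1) powr - \<psi>"
    unfolding eventually_sequentially by blast
  define m where "m = max (max k0 k1) 1"
  \<comment> \<open>The first entry lets half of the contraction absorb C; the second starts the
    induction at m.\<close>
  define B where "B = max (2 * C / c) (e m * real m powr p)"
  have B: "2 * C / c \<le> B" "0 \<le> B" "e m * real m powr p \<le> B"
    using C c by (auto simp: B_def le_max_iff_disj)
  have CB: "C \<le> B * (c / 2)"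
    using B c by (simp add: field_simps)
  have "e k \<le> B * real k powr - p" if "k \<ge> m" for k
    using that
  proof (induction k rule: dec_induct)
    case base
    have "e m * (real m powr p * real m powr - p) \<le> B * real m powr - p"
      using B(3) by (simp add: mult.assoc[symmetric] mult_right_mono)
    moreover have "real m powr p * real m powr - p = 1"
      by (simp add: m_def flip: powr_add)
    ultimately show ?case by simp
  next
    case (step k)
    let ?t = "real (Suc k) powr - \<psi>"
    have Suc: "real k + 1 = real (Suc k)" by simp
    have k1': "(1 - c * ?t) * real k powr - p \<le> (1 - c / 2 * ?t) * real (Suc k) powr - p"
      "0 \<le> 1 - c * ?t"
      using k1[of k] step.hyps(1) unfolding Suc m_def by auto
    have "e (Suc k) \<le> (1 - c * ?t) * e k + C * real (Suc k) powr (- \<psi> - p)"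
      using assms(7)[of k] step.hyps by (simp add: m_def)
    also have "\<dots> \<le> (1 - c * ?t) * (B * real k powr - p) + (B * (c / 2)) * (?t * real (Suc k) powr - p)"
    proof (rule add_mono)
      show "(1 - c * ?t) * e k \<le> (1 - c * ?t) * (B * real k powr - p)"
        using k1'(2) step.IH by (rule mult_left_mono[rotated])
      have "real (Suc k) powr (- \<psi> - p) = ?t * real (Suc k) powr - p"
        by (simp flip: powr_add)
      then show "C * real (Suc k) powr (- \<psi> - p) \<le> (B * (c / 2)) * (?t * real (Suc k) powr - p)"
        using CB by (simp only:) (intro mult_right_mono, auto)
    qed
    also have "\<dots> \<le> B * ((1 - c / 2 * ?t) * real (Suc k) powr - p) + (B * (c / 2)) * (?t * real (Suc k) powr - p)"
      using mult_left_mono[OF k1'(1) B(2)] by (simp add: mult.left_commute mult.assoc)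
    also have "\<dots> = B * real (Suc k) powr - p"
      by (simp add: algebra_simps)
    finally show ?case .
  qed
  then have "eventually (\<lambda>k. norm (e k) \<le> B * norm (real k powr - p)) sequentially"
    using e unfolding eventually_sequentially by (intro exI[of _ m]) auto
  then show ?thesis by (rule bigoI)
qed

subsection \<open>Moments, independence and a central limit theorem for predictable arrays\<close>

lemma norm_integral_le:
  fixes f :: "'a \<Rightarrow> 'b::{banach, second_countable_topology}"
  assumes "integrable M f" "integrable M g" "\<And>\<omega>. norm (f \<omega>) \<le> g \<omega>"
  shows "norm (\<integral>\<omega>. f \<omega> \<partial>M) \<le> (\<integral>\<omega>. g \<omega> \<partial>M)"
  by (rule order_trans[OF integral_norm_bound integral_mono]) (use assms in auto)

text \<open>Bernoulli's inequality for real exponents, from Young's inequality for the product a * 1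
  with exponents r and r / (r - 1).\<close>

lemma powr_tangent:
  fixes a r :: real
  assumes "0 \<le> a" "1 \<le> r"
  shows "1 + r * (a - 1) \<le> a powr r"
proof (cases "r = 1")
  case True
  then show ?thesis using assms by simp
next
  case False
  then have r: "r > 1" using assms by simp
  define q where "q = r / (r - 1)"
  have "a * 1 \<le> a powr r / r + 1 powr q / q"
    by (rule Youngs_inequality) (use r assms in \<open>auto simp: q_def field_simps\<close>)
  then have "a * 1 \<le> a powr r / r + (r - 1) / r" by (simp add: q_def)
  then have "r * a \<le> r * (a powr r / r + (r - 1) / r)"
    using r by (intro mult_left_mono) auto
  also have "\<dots> = a powr r + (r - 1)"
    using r by (simp add: field_simps)
  finally show ?thesis by (simp add: algebra_simps)
qed

text \<open>Jensen's inequality for the power r, obtained by integrating the tangent at the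
  mean.\<close>

lemma (in prob_space) power_mean:
  fixes Z :: "'a \<Rightarrow> real"
  assumes Z [measurable]: "Z \<in> borel_measurable M" and nn: "\<And>\<omega>. 0 \<le> Z \<omega>" and r: "1 \<le> r"
    and int: "integrable M (\<lambda>\<omega>. Z \<omega> powr r)"
  shows "integrable M Z" "expectation Z powr r \<le> expectation (\<lambda>\<omega>. Z \<omega> powr r)"
proof -
  have le: "Z \<omega> \<le> 1 + Z \<omega> powr r" for \<omega>
  proof (cases "Z \<omega> \<le> 1")
    case False
    then have "Z \<omega> powr 1 \<le> Z \<omega> powr r"
      using r by (intro powr_mono) auto
    then show ?thesis using False by simp
  qed (simp add: add_increasing2)
  show iZ: "integrable M Z"
    by (rule Bochner_Integration.integrable_bound[of _ "\<lambda>\<omega>. 1 + Z \<omega> powr r"])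
      (use int le nn in \<open>auto simp: abs_of_nonneg add_nonneg_nonneg\<close>)
  let ?m = "expectation Z"
  have m0: "0 \<le> ?m" using nn by simp
  show "?m powr r \<le> expectation (\<lambda>\<omega>. Z \<omega> powr r)"
  proof (cases "?m = 0")
    case True
    then show ?thesis using r by simp
  next
    case False
    then have m: "?m > 0" using m0 by simp
    have "1 = expectation (\<lambda>\<omega>. 1 + r * (Z \<omega> / ?m - 1))"
      using iZ m by (simp add: prob_space)
    also have "\<dots> \<le> expectation (\<lambda>\<omega>. Z \<omega> powr r / ?m powr r)"
    proof (rule integral_mono)
      fix \<omega>
      show "1 + r * (Z \<omega> / ?m - 1) \<le> Z \<omega> powr r / ?m powr r"
        using powr_tangent[of "Z \<omega> / ?m" r] nn[of \<omega>] m r by (simp add: powr_divide)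
    qed (use iZ int in auto)
    also have "\<dots> = expectation (\<lambda>\<omega>. Z \<omega> powr r) / ?m powr r" by simp
    finally show ?thesis using m by (simp add: field_simps)
  qed
qed

text \<open>The Taylor remainder is at most |x|^3 and at most |x|^2. One of these is below |x|^q on
  each side of |x| = 1, which is why q lies between 2 and 3.\<close>

lemma cis_taylor_powr:
  assumes "2 \<le> q" "q \<le> 3"
  shows "cmod (cis x - (1 + \<i> * x - x\<^sup>2 / 2)) \<le> \<bar>x\<bar> powr q"
proof -
  have eq: "(\<Sum>k\<le>2. (\<i> * x) ^ k / fact k) = 1 + \<i> * x - x\<^sup>2 / 2"
    by (simp add: eval_nat_numeral power2_eq_square) (simp add: complex_eq_iff)
  show ?thesis
  proof (cases "\<bar>x\<bar> \<le> 1")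
    case True
    have "cmod (cis x - (1 + \<i> * x - x\<^sup>2 / 2)) \<le> \<bar>x\<bar> ^ 3 / 6"
      using iexp_approx1[of x 2] unfolding eq cis_conv_exp by (simp add: eval_nat_numeral)
    also have "\<dots> \<le> \<bar>x\<bar> ^ 3" by simp
    also have "\<dots> \<le> \<bar>x\<bar> powr q"
    proof (cases "x = 0")
      case False
      then have "\<bar>x\<bar> ^ 3 = \<bar>x\<bar> powr 3" by simp
      also have "\<dots> \<le> \<bar>x\<bar> powr q"
        using True False assms by (intro powr_mono') auto
      finally show ?thesis .
    qed simp
    finally show ?thesis .
  next
    case False
    have "cmod (cis x - (1 + \<i> * x - x\<^sup>2 / 2)) \<le> \<bar>x\<bar> ^ 2"
      using iexp_approx2[of x 2] unfolding eq cis_conv_exp by (simp add: eval_nat_numeral)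
    also have "\<dots> = \<bar>x\<bar> powr 2" using False by simp
    also have "\<dots> \<le> \<bar>x\<bar> powr q"
      using False assms by (intro powr_mono) auto
    finally show ?thesis .
  qed
qed

text \<open>The remainder is at most u and at most u^2; as before, one of the two lies below u^r on
  each side of 1.\<close>

lemma exp_taylor_powr:
  fixes u r :: real
  assumes u: "0 \<le> u" and r: "1 \<le> r" "r \<le> 2"
  shows "\<bar>exp (- u) - (1 - u)\<bar> \<le> u powr r"
proof -
  have ge: "0 \<le> exp (- u) - (1 - u)" using exp_ge_add_one_self[of "- u"] by simp
  have le1: "exp (- u) - (1 - u) \<le> u" using u by simp
  have le2: "exp (- u) - (1 - u) \<le> u\<^sup>2"
  proof (cases "u \<le> 1")
    case True
    have "exp (- u) = 1 / exp u" by (simp add: exp_minus inverse_eq_divide)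
    also have "\<dots> \<le> 1 / (1 + u)"
      using exp_ge_add_one_self[of u] u by (intro divide_left_mono) auto
    also have "\<dots> \<le> 1 - u + u\<^sup>2"
      using u by (simp add: field_simps power2_eq_square)
    finally show ?thesis by simp
  next
    case False
    then have "u * 1 \<le> u * u" by (intro mult_left_mono) auto
    then show ?thesis using le1 unfolding power2_eq_square by linarith
  qed
  show ?thesis
  proof (cases "u = 0")
    case False
    then have u0: "u > 0" using u by simp
    show ?thesis
    proof (cases "u \<le> 1")
      case True
      have "u\<^sup>2 = u powr 2" using u0 by simp
      also have "\<dots> \<le> u powr r" using True u0 r by (intro powr_mono') auto
      finally show ?thesis using ge le2 by linarith
    next
      case False
      have "u = u powr 1" using u0 by simp
      also have "\<dots> \<le> u powr r" using False r by (intro powr_mono) auto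
      finally show ?thesis using ge le1 by linarith
    qed
  qed simp
qed

text \<open>Both functions are compared with 1 - v/2, where v is the variance. Each comparison costs
  one q-th absolute moment: the first by the Taylor bound, the second because v^(q/2) is at most
  that moment.\<close>

lemma (in prob_space) char_approx_powr:
  fixes X :: "'a \<Rightarrow> real"
  assumes X [measurable]: "X \<in> borel_measurable M" and q: "2 \<le> q" "q \<le> 3"
    and int: "integrable M (\<lambda>\<omega>. \<bar>X \<omega>\<bar> powr q)" and mean: "expectation X = 0"
  shows "integrable M X" "integrable M (\<lambda>\<omega>. (X \<omega>)\<^sup>2)"
    "cmod (expectation (\<lambda>\<omega>. cis (X \<omega>)) - exp (- expectation (\<lambda>\<omega>. (X \<omega>)\<^sup>2) / 2))
      \<le> 2 * expectation (\<lambda>\<omega>. \<bar>X \<omega>\<bar> powr q)"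
proof -
  have sq: "((X \<omega>)\<^sup>2) powr (q / 2) = \<bar>X \<omega>\<bar> powr q" for \<omega>
  proof (cases "X \<omega> = 0")
    case False
    then have "(X \<omega>)\<^sup>2 = \<bar>X \<omega>\<bar> powr 2" by simp
    then show ?thesis by (simp only: powr_powr) simp
  qed (use q in simp)
  have pm: "integrable M (\<lambda>\<omega>. (X \<omega>)\<^sup>2)"
    "expectation (\<lambda>\<omega>. (X \<omega>)\<^sup>2) powr (q / 2) \<le> expectation (\<lambda>\<omega>. \<bar>X \<omega>\<bar> powr q)"
    using power_mean[of "\<lambda>\<omega>. (X \<omega>)\<^sup>2" "q / 2"] int q by (simp_all add: sq)
  show i2: "integrable M (\<lambda>\<omega>. (X \<omega>)\<^sup>2)" by (rule pm)
  show i1: "integrable M X"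
    by (rule square_integrable_imp_integrable[OF X i2])
  let ?v = "expectation (\<lambda>\<omega>. (X \<omega>)\<^sup>2)"
  have v0: "0 \<le> ?v" by simp
  have icis: "integrable M (\<lambda>\<omega>. cis (X \<omega>))"
    by (rule integrable_const_bound[of _ 1]) auto
  have "expectation (\<lambda>\<omega>. cis (X \<omega>)) - (1 - ?v / 2) =
    expectation (\<lambda>\<omega>. cis (X \<omega>) - (1 + \<i> * X \<omega> - (X \<omega>)\<^sup>2 / 2))"
    using icis i1 i2 mean by (simp add: prob_space flip: of_real_power)
  also have "cmod \<dots> \<le> expectation (\<lambda>\<omega>. \<bar>X \<omega>\<bar> powr q)"
    by (rule norm_integral_le)
      (use icis i1 i2 int cis_taylor_powr[OF q] in \<open>auto simp flip: of_real_power\<close>)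
  finally have 1: "cmod (expectation (\<lambda>\<omega>. cis (X \<omega>)) - (1 - ?v / 2)) \<le> expectation (\<lambda>\<omega>. \<bar>X \<omega>\<bar> powr q)" .
  have "\<bar>exp (- (?v / 2)) - (1 - ?v / 2)\<bar> \<le> (?v / 2) powr (q / 2)"
    by (rule exp_taylor_powr) (use q v0 in auto)
  also have "\<dots> \<le> ?v powr (q / 2)"
    using v0 q by (intro powr_mono2) auto
  also have "\<dots> \<le> expectation (\<lambda>\<omega>. \<bar>X \<omega>\<bar> powr q)" by (rule pm)
  finally have "cmod (complex_of_real (exp (- (?v / 2)) - (1 - ?v / 2))) \<le> expectation (\<lambda>\<omega>. \<bar>X \<omega>\<bar> powr q)"
    by (simp only: norm_of_real)
  then have 2: "cmod ((1 - ?v / 2) - exp (- ?v / 2)) \<le> expectation (\<lambda>\<omega>. \<bar>X \<omega>\<bar> powr q)"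
    by (simp add: norm_minus_commute)
  show "cmod (expectation (\<lambda>\<omega>. cis (X \<omega>)) - exp (- ?v / 2)) \<le> 2 * expectation (\<lambda>\<omega>. \<bar>X \<omega>\<bar> powr q)"
    using norm_triangle_ineq[of "expectation (\<lambda>\<omega>. cis (X \<omega>)) - (1 - ?v / 2)" "(1 - ?v / 2) - exp (- ?v / 2)"] 1 2
    by simp
qed

lemma (in prob_space) indep_sum_second_moment:
  fixes X :: "'i \<Rightarrow> 'a \<Rightarrow> real"
  assumes "finite I" "indep_vars (\<lambda>_. borel) X I"
    and "\<And>i. i \<in> I \<Longrightarrow> integrable M (\<lambda>\<omega>. (X i \<omega>)\<^sup>2)" "\<And>i. i \<in> I \<Longrightarrow> expectation (X i) = 0"
  shows "integrable M (\<lambda>\<omega>. (\<Sum>i\<in>I. X i \<omega>)\<^sup>2) \<and> expectation (\<lambda>\<omega>. \<Sum>i\<in>I. X i \<omega>) = 0 \<and>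
    expectation (\<lambda>\<omega>. (\<Sum>i\<in>I. X i \<omega>)\<^sup>2) = (\<Sum>i\<in>I. expectation (\<lambda>\<omega>. (X i \<omega>)\<^sup>2))"
  using assms
proof (induction I rule: finite_induct)
  case empty
  then show ?case by simp
next
  case (insert i F)
  let ?S = "\<lambda>\<omega>. \<Sum>i\<in>F. X i \<omega>"
  have IH: "integrable M (\<lambda>\<omega>. (?S \<omega>)\<^sup>2)" "expectation ?S = 0"
    "expectation (\<lambda>\<omega>. (?S \<omega>)\<^sup>2) = (\<Sum>i\<in>F. expectation (\<lambda>\<omega>. (X i \<omega>)\<^sup>2))"
    using insert.IH insert.prems indep_vars_subset[OF insert.prems(1)] by auto
  have rv: "X j \<in> borel_measurable M" if "j \<in> insert i F" for j
    using insert.prems(1) that by (auto simp: indep_vars_def)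
  have [measurable]: "X i \<in> borel_measurable M" "?S \<in> borel_measurable M"
    using rv by (auto intro!: borel_measurable_sum)
  have i1: "integrable M (X i)"
    by (rule square_integrable_imp_integrable) (use insert.prems(2) in auto)
  have i2: "integrable M ?S"
    by (rule square_integrable_imp_integrable) (use IH in auto)
  have ind: "indep_var borel (X i) borel ?S"
    by (rule indep_vars_sum[OF insert.hyps(1,2) insert.prems(1)])
  have cross: "integrable M (\<lambda>\<omega>. X i \<omega> * ?S \<omega>)" "expectation (\<lambda>\<omega>. X i \<omega> * ?S \<omega>) = 0"
    using indep_var_integrable[OF ind i1 i2] indep_var_lebesgue_integral[OF ind i1 i2] IH(2) by simp_all
  have sum: "(\<Sum>j\<in>insert i F. X j \<omega>) = X i \<omega> + ?S \<omega>" for \<omega>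
    using insert.hyps by simp
  have sq: "(X i \<omega> + ?S \<omega>)\<^sup>2 = (X i \<omega>)\<^sup>2 + 2 * (X i \<omega> * ?S \<omega>) + (?S \<omega>)\<^sup>2" for \<omega>
    by (simp add: power2_eq_square algebra_simps)
  show ?case
    unfolding sum sq using i1 i2 cross IH insert.prems(2,3) insert.hyps by simp
qed

text \<open>Both sides are products over I of numbers of modulus at most 1, so the difference of the
  products is at most the sum of the differences of the factors.\<close>

lemma (in prob_space) indep_sum_char:
  fixes X :: "'i \<Rightarrow> 'a \<Rightarrow> real"
  assumes I: "finite I" "indep_vars (\<lambda>_. borel) X I" and q: "2 \<le> q" "q \<le> 3"
    and int: "\<And>i. i \<in> I \<Longrightarrow> integrable M (\<lambda>\<omega>. \<bar>X i \<omega>\<bar> powr q)" and mean: "\<And>i. i \<in> I \<Longrightarrow> expectation (X i) = 0"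
  shows "cmod (expectation (\<lambda>\<omega>. cis (\<Sum>i\<in>I. X i \<omega>)) - exp (- (\<Sum>i\<in>I. expectation (\<lambda>\<omega>. (X i \<omega>)\<^sup>2)) / 2))
    \<le> 2 * (\<Sum>i\<in>I. expectation (\<lambda>\<omega>. \<bar>X i \<omega>\<bar> powr q))"
proof -
  have rv [measurable]: "X i \<in> borel_measurable M" if "i \<in> I" for i
    using I(2) that by (auto simp: indep_vars_def)
  have icis: "integrable M (\<lambda>\<omega>. cis (X i \<omega>))" if "i \<in> I" for i
    by (rule integrable_const_bound[of _ 1]) (use that in auto)
  have "expectation (\<lambda>\<omega>. cis (\<Sum>i\<in>I. X i \<omega>)) = expectation (\<lambda>\<omega>. \<Prod>i\<in>I. cis (X i \<omega>))"
  proof -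
    have "cis (\<Sum>i\<in>I. f i) = (\<Prod>i\<in>I. cis (f i))" for f
      using I(1) by (induction I rule: finite_induct) (auto simp: cis_mult[symmetric])
    then show ?thesis by simp
  qed
  also have "\<dots> = (\<Prod>i\<in>I. expectation (\<lambda>\<omega>. cis (X i \<omega>)))"
  proof (rule indep_vars_lebesgue_integral[OF I(1)])
    show "indep_vars (\<lambda>_. borel) (\<lambda>i \<omega>. cis (X i \<omega>)) I"
      by (rule indep_vars_compose2[OF I(2)]) (rule measurable_cis)
  qed (rule icis)
  finally have 1: "expectation (\<lambda>\<omega>. cis (\<Sum>i\<in>I. X i \<omega>)) = (\<Prod>i\<in>I. expectation (\<lambda>\<omega>. cis (X i \<omega>)))" .
  have 2: "complex_of_real (exp (- (\<Sum>i\<in>I. expectation (\<lambda>\<omega>. (X i \<omega>)\<^sup>2)) / 2)) =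
    (\<Prod>i\<in>I. complex_of_real (exp (- expectation (\<lambda>\<omega>. (X i \<omega>)\<^sup>2) / 2)))"
    using I(1) by (simp add: exp_sum sum_divide_distrib flip: sum_negf of_real_prod)
  have "cmod ((\<Prod>i\<in>I. expectation (\<lambda>\<omega>. cis (X i \<omega>))) - (\<Prod>i\<in>I. complex_of_real (exp (- expectation (\<lambda>\<omega>. (X i \<omega>)\<^sup>2) / 2))))
    \<le> (\<Sum>i\<in>I. cmod (expectation (\<lambda>\<omega>. cis (X i \<omega>)) - complex_of_real (exp (- expectation (\<lambda>\<omega>. (X i \<omega>)\<^sup>2) / 2))))"
  proof (rule norm_prod_diff)
    fix i assume i: "i \<in> I"
    have "cmod (expectation (\<lambda>\<omega>. cis (X i \<omega>))) \<le> expectation (\<lambda>\<omega>. 1)"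
      by (rule norm_integral_le) (use icis[OF i] in auto)
    then show "cmod (expectation (\<lambda>\<omega>. cis (X i \<omega>))) \<le> 1" by (simp add: prob_space)
    show "cmod (complex_of_real (exp (- expectation (\<lambda>\<omega>. (X i \<omega>)\<^sup>2) / 2))) \<le> 1" by simp
  qed
  also have "\<dots> \<le> (\<Sum>i\<in>I. 2 * expectation (\<lambda>\<omega>. \<bar>X i \<omega>\<bar> powr q))"
    by (intro sum_mono char_approx_powr(3) q rv int mean)
  finally show ?thesis
    unfolding 1 2 by (simp add: sum_distrib_left)
qed

section \<open>Independence of a sub-sigma-algebra from a random element, and freezing of
  variables\<close>

definition (in prob_space) indep_of :: "'a measure \<Rightarrow> 'b measure \<Rightarrow> ('a \<Rightarrow> 'b) \<Rightarrow> bool" where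
  "indep_of N T Y \<longleftrightarrow> subalgebra M N \<and> Y \<in> measurable M T \<and>
    (\<forall>A\<in>sets N. \<forall>B\<in>sets T. prob (A \<inter> (Y -` B \<inter> space M)) = prob A * prob (Y -` B \<inter> space M))"

text \<open>The identity is viewed as a random element with values in the coarser measurable space
  N; independence then says that its pair with Y has a product law. Having a whole sigma-algebra on
  the left allows every N-measurable quantity to be frozen at once.\<close>

lemma (in prob_space) indep_of_distr:
  assumes "indep_of N T Y"
  shows "distr M N (\<lambda>\<omega>. \<omega>) \<Otimes>\<^sub>M distr M T Y = distr M (N \<Otimes>\<^sub>M T) (\<lambda>\<omega>. (\<omega>, Y \<omega>))"
    and "(\<lambda>\<omega>. \<omega>) \<in> measurable M N"
proof -
  have sub: "subalgebra M N" and Y: "Y \<in> measurable M T"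
    and ind: "\<And>A B. A \<in> sets N \<Longrightarrow> B \<in> sets T \<Longrightarrow> prob (A \<inter> (Y -` B \<inter> space M)) = prob A * prob (Y -` B \<inter> space M)"
    using assms unfolding indep_of_def by auto
  have sp: "space N = space M" and sets: "sets N \<subseteq> events"
    using sub unfolding subalgebra_def by auto
  show id: "(\<lambda>\<omega>. \<omega>) \<in> measurable M N"
  proof (rule measurableI)
    show "x \<in> space N" if "x \<in> space M" for x using that sp by simp
    show "(\<lambda>\<omega>. \<omega>) -` A \<inter> space M \<in> events" if "A \<in> sets N" for A
      using that sets by (auto simp: vimage_ident)
  qed
  interpret X: prob_space "distr M N (\<lambda>\<omega>. \<omega>)" by (rule prob_space_distr) fact
  interpret Y: prob_space "distr M T Y" by (rule prob_space_distr) fact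
  have XY: "(\<lambda>\<omega>. (\<omega>, Y \<omega>)) \<in> measurable M (N \<Otimes>\<^sub>M T)"
    using id Y by (rule measurable_Pair)
  show "distr M N (\<lambda>\<omega>. \<omega>) \<Otimes>\<^sub>M distr M T Y = distr M (N \<Otimes>\<^sub>M T) (\<lambda>\<omega>. (\<omega>, Y \<omega>))"
  proof (rule pair_measure_eqI)
    show "sigma_finite_measure (distr M N (\<lambda>\<omega>. \<omega>))" ..
    show "sigma_finite_measure (distr M T Y)" ..
    fix A B assume A: "A \<in> sets (distr M N (\<lambda>\<omega>. \<omega>))" and B: "B \<in> sets (distr M T Y)"
    have A': "A \<inter> space M = A"
      using A sets sets.sets_into_space by auto
    have "emeasure (distr M (N \<Otimes>\<^sub>M T) (\<lambda>\<omega>. (\<omega>, Y \<omega>))) (A \<times> B) = emeasure M ((\<lambda>\<omega>. (\<omega>, Y \<omega>)) -` (A \<times> B) \<inter> space M)"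
      using A B by (intro emeasure_distr[OF XY]) auto
    also have "(\<lambda>\<omega>. (\<omega>, Y \<omega>)) -` (A \<times> B) \<inter> space M = A \<inter> (Y -` B \<inter> space M)"
      by auto
    also have "emeasure M \<dots> = emeasure M A * emeasure M (Y -` B \<inter> space M)"
      using ind[of A B] A B by (simp add: emeasure_eq_measure ennreal_mult)
    also have "\<dots> = emeasure (distr M N (\<lambda>\<omega>. \<omega>)) A * emeasure (distr M T Y) B"
      using id Y A B A' by (simp add: emeasure_distr)
    finally show "emeasure (distr M N (\<lambda>\<omega>. \<omega>)) A * emeasure (distr M T Y) B = emeasure (distr M (N \<Otimes>\<^sub>M T) (\<lambda>\<omega>. (\<omega>, Y \<omega>))) (A \<times> B)" by simp
  qed simp
qed

text \<open>A substitute for conditional expectation: the N-measurable argument is held fixed while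
  a fresh copy of Y is integrated. This version serves the second moments, the bounded one below the
  characteristic functions.\<close>

lemma (in prob_space) nn_integral_freeze:
  assumes ind: "indep_of N T Y" and h: "h \<in> borel_measurable (N \<Otimes>\<^sub>M T)"
  shows "(\<integral>\<^sup>+\<omega>. h (\<omega>, Y \<omega>) \<partial>M) = (\<integral>\<^sup>+\<omega>. (\<integral>\<^sup>+\<omega>'. h (\<omega>, Y \<omega>') \<partial>M) \<partial>M)"
proof -
  note eq = indep_of_distr(1)[OF ind]
  have rv [measurable]: "(\<lambda>\<omega>. \<omega>) \<in> measurable M N" "Y \<in> measurable M T"
    using ind indep_of_distr(2)[OF ind] by (auto simp: indep_of_def)
  note h[measurable]
  interpret Y: prob_space "distr M T Y" by (rule prob_space_distr) fact
  have "(\<integral>\<^sup>+\<omega>. h (\<omega>, Y \<omega>) \<partial>M) = (\<integral>\<^sup>+p. h p \<partial>distr M (N \<Otimes>\<^sub>M T) (\<lambda>x. (x, Y x)))"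
    by (subst nn_integral_distr) auto
  also have "\<dots> = (\<integral>\<^sup>+x. (\<integral>\<^sup>+y. h (x, y) \<partial>distr M T Y) \<partial>distr M N (\<lambda>\<omega>. \<omega>))"
    unfolding eq[symmetric] by (rule Y.nn_integral_fst[symmetric]) measurable
  also have "\<dots> = (\<integral>\<^sup>+\<omega>. (\<integral>\<^sup>+y. h (\<omega>, y) \<partial>distr M T Y) \<partial>M)"
    by (subst nn_integral_distr) auto
  also have "\<dots> = (\<integral>\<^sup>+\<omega>. (\<integral>\<^sup>+\<omega>'. h (\<omega>, Y \<omega>') \<partial>M) \<partial>M)"
  proof (rule nn_integral_cong)
    fix \<omega> assume "\<omega> \<in> space M"
    then have [measurable]: "\<omega> \<in> space N" using rv(1) by (rule measurable_space[rotated])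
    show "(\<integral>\<^sup>+y. h (\<omega>, y) \<partial>distr M T Y) = (\<integral>\<^sup>+\<omega>'. h (\<omega>, Y \<omega>') \<partial>M)"
      by (subst nn_integral_distr) auto
  qed
  finally show ?thesis .
qed

lemma (in prob_space) integral_freeze:
  fixes h :: "_ \<Rightarrow> 'c::{banach, second_countable_topology}"
  assumes ind: "indep_of N T Y" and h: "h \<in> borel_measurable (N \<Otimes>\<^sub>M T)" and B: "\<And>p. norm (h p) \<le> B"
  shows "(\<integral>\<omega>. h (\<omega>, Y \<omega>) \<partial>M) = (\<integral>\<omega>. (\<integral>\<omega>'. h (\<omega>, Y \<omega>') \<partial>M) \<partial>M)"
proof -
  note eq = indep_of_distr(1)[OF ind]
  have rv [measurable]: "(\<lambda>\<omega>. \<omega>) \<in> measurable M N" "Y \<in> measurable M T"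
    using ind indep_of_distr(2)[OF ind] by (auto simp: indep_of_def)
  note h[measurable]
  interpret X: prob_space "distr M N (\<lambda>\<omega>. \<omega>)" by (rule prob_space_distr) fact
  interpret Y: prob_space "distr M T Y" by (rule prob_space_distr) fact
  interpret XY: pair_prob_space "distr M N (\<lambda>\<omega>. \<omega>)" "distr M T Y" ..
  have "(\<integral>\<omega>. h (\<omega>, Y \<omega>) \<partial>M) = (\<integral>p. h p \<partial>distr M (N \<Otimes>\<^sub>M T) (\<lambda>x. (x, Y x)))"
    by (subst integral_distr) auto
  also have "\<dots> = (\<integral>x. (\<integral>y. h (x, y) \<partial>distr M T Y) \<partial>distr M N (\<lambda>\<omega>. \<omega>))"
    unfolding eq[symmetric]
    by (rule XY.integral_fst'[symmetric], rule XY.P.integrable_const_bound[of _ B]) (use B in auto)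
  also have "\<dots> = (\<integral>\<omega>. (\<integral>y. h (\<omega>, y) \<partial>distr M T Y) \<partial>M)"
    by (subst integral_distr) auto
  also have "\<dots> = (\<integral>\<omega>. (\<integral>\<omega>'. h (\<omega>, Y \<omega>') \<partial>M) \<partial>M)"
  proof (rule Bochner_Integration.integral_cong[OF refl])
    fix \<omega> assume "\<omega> \<in> space M"
    then have [measurable]: "\<omega> \<in> space N" using rv(1) by (rule measurable_space[rotated])
    show "(\<integral>y. h (\<omega>, y) \<partial>distr M T Y) = (\<integral>\<omega>'. h (\<omega>, Y \<omega>') \<partial>M)"
      by (subst integral_distr) auto
  qed
  finally show ?thesis .
qed

lemma (in prob_space) indep_of_vimage_algebra:
  assumes "indep_var S X T Y"
  shows "indep_of (vimage_algebra (space M) X S) T Y"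
  unfolding indep_of_def
proof (intro conjI ballI)
  have rv: "X \<in> measurable M S" "Y \<in> measurable M T"
    using assms by (auto simp: indep_var_eq)
  show "Y \<in> measurable M T" by fact
  have sp: "X \<in> space M \<rightarrow> space S" using rv(1) by (auto dest: measurable_space)
  show "subalgebra M (vimage_algebra (space M) X S)"
    unfolding subalgebra_def using sets_image_in_sets[OF refl rv(1)] by simp
  fix A B assume "A \<in> sets (vimage_algebra (space M) X S)" and B: "B \<in> sets T"
  then obtain A' where A': "A = X -` A' \<inter> space M" "A' \<in> sets S"
    unfolding sets_vimage_algebra2[OF sp] by auto
  have "A \<inter> (Y -` B \<inter> space M) = (\<lambda>x. (X x, Y x)) -` (A' \<times> B) \<inter> space M"
    using A' by auto
  then show "prob (A \<inter> (Y -` B \<inter> space M)) = prob A * prob (Y -` B \<inter> space M)"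
    using indep_varD[OF assms A'(2) B] A'(1) by simp
qed

text \<open>The events satisfying the conclusion form a Dynkin system. For countable disjoint unions
  the bounds 1 on Y and c are decisive: replacing the union by finitely many members costs only the
  probability of the rest, uniformly in n.\<close>

lemma (in prob_space) mixing_extension:
  fixes Y :: "nat \<Rightarrow> 'a \<Rightarrow> complex" and c :: complex
  assumes G: "Int_stable G" "G \<subseteq> events" "space M \<in> G"
    and Y [measurable]: "\<And>n. Y n \<in> borel_measurable M" and Y1: "\<And>n \<omega>. cmod (Y n \<omega>) \<le> 1"
    and lim: "\<And>A. A \<in> G \<Longrightarrow> (\<lambda>n. \<integral>\<omega>. indicator A \<omega> *\<^sub>R Y n \<omega> \<partial>M) \<longlonglongrightarrow> prob A *\<^sub>R c"
    and c: "cmod c \<le> 1"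
    and A: "A \<in> sigma_sets (space M) G"
  shows "(\<lambda>n. \<integral>\<omega>. indicator A \<omega> *\<^sub>R Y n \<omega> \<partial>M) \<longlonglongrightarrow> prob A *\<^sub>R c"
proof -
  have ev: "sigma_sets (space M) G \<subseteq> events"
    using G(2) by (rule sets.sigma_sets_subset)
  have int: "integrable M (\<lambda>\<omega>. indicator B \<omega> *\<^sub>R Y n \<omega>)" if "B \<in> events" for B n
    by (rule integrable_const_bound[of _ 1]) (use that Y1 in \<open>auto simp: indicator_def\<close>)
  have sp: "G \<subseteq> Pow (space M)" using G(2) sets.sets_into_space by blast
  from G(1) sp A show ?thesis
  proof (induction rule: sigma_sets_induct_disjoint)
    case (basic B)
    then show ?case by (rule lim)
  next
    case empty
    then show ?case by simp
  next
    case (compl B)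
    have B: "B \<in> events" using compl(1) ev by auto
    have eq: "(\<integral>\<omega>. indicator (space M - B) \<omega> *\<^sub>R Y n \<omega> \<partial>M) =
      (\<integral>\<omega>. indicator (space M) \<omega> *\<^sub>R Y n \<omega> \<partial>M) - (\<integral>\<omega>. indicator B \<omega> *\<^sub>R Y n \<omega> \<partial>M)" for n
    proof -
      have "(\<integral>\<omega>. indicator (space M - B) \<omega> *\<^sub>R Y n \<omega> \<partial>M) =
        (\<integral>\<omega>. indicator (space M) \<omega> *\<^sub>R Y n \<omega> - indicator B \<omega> *\<^sub>R Y n \<omega> \<partial>M)"
        using sets.sets_into_space[OF B] by (intro Bochner_Integration.integral_cong) (auto simp: indicator_def)
      then show ?thesis using int[OF B] int[OF sets.top] by simp
    qed
    have pr: "prob (space M - B) *\<^sub>R c = prob (space M) *\<^sub>R c - prob B *\<^sub>R c"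
      using prob_compl[OF B] by (simp add: prob_space scaleR_diff_left)
    show ?case
      unfolding eq pr by (intro tendsto_diff lim[OF G(3)] compl)
  next
    case (union B)
    have B: "B i \<in> events" for i using union(2) ev by auto
    define U where "U = (\<Union>i. B i)"
    define W where "W N = (\<Union>i<N. B i)" for N
    have U: "U \<in> events" and W: "W N \<in> events" for N
      using B by (auto simp: U_def W_def)
    have Wsub: "W N \<subseteq> U" for N by (auto simp: W_def U_def)
    have disj: "disjoint_family_on B {..<N}" for N
      using union(1) by (rule disjoint_family_on_mono[rotated]) simp
    have limW: "(\<lambda>n. \<integral>\<omega>. indicator (W N) \<omega> *\<^sub>R Y n \<omega> \<partial>M) \<longlonglongrightarrow> prob (W N) *\<^sub>R c" for N
    proof -
      have ind: "indicator (W N) \<omega> = (\<Sum>i<N. indicator (B i) \<omega> :: real)" for \<omega>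
        unfolding W_def by (rule indicator_UN_disjoint) (use disj in auto)
      have e1: "(\<integral>\<omega>. indicator (W N) \<omega> *\<^sub>R Y n \<omega> \<partial>M) = (\<Sum>i<N. \<integral>\<omega>. indicator (B i) \<omega> *\<^sub>R Y n \<omega> \<partial>M)" for n
        unfolding ind scaleR_sum_left by (rule Bochner_Integration.integral_sum) (rule int[OF B])
      have e2: "prob (W N) = (\<Sum>i<N. prob (B i))"
        unfolding W_def by (rule finite_measure_finite_Union) (use B disj in auto)
      show ?thesis
        unfolding e1 e2 scaleR_sum_left by (intro tendsto_sum union)
    qed
    have inc: "(\<lambda>N. prob (W N)) \<longlonglongrightarrow> prob U"
    proof -
      have "range W \<subseteq> events" using W by auto
      moreover have "incseq W"
        unfolding incseq_def W_def by (intro allI impI UN_mono) auto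
      moreover have "(\<Union>N. W N) = U" by (auto simp: W_def U_def)
      ultimately show ?thesis
        using finite_Lim_measure_incseq[of W] by simp
    qed
    show ?case
      unfolding U_def[symmetric]
    proof (rule LIMSEQ_I)
      fix r :: real assume r: "r > 0"
      have "eventually (\<lambda>N. prob (W N) > prob U - r / 3) sequentially"
        using r by (intro order_tendstoD(1)[OF inc]) auto
      then obtain N where N: "prob (W N) > prob U - r / 3"
        unfolding eventually_sequentially by blast
      have diff: "prob (U - W N) < r / 3"
        using finite_measure_Diff[OF U W Wsub, of N] N by simp
      obtain n0 where n0: "\<And>n. n \<ge> n0 \<Longrightarrow> cmod ((\<integral>\<omega>. indicator (W N) \<omega> *\<^sub>R Y n \<omega> \<partial>M) - prob (W N) *\<^sub>R c) < r / 3"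
        using LIMSEQ_D[OF limW, of "r / 3" N] r by auto
      have "cmod ((\<integral>\<omega>. indicator U \<omega> *\<^sub>R Y n \<omega> \<partial>M) - prob U *\<^sub>R c) < r" if n: "n \<ge> n0" for n
      proof -
        have "(\<integral>\<omega>. indicator U \<omega> *\<^sub>R Y n \<omega> \<partial>M) - (\<integral>\<omega>. indicator (W N) \<omega> *\<^sub>R Y n \<omega> \<partial>M) =
          (\<integral>\<omega>. indicator U \<omega> *\<^sub>R Y n \<omega> - indicator (W N) \<omega> *\<^sub>R Y n \<omega> \<partial>M)"
          by (rule Bochner_Integration.integral_diff[symmetric]) (rule int[OF U] int[OF W])+
        also have "\<dots> = (\<integral>\<omega>. indicator (U - W N) \<omega> *\<^sub>R Y n \<omega> \<partial>M)"
          using Wsub by (intro Bochner_Integration.integral_cong) (auto simp: indicator_def)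
        also have "cmod \<dots> \<le> (\<integral>\<omega>. indicator (U - W N) \<omega> \<partial>M)"
        proof (rule norm_integral_le)
          show "integrable M (\<lambda>\<omega>. indicator (U - W N) \<omega> *\<^sub>R Y n \<omega>)"
            using U W by (intro int) auto
          show "integrable M (indicator (U - W N) :: _ \<Rightarrow> real)"
            using U W by (intro integrable_real_indicator) (auto simp: emeasure_eq_measure)
        qed (use Y1 in \<open>auto simp: indicator_def\<close>)
        also have "\<dots> = prob (U - W N)"
          using U W by (simp add: emeasure_eq_measure)
        finally have 1: "cmod ((\<integral>\<omega>. indicator U \<omega> *\<^sub>R Y n \<omega> \<partial>M) - (\<integral>\<omega>. indicator (W N) \<omega> *\<^sub>R Y n \<omega> \<partial>M)) < r / 3"
          using diff by simp
        have "cmod (prob (W N) *\<^sub>R c - prob U *\<^sub>R c) = \<bar>prob (W N) - prob U\<bar> * cmod c"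
          by (simp flip: scaleR_diff_left)
        also have "\<dots> \<le> \<bar>prob (W N) - prob U\<bar> * 1"
          by (intro mult_left_mono c) auto
        also have "\<dots> < r / 3"
          using N finite_measure_mono[OF Wsub U, of N] by simp
        finally have 2: "cmod (prob (W N) *\<^sub>R c - prob U *\<^sub>R c) < r / 3" .
        let ?a = "\<integral>\<omega>. indicator U \<omega> *\<^sub>R Y n \<omega> \<partial>M" and ?b = "\<integral>\<omega>. indicator (W N) \<omega> *\<^sub>R Y n \<omega> \<partial>M"
        have "?a - prob U *\<^sub>R c = (?a - ?b) + ((?b - prob (W N) *\<^sub>R c) + (prob (W N) *\<^sub>R c - prob U *\<^sub>R c))"
          by simp
        also have "cmod \<dots> \<le> cmod (?a - ?b) + (cmod (?b - prob (W N) *\<^sub>R c) + cmod (prob (W N) *\<^sub>R c - prob U *\<^sub>R c))"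
          by (intro norm_triangle_mono norm_triangle_ineq order_refl)
        also have "\<dots> < r"
          using 1 2 n0[OF n] by linarith
        finally show ?thesis .
      qed
      then show "\<exists>n0. \<forall>n\<ge>n0. cmod ((\<integral>\<omega>. indicator U \<omega> *\<^sub>R Y n \<omega> \<partial>M) - prob U *\<^sub>R c) < r"
        by blast
    qed
  qed
qed

lemma exp_diff_le:
  fixes a b K :: real
  assumes "a \<le> K" "b \<le> K"
  shows "\<bar>exp a - exp b\<bar> \<le> exp K * \<bar>a - b\<bar>"
proof -
  have *: "exp a - exp b \<le> exp K * (a - b)" if "b \<le> a" "a \<le> K" for a b :: real
  proof -
    have "exp a - exp b = exp a * (1 - exp (b - a))"
      by (simp add: algebra_simps flip: exp_add)
    also have "\<dots> \<le> exp a * (a - b)"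
    proof (rule mult_left_mono)
      show "1 - exp (b - a) \<le> a - b"
        using exp_ge_add_one_self[of "b - a"] by linarith
    qed simp
    also have "\<dots> \<le> exp K * (a - b)"
      using that by (intro mult_right_mono) auto
    finally show ?thesis .
  qed
  show ?thesis
    using *[of b a] *[of a b] assms by (cases "b \<le> a") auto
qed

text \<open>The variances are predictable, so multiplying the characteristic function by
  \<open>exp (W / 2)\<close>, where \<open>W\<close> is their partial sum, turns it into an almost-martingale.\<close>

lemma (in prob_space) predictable_array_clt:
  fixes Fil :: "nat \<Rightarrow> 'a measure" and \<xi> v :: "nat \<Rightarrow> nat \<Rightarrow> 'a \<Rightarrow> real"
  assumes sub: "\<And>k. subalgebra M (Fil k)" and mono: "\<And>j k. j \<le> k \<Longrightarrow> sets (Fil j) \<subseteq> sets (Fil k)"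
    and \<xi>m: "\<And>n k. \<xi> n k \<in> borel_measurable (Fil (Suc k))" and vm: "\<And>n k. v n k \<in> borel_measurable (Fil k)"
    and v0: "\<And>n k \<omega>. 0 \<le> v n k \<omega>" and vC: "\<And>n \<omega>. (\<Sum>k<n. v n k \<omega>) \<le> C"
    and cond: "\<And>n k g B. k < n \<Longrightarrow> g \<in> borel_measurable (Fil k) \<Longrightarrow> (\<And>\<omega>. cmod (g \<omega>) \<le> B) \<Longrightarrow>
      cmod (\<integral>\<omega>. g \<omega> * (cis (\<xi> n k \<omega>) - of_real (exp (- v n k \<omega> / 2))) \<partial>M) \<le> B * \<rho> n k"
    and \<rho>: "\<And>n k. 0 \<le> \<rho> n k" "(\<lambda>n. \<Sum>k<n. \<rho> n k) \<longlonglongrightarrow> 0"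
    and vlim: "(\<lambda>n. \<integral>\<omega>. \<bar>(\<Sum>k<n. v n k \<omega>) - s2\<bar> \<partial>M) \<longlonglongrightarrow> 0"
    and neg: "\<And>k \<omega>. \<omega> \<in> space M \<Longrightarrow> (\<lambda>n. \<xi> n k \<omega>) \<longlonglongrightarrow> 0" "\<And>k \<omega>. \<omega> \<in> space M \<Longrightarrow> (\<lambda>n. v n k \<omega>) \<longlonglongrightarrow> 0"
    and A: "A \<in> sets (Fil m)"
  shows "(\<lambda>n. \<integral>\<omega>. indicator A \<omega> *\<^sub>R cis (\<Sum>k<n. \<xi> n k \<omega>) \<partial>M) \<longlonglongrightarrow> prob A *\<^sub>R complex_of_real (exp (- s2 / 2))"
proof -
  have Fsp: "space (Fil k) = space M" for k
    using sub unfolding subalgebra_def by auto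
  have up: "f \<in> borel_measurable (Fil k)" if "f \<in> borel_measurable (Fil j)" "j \<le> k" for f :: "'a \<Rightarrow> 'b::topological_space" and j k
    using that mono[OF that(2)] Fsp unfolding measurable_def by auto
  have upM: "f \<in> borel_measurable M" if "f \<in> borel_measurable (Fil j)" for f :: "'a \<Rightarrow> 'b::topological_space" and j
    by (rule measurable_from_subalg[OF sub that])
  have [measurable]: "\<xi> n k \<in> borel_measurable M" "v n k \<in> borel_measurable M" for n k
    using upM[OF \<xi>m] upM[OF vm] by auto
  have AM [measurable]: "A \<in> events" using sub A unfolding subalgebra_def by auto
  define S where "S n j \<omega> = (\<Sum>k<j. \<xi> n k \<omega>)" for n j \<omega>
  define W where "W n j \<omega> = (\<Sum>k<j. v n k \<omega>)" for n j \<omega>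
  have Wle: "W n j \<omega> \<le> C" if "j \<le> n" for n j \<omega>
  proof -
    have "W n j \<omega> \<le> (\<Sum>k<n. v n k \<omega>)"
      unfolding W_def using that v0 by (intro sum_mono2) auto
    then show ?thesis using vC[of n \<omega>] by simp
  qed
  define K where "K = exp (C / 2)"
  have K: "K > 0" by (simp add: K_def)
  define T where "T n j \<omega> = cis (S n j \<omega>) * complex_of_real (exp (W n j \<omega> / 2))" for n j \<omega>
  have Tm [measurable]: "T n j \<in> borel_measurable M" for n j
    unfolding T_def S_def W_def by measurable
  have Tn: "cmod (T n j \<omega>) \<le> K" if "j \<le> n" for n j \<omega>
    using Wle[OF that] by (simp add: T_def norm_mult K_def)
  have Tint: "integrable M (\<lambda>\<omega>. indicator A \<omega> *\<^sub>R T n j \<omega>)" if "j \<le> n" for n j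
    by (rule integrable_const_bound[of _ K]) (use Tn[OF that] K in \<open>auto simp: indicator_def\<close>)
  let ?E = "\<lambda>n j. \<integral>\<omega>. indicator A \<omega> *\<^sub>R T n j \<omega> \<partial>M"
  \<comment> \<open>Since v is predictable, exp(W/2) with the index \<open>Suc j\<close> is still
    measurable for \<open>Fil j\<close>. The increment of T is thus a bounded
    \<open>Fil j\<close>-measurable factor times the difference that \<open>cond\<close>
    controls.\<close>
  have incr: "cmod (?E n (Suc j) - ?E n j) \<le> K * \<rho> n j" if j: "m \<le> j" "j < n" for n j
  proof -
    let ?g = "\<lambda>\<omega>. indicator A \<omega> *\<^sub>R (cis (S n j \<omega>) * complex_of_real (exp (W n (Suc j) \<omega> / 2)))"
    have "\<xi> n k \<in> borel_measurable (Fil j)" if "k < j" for k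
      by (rule up[OF \<xi>m]) (use that in auto)
    moreover have "v n k \<in> borel_measurable (Fil j)" if "k < Suc j" for k
      by (rule up[OF vm]) (use that in auto)
    ultimately have [measurable]: "S n j \<in> borel_measurable (Fil j)" "W n (Suc j) \<in> borel_measurable (Fil j)"
      unfolding S_def W_def by (auto intro!: borel_measurable_sum)
    have [measurable]: "A \<in> sets (Fil j)" using A mono[OF j(1)] by auto
    have gm: "?g \<in> borel_measurable (Fil j)" by measurable
    have gB: "cmod (?g \<omega>) \<le> K" for \<omega>
      using Wle[of "Suc j" n \<omega>] j K by (auto simp: indicator_def norm_mult K_def)
    have "?E n (Suc j) - ?E n j = (\<integral>\<omega>. indicator A \<omega> *\<^sub>R T n (Suc j) \<omega> - indicator A \<omega> *\<^sub>R T n j \<omega> \<partial>M)"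
      by (rule Bochner_Integration.integral_diff[symmetric]) (use j in \<open>auto intro!: Tint\<close>)
    also have "\<dots> = (\<integral>\<omega>. ?g \<omega> * (cis (\<xi> n j \<omega>) - of_real (exp (- v n j \<omega> / 2))) \<partial>M)"
    proof (rule Bochner_Integration.integral_cong[OF refl])
      fix \<omega>
      have "T n (Suc j) \<omega> = cis (S n j \<omega>) * of_real (exp (W n (Suc j) \<omega> / 2)) * cis (\<xi> n j \<omega>)"
        by (simp add: T_def S_def flip: cis_mult)
      moreover have "exp (W n j \<omega> / 2) = exp (W n (Suc j) \<omega> / 2) * exp (- v n j \<omega> / 2)"
        by (simp add: W_def add_divide_distrib flip: exp_add)
      then have "T n j \<omega> = cis (S n j \<omega>) * of_real (exp (W n (Suc j) \<omega> / 2)) * of_real (exp (- v n j \<omega> / 2))"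
        by (simp only: T_def of_real_mult mult.assoc)
      ultimately show "indicator A \<omega> *\<^sub>R T n (Suc j) \<omega> - indicator A \<omega> *\<^sub>R T n j \<omega> =
        ?g \<omega> * (cis (\<xi> n j \<omega>) - of_real (exp (- v n j \<omega> / 2)))"
        by (simp only: right_diff_distrib scaleR_diff_right mult_scaleR_left)
    qed
    finally show ?thesis
      using cond[OF j(2) gm gB] by simp
  qed
  have tele: "cmod (?E n n - ?E n m) \<le> K * (\<Sum>k<n. \<rho> n k)" if "m \<le> n" for n
  proof -
    have "cmod (?E n j - ?E n m) \<le> K * (\<Sum>k=m..<j. \<rho> n k)" if "m \<le> j" "j \<le> n" for j
      using that
    proof (induction j rule: dec_induct)
      case base
      then show ?case by simp
    next
      case (step j)
      have "cmod (?E n (Suc j) - ?E n m) \<le> cmod (?E n (Suc j) - ?E n j) + cmod (?E n j - ?E n m)"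
        using norm_triangle_ineq[of "?E n (Suc j) - ?E n j" "?E n j - ?E n m"] by (simp only: diff_add_cancel add_diff_eq)
      also have "\<dots> \<le> K * \<rho> n j + K * (\<Sum>k=m..<j. \<rho> n k)"
      proof (rule add_mono)
        show "cmod (?E n (Suc j) - ?E n j) \<le> K * \<rho> n j"
          by (rule incr) (use step in auto)
        show "cmod (?E n j - ?E n m) \<le> K * (\<Sum>k=m..<j. \<rho> n k)"
          by (rule step.IH) (use step in auto)
      qed
      finally show ?case using step.hyps by (simp add: algebra_simps)
    qed
    then have "cmod (?E n n - ?E n m) \<le> K * (\<Sum>k=m..<n. \<rho> n k)" using that by simp
    also have "\<dots> \<le> K * (\<Sum>k<n. \<rho> n k)"
      using K \<rho>(1) by (intro mult_left_mono sum_mono2) auto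
    finally show ?thesis .
  qed
  \<comment> \<open>A is known only from time m on, so the comparison starts there. The part before
    m consists of a fixed number of terms, each tending to 0.\<close>
  have initial: "(\<lambda>n. ?E n m) \<longlonglongrightarrow> prob A *\<^sub>R 1"
  proof (rule LIMSEQ_offset[of _ m])
    have "(\<lambda>n. ?E (n + m) m) \<longlonglongrightarrow> (\<integral>\<omega>. indicator A \<omega> *\<^sub>R (1::complex) \<partial>M)"
    proof (rule integral_dominated_convergence[where w = "\<lambda>_. K"])
      show "AE \<omega> in M. (\<lambda>n. indicator A \<omega> *\<^sub>R T (n + m) m \<omega>) \<longlonglongrightarrow> indicator A \<omega> *\<^sub>R 1"
      proof (rule AE_I2)
        fix \<omega> assume w: "\<omega> \<in> space M"
        have "(\<lambda>n. S n m \<omega>) \<longlonglongrightarrow> (\<Sum>k<m. 0)" "(\<lambda>n. W n m \<omega>) \<longlonglongrightarrow> (\<Sum>k<m. 0)"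
          unfolding S_def W_def by (intro tendsto_sum neg w)+
        then have "(\<lambda>n. T n m \<omega>) \<longlonglongrightarrow> cis 0 * complex_of_real (exp (0 / 2))"
          unfolding T_def by (intro tendsto_intros) auto
        then have "(\<lambda>n. T (n + m) m \<omega>) \<longlonglongrightarrow> 1"
          using LIMSEQ_ignore_initial_segment[of "\<lambda>n. T n m \<omega>" 1 m] by simp
        then show "(\<lambda>n. indicator A \<omega> *\<^sub>R T (n + m) m \<omega>) \<longlonglongrightarrow> indicator A \<omega> *\<^sub>R 1"
          by (intro tendsto_scaleR tendsto_const)
      qed
      show "AE \<omega> in M. norm (indicator A \<omega> *\<^sub>R T (n + m) m \<omega>) \<le> K" for n
        using Tn[of m "n + m"] K by (intro AE_I2) (auto simp: indicator_def)
    qed auto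
    then show "(\<lambda>n. ?E (n + m) m) \<longlonglongrightarrow> prob A *\<^sub>R 1"
      by (simp add: emeasure_eq_measure scaleR_conv_of_real)
  qed
  have "(\<lambda>n. ?E n n - ?E n m) \<longlonglongrightarrow> 0"
  proof (rule Lim_null_comparison)
    show "eventually (\<lambda>n. cmod (?E n n - ?E n m) \<le> K * (\<Sum>k<n. \<rho> n k)) sequentially"
      using eventually_ge_at_top[of m] by eventually_elim (rule tele)
    show "(\<lambda>n. K * (\<Sum>k<n. \<rho> n k)) \<longlonglongrightarrow> 0"
      using tendsto_mult_left[OF \<rho>(2), of K] by simp
  qed
  from tendsto_add[OF this initial] have main: "(\<lambda>n. ?E n n) \<longlonglongrightarrow> prob A *\<^sub>R 1" by simp
  \<comment> \<open>A Lipschitz constant of exp on the range of W/2 and s2/2. It bounds the cost of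
    replacing the random factor exp(W/2) by exp(s2/2) in terms of the L1 distance of W and
    s2.\<close>
  define K' where "K' = exp (max C s2 / 2)"
  let ?Y = "\<lambda>n \<omega>. cis (\<Sum>k<n. \<xi> n k \<omega>)"
  have Yint: "integrable M (\<lambda>\<omega>. indicator A \<omega> *\<^sub>R ?Y n \<omega>)" for n
    by (rule integrable_const_bound[of _ 1]) (auto simp: indicator_def)
  have Wint: "integrable M (\<lambda>\<omega>. \<bar>(\<Sum>k<n. v n k \<omega>) - s2\<bar>)" for n
  proof (rule integrable_const_bound[of _ "C + \<bar>s2\<bar>"])
    show "AE \<omega> in M. norm \<bar>(\<Sum>k<n. v n k \<omega>) - s2\<bar> \<le> C + \<bar>s2\<bar>"
    proof (rule AE_I2)
      fix \<omega>
      show "norm \<bar>(\<Sum>k<n. v n k \<omega>) - s2\<bar> \<le> C + \<bar>s2\<bar>"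
        using vC[of n \<omega>] sum_nonneg[of "{..<n}" "\<lambda>k. v n k \<omega>"] v0 by simp
    qed
  qed measurable
  have "(\<lambda>n. ?E n n - of_real (exp (s2 / 2)) * (\<integral>\<omega>. indicator A \<omega> *\<^sub>R ?Y n \<omega> \<partial>M)) \<longlonglongrightarrow> 0"
  proof (rule Lim_null_comparison)
    show "eventually (\<lambda>n. cmod (?E n n - of_real (exp (s2 / 2)) * (\<integral>\<omega>. indicator A \<omega> *\<^sub>R ?Y n \<omega> \<partial>M)) \<le>
      K' / 2 * (\<integral>\<omega>. \<bar>(\<Sum>k<n. v n k \<omega>) - s2\<bar> \<partial>M)) sequentially"
    proof (rule always_eventually, rule allI)
      fix n
      have cY: "integrable M (\<lambda>\<omega>. of_real (exp (s2 / 2)) * (indicator A \<omega> *\<^sub>R ?Y n \<omega>))"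
        by (intro integrable_mult_right Yint)
      have "?E n n - of_real (exp (s2 / 2)) * (\<integral>\<omega>. indicator A \<omega> *\<^sub>R ?Y n \<omega> \<partial>M) =
        (\<integral>\<omega>. indicator A \<omega> *\<^sub>R T n n \<omega> - of_real (exp (s2 / 2)) * (indicator A \<omega> *\<^sub>R ?Y n \<omega>) \<partial>M)"
        by (simp only: Bochner_Integration.integral_diff[OF Tint[OF order_refl] cY] integral_mult_right_zero)
      also have "cmod \<dots> \<le> (\<integral>\<omega>. K' / 2 * \<bar>(\<Sum>k<n. v n k \<omega>) - s2\<bar> \<partial>M)"
      proof (rule norm_integral_le)
        show "integrable M (\<lambda>\<omega>. indicator A \<omega> *\<^sub>R T n n \<omega> - of_real (exp (s2 / 2)) * (indicator A \<omega> *\<^sub>R ?Y n \<omega>))"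
          by (intro Bochner_Integration.integrable_diff Tint order_refl cY)
        show "integrable M (\<lambda>\<omega>. K' / 2 * \<bar>(\<Sum>k<n. v n k \<omega>) - s2\<bar>)"
          using Wint[of n] by auto
        fix \<omega>
        have "indicator A \<omega> *\<^sub>R T n n \<omega> - of_real (exp (s2 / 2)) * (indicator A \<omega> *\<^sub>R ?Y n \<omega>) =
          indicator A \<omega> *\<^sub>R (?Y n \<omega> * of_real (exp (W n n \<omega> / 2) - exp (s2 / 2)))"
          by (simp add: T_def S_def algebra_simps)
        also have "cmod \<dots> \<le> \<bar>exp (W n n \<omega> / 2) - exp (s2 / 2)\<bar>"
          by (simp only: norm_scaleR norm_mult norm_cis norm_of_real) (simp add: indicator_def)
        also have "\<dots> \<le> K' * \<bar>W n n \<omega> / 2 - s2 / 2\<bar>"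
          unfolding K'_def using Wle[of n n \<omega>] by (intro exp_diff_le) auto
        also have "\<dots> = K' / 2 * \<bar>(\<Sum>k<n. v n k \<omega>) - s2\<bar>"
          by (simp add: W_def abs_divide flip: diff_divide_distrib)
        finally show "cmod (indicator A \<omega> *\<^sub>R T n n \<omega> - of_real (exp (s2 / 2)) * (indicator A \<omega> *\<^sub>R ?Y n \<omega>)) \<le>
          K' / 2 * \<bar>(\<Sum>k<n. v n k \<omega>) - s2\<bar>" .
      qed
      finally show "cmod (?E n n - of_real (exp (s2 / 2)) * (\<integral>\<omega>. indicator A \<omega> *\<^sub>R ?Y n \<omega> \<partial>M)) \<le>
        K' / 2 * (\<integral>\<omega>. \<bar>(\<Sum>k<n. v n k \<omega>) - s2\<bar> \<partial>M)" by simp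
    qed
    show "(\<lambda>n. K' / 2 * (\<integral>\<omega>. \<bar>(\<Sum>k<n. v n k \<omega>) - s2\<bar> \<partial>M)) \<longlonglongrightarrow> 0"
      using tendsto_mult_left[OF vlim, of "K' / 2"] by simp
  qed
  from tendsto_diff[OF main this]
  have "(\<lambda>n. of_real (exp (s2 / 2)) * (\<integral>\<omega>. indicator A \<omega> *\<^sub>R ?Y n \<omega> \<partial>M)) \<longlonglongrightarrow> prob A *\<^sub>R (1::complex)" by simp
  from tendsto_mult_left[OF this, of "complex_of_real (exp (- s2 / 2))"]
  have "(\<lambda>n. (of_real (exp (- s2 / 2)) * of_real (exp (s2 / 2))) * (\<integral>\<omega>. indicator A \<omega> *\<^sub>R ?Y n \<omega> \<partial>M)) \<longlonglongrightarrow>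
    complex_of_real (exp (- s2 / 2)) * prob A *\<^sub>R (1::complex)"
    by (simp only: mult.assoc)
  moreover have "complex_of_real (exp (- s2 / 2)) * complex_of_real (exp (s2 / 2)) = 1"
    by (simp flip: exp_add of_real_mult)
  ultimately show ?thesis
    by (simp only:) (simp add: scaleR_conv_of_real mult.commute)
qed

subsection \<open>Parameters of the algorithm\<close>

locale mlsa_params =
  fixes lam M \<alpha> \<phi> \<rho> \<psi> \<kappa>K :: real and alphas :: "nat \<Rightarrow> real" and s :: "nat \<Rightarrow> nat"
  assumes lam: "0 < lam" "lam \<le> 1" and M: "M > 1" and \<alpha>: "\<alpha> > 1 / 2"
    and \<phi>: "1 / (2 * \<alpha> - 1) < \<phi>" and \<rho>: "\<phi> + 1 < 2 * (\<rho> + 1)"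
    and \<psi>: "max (1 - lam / (lam + 1) * (\<phi> + 1)) 0 < \<psi>" "\<psi> < 1"
    and s1: "\<forall>n\<ge>1. s n \<ge> 1"
    and bias_rate: "(\<lambda>n. M powr (- alphas (s n) * real (s n)))
           \<in> o(\<lambda>n. real n powr (- (\<phi> + 1) / 2) * sqrt (ln (real n)))"
    and s_rate: "(\<lambda>n. \<alpha> * real (s n)) \<sim>[sequentially] (\<lambda>n. log M (real n powr ((\<phi> + 1) / 2)))"
    and \<kappa>K: "\<kappa>K > 0"
begin

definition step_size where "step_size n = real n powr (- \<psi>)" for n :: nat
definition samples where "samples n = \<kappa>K * (\<phi> + 1) * real n powr \<phi>" for n :: nat
definition wt where "wt n = real n powr \<rho>" for n :: nat
definition bias where "bias n = M powr (- alphas (s n) * real (s n))" for n :: nat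
definition vrate where "vrate n = real (s n) / samples n" for n :: nat
text \<open>The weight of index k meets the variance of step k + 1: the drift at the iterate k, and
  hence its error, enters the recursion in the step that leads to the next iterate.\<close>

definition total_var where "total_var n = (\<Sum>k=1..n. (wt k)\<^sup>2 * vrate (Suc k))" for n :: nat
text \<open>Half the growth exponent of the accumulated variance, which is of order n^(2
  \<open>expo\<close>) log n.\<close>

definition expo where "expo = \<rho> + 1 / 2 - \<phi> / 2"

lemma \<phi>_pos: "\<phi> > 0"
proof -
  have "0 < 1 / (2 * \<alpha> - 1)" using \<alpha> by simp
  then show ?thesis using \<phi> by (rule less_trans)
qed

text \<open>The left side is the exponent of M^s_n as a power of n, up to o(1); the right side is
  that of the sample size.\<close>

lemma \<phi>_alpha: "(\<phi> + 1) / (2 * \<alpha>) < \<phi>"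
proof -
  have "1 < \<phi> * (2 * \<alpha> - 1)" using \<phi> \<alpha> by (simp add: pos_divide_less_eq)
  then show ?thesis using \<alpha> by (simp add: pos_divide_less_eq algebra_simps)
qed

lemma expo_pos: "expo > 0"
  using \<rho> by (simp add: expo_def)

lemma \<rho>_gt: "\<rho> > -1"
  using \<rho> \<phi>_pos by (simp add: algebra_simps)

lemma lnM: "ln M > 0"
  using M by simp

lemma samples_pos: "n \<ge> 1 \<Longrightarrow> samples n > 0"
  using \<kappa>K \<phi>_pos by (simp add: samples_def)

lemma vrate_nonneg: "0 \<le> vrate n"
  using \<kappa>K \<phi>_pos by (simp add: vrate_def samples_def)

lemma vrate_pos: "n \<ge> 1 \<Longrightarrow> vrate n > 0"
  using samples_pos s1 by (force simp: vrate_def)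

lemma s_equiv: "(\<lambda>n. real (s n)) \<sim>[sequentially] (\<lambda>n. (\<phi> + 1) / (2 * \<alpha> * ln M) * ln (real n))"
proof -
  have "(\<lambda>n. (1 / \<alpha>) * (\<alpha> * real (s n))) \<sim>[sequentially] (\<lambda>n. (1 / \<alpha>) * log M (real n powr ((\<phi> + 1) / 2)))"
    by (intro asymp_equiv_mult s_rate asymp_equiv_refl)
  also have "(\<lambda>n. (1 / \<alpha>) * (\<alpha> * real (s n))) = (\<lambda>n. real (s n))"
    using \<alpha> by auto
  also have "(\<lambda>n. (1 / \<alpha>) * log M (real n powr ((\<phi> + 1) / 2))) \<sim>[sequentially] (\<lambda>n. (\<phi> + 1) / (2 * \<alpha> * ln M) * ln (real n))"
  proof (rule asymp_equiv_refl_ev, rule eventually_mono[OF eventually_gt_at_top[of 0]])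
    fix n :: nat assume "0 < n"
    then show "(1 / \<alpha>) * log M (real n powr ((\<phi> + 1) / 2)) = (\<phi> + 1) / (2 * \<alpha> * ln M) * ln (real n)"
      by (simp add: log_def ln_powr field_simps)
  qed
  finally show ?thesis .
qed

lemma s_at_top: "filterlim s at_top sequentially"
proof -
  have "(\<phi> + 1) / (2 * \<alpha> * ln M) > 0"
    using \<phi>_pos \<alpha> lnM by simp
  then have "filterlim (\<lambda>n. (\<phi> + 1) / (2 * \<alpha> * ln M) * ln (real n)) at_top sequentially"
    by real_asymp
  then have "filterlim (\<lambda>n. real (s n)) at_top sequentially"
    using asymp_equiv_at_top_transfer[OF asymp_equiv_symI[OF s_equiv]] by blast
  then show ?thesis
    by (simp only: filterlim_sequentially_iff_filterlim_real)
qed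

text \<open>The expected sample number on the finest level diverges. This makes the rounding errors
  and the Lyapunov ratios vanish.\<close>

lemma samples_ratio_at_top: "filterlim (\<lambda>n. samples n / M powr real (s n)) at_top sequentially"
proof -
  \<comment> \<open>The number of levels is known only up to a factor tending to 1, which changes
    the exponent of M^s_n by o(1); \<tau> leaves room for this.\<close>
  obtain \<tau> where \<tau>: "(\<phi> + 1) / (2 * \<alpha>) < \<tau>" "\<tau> < \<phi>"
    using dense[OF \<phi>_alpha] by blast
  define L where "L = (\<phi> + 1) / (2 * \<alpha> * ln M)"
  have L: "L < \<tau> / ln M"
    using \<tau>(1) lnM by (simp add: L_def divide_strict_right_mono flip: divide_divide_eq_left)
  have L0: "L > 0" using \<phi>_pos \<alpha> lnM by (simp add: L_def)
  note s_equiv' = s_equiv[folded L_def]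
  have "((\<lambda>n. real (s n) / (L * ln (real n))) \<longlongrightarrow> 1) sequentially"
  proof -
    have "eventually (\<lambda>n::nat. real (s n) \<noteq> 0 \<or> L * ln (real n) \<noteq> 0) sequentially"
      using eventually_ge_at_top[of 1] by eventually_elim (use s1 in force)
    from asymp_equivD_strong[OF s_equiv' this] show ?thesis .
  qed
  from tendsto_mult_left[OF this, of L]
  have "((\<lambda>n. L * (real (s n) / (L * ln (real n)))) \<longlongrightarrow> L) sequentially" by (simp only: mult_1_right)
  from order_tendstoD(2)[OF this L]
  have "eventually (\<lambda>n. L * (real (s n) / (L * ln (real n))) < \<tau> / ln M) sequentially" .
  then have ev: "eventually (\<lambda>n. \<kappa>K * (\<phi> + 1) * real n powr (\<phi> - \<tau>) \<le> samples n / M powr real (s n)) sequentially"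
    using eventually_gt_at_top[of 1]
  proof eventually_elim
    case (elim n)
    have ln: "ln (real n) > 0" using elim by simp
    have "real (s n) / ln (real n) < \<tau> / ln M"
      using elim(1) L0 by simp
    then have "real (s n) * ln M \<le> \<tau> * ln (real n)"
      using ln lnM by (simp add: field_simps)
    then have "M powr real (s n) \<le> real n powr \<tau>"
      using M elim by (simp add: powr_def)
    then have "samples n / real n powr \<tau> \<le> samples n / M powr real (s n)"
      using elim samples_pos[of n] M by (intro divide_left_mono) auto
    then show ?case
      by (simp add: samples_def powr_diff)
  qed
  have "filterlim (\<lambda>n. \<kappa>K * (\<phi> + 1) * real n powr (\<phi> - \<tau>)) at_top sequentially"
  proof -
    have "\<kappa>K * (\<phi> + 1) > 0" "\<phi> - \<tau> > 0" using \<kappa>K \<phi>_pos \<tau> by simp_all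
    then show ?thesis by real_asymp
  qed
  then show ?thesis
    using ev by (rule filterlim_at_top_mono)
qed

lemma vrate_equiv: "vrate \<sim>[sequentially] (\<lambda>n. real n powr (- \<phi>) * ln (real n) / (2 * \<alpha> * \<kappa>K * ln M))"
proof -
  have "(\<lambda>n. real (s n) / samples n) \<sim>[sequentially] (\<lambda>n. (\<phi> + 1) / (2 * \<alpha> * ln M) * ln (real n) / samples n)"
    by (intro asymp_equiv_divide s_equiv asymp_equiv_refl)
  also have "\<dots> = (\<lambda>n. real n powr (- \<phi>) * ln (real n) / (2 * \<alpha> * \<kappa>K * ln M))"
  proof
    fix n
    have cancel: "z / A * l / (k * z * p) = inverse p * l / (A * k)" if "z \<noteq> 0" for z A l k p :: real
      using that by (simp add: field_simps)
    have "\<phi> + 1 \<noteq> 0" using \<phi>_pos by simp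
    from cancel[OF this, of "2 * \<alpha> * ln M" "ln (real n)" \<kappa>K "real n powr \<phi>"]
    show "(\<phi> + 1) / (2 * \<alpha> * ln M) * ln (real n) / samples n = real n powr (- \<phi>) * ln (real n) / (2 * \<alpha> * \<kappa>K * ln M)"
      by (simp add: samples_def powr_minus mult_ac)
  qed
  finally show ?thesis by (simp add: vrate_def[abs_def])
qed

lemma vrate_Suc_equiv:
  "(\<lambda>n. vrate (Suc n)) \<sim>[sequentially] (\<lambda>n. real n powr (- \<phi>) * ln (real n) / (2 * \<alpha> * \<kappa>K * ln M))"
proof -
  define c where "c = 2 * \<alpha> * \<kappa>K * ln M"
  have c: "c > 0" using \<alpha> \<kappa>K lnM by (simp add: c_def)
  have "(\<lambda>n. vrate (Suc n)) \<sim>[sequentially] (\<lambda>n. real (Suc n) powr (- \<phi>) * ln (real (Suc n)) / c)"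
    using vrate_equiv unfolding c_def[symmetric] by (rule asymp_equiv_compose'[OF _ filterlim_Suc])
  also have "\<dots> \<sim>[sequentially] (\<lambda>n. real n powr (- \<phi>) * ln (real n) / c)"
    using c \<phi>_pos by real_asymp
  finally show ?thesis by (simp add: c_def)
qed

lemma total_var_equiv: "total_var \<sim>[sequentially] (\<lambda>n. real n powr (2 * expo) * ln (real n) / (2 * \<alpha> * \<kappa>K * ln M * (2 * expo)))"
proof -
  define c where "c = 2 * \<alpha> * \<kappa>K * ln M"
  have c: "c > 0" using \<alpha> \<kappa>K lnM by (simp add: c_def)
  define y where "y = 2 * expo"
  have y: "y > 0" using expo_pos by (simp add: y_def)
  \<comment> \<open>To leading order the antiderivative of x^(y-1) log x / c.\<close>
  let ?G = "\<lambda>n::nat. real n powr y * ln (real n) / (c * y)"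
  have "(\<lambda>k. (wt k)\<^sup>2 * vrate (Suc k)) \<sim>[sequentially] (\<lambda>k. (wt k)\<^sup>2 * (real k powr (- \<phi>) * ln (real k) / c))"
    unfolding c_def by (intro asymp_equiv_mult asymp_equiv_refl vrate_Suc_equiv)
  also have "\<dots> \<sim>[sequentially] (\<lambda>k. real k powr (y - 1) * ln (real k) / c)"
  proof (rule asymp_equiv_refl_ev, rule eventually_mono[OF eventually_gt_at_top[of 0]])
    fix k :: nat assume "0 < k"
    then have "(wt k)\<^sup>2 * real k powr (- \<phi>) = real k powr (y - 1)"
      by (simp add: wt_def power2_eq_square y_def expo_def algebra_simps flip: powr_add)
    then show "(wt k)\<^sup>2 * (real k powr (- \<phi>) * ln (real k) / c) = real k powr (y - 1) * ln (real k) / c"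
      by (simp flip: mult.assoc)
  qed
  also have "\<dots> \<sim>[sequentially] (\<lambda>n. ?G n - ?G (n - 1))"
    using y c by real_asymp
  finally have "(\<lambda>n. \<Sum>k=1..n. (wt k)\<^sup>2 * vrate (Suc k)) \<sim>[sequentially] ?G"
  proof (rule sum_asymp_equiv_antidiff)
    show "filterlim ?G at_top sequentially"
      using y c by real_asymp
    fix k :: nat assume "1 \<le> k"
    then show "?G (k - 1) \<le> ?G k"
      using y c by (cases "k = 1") (auto intro!: divide_right_mono mult_mono powr_mono2)
  qed
  then show ?thesis by (simp add: total_var_def[abs_def] c_def y_def)
qed

lemma total_var_nonneg: "0 \<le> total_var n"
  unfolding total_var_def by (intro sum_nonneg mult_nonneg_nonneg vrate_nonneg) auto

lemma total_var_at_top: "filterlim total_var at_top sequentially"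
proof -
  define c where "c = 2 * \<alpha> * \<kappa>K * ln M * (2 * expo)"
  define y where "y = 2 * expo"
  have "c > 0" "y > 0" using \<alpha> \<kappa>K lnM expo_pos by (simp_all add: c_def y_def)
  then have "filterlim (\<lambda>n. real n powr y * ln (real n) / c) at_top sequentially"
    by real_asymp
  then show ?thesis
    using asymp_equiv_at_top_transfer[OF asymp_equiv_symI[OF total_var_equiv]] by (simp add: c_def y_def)
qed

lemma wt_sum_equiv: "(\<lambda>n. \<Sum>k=1..n. wt k) \<sim>[sequentially] (\<lambda>n. real n powr (\<rho> + 1) / (\<rho> + 1))"
proof (rule sum_asymp_equiv_antidiff)
  define r where "r = \<rho> + 1"
  have r: "r > 0" using \<rho>_gt by (simp add: r_def)
  have "(\<lambda>n. real n powr (r - 1)) \<sim>[sequentially] (\<lambda>n. real n powr r / r - real (n - 1) powr r / r)"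
    using r by real_asymp
  then show "wt \<sim>[sequentially] (\<lambda>n. real n powr (\<rho> + 1) / (\<rho> + 1) - real (n - 1) powr (\<rho> + 1) / (\<rho> + 1))"
    by (simp add: wt_def[abs_def] r_def)
  have "filterlim (\<lambda>n. real n powr r / r) at_top sequentially"
    using r by real_asymp
  then show "filterlim (\<lambda>n. real n powr (\<rho> + 1) / (\<rho> + 1)) at_top sequentially"
    by (simp add: r_def)
  fix k :: nat assume "1 \<le> k"
  then show "real (k - 1) powr (\<rho> + 1) / (\<rho> + 1) \<le> real k powr (\<rho> + 1) / (\<rho> + 1)"
    using \<rho>_gt by (intro divide_right_mono powr_mono2) auto
qed

lemma eps_sq: "n > 0 \<Longrightarrow> (eps_diff M \<alpha> \<kappa>K \<phi> \<rho> n)\<^sup>2 =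
    (\<rho> + 1)\<^sup>2 / (2 * \<alpha> * \<kappa>K * ln M * (2 * expo)) * real n powr (- (\<phi> + 1)) * ln (real n)"
proof -
  assume n: "n > 0"
  have ge: "2 * ((\<rho> + 1) / (\<phi> + 1)) - 1 = (2 * expo) / (\<phi> + 1)"
    using \<phi>_pos by (simp add: expo_def field_simps)
  have lg: "log M (real n powr (\<phi> + 1)) = (\<phi> + 1) * ln (real n) / ln M"
    using n by (simp add: log_def ln_powr)
  have lg0: "(\<phi> + 1) * ln (real n) / ln M \<ge> 0"
    using n \<phi>_pos lnM by simp
  have pw: "(real n powr (- (\<phi> + 1) / 2))\<^sup>2 = real n powr (- (\<phi> + 1))"
    by (simp add: power2_eq_square flip: powr_add)
  have "(eps_diff M \<alpha> \<kappa>K \<phi> \<rho> n)\<^sup>2 = 1 / (2 * \<alpha> * \<kappa>K) * (((\<rho> + 1) / (\<phi> + 1))\<^sup>2 / (2 * expo / (\<phi> + 1)))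
     * real n powr (- (\<phi> + 1)) * ((\<phi> + 1) * ln (real n) / ln M)"
    unfolding eps_diff_def power_mult_distrib power_divide ge lg pw
    using \<alpha> \<kappa>K expo_pos \<phi>_pos lg0 by (simp add: real_sqrt_pow2)
  also have "\<dots> = (\<rho> + 1)\<^sup>2 / (2 * \<alpha> * \<kappa>K * ln M * (2 * expo)) * real n powr (- (\<phi> + 1)) * ln (real n)"
  proof -
    have cancel: "1 / A * ((r / p)\<^sup>2 / (e / p)) * x * (p * l / m) = r\<^sup>2 / (A * m * e) * x * l"
      if "p \<noteq> 0" for A r p e x l m :: real
      using that by (simp add: power2_eq_square mult_ac)
    show ?thesis using \<phi>_pos by (intro cancel) simp
  qed
  finally show ?thesis .
qed

lemma eps_nonneg: "0 \<le> eps_diff M \<alpha> \<kappa>K \<phi> \<rho> n"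
proof -
  have "log M (real n powr (\<phi> + 1)) \<ge> 0"
    using M \<phi>_pos by (cases "n = 0") (auto simp: ge_one_powr_ge_zero log_def)
  then show ?thesis
    unfolding eps_diff_def using \<alpha> \<kappa>K \<rho>_gt \<phi>_pos \<rho>
    by (intro mult_nonneg_nonneg divide_nonneg_nonneg) (auto simp: field_simps)
qed

text \<open>Up to a factor tending to 1, \<open>eps_diff\<close> is the standard deviation
  sqrt(\<open>total_var\<close>) of the weighted noise divided by the total weight; its constant is
  chosen for this purpose.\<close>

lemma normalisation: "(\<lambda>n. sqrt (total_var n) / (eps_diff M \<alpha> \<kappa>K \<phi> \<rho> n * (\<Sum>k=1..n. wt k))) \<longlonglongrightarrow> 1"
proof -
  let ?e = "eps_diff M \<alpha> \<kappa>K \<phi> \<rho>" and ?b = "\<lambda>n. \<Sum>k=1..n. wt k"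
  have "(\<lambda>n. (?e n)\<^sup>2 * (?b n)\<^sup>2) \<sim>[sequentially] (\<lambda>n. (?e n)\<^sup>2 * (real n powr (\<rho> + 1) / (\<rho> + 1))\<^sup>2)"
    by (intro asymp_equiv_mult asymp_equiv_power asymp_equiv_refl wt_sum_equiv)
  also have "\<dots> \<sim>[sequentially] (\<lambda>n. real n powr (2 * expo) * ln (real n) / (2 * \<alpha> * \<kappa>K * ln M * (2 * expo)))"
  proof (rule asymp_equiv_refl_ev, rule eventually_mono[OF eventually_gt_at_top[of 0]])
    fix n :: nat assume n: "0 < n"
    have "real n powr (- (\<phi> + 1)) * (real n powr (\<rho> + 1))\<^sup>2 = real n powr (2 * expo)"
      by (simp add: power2_eq_square expo_def algebra_simps flip: powr_add)
    then show "(?e n)\<^sup>2 * (real n powr (\<rho> + 1) / (\<rho> + 1))\<^sup>2 = real n powr (2 * expo) * ln (real n) / (2 * \<alpha> * \<kappa>K * ln M * (2 * expo))"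
      unfolding eps_sq[OF n] using \<rho>_gt by (simp add: power_divide mult_ac)
  qed
  also have "\<dots> \<sim>[sequentially] total_var"
    by (rule asymp_equiv_symI[OF total_var_equiv])
  finally have "total_var \<sim>[sequentially] (\<lambda>n. (?e n)\<^sup>2 * (?b n)\<^sup>2)"
    by (rule asymp_equiv_symI)
  moreover have "eventually (\<lambda>n. total_var n \<noteq> 0 \<or> (?e n)\<^sup>2 * (?b n)\<^sup>2 \<noteq> 0) sequentially"
    using filterlim_at_top_dense[THEN iffD1, OF total_var_at_top, rule_format, of 0] by eventually_elim auto
  ultimately have "((\<lambda>n. total_var n / ((?e n)\<^sup>2 * (?b n)\<^sup>2)) \<longlongrightarrow> 1) sequentially"
    by (rule asymp_equivD_strong)
  from tendsto_real_sqrt[OF this] have "(\<lambda>n. sqrt (total_var n / ((?e n)\<^sup>2 * (?b n)\<^sup>2))) \<longlonglongrightarrow> 1" by simp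
  moreover have "sqrt (total_var n / ((?e n)\<^sup>2 * (?b n)\<^sup>2)) = sqrt (total_var n) / (?e n * ?b n)" for n
  proof -
    have "0 \<le> ?b n" by (intro sum_nonneg) (simp add: wt_def)
    then show ?thesis
      using eps_nonneg[of n] by (simp add: real_sqrt_divide real_sqrt_mult)
  qed
  ultimately show ?thesis by simp
qed

text \<open>Since (\<phi>+1)/(1+lam) = \<phi> + 1 - lam/(lam+1) (\<phi>+1), the third condition can
  be met below \<psi> + \<phi> by the lower bound on \<psi>; the second can be met by \<psi> <
  1.\<close>

lemma rate_exists:
  "\<exists>p. 0 < p \<and> 2 * \<psi> + \<phi> - 1 < p \<and> \<phi> + 1 < p * (1 + lam) \<and> p < \<psi> + \<phi>"
proof -
  have "(\<phi> + 1) / (1 + lam) = \<phi> + 1 - lam / (lam + 1) * (\<phi> + 1)"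
    using lam by (simp add: field_simps)
  then have "max (max (2 * \<psi> + \<phi> - 1) ((\<phi> + 1) / (1 + lam))) 0 < \<psi> + \<phi>"
    using \<psi> \<phi>_pos by auto
  from dense[OF this] obtain p where "max (max (2 * \<psi> + \<phi> - 1) ((\<phi> + 1) / (1 + lam))) 0 < p" "p < \<psi> + \<phi>" by blast
  then show ?thesis
    using lam by (intro exI[of _ p]) (auto simp: pos_divide_less_eq)
qed

text \<open>The squared bias is O(n^(-(\<phi>+1)) log n) and the noise contributes
  n^(-2\<psi>-\<phi>) log n. The strict inequalities p < \<phi> + 1 and p < \<psi> + \<phi> absorb
  the logarithms.\<close>

lemma recursion_input:
  assumes p: "p < \<psi> + \<phi>"
  shows "(\<lambda>n. step_size n * (bias n)\<^sup>2 + (step_size n)\<^sup>2 * vrate n) \<in> O(\<lambda>n. real n powr (- \<psi> - p))"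
proof (rule sum_in_bigo)
  have p': "p < \<phi> + 1" using p \<psi> by simp
  have "bias \<in> O(\<lambda>n. real n powr (- (\<phi> + 1) / 2) * sqrt (ln (real n)))"
    using landau_o.small_imp_big[OF bias_rate] by (simp add: bias_def[abs_def])
  then have "(\<lambda>n. step_size n * (bias n * bias n)) \<in> O(\<lambda>n. step_size n *
    ((real n powr (- (\<phi> + 1) / 2) * sqrt (ln (real n))) * (real n powr (- (\<phi> + 1) / 2) * sqrt (ln (real n)))))"
    by (intro landau_o.big.mult landau_o.big_refl)
  also have "(\<lambda>n. step_size n * ((real n powr (- (\<phi> + 1) / 2) * sqrt (ln (real n))) *
      (real n powr (- (\<phi> + 1) / 2) * sqrt (ln (real n))))) \<in> O(\<lambda>n. real n powr (- \<psi> - p))"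
    unfolding step_size_def using p' by real_asymp
  finally show "(\<lambda>n. step_size n * (bias n)\<^sup>2) \<in> O(\<lambda>n. real n powr (- \<psi> - p))"
    by (simp add: power2_eq_square)
  define c where "c = 2 * \<alpha> * \<kappa>K * ln M"
  have c: "c > 0" using \<alpha> \<kappa>K lnM by (simp add: c_def)
  have "(\<lambda>n. (step_size n * step_size n) * vrate n) \<in> O(\<lambda>n. (step_size n * step_size n) * (real n powr (- \<phi>) * ln (real n) / c))"
    unfolding c_def by (intro landau_o.big.mult landau_o.big_refl asymp_equiv_imp_bigo vrate_equiv)
  also have "(\<lambda>n. (step_size n * step_size n) * (real n powr (- \<phi>) * ln (real n) / c)) \<in> O(\<lambda>n. real n powr (- \<psi> - p))"
    unfolding step_size_def using p c by real_asymp
  finally show "(\<lambda>n. (step_size n)\<^sup>2 * vrate n) \<in> O(\<lambda>n. real n powr (- \<psi> - p))"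
    by (simp add: power2_eq_square)
qed

text \<open>The logarithm puts the standard deviation above the pure power, so an error needs only
  to be o(n^\<open>expo\<close>) to be negligible.\<close>

lemma power_le_sqrt_total_var: "eventually (\<lambda>n. real n powr expo \<le> sqrt (total_var n)) sequentially"
proof -
  define c where "c = 2 * \<alpha> * \<kappa>K * ln M * (2 * expo)"
  define y where "y = expo"
  have c: "c > 0" "y > 0" using \<alpha> \<kappa>K lnM expo_pos by (simp_all add: c_def y_def)
  have "(\<lambda>n. (real n powr y)\<^sup>2) \<in> o(\<lambda>n. real n powr (2 * y) * ln (real n) / c)"
    using c by real_asymp
  also have "(\<lambda>n. real n powr (2 * y) * ln (real n) / c) \<in> O(total_var)"
    unfolding c_def y_def by (rule asymp_equiv_imp_bigo[OF asymp_equiv_symI[OF total_var_equiv]])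
  finally have "eventually (\<lambda>n. norm ((real n powr y)\<^sup>2) \<le> 1 * norm (total_var n)) sequentially"
    by (rule landau_o.smallD) simp
  then show ?thesis
    by eventually_elim (use total_var_nonneg in \<open>auto simp: y_def intro!: real_le_rsqrt\<close>)
qed

lemma smallo_power_negligible:
  assumes "u \<in> o(\<lambda>n. real n powr expo)"
  shows "(\<lambda>n. u n / sqrt (total_var n)) \<longlonglongrightarrow> 0"
proof -
  have "(\<lambda>n. real n powr expo) \<in> O(\<lambda>n. sqrt (total_var n))"
    by (rule bigoI[of _ 1]) (use power_le_sqrt_total_var in \<open>eventually_elim, simp\<close>)
  with assms have "u \<in> o(\<lambda>n. sqrt (total_var n))" by (rule landau_o.small_big_trans)
  then show ?thesis by (rule smalloD_tendsto)
qed

lemma sum_negligible: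
  assumes "u \<in> o(\<lambda>k. real k powr (expo - 1))"
  shows "(\<lambda>n. (\<Sum>k=1..n. u k) / sqrt (total_var n)) \<longlonglongrightarrow> 0"
proof (rule smallo_power_negligible)
  define y where "y = expo"
  have y: "y > 0" using expo_pos by (simp add: y_def)
  have "(\<lambda>n. real n powr (y - 1)) \<sim>[sequentially] (\<lambda>n. real n powr y / y - real (n - 1) powr y / y)"
    using y by real_asymp
  then have eq: "(\<lambda>n. \<Sum>k=1..n. real k powr (y - 1)) \<sim>[sequentially] (\<lambda>n. real n powr y / y)"
  proof (rule sum_asymp_equiv_antidiff)
    show "filterlim (\<lambda>n. real n powr y / y) at_top sequentially" using y by real_asymp
    fix k :: nat assume "1 \<le> k"
    then show "real (k - 1) powr y / y \<le> real k powr y / y"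
      using y by (intro divide_right_mono powr_mono2) auto
  qed
  have top: "filterlim (\<lambda>n. \<Sum>k=1..n. real k powr (y - 1)) at_top sequentially"
  proof -
    have "filterlim (\<lambda>n. real n powr y / y) at_top sequentially" using y by real_asymp
    then show ?thesis using asymp_equiv_at_top_transfer[OF asymp_equiv_symI[OF eq]] by blast
  qed
  have "(\<lambda>n. \<Sum>k=1..n. u k) \<in> o(\<lambda>n. \<Sum>k=1..n. real k powr (y - 1))"
    by (rule sum_smallo_sum[OF _ _ top]) (use assms in \<open>auto simp: y_def\<close>)
  also have "(\<lambda>n. \<Sum>k=1..n. real k powr (y - 1)) \<in> O(\<lambda>n. real n powr y / y)"
    by (rule asymp_equiv_imp_bigo[OF eq])
  also have "(\<lambda>n. real n powr y / y) \<in> O(\<lambda>n. real n powr y)"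
    using y by real_asymp
  finally show "(\<lambda>n. \<Sum>k=1..n. u k) \<in> o(\<lambda>n. real n powr expo)" by (simp add: y_def)
qed

text \<open>The borderline term: the bias need not be o(n^(-(\<phi>+1)/2)), only o of this times
  sqrt(log n). The comparison therefore keeps the factor sqrt(log n), which the standard deviation
  also contains.\<close>

lemma bias_sum_negligible: "(\<lambda>n. (\<Sum>k=1..n. wt k * bias (Suc k)) / sqrt (total_var n)) \<longlonglongrightarrow> 0"
proof -
  define y where "y = expo"
  have y: "y > 0" using expo_pos by (simp add: y_def)
  let ?g = "\<lambda>n::nat. real n powr (y - 1) * sqrt (ln (real n))"
  let ?G = "\<lambda>n::nat. real n powr y * sqrt (ln (real n)) / y"
  have "(\<lambda>n. bias (Suc n)) \<in> o(\<lambda>n. real (Suc n) powr (- (\<phi> + 1) / 2) * sqrt (ln (real (Suc n))))"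
    using landau_o.small.compose[OF bias_rate filterlim_Suc] by (simp add: bias_def)
  then have "(\<lambda>k. wt k * bias (Suc k)) \<in> o(\<lambda>k. wt k * (real (Suc k) powr (- (\<phi> + 1) / 2) * sqrt (ln (real (Suc k)))))"
    by (intro landau_o.small.mult_left)
  also have "(\<lambda>k. wt k * (real (Suc k) powr (- (\<phi> + 1) / 2) * sqrt (ln (real (Suc k))))) \<in> O(?g)"
  proof -
    define a where "a = (\<phi> + 1) / 2"
    have "(\<lambda>k. real (Suc k) powr (- a)) \<in> O(\<lambda>k. real k powr (- a))"
      by real_asymp
    moreover have "(\<lambda>k. sqrt (ln (real (Suc k)))) \<in> O(\<lambda>k. sqrt (ln (real k)))"
      by real_asymp
    ultimately have "(\<lambda>k. wt k * (real (Suc k) powr (- a) * sqrt (ln (real (Suc k))))) \<in> O(\<lambda>k. wt k * (real k powr (- a) * sqrt (ln (real k))))"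
      by (intro landau_o.big.mult landau_o.big_refl)
    moreover have "wt k * (real k powr (- a) * sqrt (ln (real k))) = ?g k" for k
    proof -
      have "\<rho> + - a = y - 1" by (simp add: y_def expo_def a_def field_simps)
      then have "real k powr \<rho> * real k powr (- a) = real k powr (y - 1)" by (simp only: powr_add[symmetric])
      then show ?thesis by (simp add: wt_def flip: mult.assoc)
    qed
    moreover have "- (\<phi> + 1) / 2 = - a" unfolding a_def by (rule minus_divide_left[symmetric])
    ultimately show ?thesis by (simp only:)
  qed
  finally have small: "(\<lambda>k. wt k * bias (Suc k)) \<in> o(?g)" .
  have "?g \<sim>[sequentially] (\<lambda>n. ?G n - ?G (n - 1))"
    using y by real_asymp
  then have eq: "(\<lambda>n. \<Sum>k=1..n. ?g k) \<sim>[sequentially] ?G"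
  proof (rule sum_asymp_equiv_antidiff)
    show "filterlim ?G at_top sequentially" using y by real_asymp
    fix k :: nat assume "1 \<le> k"
    then show "?G (k - 1) \<le> ?G k"
      using y by (cases "k = 1") (auto intro!: divide_right_mono mult_mono powr_mono2)
  qed
  have top: "filterlim (\<lambda>n. \<Sum>k=1..n. ?g k) at_top sequentially"
  proof -
    have "filterlim ?G at_top sequentially" using y by real_asymp
    then show ?thesis using asymp_equiv_at_top_transfer[OF asymp_equiv_symI[OF eq]] by blast
  qed
  have "(\<lambda>n. \<Sum>k=1..n. wt k * bias (Suc k)) \<in> o(\<lambda>n. \<Sum>k=1..n. ?g k)"
    by (rule sum_smallo_sum[OF small _ top]) auto
  also have "(\<lambda>n. \<Sum>k=1..n. ?g k) \<in> O(?G)" by (rule asymp_equiv_imp_bigo[OF eq])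
  also have "?G \<in> O(\<lambda>n. sqrt (total_var n))"
  proof -
    define c where "c = 2 * \<alpha> * \<kappa>K * ln M * (2 * expo)"
    have c: "c > 0" using \<alpha> \<kappa>K lnM expo_pos by (simp add: c_def)
    have "(\<lambda>n. (?G n)\<^sup>2) \<in> O(\<lambda>n. real n powr (2 * y) * ln (real n) / c)"
      using c y by real_asymp
    also have "(\<lambda>n. real n powr (2 * y) * ln (real n) / c) \<in> O(total_var)"
      unfolding c_def y_def by (rule asymp_equiv_imp_bigo[OF asymp_equiv_symI[OF total_var_equiv]])
    finally obtain C where C: "C > 0" "eventually (\<lambda>n. norm ((?G n)\<^sup>2) \<le> C * norm (total_var n)) sequentially"
      by (elim landau_o.bigE)
    show ?thesis
    proof (rule bigoI[of _ "sqrt C"])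
      show "eventually (\<lambda>n. norm (?G n) \<le> sqrt C * norm (sqrt (total_var n))) sequentially"
        using C(2)
      proof eventually_elim
        case (elim n)
        then have "(norm (?G n))\<^sup>2 \<le> C * total_var n"
          using total_var_nonneg[of n] unfolding norm_power real_norm_def[of "total_var n"] by simp
        then have "norm (?G n) \<le> sqrt (C * total_var n)" by (rule real_le_rsqrt)
        then show ?case using total_var_nonneg[of n] by (simp add: real_sqrt_mult)
      qed
    qed
  qed
  finally show ?thesis by (rule smalloD_tendsto)
qed

lemma cost_sum_equiv: "(\<lambda>n. \<Sum>m=1..n. samples m * real (s m)) \<sim>[sequentially]
    (\<lambda>n. \<kappa>K * (\<phi> + 1) / (2 * \<alpha> * ln M) * real n powr (\<phi> + 1) * ln (real n))"
proof -
  define c where "c = \<kappa>K * (\<phi> + 1) / (2 * \<alpha> * ln M)"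
  define y where "y = \<phi> + 1"
  have c: "c > 0" "y > 0" using \<alpha> \<kappa>K lnM \<phi>_pos by (simp_all add: c_def y_def)
  let ?G = "\<lambda>n::nat. c * real n powr y * ln (real n)"
  have "(\<lambda>m. samples m * real (s m)) \<sim>[sequentially] (\<lambda>m. samples m * ((\<phi> + 1) / (2 * \<alpha> * ln M) * ln (real m)))"
    by (intro asymp_equiv_mult asymp_equiv_refl s_equiv)
  also have "\<dots> = (\<lambda>m. c * y * real m powr (y - 1) * ln (real m))"
    by (simp add: samples_def c_def y_def fun_eq_iff)
  also have "\<dots> \<sim>[sequentially] (\<lambda>n. ?G n - ?G (n - 1))"
    using c by real_asymp
  finally have "(\<lambda>n. \<Sum>m=1..n. samples m * real (s m)) \<sim>[sequentially] ?G"
  proof (rule sum_asymp_equiv_antidiff)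
    show "filterlim ?G at_top sequentially" using c by real_asymp
    fix k :: nat assume "1 \<le> k"
    then show "?G (k - 1) \<le> ?G k"
      using c by (cases "k = 1") (auto intro!: mult_mono powr_mono2)
  qed
  then show ?thesis by (simp add: c_def y_def)
qed

text \<open>The cost is equivalent to a constant times n^(\<phi>+1) log n, so its logarithm is
  equivalent to (\<phi>+1) log n. In log(cost)/sqrt(cost) one logarithm is left over from the square
  root, as in \<open>eps_diff\<close>, and \<kappa>K is absorbed into the cost.\<close>

lemma eps_in_terms_of_cost:
  assumes \<kappa>C: "\<kappa>C > 0" and cost: "cost \<sim>[sequentially] (\<lambda>n. \<kappa>C * (\<Sum>m=1..n. samples m * real (s m)))"
  shows "eps_diff M \<alpha> \<kappa>K \<phi> \<rho> \<sim>[sequentially]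
    (\<lambda>n. sqrt \<kappa>C / (2 * \<alpha>) * (((\<rho> + 1) / (\<phi> + 1)) / sqrt (2 * ((\<rho> + 1) / (\<phi> + 1)) - 1))
                   * (log M (cost n) / sqrt (cost n)))"
proof -
  define c where "c = \<kappa>C * (\<kappa>K * (\<phi> + 1) / (2 * \<alpha> * ln M))"
  define y where "y = \<phi> + 1"
  have c: "c > 0" "y > 0" using \<alpha> \<kappa>K lnM \<phi>_pos \<kappa>C by (simp_all add: c_def y_def)
  let ?g = "\<lambda>n::nat. c * real n powr y * ln (real n)"
  have "(\<lambda>n. \<kappa>C * (\<Sum>m=1..n. samples m * real (s m))) \<sim>[sequentially]
    (\<lambda>n. \<kappa>C * (\<kappa>K * (\<phi> + 1) / (2 * \<alpha> * ln M) * real n powr (\<phi> + 1) * ln (real n)))"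
    by (intro asymp_equiv_mult asymp_equiv_refl cost_sum_equiv)
  with cost have cg: "cost \<sim>[sequentially] ?g"
    unfolding c_def y_def by (auto intro: asymp_equiv_trans simp: mult.assoc)
  have gtop: "filterlim ?g at_top sequentially" using c by real_asymp
  then have ctop: "filterlim cost at_top sequentially"
    by (rule asymp_equiv_at_top_transfer[OF asymp_equiv_symI[OF cg]])
  have gpos: "eventually (\<lambda>n. ?g n > 0) sequentially" and cpos: "eventually (\<lambda>n. cost n > 0) sequentially"
    using gtop ctop unfolding filterlim_at_top_dense by auto
  \<comment> \<open>Equivalence does not survive a logarithm in general. Here the difference of the
    logarithms tends to 0 while the logarithms stay away from 0.\<close>
  have ln: "(\<lambda>n. ln (cost n)) \<sim>[sequentially] (\<lambda>n. ln (?g n))"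
    unfolding asymp_equiv_altdef
  proof -
    have "eventually (\<lambda>n. cost n \<noteq> 0 \<or> ?g n \<noteq> 0) sequentially"
      by (rule eventually_mono[OF cpos]) (rule disjI1, rule less_imp_neq[THEN not_sym])
    from asymp_equivD_strong[OF cg this] have "(\<lambda>n. ln (cost n / ?g n)) \<longlonglongrightarrow> ln 1"
      by (rule tendsto_ln) simp
    then have "(\<lambda>n. ln (cost n / ?g n)) \<longlonglongrightarrow> 0"
      unfolding ln_one .
    moreover have "eventually (\<lambda>n. ln (cost n / ?g n) = ln (cost n) - ln (?g n)) sequentially"
      using gpos cpos by eventually_elim (rule ln_divide_pos)
    ultimately have "(\<lambda>n. ln (cost n) - ln (?g n)) \<longlonglongrightarrow> 0"
      by (rule Lim_transform_eventually)
    then have A: "(\<lambda>n. ln (cost n) - ln (?g n)) \<in> o(\<lambda>_. 1)"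
      by (intro smalloI_tendsto) auto
    have B: "(\<lambda>_. 1) \<in> O(\<lambda>n. ln (?g n))"
      using c by real_asymp
    show "(\<lambda>n. ln (cost n) - ln (?g n)) \<in> o(\<lambda>n. ln (?g n))"
      by (rule landau_o.small_big_trans[OF A B])
  qed
  also have "(\<lambda>n. ln (?g n)) \<sim>[sequentially] (\<lambda>n. y * ln (real n))"
    using c by real_asymp
  finally have lnc: "(\<lambda>n. ln (cost n)) \<sim>[sequentially] (\<lambda>n. y * ln (real n))" .
  have "(\<lambda>n. cost n powr (1 / 2)) \<sim>[sequentially] (\<lambda>n. ?g n powr (1 / 2))"
    by (rule asymp_equiv_powr_real[OF cg]; rule eventually_mono[OF gpos] eventually_mono[OF cpos]; simp)
  then have sq: "(\<lambda>n. sqrt (cost n)) \<sim>[sequentially] (\<lambda>n. sqrt (?g n))"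
    by (rule asymp_equiv_transfer; intro eventually_mono[OF gpos] eventually_mono[OF cpos]; simp add: powr_half_sqrt)
  define R where "R = ((\<rho> + 1) / (\<phi> + 1)) / sqrt (2 * ((\<rho> + 1) / (\<phi> + 1)) - 1)"
  define k where "k = sqrt \<kappa>C / (2 * \<alpha>) * R"
  have ge: "2 * ((\<rho> + 1) / (\<phi> + 1)) - 1 = (2 * expo) / y"
    using \<phi>_pos by (simp add: expo_def y_def field_simps)
  have ge0: "2 * ((\<rho> + 1) / (\<phi> + 1)) - 1 > 0"
    unfolding ge using expo_pos c by simp
  have R2: "R\<^sup>2 = (\<rho> + 1)\<^sup>2 / (y * (2 * expo))"
  proof -
    have "R\<^sup>2 = ((\<rho> + 1) / (\<phi> + 1))\<^sup>2 / (sqrt (2 * ((\<rho> + 1) / (\<phi> + 1)) - 1))\<^sup>2"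
      unfolding R_def by (rule power_divide)
    also have "\<dots> = ((\<rho> + 1) / y)\<^sup>2 / ((2 * expo) / y)"
      by (simp only: real_sqrt_pow2[OF less_imp_le[OF ge0]]) (simp only: ge y_def)
    also have "\<dots> = (\<rho> + 1)\<^sup>2 / (y * (2 * expo))"
      using c by (simp add: power2_eq_square)
    finally show ?thesis .
  qed
  have R0: "R \<ge> 0" using \<rho>_gt \<phi>_pos ge0 by (simp add: R_def)
  have "(\<lambda>n. k * ((ln (cost n) * (1 / ln M)) / sqrt (cost n))) \<sim>[sequentially] (\<lambda>n. k * ((y * ln (real n) * (1 / ln M)) / sqrt (?g n)))"
    by (intro asymp_equiv_mult asymp_equiv_divide asymp_equiv_refl lnc sq)
  also have "\<dots> \<sim>[sequentially] eps_diff M \<alpha> \<kappa>K \<phi> \<rho>"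
  proof (rule asymp_equiv_refl_ev, rule eventually_mono[OF eventually_gt_at_top[of 1]])
    fix n :: nat assume n: "1 < n"
    have l: "ln (real n) > 0" using n by simp
    have np: "real n powr y > 0" using n by simp
    let ?l = "k * ((y * ln (real n) * (1 / ln M)) / sqrt (?g n))"
    show "?l = eps_diff M \<alpha> \<kappa>K \<phi> \<rho> n"
    \<comment> \<open>Both sides are nonnegative; squaring removes the roots and leaves an identity
      of monomials.\<close>
    proof (rule power2_eq_imp_eq)
      have "?l\<^sup>2 = k\<^sup>2 * ((y * ln (real n) * (1 / ln M))\<^sup>2 / (?g n))"
        using c l np by (simp only: power_mult_distrib power_divide) simp
      also have "k\<^sup>2 = \<kappa>C / (4 * \<alpha>\<^sup>2) * R\<^sup>2"
        using \<kappa>C by (simp add: k_def power_mult_distrib power_divide)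
      also have "\<kappa>C / (4 * \<alpha>\<^sup>2) * R\<^sup>2 * ((y * ln (real n) * (1 / ln M))\<^sup>2 / (?g n)) =
        (\<rho> + 1)\<^sup>2 / (2 * \<alpha> * \<kappa>K * ln M * (2 * expo)) * real n powr (- y) * ln (real n)"
      proof -
        have cancel: "kC / (4 * a\<^sup>2) * (r / (y * e)) * ((y * l * (1 / m))\<^sup>2 / (kC * (kK * y / (2 * a * m)) * p * l)) =
          r / (2 * a * kK * m * e) * inverse p * l"
          if "kC \<noteq> 0" "a \<noteq> 0" "y \<noteq> 0" "m \<noteq> 0" "l \<noteq> 0" "p \<noteq> 0" for kC a r y e l m kK p :: real
          using that by (simp add: power2_eq_square inverse_eq_divide mult_ac)
        show ?thesis
          unfolding R2 c_def y_def[symmetric] powr_minus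
          by (rule cancel) (use \<kappa>C \<alpha> c lnM l np in auto)
      qed
      also have "\<dots> = (eps_diff M \<alpha> \<kappa>K \<phi> \<rho> n)\<^sup>2"
        using eps_sq[of n] n by (simp add: y_def)
      finally show "?l\<^sup>2 = (eps_diff M \<alpha> \<kappa>K \<phi> \<rho> n)\<^sup>2" .
      show "0 \<le> ?l"
        using R0 \<kappa>C \<alpha> c l lnM np by (intro mult_nonneg_nonneg divide_nonneg_nonneg) (auto simp: k_def)
    qed (rule eps_nonneg)
  qed
  finally have "eps_diff M \<alpha> \<kappa>K \<phi> \<rho> \<sim>[sequentially] (\<lambda>n. k * ((ln (cost n) * (1 / ln M)) / sqrt (cost n)))"
    by (rule asymp_equiv_symI)
  then show ?thesis
    unfolding k_def R_def log_def by (simp only: mult_1_right times_divide_eq_right)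
qed

end

subsection \<open>One step of the algorithm\<close>

text \<open>With N samples of scale m on a level, the left side is its total q-th moment. The right
  side splits off the variance m / N of the level average and leaves a small factor.\<close>

lemma powr_level_identity:
  fixes N m q :: real
  assumes "N > 0" "m > 0"
  shows "N * (1 / N) powr q * m powr (q / 2) = (1 / N * m) * (N\<^sup>2 / m) powr (- (q / 2 - 1))"
proof -
  obtain a where a: "N = exp a" using assms(1) exp_ln by metis
  obtain b where b: "m = exp b" using assms(2) exp_ln by metis
  have 1: "1 / exp a = exp (- a)" "exp a ^ 2 / exp b = exp (2 * a - b)"
    by (simp_all add: exp_minus inverse_eq_divide exp_diff exp_double)
  show ?thesis
    unfolding a b 1 exp_powr_real exp_add[symmetric] by (simp add: algebra_simps)
qed

locale mlsa = mlsa_params lam M \<alpha> \<phi> \<rho> \<psi> \<kappa>K alphas s + prob_space P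
  for lam M \<alpha> \<phi> \<rho> \<psi> \<kappa>K :: real and alphas :: "nat \<Rightarrow> real" and s :: "nat \<Rightarrow> nat"
    and P :: "'w measure" +
  fixes \<U> :: "'u measure" and U :: "'w \<Rightarrow> 'u" and UU :: "nat \<Rightarrow> nat \<Rightarrow> nat \<Rightarrow> 'w \<Rightarrow> 'u"
    and D :: "(real^'d) set" and Proj :: "real^'d \<Rightarrow> real^'d"
    and F :: "real^'d \<Rightarrow> 'u \<Rightarrow> real^'d" and Fk :: "nat \<Rightarrow> real^'d \<Rightarrow> 'u \<Rightarrow> real^'d"
    and \<theta>s \<theta>0 :: "real^'d" and H \<Gamma> :: "real^'d^'d"
  assumes U [measurable]: "U \<in> measurable P \<U>"
    and Proj [measurable]: "Proj \<in> borel_measurable borel"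
    and Proj_D: "\<And>x. Proj x \<in> D" and Proj_id: "\<And>x. x \<in> D \<Longrightarrow> Proj x = x"
    and Proj_frontier: "\<And>x. x \<notin> D \<Longrightarrow> Proj x \<in> frontier D"
    and indep: "indep_vars (\<lambda>_. \<U>) (\<lambda>(n, k, l). UU n k l) ({1..} \<times> {1..} \<times> {1..})"
    and ident: "\<And>n k l. n \<ge> 1 \<Longrightarrow> k \<ge> 1 \<Longrightarrow> l \<ge> 1 \<Longrightarrow> distr P \<U> (UU n k l) = distr P \<U> U"
    and Fk_meas: "\<And>k. k \<ge> 1 \<Longrightarrow> param_measurable D \<U> (Fk k)"
    and Fk_int: "\<And>k x. k \<ge> 1 \<Longrightarrow> x \<in> D \<Longrightarrow> integrable P (\<lambda>\<omega>. Fk k x (U \<omega>))"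
    and \<theta>0: "\<theta>0 \<in> D" and \<theta>s: "\<theta>s \<in> interior D"
begin

abbreviation param_space where "param_space \<equiv> restrict_space borel D"
abbreviation "f \<equiv> mean_field P U F"
abbreviation "level_mean k \<equiv> mean_field P U (Fk k)"
definition \<theta> where "\<theta> = iterate Proj Fk M step_size samples s \<theta>0 UU"
definition Nk where "Nk n k = level_samples M k (samples n)"
definition dev where "dev k x u = level_diff Fk k x u - mean_field P U (level_diff Fk k) x"
definition cov where "cov k x = cov_matrix P (\<lambda>\<omega>. level_diff Fk k x (U \<omega>))"
definition sample where "sample = (\<lambda>(n, k, l). UU n k l)"
definition past where "past k = {1..k} \<times> {1::nat..} \<times> {1::nat..}" for k :: nat
definition block where "block n = {n} \<times> {1::nat..} \<times> {1::nat..}" for n :: nat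
definition Fil where "Fil k = vimage_algebra (space P) (\<lambda>\<omega>. restrict (\<lambda>i. sample i \<omega>) (past k)) (PiM (past k) (\<lambda>_. \<U>))"
abbreviation block_space where "block_space n \<equiv> PiM (block n) (\<lambda>_. \<U>)"
definition sample_block where "sample_block n \<omega> = restrict (\<lambda>i. sample i \<omega>) (block n)"
text \<open>The estimator as a function of the parameter and of the sample block separately, so that
  the parameter can be frozen while the block is integrated.\<close>

definition est where "est n x y = multilevel_estimator Fk M (\<lambda>k l. y (n, k, l)) x (s n) (samples n)"
definition noise where "noise n x y = est n x y - level_mean (s n) x"
definition step_var where "step_var a n x = (\<Sum>k=1..s n. 1 / real (Nk n k) * (a \<bullet> (cov k x *v a)))"

lemma \<theta>s_D: "\<theta>s \<in> D" using \<theta>s interior_subset by blast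

lemma UU_rv: "n \<ge> 1 \<Longrightarrow> k \<ge> 1 \<Longrightarrow> l \<ge> 1 \<Longrightarrow> UU n k l \<in> measurable P \<U>"
  using indep unfolding indep_vars_def by (auto dest!: bspec[of _ _ "(n, k, l)"])

lemma sample_rv: "i \<in> {1..} \<times> {1..} \<times> {1..} \<Longrightarrow> sample i \<in> measurable P \<U>"
  unfolding sample_def by (auto intro: UU_rv)

lemma sample_indep: "indep_vars (\<lambda>_. \<U>) sample ({1..} \<times> {1..} \<times> {1..})"
  using indep by (simp add: sample_def)

lemma Fk_comp:
  assumes "k \<ge> 1" "g \<in> measurable N param_space" "u \<in> measurable N \<U>"
  shows "(\<lambda>x. Fk k (g x) (u x)) \<in> borel_measurable N"
proof -
  have "(\<lambda>x. (g x, u x)) \<in> measurable N (param_space \<Otimes>\<^sub>M \<U>)"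
    using assms by measurable
  from measurable_compose[OF this Fk_meas[OF assms(1), unfolded param_measurable_def]] show ?thesis by simp
qed

lemma level_diff_comp:
  assumes "k \<ge> 1" "g \<in> measurable N param_space" "u \<in> measurable N \<U>"
  shows "(\<lambda>x. level_diff Fk k (g x) (u x)) \<in> borel_measurable N"
proof (cases "k = 1")
  case True
  then show ?thesis unfolding level_diff_def using Fk_comp[OF _ assms(2,3), of 1] by simp
next
  case False
  then show ?thesis unfolding level_diff_def using assms
    by (auto intro!: borel_measurable_diff Fk_comp)
qed

lemma level_mean_meas [measurable]:
  assumes "k \<ge> 1"
  shows "level_mean k \<in> borel_measurable param_space"
proof -
  have "(\<lambda>x. \<integral>\<omega>. Fk k x (U \<omega>) \<partial>P) \<in> borel_measurable param_space"
  proof (rule borel_measurable_lebesgue_integral)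
    have "(\<lambda>p. Fk k (fst p) (U (snd p))) \<in> borel_measurable (param_space \<Otimes>\<^sub>M P)"
      by (rule Fk_comp[OF assms]) measurable
    then show "(\<lambda>(x, \<omega>). Fk k x (U \<omega>)) \<in> borel_measurable (param_space \<Otimes>\<^sub>M P)"
      by (simp add: case_prod_beta')
  qed
  then show ?thesis by (simp add: mean_field_def[abs_def])
qed

lemma estimator_comp:
  assumes "g \<in> measurable N param_space" "\<And>k l. k \<ge> 1 \<Longrightarrow> l \<ge> 1 \<Longrightarrow> u k l \<in> measurable N \<U>"
  shows "(\<lambda>x. multilevel_estimator Fk M (\<lambda>k l. u k l x) (g x) m r) \<in> borel_measurable N"
  unfolding multilevel_estimator_def
  by (intro borel_measurable_sum borel_measurable_scaleR borel_measurable_const level_diff_comp assms) auto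

lemma est_meas: "n \<ge> 1 \<Longrightarrow> (\<lambda>p. est n (fst p) (snd p)) \<in> borel_measurable (param_space \<Otimes>\<^sub>M block_space n)"
  unfolding est_def by (rule estimator_comp) (auto simp: block_def)

lemma noise_meas: "n \<ge> 1 \<Longrightarrow> (\<lambda>p. noise n (fst p) (snd p)) \<in> borel_measurable (param_space \<Otimes>\<^sub>M block_space n)"
  unfolding noise_def using s1 est_meas[of n]
  by (intro borel_measurable_diff measurable_compose[OF measurable_fst level_mean_meas]) auto

lemma estimator_cong:
  "(\<And>k l. k \<ge> 1 \<Longrightarrow> l \<ge> 1 \<Longrightarrow> u k l = u' k l) \<Longrightarrow> multilevel_estimator Fk M u x m r = multilevel_estimator Fk M u' x m r"
  by (simp add: multilevel_estimator_def)

lemma sample_block_est: "n \<ge> 1 \<Longrightarrow> est n x (sample_block n \<omega>) = multilevel_estimator Fk M (\<lambda>k l. UU n k l \<omega>) x (s n) (samples n)"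
  unfolding est_def by (rule estimator_cong) (auto simp: sample_block_def block_def sample_def)

lemma Fil_space [simp]: "space (Fil k) = space P"
  by (simp add: Fil_def)

lemma past_sub: "past k \<subseteq> {1..} \<times> {1..} \<times> {1..}"
  by (auto simp: past_def)

lemma past_rv: "(\<lambda>\<omega>. restrict (\<lambda>i. sample i \<omega>) (past k)) \<in> measurable P (PiM (past k) (\<lambda>_. \<U>))"
  by (intro measurable_restrict sample_rv) (use past_sub in auto)

lemma Fil_sub: "subalgebra P (Fil k)"
  unfolding subalgebra_def Fil_def using sets_image_in_sets[OF refl past_rv[of k]] by simp

lemma Fil_sample: "i \<in> past k \<Longrightarrow> sample i \<in> measurable (Fil k) \<U>"
proof -
  assume i: "i \<in> past k"
  have "(\<lambda>\<omega>. restrict (\<lambda>i. sample i \<omega>) (past k)) \<in> measurable (Fil k) (PiM (past k) (\<lambda>_. \<U>))"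
    unfolding Fil_def
    by (rule measurable_vimage_algebra1) (use past_rv[of k] in \<open>auto dest: measurable_space\<close>)
  from measurable_compose[OF this measurable_component_singleton[OF i]] i show ?thesis
    by simp
qed

lemma Fil_mono: "j \<le> k \<Longrightarrow> sets (Fil j) \<subseteq> sets (Fil k)"
proof -
  assume jk: "j \<le> k"
  have "(\<lambda>\<omega>. restrict (\<lambda>i. sample i \<omega>) (past j)) \<in> measurable (Fil k) (PiM (past j) (\<lambda>_. \<U>))"
    by (intro measurable_restrict Fil_sample) (use jk in \<open>auto simp: past_def\<close>)
  from sets_image_in_sets[OF Fil_space this] show ?thesis
    by (simp add: Fil_def[of j])
qed

lemma Fil_up: "g \<in> measurable (Fil j) N \<Longrightarrow> j \<le> k \<Longrightarrow> g \<in> measurable (Fil k) N"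
  using Fil_mono[of j k] unfolding measurable_def by auto

lemma Fil_P: "g \<in> measurable (Fil j) N \<Longrightarrow> g \<in> measurable P N"
  by (rule measurable_from_subalg[OF Fil_sub])

text \<open>Past and next block use disjoint index sets of one independent family. This licenses
  freezing the current iterate.\<close>

lemma Fil_indep: "indep_of (Fil k) (block_space (Suc k)) (sample_block (Suc k))"
  unfolding Fil_def sample_block_def[abs_def]
  by (rule indep_of_vimage_algebra, rule indep_var_restrict[OF sample_indep])
    (auto simp: past_def block_def)

lemma \<theta>_D: "\<theta> n \<omega> \<in> D"
  unfolding \<theta>_def by (cases n) (auto simp: \<theta>0 Proj_D)

lemma \<theta>_Suc: "\<theta> (Suc n) \<omega> = Proj (\<theta> n \<omega> + step_size (Suc n) *\<^sub>R est (Suc n) (\<theta> n \<omega>) (sample_block (Suc n) \<omega>))"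
  by (simp add: \<theta>_def sample_block_est)

lemma \<theta>_meas: "\<theta> n \<in> measurable (Fil n) param_space"
proof (induction n)
  case 0
  have "\<theta> 0 = (\<lambda>\<omega>. \<theta>0)" by (simp add: \<theta>_def fun_eq_iff)
  then show ?case using \<theta>0 by (simp add: space_restrict_space)
next
  case (Suc n)
  have th: "\<theta> n \<in> measurable (Fil (Suc n)) param_space"
    by (rule Fil_up[OF Suc]) simp
  have "(\<lambda>\<omega>. multilevel_estimator Fk M (\<lambda>k l. UU (Suc n) k l \<omega>) (\<theta> n \<omega>) (s (Suc n)) (samples (Suc n))) \<in> borel_measurable (Fil (Suc n))"
  proof (rule estimator_comp[OF th])
    fix k l :: nat assume "k \<ge> 1" "l \<ge> 1"
    then show "UU (Suc n) k l \<in> measurable (Fil (Suc n)) \<U>"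
      using Fil_sample[of "(Suc n, k, l)" "Suc n"] by (simp add: past_def sample_def)
  qed
  moreover have "\<theta> n \<in> borel_measurable (Fil (Suc n))"
    using th unfolding measurable_restrict_space2_iff by simp
  ultimately have "(\<lambda>\<omega>. Proj (\<theta> n \<omega> + step_size (Suc n) *\<^sub>R multilevel_estimator Fk M (\<lambda>k l. UU (Suc n) k l \<omega>) (\<theta> n \<omega>) (s (Suc n)) (samples (Suc n)))) \<in> borel_measurable (Fil (Suc n))"
    by measurable
  moreover have "\<theta> (Suc n) = (\<lambda>\<omega>. Proj (\<theta> n \<omega> + step_size (Suc n) *\<^sub>R multilevel_estimator Fk M (\<lambda>k l. UU (Suc n) k l \<omega>) (\<theta> n \<omega>) (s (Suc n)) (samples (Suc n))))"
    by (simp add: fun_eq_iff \<theta>_Suc sample_block_est)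
  ultimately have "\<theta> (Suc n) \<in> borel_measurable (Fil (Suc n))"
    by simp
  then show ?case
    by (intro measurable_restrict_space2) (auto simp: \<theta>_D)
qed

lemma Nk_pos: "n \<ge> 1 \<Longrightarrow> Nk n k \<ge> 1"
  using samples_pos[of n] M unfolding Nk_def level_samples_def
  by (simp add: Suc_leI zero_less_ceiling)

lemma Nk_ge: "samples n * M powr (- real k) \<le> real (Nk n k)"
  unfolding Nk_def level_samples_def by linarith

text \<open>Rounding the sample number up can only lower the variance, so this upper bound holds for
  every step and level.\<close>

lemma Nk_inverse_le: "n \<ge> 1 \<Longrightarrow> 1 / real (Nk n k) * M powr (- real k) \<le> 1 / samples n"
proof -
  assume n: "n \<ge> 1"
  have "M powr (- real k) > 0" using M by simp
  then have "samples n * M powr (- real k) > 0" using samples_pos[OF n] by simp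
  then have "1 / real (Nk n k) \<le> 1 / (samples n * M powr (- real k))"
    using Nk_ge[of n k] Nk_pos[OF n, of k] by (intro divide_left_mono mult_pos_pos[of "real (Nk n k)"]) auto
  then have "1 / real (Nk n k) * M powr (- real k) \<le> 1 / (samples n * M powr (- real k)) * M powr (- real k)"
    using \<open>M powr (- real k) > 0\<close> by (intro mult_right_mono) auto
  then show ?thesis using \<open>M powr (- real k) > 0\<close> by simp
qed

lemma dev_comp:
  assumes "k \<ge> 1" "x \<in> D" "u \<in> measurable N \<U>"
  shows "(\<lambda>z. dev k x (u z)) \<in> borel_measurable N"
proof -
  have "(\<lambda>_. x) \<in> measurable N param_space" using assms(2) by (simp add: space_restrict_space)
  from level_diff_comp[OF assms(1) this assms(3)] show ?thesis
    unfolding dev_def by (intro borel_measurable_diff) auto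
qed

lemma level_diff_int: "k \<ge> 1 \<Longrightarrow> x \<in> D \<Longrightarrow> integrable P (\<lambda>\<omega>. level_diff Fk k x (U \<omega>))"
  unfolding level_diff_def by (cases "k = 1") (auto intro!: Fk_int Bochner_Integration.integrable_diff)

lemma dev_int: "k \<ge> 1 \<Longrightarrow> x \<in> D \<Longrightarrow> integrable P (\<lambda>\<omega>. dev k x (U \<omega>))"
  unfolding dev_def by (intro Bochner_Integration.integrable_diff level_diff_int) auto

lemma dev_mean: "k \<ge> 1 \<Longrightarrow> x \<in> D \<Longrightarrow> (\<integral>\<omega>. dev k x (U \<omega>) \<partial>P) = 0"
  unfolding dev_def using level_diff_int[of k x] by (simp add: prob_space mean_field_def)

lemma mean_telescope:
  assumes "x \<in> D" "m \<ge> 1"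
  shows "(\<Sum>k=1..m. mean_field P U (level_diff Fk k) x) = level_mean m x"
  using assms(2)
proof (induction m rule: dec_induct)
  case base
  show ?case by (simp add: mean_field_def level_diff_def)
next
  case (step m)
  have "mean_field P U (level_diff Fk (Suc m)) x = level_mean (Suc m) x - level_mean m x"
    using step.hyps Fk_int[OF _ assms(1), of m] Fk_int[OF _ assms(1), of "Suc m"]
    by (simp add: mean_field_def level_diff_def)
  then show ?case using step by simp
qed

lemma expectation_UU:
  fixes h :: "'u \<Rightarrow> 'b::{banach, second_countable_topology}"
  assumes "n \<ge> 1" "k \<ge> 1" "l \<ge> 1" "h \<in> borel_measurable \<U>"
  shows "(\<integral>\<omega>. h (UU n k l \<omega>) \<partial>P) = (\<integral>\<omega>. h (U \<omega>) \<partial>P)"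
    "integrable P (\<lambda>\<omega>. h (UU n k l \<omega>)) \<longleftrightarrow> integrable P (\<lambda>\<omega>. h (U \<omega>))"
  using integral_distr[OF UU_rv[OF assms(1-3)] assms(4)] integral_distr[OF U assms(4)]
    integrable_distr_eq[OF UU_rv[OF assms(1-3)] assms(4)] integrable_distr_eq[OF U assms(4)]
    ident[OF assms(1-3)] by simp_all

definition sample_idx where "sample_idx n = (\<lambda>(k, l). (n, k, l)) ` (SIGMA k:{1..s n}. {1..Nk n k})"
definition summand where "summand a n x i u = (1 / real (Nk n (fst (snd i)))) * (a \<bullet> dev (fst (snd i)) x u)"

lemma sample_idx_finite: "finite (sample_idx n)"
  by (simp add: sample_idx_def)

lemma sample_idx_sub: "n \<ge> 1 \<Longrightarrow> sample_idx n \<subseteq> block n \<and> sample_idx n \<subseteq> {1..} \<times> {1..} \<times> {1..}"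
  by (auto simp: sample_idx_def block_def)

lemma sample_idx_sum: "(\<Sum>i\<in>sample_idx n. g i) = (\<Sum>k=1..s n. \<Sum>l=1..Nk n k. g (n, k, l))"
proof -
  have inj: "inj_on (\<lambda>(k, l). (n, k, l)) (SIGMA k:{1..s n}. {1..Nk n k})"
    by (auto simp: inj_on_def)
  show ?thesis
    unfolding sample_idx_def sum.reindex[OF inj] by (simp add: sum.Sigma case_prod_beta')
qed

text \<open>The mean of the finest level telescopes over the levels, so each increment can be
  centred by its own mean; the noise becomes a sum of centred terms, one per sample.\<close>

lemma noise_sum:
  assumes n: "n \<ge> 1" and x: "x \<in> D"
  shows "a \<bullet> noise n x y = (\<Sum>i\<in>sample_idx n. summand a n x i (y i))"
proof -
  have "level_mean (s n) x = (\<Sum>k=1..s n. mean_field P U (level_diff Fk k) x)"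
    using mean_telescope[OF x, of "s n"] s1 n by simp
  also have "\<dots> = (\<Sum>k=1..s n. (1 / real (Nk n k)) *\<^sub>R (\<Sum>l=1..Nk n k. mean_field P U (level_diff Fk k) x))"
  proof (intro sum.cong refl)
    fix k
    show "mean_field P U (level_diff Fk k) x = (1 / real (Nk n k)) *\<^sub>R (\<Sum>l=1..Nk n k. mean_field P U (level_diff Fk k) x)"
      using Nk_pos[OF n, of k] by (simp only: sum_constant_scaleR card_atLeastAtMost) simp
  qed
  finally have "noise n x y = (\<Sum>k=1..s n. (1 / real (Nk n k)) *\<^sub>R (\<Sum>l=1..Nk n k. dev k x (y (n, k, l))))"
    unfolding noise_def est_def multilevel_estimator_def dev_def Nk_def[symmetric]
    by (simp add: sum_subtractf scaleR_diff_right)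
  then show ?thesis
    unfolding sample_idx_sum summand_def by (simp add: inner_sum_right sum_distrib_left)
qed

lemma summand_meas: "i \<in> sample_idx n \<Longrightarrow> x \<in> D \<Longrightarrow> summand a n x i \<in> borel_measurable \<U>"
  unfolding summand_def using dev_comp[of "fst (snd i)" x "\<lambda>u. u" \<U>]
  by (intro borel_measurable_times borel_measurable_inner) (auto simp: sample_idx_def)

lemma summand_indep:
  assumes "n \<ge> 1" "x \<in> D"
  shows "indep_vars (\<lambda>_. borel) (\<lambda>i \<omega>. summand a n x i (sample i \<omega>)) (sample_idx n)"
  by (rule indep_vars_compose2[OF indep_vars_subset[OF sample_indep]])
    (use sample_idx_sub[OF assms(1)] summand_meas[OF _ assms(2)] in auto)

end

text \<open>All local hypotheses are collected on one ball around \<open>\<theta>s\<close>, with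
  explicit constants; \<open>local_constants\<close> shows that they exist. The moment exponent is
  capped at 3 for the Taylor bound of \<open>cis\<close>. The factor c / (4 LS) lets the Taylor
  remainder cost at most a quarter of the contraction in the norm |S x|.\<close>

locale mlsa_local = mlsa lam M \<alpha> \<phi> \<rho> \<psi> \<kappa>K alphas s P \<U> U UU D Proj F Fk \<theta>s \<theta>0 H \<Gamma>
  for lam M \<alpha> \<phi> \<rho> \<psi> \<kappa>K :: real and alphas :: "nat \<Rightarrow> real" and s :: "nat \<Rightarrow> nat"
    and P :: "'w measure" and \<U> :: "'u measure" and U :: "'w \<Rightarrow> 'u"
    and UU :: "nat \<Rightarrow> nat \<Rightarrow> nat \<Rightarrow> 'w \<Rightarrow> 'u"
    and D :: "(real^'d) set" and Proj :: "real^'d \<Rightarrow> real^'d"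
    and F :: "real^'d \<Rightarrow> 'u \<Rightarrow> real^'d" and Fk :: "nat \<Rightarrow> real^'d \<Rightarrow> 'u \<Rightarrow> real^'d"
    and \<theta>s \<theta>0 :: "real^'d" and H \<Gamma> :: "real^'d^'d" +
  fixes \<delta> c LS q CT CB CL :: real and S :: "real^'d^'d" and k1 :: nat
  assumes \<delta>: "\<delta> > 0" and ball_D: "ball \<theta>s \<delta> \<subseteq> interior D"
    and c: "c > 0" and S_ge: "\<And>x. norm x \<le> norm (S *v x)"
    and S_lyap: "\<And>x. (S *v x) \<bullet> (S *v (H *v x)) \<le> - c * (norm (S *v x))\<^sup>2"
    and LS: "LS > 0" "\<And>x. norm (S *v x) \<le> LS * norm x"
    and q: "2 < q" "q \<le> 3" and CT: "CT > 0"
    and tail: "\<And>x k. x \<in> ball \<theta>s \<delta> \<Longrightarrow> k \<ge> 1 \<Longrightarrow> integrable P (\<lambda>\<omega>. norm (dev k x (U \<omega>)) powr q)"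
      "\<And>x k. x \<in> ball \<theta>s \<delta> \<Longrightarrow> k \<ge> 1 \<Longrightarrow> (\<integral>\<omega>. norm (dev k x (U \<omega>)) powr q \<partial>P) \<le> (CT * M powr (- real k)) powr (q / 2)"
    and taylor: "\<And>x. x \<in> ball \<theta>s \<delta> \<Longrightarrow> norm (f x - H *v (x - \<theta>s)) \<le> CL * norm (x - \<theta>s) powr (1 + lam)" "CL \<ge> 0"
    and taylor_small: "\<And>x. x \<in> ball \<theta>s \<delta> \<Longrightarrow> norm (f x - H *v (x - \<theta>s)) \<le> c / (4 * LS) * norm (x - \<theta>s)"
    and CB: "CB > 0" and bias_le: "\<And>x k. x \<in> ball \<theta>s \<delta> \<Longrightarrow> k \<ge> k1 \<Longrightarrow> norm (level_mean k x - f x) \<le> CB * M powr (- (alphas k * real k))"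
    and var: "var_condition P U D Fk \<theta>s M \<Gamma>"
begin

abbreviation "B \<equiv> ball \<theta>s \<delta>"

lemma B_D: "x \<in> B \<Longrightarrow> x \<in> D"
  using ball_D interior_subset by blast

lemma \<theta>s_B: "\<theta>s \<in> B" using \<delta> by simp

lemma dev_sq:
  assumes x: "x \<in> B" and k: "k \<ge> 1"
  shows "integrable P (\<lambda>\<omega>. (norm (dev k x (U \<omega>)))\<^sup>2)"
    "(\<integral>\<omega>. (norm (dev k x (U \<omega>)))\<^sup>2 \<partial>P) \<le> CT * M powr (- real k)"
proof -
  have m: "(\<lambda>\<omega>. (norm (dev k x (U \<omega>)))\<^sup>2) \<in> borel_measurable P"
    using dev_comp[OF k B_D[OF x] U] by measurable
  have pw: "((norm (dev k x (U \<omega>)))\<^sup>2) powr (q / 2) = norm (dev k x (U \<omega>)) powr q" for \<omega>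
  proof (cases "dev k x (U \<omega>) = 0")
    case False
    then have "(norm (dev k x (U \<omega>)))\<^sup>2 = norm (dev k x (U \<omega>)) powr 2" by simp
    then show ?thesis by (simp only: powr_powr) simp
  qed (use q in simp)
  have pm: "integrable P (\<lambda>\<omega>. (norm (dev k x (U \<omega>)))\<^sup>2)"
    "(\<integral>\<omega>. (norm (dev k x (U \<omega>)))\<^sup>2 \<partial>P) powr (q / 2) \<le> (\<integral>\<omega>. norm (dev k x (U \<omega>)) powr q \<partial>P)"
    using power_mean[OF m, of "q / 2"] q tail(1)[OF x k] by (simp_all add: pw)
  show "integrable P (\<lambda>\<omega>. (norm (dev k x (U \<omega>)))\<^sup>2)" by (rule pm)
  have "(\<integral>\<omega>. (norm (dev k x (U \<omega>)))\<^sup>2 \<partial>P) powr (q / 2) \<le> (CT * M powr (- real k)) powr (q / 2)"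
    using pm(2) tail(2)[OF x k] by linarith
  then show "(\<integral>\<omega>. (norm (dev k x (U \<omega>)))\<^sup>2 \<partial>P) \<le> CT * M powr (- real k)"
  proof (rule contrapos_pp)
    assume "\<not> (\<integral>\<omega>. (norm (dev k x (U \<omega>)))\<^sup>2 \<partial>P) \<le> CT * M powr (- real k)"
    then have "CT * M powr (- real k) < (\<integral>\<omega>. (norm (dev k x (U \<omega>)))\<^sup>2 \<partial>P)" by simp
    then have "(CT * M powr (- real k)) powr (q / 2) < (\<integral>\<omega>. (norm (dev k x (U \<omega>)))\<^sup>2 \<partial>P) powr (q / 2)"
      using q CT M by (intro powr_less_mono2) auto
    then show "\<not> (\<integral>\<omega>. (norm (dev k x (U \<omega>)))\<^sup>2 \<partial>P) powr (q / 2) \<le> (CT * M powr (- real k)) powr (q / 2)"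
      by (simp only: not_le)
  qed
qed

lemma dev_form:
  assumes x: "x \<in> B" and k: "k \<ge> 1"
  shows "integrable P (\<lambda>\<omega>. (a \<bullet> dev k x (U \<omega>))\<^sup>2)"
    "(\<integral>\<omega>. (a \<bullet> dev k x (U \<omega>))\<^sup>2 \<partial>P) = a \<bullet> (cov k x *v a)"
    "a \<bullet> (cov k x *v a) \<le> (norm a)\<^sup>2 * (CT * M powr (- real k))" "0 \<le> a \<bullet> (cov k x *v a)"
    "transpose (cov k x) = cov k x"
proof -
  let ?d = "\<lambda>\<omega>. dev k x (U \<omega>)"
  have dm [measurable]: "?d \<in> borel_measurable P" by (rule dev_comp[OF k B_D[OF x] U])
  have prod_int: "integrable P (\<lambda>\<omega>. ?d \<omega> $ i * ?d \<omega> $ j)" for i j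
  proof (rule Bochner_Integration.integrable_bound[OF dev_sq(1)[OF x k]])
    show "AE \<omega> in P. norm (?d \<omega> $ i * ?d \<omega> $ j) \<le> norm ((norm (?d \<omega>))\<^sup>2)"
      by (intro AE_I2) (simp add: abs_mult power2_eq_square mult_mono component_le_norm_cart)
  qed (auto intro!: borel_measurable_times measurable_compose[OF dm] borel_measurable_continuous_onI continuous_intros)
  have comp: "?d \<omega> $ i = level_diff Fk k x (U \<omega>) $ i - (\<integral>\<omega>'. level_diff Fk k x (U \<omega>') $ i \<partial>P)" for \<omega> i
    unfolding dev_def mean_field_def
    using integral_bounded_linear[OF bounded_linear_vec_nth level_diff_int[OF k B_D[OF x]], of i] by simp
  have cov: "cov k x $ i $ j = (\<integral>\<omega>. ?d \<omega> $ i * ?d \<omega> $ j \<partial>P)" for i j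
    unfolding cov_def cov_matrix_def by (simp add: comp)
  have sq: "(a \<bullet> ?d \<omega>)\<^sup>2 = (\<Sum>i\<in>UNIV. \<Sum>j\<in>UNIV. (a $ i * a $ j) * (?d \<omega> $ i * ?d \<omega> $ j))" for \<omega>
    unfolding power2_eq_square inner_vec_def by (simp add: sum_product mult_ac)
  show i1: "integrable P (\<lambda>\<omega>. (a \<bullet> ?d \<omega>)\<^sup>2)"
    unfolding sq by (intro Bochner_Integration.integrable_sum integrable_mult_right prod_int)
  have "(\<integral>\<omega>. (a \<bullet> ?d \<omega>)\<^sup>2 \<partial>P) = (\<Sum>i\<in>UNIV. \<Sum>j\<in>UNIV. (a $ i * a $ j) * cov k x $ i $ j)"
    unfolding sq cov
    by (subst Bochner_Integration.integral_sum, intro Bochner_Integration.integrable_sum integrable_mult_right prod_int,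
      intro sum.cong refl, subst Bochner_Integration.integral_sum, intro integrable_mult_right prod_int) simp
  also have "\<dots> = a \<bullet> (cov k x *v a)"
    by (simp add: inner_vec_def matrix_vector_mult_def sum_distrib_left mult_ac)
  finally show e1: "(\<integral>\<omega>. (a \<bullet> ?d \<omega>)\<^sup>2 \<partial>P) = a \<bullet> (cov k x *v a)" .
  show "0 \<le> a \<bullet> (cov k x *v a)" unfolding e1[symmetric] by simp
  have "(\<integral>\<omega>. (a \<bullet> ?d \<omega>)\<^sup>2 \<partial>P) \<le> (\<integral>\<omega>. (norm a)\<^sup>2 * (norm (?d \<omega>))\<^sup>2 \<partial>P)"
  proof (rule integral_mono[OF i1])
    fix \<omega>
    have "\<bar>a \<bullet> ?d \<omega>\<bar>\<^sup>2 \<le> (norm a * norm (?d \<omega>))\<^sup>2"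
      by (intro power_mono Cauchy_Schwarz_ineq2) simp
    then show "(a \<bullet> ?d \<omega>)\<^sup>2 \<le> (norm a)\<^sup>2 * (norm (?d \<omega>))\<^sup>2"
      by (simp add: power_mult_distrib)
  qed (use dev_sq(1)[OF x k] in auto)
  also have "\<dots> = (norm a)\<^sup>2 * (\<integral>\<omega>. (norm (?d \<omega>))\<^sup>2 \<partial>P)" by simp
  also have "\<dots> \<le> (norm a)\<^sup>2 * (CT * M powr (- real k))"
    by (intro mult_left_mono dev_sq(2)[OF x k]) simp
  finally show "a \<bullet> (cov k x *v a) \<le> (norm a)\<^sup>2 * (CT * M powr (- real k))" unfolding e1 .
  show "transpose (cov k x) = cov k x"
    by (simp add: transpose_def vec_eq_iff cov mult.commute)
qed

lemma step_var_nonneg: "x \<in> B \<Longrightarrow> 0 \<le> step_var a n x"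
  unfolding step_var_def by (intro sum_nonneg mult_nonneg_nonneg dev_form(4)) auto

text \<open>Every level contributes at most a constant over K_n, because the sample number
  compensates the decay of the covariance.\<close>

lemma step_var_le: "x \<in> B \<Longrightarrow> n \<ge> 1 \<Longrightarrow> step_var a n x \<le> (norm a)\<^sup>2 * CT * vrate n"
proof -
  assume x: "x \<in> B" and n: "n \<ge> 1"
  have "step_var a n x \<le> (\<Sum>k=1..s n. (norm a)\<^sup>2 * CT * (1 / samples n))"
    unfolding step_var_def
  proof (rule sum_mono)
    fix k assume k: "k \<in> {1..s n}"
    have "1 / real (Nk n k) * (a \<bullet> (cov k x *v a)) \<le> 1 / real (Nk n k) * ((norm a)\<^sup>2 * (CT * M powr (- real k)))"
      using k by (intro mult_left_mono dev_form(3)[OF x]) auto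
    also have "\<dots> = (norm a)\<^sup>2 * CT * (1 / real (Nk n k) * M powr (- real k))"
      by simp
    also have "\<dots> \<le> (norm a)\<^sup>2 * CT * (1 / samples n)"
      using CT by (intro mult_left_mono Nk_inverse_le[OF n]) auto
    finally show "1 / real (Nk n k) * (a \<bullet> (cov k x *v a)) \<le> (norm a)\<^sup>2 * CT * (1 / samples n)" .
  qed
  also have "\<dots> = (norm a)\<^sup>2 * CT * vrate n"
    by (simp add: vrate_def)
  finally show ?thesis .
qed

lemma summand_moments:
  assumes n: "n \<ge> 1" and x: "x \<in> B" and i: "i \<in> sample_idx n"
  shows "integrable P (\<lambda>\<omega>. (summand a n x i (sample i \<omega>))\<^sup>2)" "(\<integral>\<omega>. summand a n x i (sample i \<omega>) \<partial>P) = 0"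
    "(\<integral>\<omega>. (summand a n x i (sample i \<omega>))\<^sup>2 \<partial>P) = (1 / real (Nk n (fst (snd i))))\<^sup>2 * (a \<bullet> (cov (fst (snd i)) x *v a))"
    "integrable P (\<lambda>\<omega>. \<bar>summand a n x i (sample i \<omega>)\<bar> powr q)"
    "(\<integral>\<omega>. \<bar>summand a n x i (sample i \<omega>)\<bar> powr q \<partial>P) \<le>
      (1 / real (Nk n (fst (snd i)))) powr q * (norm a powr q * (CT * M powr (- real (fst (snd i)))) powr (q / 2))"
proof -
  obtain k l where kl: "i = (n, k, l)" "k \<ge> 1" "l \<ge> 1" using i by (auto simp: sample_idx_def)
  note xD = B_D[OF x]
  let ?N = "1 / real (Nk n k)"
  have W: "summand a n x i u = ?N * (a \<bullet> dev k x u)" for u by (simp add: summand_def kl)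
  have X: "sample i = UU n k l" by (simp add: sample_def kl)
  have Wm [measurable]: "summand a n x i \<in> borel_measurable \<U>" by (rule summand_meas[OF i xD])
  note tr = expectation_UU[OF n kl(2,3)]
  have e1: "(\<integral>\<omega>. h (summand a n x i (sample i \<omega>)) \<partial>P) = (\<integral>\<omega>. h (summand a n x i (U \<omega>)) \<partial>P)"
    and e2: "integrable P (\<lambda>\<omega>. h (summand a n x i (sample i \<omega>))) \<longleftrightarrow> integrable P (\<lambda>\<omega>. h (summand a n x i (U \<omega>)))"
    if [measurable]: "h \<in> borel_measurable borel" for h :: "real \<Rightarrow> real"
    unfolding X by (rule tr, measurable)+
  show "integrable P (\<lambda>\<omega>. (summand a n x i (sample i \<omega>))\<^sup>2)"
    using dev_form(1)[OF x kl(2), of a] by (subst e2) (auto simp: W power_mult_distrib power_divide)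
  show "(\<integral>\<omega>. summand a n x i (sample i \<omega>) \<partial>P) = 0"
    using e1[of "\<lambda>u. u"] dev_mean[OF kl(2) xD] dev_int[OF kl(2) xD] by (simp add: W)
  show "(\<integral>\<omega>. (summand a n x i (sample i \<omega>))\<^sup>2 \<partial>P) = (1 / real (Nk n (fst (snd i))))\<^sup>2 * (a \<bullet> (cov (fst (snd i)) x *v a))"
  proof -
    have "(\<integral>\<omega>. (summand a n x i (sample i \<omega>))\<^sup>2 \<partial>P) = (\<integral>\<omega>. (summand a n x i (U \<omega>))\<^sup>2 \<partial>P)"
      using e1[of "\<lambda>u. u\<^sup>2"] by simp
    also have "\<dots> = ?N\<^sup>2 * (a \<bullet> (cov k x *v a))"
      by (simp only: W power_mult_distrib integral_mult_right_zero dev_form(2)[OF x kl(2)])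
    finally show ?thesis by (simp add: kl(1))
  qed
  have le: "\<bar>summand a n x i (U \<omega>)\<bar> powr q \<le> ?N powr q * (norm a powr q * norm (dev k x (U \<omega>)) powr q)" for \<omega>
  proof -
    have "\<bar>summand a n x i (U \<omega>)\<bar> \<le> ?N * (norm a * norm (dev k x (U \<omega>)))"
      unfolding W abs_mult using Cauchy_Schwarz_ineq2[of a "dev k x (U \<omega>)"] by (intro mult_mono) auto
    then have "\<bar>summand a n x i (U \<omega>)\<bar> powr q \<le> (?N * (norm a * norm (dev k x (U \<omega>)))) powr q"
      using q by (intro powr_mono2) auto
    then show ?thesis by (simp add: powr_mult powr_divide)
  qed
  have int': "integrable P (\<lambda>\<omega>. ?N powr q * (norm a powr q * norm (dev k x (U \<omega>)) powr q))"
    by (intro integrable_mult_right tail(1)[OF x kl(2)])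
  have int: "integrable P (\<lambda>\<omega>. \<bar>summand a n x i (U \<omega>)\<bar> powr q)"
    by (rule Bochner_Integration.integrable_bound[OF int']) (use le in auto)
  then show "integrable P (\<lambda>\<omega>. \<bar>summand a n x i (sample i \<omega>)\<bar> powr q)"
    by (subst e2) auto
  have "(\<integral>\<omega>. \<bar>summand a n x i (sample i \<omega>)\<bar> powr q \<partial>P) = (\<integral>\<omega>. \<bar>summand a n x i (U \<omega>)\<bar> powr q \<partial>P)"
    by (rule e1) measurable
  also have "\<dots> \<le> (\<integral>\<omega>. ?N powr q * (norm a powr q * norm (dev k x (U \<omega>)) powr q) \<partial>P)"
    by (rule integral_mono[OF int int' le])
  also have "\<dots> = ?N powr q * (norm a powr q * (\<integral>\<omega>. norm (dev k x (U \<omega>)) powr q \<partial>P))" by simp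
  also have "\<dots> \<le> ?N powr q * (norm a powr q * (CT * M powr (- real k)) powr (q / 2))"
    by (intro mult_left_mono tail(2)[OF x kl(2)]) auto
  finally show "(\<integral>\<omega>. \<bar>summand a n x i (sample i \<omega>)\<bar> powr q \<partial>P) \<le>
      (1 / real (Nk n (fst (snd i)))) powr q * (norm a powr q * (CT * M powr (- real (fst (snd i)))) powr (q / 2))"
    by (simp add: kl(1))
qed

lemma noise_sample_block:
  assumes n: "n \<ge> 1" and x: "x \<in> B"
  shows "a \<bullet> noise n x (sample_block n \<omega>) = (\<Sum>i\<in>sample_idx n. summand a n x i (sample i \<omega>))"
  unfolding noise_sum[OF n B_D[OF x]]
  by (intro sum.cong refl arg_cong[of _ _ "summand a n x i" for i]) (use sample_idx_sub[OF n] in \<open>auto simp: sample_block_def\<close>)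

lemma noise_second_moment:
  assumes n: "n \<ge> 1" and x: "x \<in> B"
  shows "integrable P (\<lambda>\<omega>. (a \<bullet> noise n x (sample_block n \<omega>))\<^sup>2)" "(\<integral>\<omega>. a \<bullet> noise n x (sample_block n \<omega>) \<partial>P) = 0"
    "(\<integral>\<omega>. (a \<bullet> noise n x (sample_block n \<omega>))\<^sup>2 \<partial>P) = step_var a n x"
proof -
  note 1 = indep_sum_second_moment[OF sample_idx_finite summand_indep[OF n B_D[OF x]] summand_moments(1)[OF n x] summand_moments(2)[OF n x], of a]
  show "integrable P (\<lambda>\<omega>. (a \<bullet> noise n x (sample_block n \<omega>))\<^sup>2)" "(\<integral>\<omega>. a \<bullet> noise n x (sample_block n \<omega>) \<partial>P) = 0"
    using 1 unfolding noise_sample_block[OF n x] by auto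
  have "(\<integral>\<omega>. (a \<bullet> noise n x (sample_block n \<omega>))\<^sup>2 \<partial>P) = (\<Sum>i\<in>sample_idx n. (1 / real (Nk n (fst (snd i))))\<^sup>2 * (a \<bullet> (cov (fst (snd i)) x *v a)))"
    using 1 unfolding noise_sample_block[OF n x] by (simp add: summand_moments(3)[OF n x])
  also have "\<dots> = step_var a n x"
    unfolding sample_idx_sum step_var_def
  proof (intro sum.cong refl)
    fix k assume "k \<in> {1..s n}"
    show "(\<Sum>l=1..Nk n k. (1 / real (Nk n (fst (snd (n, k, l)))))\<^sup>2 * (a \<bullet> (cov (fst (snd (n, k, l))) x *v a))) = 1 / real (Nk n k) * (a \<bullet> (cov k x *v a))"
      using Nk_pos[OF n, of k] by (simp add: power2_eq_square)
  qed
  finally show "(\<integral>\<omega>. (a \<bullet> noise n x (sample_block n \<omega>))\<^sup>2 \<partial>P) = step_var a n x" .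
qed

text \<open>The relative size of the q-th moments against the variances. It is kept as a product:
  the first factor compensates the normalised weights in \<open>lindeberg_term\<close>, the second
  tends to 0.\<close>

definition lyapunov_sum where "lyapunov_sum n = samples n powr (- (q / 2 - 1)) * (samples n / M powr real (s n)) powr (- (q / 2 - 1))"

lemma noise_char:
  assumes n: "n \<ge> 1" and x: "x \<in> B"
  shows "cmod ((\<integral>\<omega>. cis (a \<bullet> noise n x (sample_block n \<omega>)) \<partial>P) - exp (- step_var a n x / 2)) \<le>
    2 * (norm a powr q * CT powr (q / 2) * vrate n * lyapunov_sum n)"
proof -
  have v: "(\<Sum>i\<in>sample_idx n. \<integral>\<omega>. (summand a n x i (sample i \<omega>))\<^sup>2 \<partial>P) = step_var a n x"
    using noise_second_moment(3)[OF n x, of a]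
      indep_sum_second_moment[OF sample_idx_finite summand_indep[OF n B_D[OF x]] summand_moments(1)[OF n x] summand_moments(2)[OF n x], of a]
    unfolding noise_sample_block[OF n x] by simp
  have "cmod ((\<integral>\<omega>. cis (a \<bullet> noise n x (sample_block n \<omega>)) \<partial>P) - exp (- step_var a n x / 2)) \<le>
    2 * (\<Sum>i\<in>sample_idx n. \<integral>\<omega>. \<bar>summand a n x i (sample i \<omega>)\<bar> powr q \<partial>P)"
    unfolding noise_sample_block[OF n x] v[symmetric]
    by (rule indep_sum_char[OF sample_idx_finite summand_indep[OF n B_D[OF x]]]) (use q summand_moments[OF n x] in auto)
  also have "(\<Sum>i\<in>sample_idx n. \<integral>\<omega>. \<bar>summand a n x i (sample i \<omega>)\<bar> powr q \<partial>P) \<le>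
    (\<Sum>i\<in>sample_idx n. (1 / real (Nk n (fst (snd i)))) powr q * (norm a powr q * (CT * M powr (- real (fst (snd i)))) powr (q / 2)))"
    by (intro sum_mono summand_moments(5)[OF n x])
  also have "\<dots> \<le> norm a powr q * CT powr (q / 2) * vrate n * lyapunov_sum n"
  proof -
    have "(\<Sum>l=1..Nk n k. (1 / real (Nk n k)) powr q * (norm a powr q * (CT * M powr (- real k)) powr (q / 2)))
      \<le> norm a powr q * CT powr (q / 2) * (1 / samples n * lyapunov_sum n)" if k: "k \<in> {1..s n}" for k
    proof -
      let ?N = "real (Nk n k)" and ?m = "M powr (- real k)"
      have N: "?N > 0" using Nk_pos[OF n, of k] by simp
      have m: "?m > 0" using M by simp
      have K: "samples n > 0" by (rule samples_pos[OF n])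
      have "(\<Sum>l=1..Nk n k. (1 / ?N) powr q * (norm a powr q * (CT * ?m) powr (q / 2))) =
        norm a powr q * CT powr (q / 2) * (?N * (1 / ?N) powr q * ?m powr (q / 2))"
        using CT m by (simp add: powr_mult)
      also have "?N * (1 / ?N) powr q * ?m powr (q / 2) = (1 / ?N * ?m) * (?N\<^sup>2 / ?m) powr (- (q / 2 - 1))"
        by (rule powr_level_identity[OF N m])
      also have "\<dots> \<le> 1 / samples n * lyapunov_sum n"
      proof (rule mult_mono)
        show "1 / ?N * ?m \<le> 1 / samples n" by (rule Nk_inverse_le[OF n])
        \<comment> \<open>N^2 / m is at least K_n^2 M^(-k), whose smallest value belongs to the
          finest level k = s_n.\<close>
        have "samples n * (samples n / M powr real (s n)) \<le> ?N\<^sup>2 / ?m"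
        proof -
          have "M powr (- real (s n)) \<le> ?m" using k M by (intro powr_mono) auto
          then have "samples n * (samples n * M powr (- real (s n))) \<le> samples n * (samples n * ?m)"
            using K by (intro mult_left_mono) auto
          also have "\<dots> = (samples n * ?m)\<^sup>2 / ?m"
            using m by (simp add: power2_eq_square)
          also have "\<dots> \<le> ?N\<^sup>2 / ?m"
            using Nk_ge[of n k] m K by (intro divide_right_mono power_mono) auto
          finally show ?thesis by (simp add: powr_minus_divide)
        qed
        then have "(?N\<^sup>2 / ?m) powr (- (q / 2 - 1)) \<le> (samples n * (samples n / M powr real (s n))) powr (- (q / 2 - 1))"
          using K M q by (intro powr_mono2') auto
        also have "\<dots> = lyapunov_sum n"
          unfolding lyapunov_sum_def by (rule powr_mult)
        finally show "(?N\<^sup>2 / ?m) powr (- (q / 2 - 1)) \<le> lyapunov_sum n" .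
      qed (use K in auto)
      finally show ?thesis
        by (simp add: mult_left_mono)
    qed
    then have "(\<Sum>i\<in>sample_idx n. (1 / real (Nk n (fst (snd i)))) powr q * (norm a powr q * (CT * M powr (- real (fst (snd i)))) powr (q / 2)))
      \<le> (\<Sum>k=1..s n. norm a powr q * CT powr (q / 2) * (1 / samples n * lyapunov_sum n))"
      unfolding sample_idx_sum fst_conv snd_conv by (intro sum_mono)
    also have "\<dots> = norm a powr q * CT powr (q / 2) * vrate n * lyapunov_sum n"
      by (simp add: vrate_def)
    finally show ?thesis .
  qed
  finally show ?thesis by simp
qed

end

subsection \<open>Rate of convergence of the stopped iterates\<close>

context mlsa_local
begin

definition stay where "stay N k \<omega> \<longleftrightarrow> (\<forall>j\<in>{N..k}. \<theta> j \<omega> \<in> B)"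

text \<open>The iterate, reset to \<open>\<theta>s\<close> before time \<open>N\<close> and once the path has left the ball after
  time \<open>N\<close>. It is adapted, never leaves the ball, and agrees with the iterate for ever on the
  event that the path stays.\<close>

definition hat where "hat N k \<omega> = (if N \<le> k \<and> stay N k \<omega> then \<theta> k \<omega> else \<theta>s)"

lemma hat_B: "hat N k \<omega> \<in> B"
  using \<delta> by (auto simp: hat_def stay_def)

lemma hat_D: "hat N k \<omega> \<in> D"
  using hat_B B_D by blast

lemma \<theta>_borel: "j \<le> k \<Longrightarrow> \<theta> j \<in> borel_measurable (Fil k)"
  using Fil_up[OF \<theta>_meas[of j]] unfolding measurable_restrict_space2_iff by auto

lemma hat_meas: "hat N k \<in> measurable (Fil k) param_space"
proof (rule measurable_restrict_space2)
  show "hat N k \<in> borel_measurable (Fil k)"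
  proof (cases "N \<le> k")
    case True
    have "{\<omega>. stay N k \<omega>} \<inter> space (Fil k) = (\<Inter>j\<in>{N..k}. \<theta> j -` B \<inter> space (Fil k))"
      using True by (auto simp: stay_def)
    also have "\<dots> \<in> sets (Fil k)"
      using True by (intro sets.finite_INT measurable_sets[OF \<theta>_borel]) auto
    finally have "(\<lambda>\<omega>. if \<omega> \<in> {\<omega>. stay N k \<omega>} then \<theta> k \<omega> else \<theta>s) \<in> borel_measurable (Fil k)"
      by (intro measurable_If_set \<theta>_borel) auto
    also have "(\<lambda>\<omega>. if \<omega> \<in> {\<omega>. stay N k \<omega>} then \<theta> k \<omega> else \<theta>s) = hat N k"
      using True by (simp add: hat_def fun_eq_iff)
    finally show ?thesis .
  next
    case False
    then have "hat N k = (\<lambda>_. \<theta>s)" by (simp add: hat_def fun_eq_iff)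
    then show ?thesis by simp
  qed
qed (use hat_D in auto)

lemma hat_borel: "hat N k \<in> borel_measurable (Fil k)"
  using hat_meas unfolding measurable_restrict_space2_iff by auto

lemma hat_rv [measurable]: "hat N k \<in> borel_measurable P"
  by (rule Fil_P[OF hat_borel])

text \<open>Points outside D go to the frontier, which misses the ball. If the projected point lies
  in the ball, the projection did not act, and the recursion is unprojected as long as the path
  stays.\<close>

lemma Proj_interior: "Proj x \<in> B \<Longrightarrow> Proj x = x"
  using Proj_id[of x] Proj_frontier[of x] ball_D by (cases "x \<in> D") (auto simp: frontier_def)

lemma stay_Suc:
  assumes "N \<le> k" "stay N (Suc k) \<omega>"
  shows "stay N k \<omega>" "hat N k \<omega> = \<theta> k \<omega>" "hat N (Suc k) \<omega> = \<theta> (Suc k) \<omega>"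
    "\<theta> (Suc k) \<omega> = \<theta> k \<omega> + step_size (Suc k) *\<^sub>R est (Suc k) (\<theta> k \<omega>) (sample_block (Suc k) \<omega>)"
proof -
  show st: "stay N k \<omega>" using assms by (auto simp: stay_def)
  then show "hat N k \<omega> = \<theta> k \<omega>" "hat N (Suc k) \<omega> = \<theta> (Suc k) \<omega>"
    using assms by (auto simp: hat_def)
  have "\<theta> (Suc k) \<omega> \<in> B" using assms by (auto simp: stay_def)
  then show "\<theta> (Suc k) \<omega> = \<theta> k \<omega> + step_size (Suc k) *\<^sub>R est (Suc k) (\<theta> k \<omega>) (sample_block (Suc k) \<omega>)"
    unfolding \<theta>_Suc by (rule Proj_interior)
qed

definition wnorm where "wnorm x = norm (S *v (x - \<theta>s))"

lemma wnorm_nonneg: "0 \<le> wnorm x" by (simp add: wnorm_def)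

lemma norm_le_wnorm: "norm (x - \<theta>s) \<le> wnorm x" by (simp add: wnorm_def S_ge)

lemma wnorm_le: "x \<in> B \<Longrightarrow> wnorm x \<le> LS * \<delta>"
  using LS order_trans[OF LS(2)[of "x - \<theta>s"] mult_left_mono[of "norm (x - \<theta>s)" \<delta> LS]]
  by (simp add: wnorm_def dist_norm norm_minus_commute)

text \<open>After leaving the ball the reset path sits at \<open>\<theta>s\<close>, where the left
  side is 0. Resetting to the target rather than freezing at the exit point makes the one-step
  inequality hold without an indicator.\<close>

lemma wnorm_hat_step:
  assumes "N \<le> k"
  shows "(wnorm (hat N (Suc k) \<omega>))\<^sup>2 \<le> (norm (S *v (hat N k \<omega> - \<theta>s + step_size (Suc k) *\<^sub>R est (Suc k) (hat N k \<omega>) (sample_block (Suc k) \<omega>))))\<^sup>2"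
proof (cases "stay N (Suc k) \<omega>")
  case True
  have "hat N (Suc k) \<omega> - \<theta>s = hat N k \<omega> - \<theta>s + step_size (Suc k) *\<^sub>R est (Suc k) (hat N k \<omega>) (sample_block (Suc k) \<omega>)"
    unfolding stay_Suc(2,3)[OF assms True] by (subst stay_Suc(4)[OF assms True]) simp
  then show ?thesis unfolding wnorm_def by (simp only: order_refl)
next
  case False
  then have "hat N (Suc k) \<omega> = \<theta>s" by (simp add: hat_def)
  then show ?thesis by (simp add: wnorm_def)
qed

text \<open>The squared Hilbert-Schmidt norm of S, which bounds the variance of S times the
  noise.\<close>

definition S_row_norms where "S_row_norms = (\<Sum>i\<in>UNIV. (norm (S $ i))\<^sup>2)"

text \<open>The noise is centred at a fixed parameter, so the cross term vanishes and the square
  splits into drift and variance, row by row of S.\<close>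

lemma one_step_second_moment:
  assumes n: "n \<ge> 1" and x: "x \<in> B"
  shows "(\<integral>\<^sup>+\<omega>. ennreal ((norm (S *v (x - \<theta>s + \<gamma> *\<^sub>R est n x (sample_block n \<omega>))))\<^sup>2) \<partial>P) \<le>
    ennreal ((norm (S *v (x - \<theta>s) + \<gamma> *\<^sub>R (S *v level_mean (s n) x)))\<^sup>2 + \<gamma>\<^sup>2 * (S_row_norms * CT * vrate n))"
proof -
  let ?v = "S *v (x - \<theta>s) + \<gamma> *\<^sub>R (S *v level_mean (s n) x)"
  let ?g = "\<lambda>i \<omega>. S $ i \<bullet> noise n x (sample_block n \<omega>)"
  have expand: "(norm (S *v (x - \<theta>s + \<gamma> *\<^sub>R est n x (sample_block n \<omega>))))\<^sup>2 = (\<Sum>i\<in>UNIV. (?v $ i + \<gamma> * ?g i \<omega>)\<^sup>2)" for \<omega>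
  proof -
    have "S *v (x - \<theta>s + \<gamma> *\<^sub>R est n x (sample_block n \<omega>)) = ?v + \<gamma> *\<^sub>R (S *v noise n x (sample_block n \<omega>))"
      by (simp add: noise_def matrix_vector_right_distrib matrix_vector_mult_scaleR matrix_vector_mult_diff_distrib scaleR_diff_right)
    then have "(norm (S *v (x - \<theta>s + \<gamma> *\<^sub>R est n x (sample_block n \<omega>))))\<^sup>2 = (\<Sum>i\<in>UNIV. ((?v + \<gamma> *\<^sub>R (S *v noise n x (sample_block n \<omega>))) $ i)\<^sup>2)"
      by (simp only: norm_vec_def L2_set_def real_norm_def power2_abs) (simp add: sum_nonneg)
    also have "\<dots> = (\<Sum>i\<in>UNIV. (?v $ i + \<gamma> * ?g i \<omega>)\<^sup>2)"
      by (simp add: matrix_vector_mul_component)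
    finally show ?thesis .
  qed
  have gi: "integrable P (\<lambda>\<omega>. (?g i \<omega>)\<^sup>2)" "(\<integral>\<omega>. ?g i \<omega> \<partial>P) = 0" "(\<integral>\<omega>. (?g i \<omega>)\<^sup>2 \<partial>P) = step_var (S $ i) n x" for i
    by (rule noise_second_moment[OF n x])+
  have gm: "?g i \<in> borel_measurable P" for i
  proof -
    have "(\<lambda>\<omega>. summand (S $ i) n x j (sample j \<omega>)) \<in> borel_measurable P" if "j \<in> sample_idx n" for j
      using measurable_compose[OF sample_rv summand_meas[OF that B_D[OF x]]] that sample_idx_sub[OF n] by auto
    then show ?thesis unfolding noise_sample_block[OF n x] by (intro borel_measurable_sum)
  qed
  have gint: "integrable P (?g i)" for i
    by (rule square_integrable_imp_integrable[OF gm gi(1)])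
  have sq: "(?v $ i + \<gamma> * ?g i \<omega>)\<^sup>2 = (?v $ i)\<^sup>2 + (2 * ?v $ i * \<gamma>) * ?g i \<omega> + \<gamma>\<^sup>2 * (?g i \<omega>)\<^sup>2" for i \<omega>
    by (simp add: power2_eq_square algebra_simps)
  have i1: "integrable P (\<lambda>\<omega>. (?v $ i + \<gamma> * ?g i \<omega>)\<^sup>2)" for i
    unfolding sq using gint gi(1) by (intro Bochner_Integration.integrable_add integrable_mult_right) auto
  have e1: "(\<integral>\<omega>. (?v $ i + \<gamma> * ?g i \<omega>)\<^sup>2 \<partial>P) = (?v $ i)\<^sup>2 + \<gamma>\<^sup>2 * step_var (S $ i) n x" for i
    unfolding sq using gint[of i] gi[of i] by (simp add: prob_space)
  have "(\<integral>\<^sup>+\<omega>. ennreal ((norm (S *v (x - \<theta>s + \<gamma> *\<^sub>R est n x (sample_block n \<omega>))))\<^sup>2) \<partial>P) =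
    ennreal (\<integral>\<omega>. (\<Sum>i\<in>UNIV. (?v $ i + \<gamma> * ?g i \<omega>)\<^sup>2) \<partial>P)"
    unfolding expand
  proof (rule nn_integral_eq_integral)
    show "integrable P (\<lambda>\<omega>. \<Sum>i\<in>UNIV. (?v $ i + \<gamma> * ?g i \<omega>)\<^sup>2)"
      by (intro Bochner_Integration.integrable_sum i1)
    show "AE \<omega> in P. 0 \<le> (\<Sum>i\<in>UNIV. (?v $ i + \<gamma> * ?g i \<omega>)\<^sup>2)"
      by (intro AE_I2 sum_nonneg) simp
  qed
  also have "(\<integral>\<omega>. (\<Sum>i\<in>UNIV. (?v $ i + \<gamma> * ?g i \<omega>)\<^sup>2) \<partial>P) = (\<Sum>i\<in>UNIV. (?v $ i)\<^sup>2 + \<gamma>\<^sup>2 * step_var (S $ i) n x)"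
    by (simp only: Bochner_Integration.integral_sum[OF i1] e1)
  also have "\<dots> \<le> (\<Sum>i\<in>UNIV. (?v $ i)\<^sup>2 + \<gamma>\<^sup>2 * ((norm (S $ i))\<^sup>2 * CT * vrate n))"
    by (intro sum_mono add_left_mono mult_left_mono step_var_le x n) auto
  also have "\<dots> = (norm ?v)\<^sup>2 + \<gamma>\<^sup>2 * (S_row_norms * CT * vrate n)"
  proof -
    have "(norm ?v)\<^sup>2 = (\<Sum>i\<in>UNIV. (?v $ i)\<^sup>2)"
      by (simp only: norm_vec_def L2_set_def real_norm_def power2_abs) (simp add: sum_nonneg)
    then show ?thesis
      by (simp only: sum.distrib S_row_norms_def sum_distrib_left sum_distrib_right mult.assoc)
  qed
  finally show ?thesis by (simp add: ennreal_leI)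
qed

lemma drift_bound:
  "\<exists>C n0. 0 \<le> C \<and> (\<forall>n\<ge>n0. \<forall>x\<in>B. (norm (S *v (x - \<theta>s) + step_size n *\<^sub>R (S *v level_mean (s n) x)))\<^sup>2
     \<le> (1 - c * step_size n) * (wnorm x)\<^sup>2 + C * (step_size n * (bias n)\<^sup>2))"
proof -
  obtain LH where LH: "LH > 0" "\<And>y. norm ((S ** H) *v y) \<le> norm y * LH"
    using bounded_linear.pos_bounded[OF matrix_vector_mul_bounded_linear[of "S ** H"]] by blast
  \<comment> \<open>A bounds the drift apart from the bias: LH for the linear part and c/4 for the
    Taylor remainder, both relative to |S (x - \<theta>s)|.\<close>
  define A where "A = LH + c / 4"
  have A: "A > 0" using LH c by (simp add: A_def)
  define C where "C = (4 / c + 2) * (LS * CB)\<^sup>2"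
  have C: "C \<ge> 0" using c by (simp add: C_def)
  have "(\<lambda>n. step_size n) \<longlonglongrightarrow> 0"
    unfolding step_size_def using \<psi> by real_asymp
  then have "eventually (\<lambda>n. step_size n < min 1 (c / (8 * A\<^sup>2))) sequentially"
    using A c by (intro order_tendstoD(2)) auto
  moreover have "eventually (\<lambda>n. s n \<ge> k1) sequentially"
    using s_at_top unfolding filterlim_at_top by auto
  ultimately have "eventually (\<lambda>n. step_size n < min 1 (c / (8 * A\<^sup>2)) \<and> s n \<ge> k1) sequentially"
    by (rule eventually_conj)
  then obtain n0 where n0: "\<And>n. n \<ge> n0 \<Longrightarrow> step_size n < min 1 (c / (8 * A\<^sup>2)) \<and> s n \<ge> k1"
    unfolding eventually_sequentially by blast
  have "(norm (S *v (x - \<theta>s) + step_size n *\<^sub>R (S *v level_mean (s n) x)))\<^sup>2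
     \<le> (1 - c * step_size n) * (wnorm x)\<^sup>2 + C * (step_size n * (bias n)\<^sup>2)" if n: "n \<ge> n0" and x: "x \<in> B" for n x
  proof -
    let ?\<gamma> = "step_size n" and ?m = "level_mean (s n) x" and ?w = "S *v (x - \<theta>s)" and ?y = "x - \<theta>s"
    have \<gamma>: "0 \<le> ?\<gamma>" "?\<gamma> < 1" "?\<gamma> < c / (8 * A\<^sup>2)" and sk: "s n \<ge> k1"
      using n0[OF n] by (auto simp: step_size_def)
    let ?W = "norm ?w" and ?G = "LS * CB * bias n"
    have G0: "?G \<ge> 0" using LS CB by (simp add: bias_def)
    have Sm: "S *v ?m = S *v (H *v ?y) + (S *v (f x - H *v ?y) + S *v (?m - f x))"
      by (simp add: matrix_vector_mult_diff_distrib)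
    have r1: "norm (S *v (f x - H *v ?y)) \<le> c / 4 * ?W"
    proof -
      have "norm (S *v (f x - H *v ?y)) \<le> LS * norm (f x - H *v ?y)" by (rule LS(2))
      also have "\<dots> \<le> LS * (c / (4 * LS) * norm ?y)"
        using LS(1) by (intro mult_left_mono taylor_small[OF x]) auto
      also have "\<dots> = c / 4 * norm ?y" using LS(1) by simp
      also have "\<dots> \<le> c / 4 * ?W" using c by (intro mult_left_mono S_ge) auto
      finally show ?thesis .
    qed
    have r2: "norm (S *v (?m - f x)) \<le> ?G"
    proof -
      have "norm (S *v (?m - f x)) \<le> LS * norm (?m - f x)" by (rule LS(2))
      also have "\<dots> \<le> LS * (CB * bias n)"
        using LS(1) bias_le[OF x sk] by (intro mult_left_mono) (auto simp: bias_def)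
      finally show ?thesis by (simp add: mult.assoc)
    qed
    have "?w \<bullet> (S *v ?m) = ?w \<bullet> (S *v (H *v ?y)) + (?w \<bullet> (S *v (f x - H *v ?y)) + ?w \<bullet> (S *v (?m - f x)))"
      unfolding Sm by (simp only: inner_add_right)
    also have "\<dots> \<le> - c * ?W\<^sup>2 + (?W * (c / 4 * ?W) + ?W * ?G)"
    proof (intro add_mono S_lyap)
      show "?w \<bullet> (S *v (f x - H *v ?y)) \<le> ?W * (c / 4 * ?W)"
        by (rule order_trans[OF norm_cauchy_schwarz]) (intro mult_left_mono r1 norm_ge_zero)
      show "?w \<bullet> (S *v (?m - f x)) \<le> ?W * ?G"
        by (rule order_trans[OF norm_cauchy_schwarz]) (intro mult_left_mono r2 norm_ge_zero)
    qed
    \<comment> \<open>Young's inequality, with weights leaving -c + c/4 + c/8 = -5c/8. After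
      doubling this exceeds the claimed rate c by c/4.\<close>
    also have "?W * ?G \<le> c / 8 * ?W\<^sup>2 + 2 / c * ?G\<^sup>2"
    proof -
      have "0 \<le> (c / 4 * ?W - ?G)\<^sup>2" by simp
      also have "\<dots> = c / 2 * (c / 8 * ?W\<^sup>2 + 2 / c * ?G\<^sup>2 - ?W * ?G)"
        using c by (simp add: power2_eq_square field_simps)
      finally show ?thesis using c by (simp add: zero_le_mult_iff)
    qed
    finally have in1: "?w \<bullet> (S *v ?m) \<le> - (5 * c / 8) * ?W\<^sup>2 + 2 / c * ?G\<^sup>2"
      by (simp add: power2_eq_square algebra_simps)
    have nm: "norm (S *v ?m) \<le> A * ?W + ?G"
    proof -
      have "norm (S *v ?m) \<le> norm (S *v (H *v ?y)) + (norm (S *v (f x - H *v ?y)) + norm (S *v (?m - f x)))"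
        unfolding Sm by (intro norm_triangle_mono norm_triangle_ineq order_refl)
      also have "norm (S *v (H *v ?y)) \<le> LH * ?W"
      proof -
        have "norm (S *v (H *v ?y)) \<le> norm ?y * LH" using LH(2)[of ?y] by (simp only: matrix_vector_mul_assoc)
        also have "\<dots> \<le> ?W * LH" using LH(1) S_ge by (intro mult_right_mono) auto
        finally show ?thesis by (simp add: mult.commute)
      qed
      finally show ?thesis using r1 r2 by (simp add: A_def algebra_simps)
    qed
    have nm2: "(norm (S *v ?m))\<^sup>2 \<le> 2 * A\<^sup>2 * ?W\<^sup>2 + 2 * ?G\<^sup>2"
    proof -
      have "(norm (S *v ?m))\<^sup>2 \<le> (A * ?W + ?G)\<^sup>2"
        by (intro power_mono nm) auto
      also have "\<dots> \<le> 2 * (A * ?W)\<^sup>2 + 2 * ?G\<^sup>2"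
        using zero_le_power2[of "A * ?W - ?G"] by (simp add: power2_eq_square algebra_simps)
      finally show ?thesis by (simp add: power_mult_distrib)
    qed
    have "(norm (?w + ?\<gamma> *\<^sub>R (S *v ?m)))\<^sup>2 = ?W\<^sup>2 + 2 * ?\<gamma> * (?w \<bullet> (S *v ?m)) + ?\<gamma>\<^sup>2 * (norm (S *v ?m))\<^sup>2"
      unfolding power2_norm_eq_inner by (simp add: inner_add_left inner_add_right inner_commute power2_eq_square algebra_simps)
    also have "\<dots> \<le> ?W\<^sup>2 + 2 * ?\<gamma> * (- (5 * c / 8) * ?W\<^sup>2 + 2 / c * ?G\<^sup>2) + ?\<gamma>\<^sup>2 * (2 * A\<^sup>2 * ?W\<^sup>2 + 2 * ?G\<^sup>2)"
      using \<gamma> by (intro add_mono mult_left_mono in1 nm2 order_refl) auto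
    also have "\<dots> = (1 - 5 * c / 4 * ?\<gamma> + 2 * A\<^sup>2 * ?\<gamma> * ?\<gamma>) * ?W\<^sup>2 + (4 / c * ?\<gamma> + 2 * ?\<gamma> * ?\<gamma>) * ?G\<^sup>2"
      by (simp add: power2_eq_square algebra_simps)
    \<comment> \<open>The excess c/4 pays for the term quadratic in the step size, since the step
      size is below c / (8 A^2).\<close>
    also have "\<dots> \<le> (1 - c * ?\<gamma>) * ?W\<^sup>2 + (4 / c * ?\<gamma> + 2 * ?\<gamma> * 1) * ?G\<^sup>2"
    proof (rule add_mono[OF mult_right_mono mult_right_mono])
      have "2 * A\<^sup>2 * ?\<gamma> \<le> c / 4"
        using \<gamma>(3) A by (simp add: field_simps)
      then have "2 * A\<^sup>2 * ?\<gamma> * ?\<gamma> \<le> c / 4 * ?\<gamma>"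
        using \<gamma>(1) by (rule mult_right_mono)
      then show "1 - 5 * c / 4 * ?\<gamma> + 2 * A\<^sup>2 * ?\<gamma> * ?\<gamma> \<le> 1 - c * ?\<gamma>"
        by (simp add: algebra_simps)
      show "4 / c * ?\<gamma> + 2 * ?\<gamma> * ?\<gamma> \<le> 4 / c * ?\<gamma> + 2 * ?\<gamma> * 1"
        using mult_left_mono[of ?\<gamma> 1 ?\<gamma>] \<gamma> by simp
    qed auto
    also have "(4 / c * ?\<gamma> + 2 * ?\<gamma> * 1) * ?G\<^sup>2 = C * (?\<gamma> * (bias n)\<^sup>2)"
      by (simp add: C_def power_mult_distrib algebra_simps)
    finally show ?thesis unfolding wnorm_def .
  qed
  then show ?thesis using C by blast
qed

definition err where "err N k = (\<integral>\<omega>. (wnorm (hat N k \<omega>))\<^sup>2 \<partial>P)"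

lemma wnorm_meas [measurable]: "wnorm \<in> borel_measurable borel"
  unfolding wnorm_def[abs_def] by measurable

lemma wnorm_int: "integrable P (\<lambda>\<omega>. (wnorm (hat N k \<omega>))\<^sup>2)"
proof (rule integrable_const_bound[of _ "(LS * \<delta>)\<^sup>2"])
  show "AE \<omega> in P. norm ((wnorm (hat N k \<omega>))\<^sup>2) \<le> (LS * \<delta>)\<^sup>2"
    using wnorm_le[OF hat_B] wnorm_nonneg by (intro AE_I2) (auto intro!: power_mono)
qed measurable

lemma err_nonneg: "0 \<le> err N k"
  by (simp add: err_def)

text \<open>Given the past, \<open>hat N k\<close> is fixed and the next block is fresh, so freezing
  reduces the step to the bounds at a fixed parameter. The constants do not depend on N.\<close>

lemma err_step:
  "\<exists>C n0. 0 \<le> C \<and> (\<forall>N. \<forall>k\<ge>n0. N \<le> k \<longrightarrow> err N (Suc k) \<le> (1 - c * step_size (Suc k)) * err N k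
    + C * (step_size (Suc k) * (bias (Suc k))\<^sup>2 + (step_size (Suc k))\<^sup>2 * vrate (Suc k)))"
proof -
  from drift_bound obtain C1 n0 where Cn: "0 \<le> C1 \<and> (\<forall>n\<ge>n0. \<forall>x\<in>B. (norm (S *v (x - \<theta>s) + step_size n *\<^sub>R (S *v level_mean (s n) x)))\<^sup>2
     \<le> (1 - c * step_size n) * (wnorm x)\<^sup>2 + C1 * (step_size n * (bias n)\<^sup>2))"
    by (elim exE)
  then have C1: "0 \<le> C1" by simp
  from Cn have n0: "(norm (S *v (x - \<theta>s) + step_size n *\<^sub>R (S *v level_mean (s n) x)))\<^sup>2
     \<le> (1 - c * step_size n) * (wnorm x)\<^sup>2 + C1 * (step_size n * (bias n)\<^sup>2)" if "n \<ge> n0" "x \<in> B" for n x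
    using that by simp_all
  define C where "C = max C1 (S_row_norms * CT)"
  have LR0: "0 \<le> S_row_norms" unfolding S_row_norms_def by (intro sum_nonneg) simp
  have C: "0 \<le> C" using C1 by (simp add: C_def)
  have "err N (Suc k) \<le> (1 - c * step_size (Suc k)) * err N k
    + C * (step_size (Suc k) * (bias (Suc k))\<^sup>2 + (step_size (Suc k))\<^sup>2 * vrate (Suc k))" if k: "k \<ge> n0" and N: "N \<le> k" for N k
  proof -
    let ?n = "Suc k" and ?\<gamma> = "step_size (Suc k)"
    let ?R = "C * (?\<gamma> * (bias ?n)\<^sup>2 + ?\<gamma>\<^sup>2 * vrate ?n)"
    let ?h = "\<lambda>p. ennreal ((norm (S *v (hat N k (fst p) - \<theta>s + ?\<gamma> *\<^sub>R est ?n (hat N k (fst p)) (snd p))))\<^sup>2)"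
    have hm: "?h \<in> borel_measurable (Fil k \<Otimes>\<^sub>M block_space ?n)"
    proof -
      have "(\<lambda>p. (hat N k (fst p), snd p)) \<in> measurable (Fil k \<Otimes>\<^sub>M block_space ?n) (param_space \<Otimes>\<^sub>M block_space ?n)"
        by (intro measurable_Pair measurable_compose[OF measurable_fst hat_meas] measurable_snd)
      from measurable_compose[OF this est_meas[of ?n]]
      have [measurable]: "(\<lambda>p. est ?n (hat N k (fst p)) (snd p)) \<in> borel_measurable (Fil k \<Otimes>\<^sub>M block_space ?n)" by simp
      have [measurable]: "hat N k \<in> borel_measurable (Fil k)" by (rule hat_borel)
      show ?thesis by measurable
    qed
    \<comment> \<open>Returning from \<open>ennreal\<close> to reals requires a nonnegative bound.
      The factor 1 - c \<gamma> alone carries no sign here, but the whole expression dominates a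
      square.\<close>
    have pos: "0 \<le> (1 - c * ?\<gamma>) * (wnorm (hat N k \<omega>))\<^sup>2 + ?R" for \<omega>
    proof -
      have "0 \<le> (norm (S *v (hat N k \<omega> - \<theta>s) + ?\<gamma> *\<^sub>R (S *v level_mean (s ?n) (hat N k \<omega>))))\<^sup>2" by simp
      also have "\<dots> \<le> (1 - c * ?\<gamma>) * (wnorm (hat N k \<omega>))\<^sup>2 + C1 * (?\<gamma> * (bias ?n)\<^sup>2)"
        by (rule n0[OF _ hat_B]) (use k in simp)
      also have "\<dots> \<le> (1 - c * ?\<gamma>) * (wnorm (hat N k \<omega>))\<^sup>2 + ?R"
        unfolding distrib_left using C vrate_nonneg[of ?n]
        by (intro add_left_mono add_increasing2 mult_right_mono mult_nonneg_nonneg) (auto simp: C_def step_size_def)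
      finally show ?thesis .
    qed
    have "ennreal (err N ?n) = (\<integral>\<^sup>+\<omega>. ennreal ((wnorm (hat N ?n \<omega>))\<^sup>2) \<partial>P)"
      unfolding err_def by (rule nn_integral_eq_integral[OF wnorm_int, symmetric]) auto
    also have "\<dots> \<le> (\<integral>\<^sup>+\<omega>. ?h (\<omega>, sample_block ?n \<omega>) \<partial>P)"
      unfolding fst_conv snd_conv by (intro nn_integral_mono ennreal_leI wnorm_hat_step[OF N])
    also have "\<dots> = (\<integral>\<^sup>+\<omega>. (\<integral>\<^sup>+\<omega>'. ?h (\<omega>, sample_block ?n \<omega>') \<partial>P) \<partial>P)"
      by (rule nn_integral_freeze[OF Fil_indep hm])
    also have "\<dots> \<le> (\<integral>\<^sup>+\<omega>. ennreal ((1 - c * ?\<gamma>) * (wnorm (hat N k \<omega>))\<^sup>2 + ?R) \<partial>P)"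
    proof (rule nn_integral_mono)
      fix \<omega>
      have "(\<integral>\<^sup>+\<omega>'. ?h (\<omega>, sample_block ?n \<omega>') \<partial>P) \<le> ennreal ((norm (S *v (hat N k \<omega> - \<theta>s) + ?\<gamma> *\<^sub>R (S *v level_mean (s ?n) (hat N k \<omega>))))\<^sup>2 + ?\<gamma>\<^sup>2 * (S_row_norms * CT * vrate ?n))"
        unfolding fst_conv snd_conv by (rule one_step_second_moment[OF _ hat_B]) simp
      also have "\<dots> \<le> ennreal ((1 - c * ?\<gamma>) * (wnorm (hat N k \<omega>))\<^sup>2 + ?R)"
      proof (rule ennreal_leI)
        have "(norm (S *v (hat N k \<omega> - \<theta>s) + ?\<gamma> *\<^sub>R (S *v level_mean (s ?n) (hat N k \<omega>))))\<^sup>2 \<le> (1 - c * ?\<gamma>) * (wnorm (hat N k \<omega>))\<^sup>2 + C1 * (?\<gamma> * (bias ?n)\<^sup>2)"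
          by (rule n0[OF _ hat_B]) (use k in simp)
        moreover have "C1 * (?\<gamma> * (bias ?n)\<^sup>2) \<le> C * (?\<gamma> * (bias ?n)\<^sup>2)"
          by (intro mult_right_mono) (auto simp: C_def step_size_def)
        moreover have "?\<gamma>\<^sup>2 * (S_row_norms * CT * vrate ?n) \<le> C * (?\<gamma>\<^sup>2 * vrate ?n)"
        proof -
          have "(S_row_norms * CT) * (?\<gamma>\<^sup>2 * vrate ?n) \<le> C * (?\<gamma>\<^sup>2 * vrate ?n)"
            using vrate_nonneg by (intro mult_right_mono) (auto simp: C_def)
          then show ?thesis by (simp add: mult_ac)
        qed
        ultimately show "(norm (S *v (hat N k \<omega> - \<theta>s) + ?\<gamma> *\<^sub>R (S *v level_mean (s ?n) (hat N k \<omega>))))\<^sup>2 + ?\<gamma>\<^sup>2 * (S_row_norms * CT * vrate ?n) \<le> (1 - c * ?\<gamma>) * (wnorm (hat N k \<omega>))\<^sup>2 + ?R"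
          unfolding distrib_left by linarith
      qed
      finally show "(\<integral>\<^sup>+\<omega>'. ?h (\<omega>, sample_block ?n \<omega>') \<partial>P) \<le> ennreal ((1 - c * ?\<gamma>) * (wnorm (hat N k \<omega>))\<^sup>2 + ?R)" .
    qed
    also have "\<dots> = ennreal (\<integral>\<omega>. (1 - c * ?\<gamma>) * (wnorm (hat N k \<omega>))\<^sup>2 + ?R \<partial>P)"
    proof (rule nn_integral_eq_integral)
      show "integrable P (\<lambda>\<omega>. (1 - c * ?\<gamma>) * (wnorm (hat N k \<omega>))\<^sup>2 + ?R)"
        using wnorm_int[of N k] by auto
      show "AE \<omega> in P. 0 \<le> (1 - c * ?\<gamma>) * (wnorm (hat N k \<omega>))\<^sup>2 + ?R" using pos by simp
    qed
    also have mean: "(\<integral>\<omega>. (1 - c * ?\<gamma>) * (wnorm (hat N k \<omega>))\<^sup>2 + ?R \<partial>P) = (1 - c * ?\<gamma>) * err N k + ?R"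
      using wnorm_int[of N k] by (simp add: err_def prob_space)
    finally have le: "ennreal (err N ?n) \<le> ennreal ((1 - c * ?\<gamma>) * err N k + ?R)" .
    have "0 \<le> (\<integral>\<omega>. (1 - c * ?\<gamma>) * (wnorm (hat N k \<omega>))\<^sup>2 + ?R \<partial>P)"
      using pos by (intro integral_nonneg_AE) simp
    then show ?thesis
      using le unfolding mean by (simp add: ennreal_le_iff)
  qed
  then show ?thesis using C by blast
qed

lemma err_rate:
  assumes p: "0 < p" "p < \<psi> + \<phi>"
  shows "err N \<in> O(\<lambda>k. real k powr - p)"
proof -
  obtain C n0 where C: "0 \<le> C" and st: "\<And>k. k \<ge> n0 \<Longrightarrow> N \<le> k \<Longrightarrow> err N (Suc k) \<le> (1 - c * step_size (Suc k)) * err N k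
    + C * (step_size (Suc k) * (bias (Suc k))\<^sup>2 + (step_size (Suc k))\<^sup>2 * vrate (Suc k))"
    using err_step by blast
  obtain C2 where C2: "C2 > 0" "eventually (\<lambda>n. norm (step_size n * (bias n)\<^sup>2 + (step_size n)\<^sup>2 * vrate n) \<le> C2 * norm (real n powr (- \<psi> - p))) sequentially"
    using recursion_input[OF p(2)] by (elim landau_o.bigE)
  then obtain n2 where n2: "\<And>n. n \<ge> n2 \<Longrightarrow> step_size n * (bias n)\<^sup>2 + (step_size n)\<^sup>2 * vrate n \<le> C2 * real n powr (- \<psi> - p)"
    unfolding eventually_sequentially by (auto dest: abs_le_D1)
  show ?thesis
  proof (rule recursion_rate[of \<psi> p c "C * C2" "err N" "max (max n0 n2) N"])
    show "0 < \<psi>" "\<psi> < 1" using \<psi> by auto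
    fix k assume k: "max (max n0 n2) N \<le> k"
    have "C * (step_size (Suc k) * (bias (Suc k))\<^sup>2 + (step_size (Suc k))\<^sup>2 * vrate (Suc k)) \<le> C * (C2 * real (Suc k) powr (- \<psi> - p))"
      using k by (intro mult_left_mono n2 C) auto
    then show "err N (Suc k) \<le> (1 - c * real (Suc k) powr - \<psi>) * err N k + C * C2 * real (Suc k) powr (- \<psi> - p)"
      using st[of k] k unfolding step_size_def by (simp add: mult.assoc)
  qed (use p c C C2 err_nonneg in auto)
qed

end

subsection \<open>Central limit theorem for the noise\<close>

context mlsa
begin

lemma cov_meas: "k \<ge> 1 \<Longrightarrow> (\<lambda>x. cov k x $ i $ j) \<in> borel_measurable param_space"
proof -
  assume k: "k \<ge> 1"
  have ld: "(\<lambda>p. level_diff Fk k (fst p) (U (snd p))) \<in> borel_measurable (param_space \<Otimes>\<^sub>M P)"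
    by (rule level_diff_comp[OF k]) measurable
  have comp: "(\<lambda>p. level_diff Fk k (fst p) (U (snd p)) $ i) \<in> borel_measurable (param_space \<Otimes>\<^sub>M P)" for i
    by (rule measurable_compose[OF ld]) (intro borel_measurable_continuous_onI continuous_intros)
  have mean: "(\<lambda>x. \<integral>\<omega>. level_diff Fk k x (U \<omega>) $ i \<partial>P) \<in> borel_measurable param_space" for i
    by (rule borel_measurable_lebesgue_integral) (use comp[of i] in \<open>simp add: case_prod_beta'\<close>)
  have "(\<lambda>x. \<integral>\<omega>. (level_diff Fk k x (U \<omega>) $ i - (\<integral>\<omega>'. level_diff Fk k x (U \<omega>') $ i \<partial>P)) *
      (level_diff Fk k x (U \<omega>) $ j - (\<integral>\<omega>'. level_diff Fk k x (U \<omega>') $ j \<partial>P)) \<partial>P) \<in> borel_measurable param_space"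
  proof (rule borel_measurable_lebesgue_integral)
    have "(\<lambda>p. (level_diff Fk k (fst p) (U (snd p)) $ i - (\<integral>\<omega>'. level_diff Fk k (fst p) (U \<omega>') $ i \<partial>P)) *
      (level_diff Fk k (fst p) (U (snd p)) $ j - (\<integral>\<omega>'. level_diff Fk k (fst p) (U \<omega>') $ j \<partial>P))) \<in> borel_measurable (param_space \<Otimes>\<^sub>M P)"
      by (intro borel_measurable_times borel_measurable_diff comp measurable_compose[OF measurable_fst mean])
    then show "(\<lambda>(x, \<omega>). (level_diff Fk k x (U \<omega>) $ i - (\<integral>\<omega>'. level_diff Fk k x (U \<omega>') $ i \<partial>P)) *
      (level_diff Fk k x (U \<omega>) $ j - (\<integral>\<omega>'. level_diff Fk k x (U \<omega>') $ j \<partial>P))) \<in> borel_measurable (param_space \<Otimes>\<^sub>M P)"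
      by (simp add: case_prod_beta')
  qed
  then show ?thesis unfolding cov_def cov_matrix_def by simp
qed

lemma step_var_meas: "step_var a n \<in> borel_measurable param_space"
  unfolding step_var_def[abs_def] inner_vec_def matrix_vector_mult_def
  by (simp, intro borel_measurable_sum borel_measurable_times borel_measurable_divide borel_measurable_const cov_meas) auto

lemma step_var_scaleR: "step_var (r *\<^sub>R a) n x = r\<^sup>2 * step_var a n x"
  unfolding step_var_def by (simp add: matrix_vector_mult_scaleR sum_distrib_left power2_eq_square mult_ac)

section \<open>The event of convergence and the sigma-algebra generated by past events\<close>

definition conv where "conv = {\<omega> \<in> space P. (\<lambda>n. \<theta> n \<omega>) \<longlonglongrightarrow> \<theta>s}"

definition past_events where "past_events = (\<Union>k. sets (Fil k))"

lemma past_events_sub: "past_events \<subseteq> sets P"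
  using Fil_sub unfolding past_events_def subalgebra_def by auto

text \<open>The array of the limit theorem is indexed from 0, while its first term belongs to the
  history of step 1; this matches the shifted filtration.\<close>

lemma Fil_Suc_past: "past_events = (\<Union>k. sets (Fil (Suc k)))"
  unfolding past_events_def using Fil_mono[OF le_SucI[OF order_refl]] by auto

lemma past_events_Int_stable: "Int_stable past_events"
proof (rule Int_stableI)
  fix A B assume "A \<in> past_events" "B \<in> past_events"
  then obtain i j where "A \<in> sets (Fil i)" "B \<in> sets (Fil j)"
    unfolding past_events_def by auto
  then have "A \<in> sets (Fil (max i j))" "B \<in> sets (Fil (max i j))"
    using Fil_mono[of i "max i j"] Fil_mono[of j "max i j"] by auto
  then show "A \<inter> B \<in> past_events"
    unfolding past_events_def by auto
qed

lemma space_past_events: "space P \<in> past_events"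
  unfolding past_events_def using sets.top[of "Fil 0"] by auto

text \<open>Convergence depends on the iterates only, and each iterate is known at some finite time;
  hence the event lies in the sigma-algebra generated by the past events, though in general in none
  of the histories.\<close>

lemma conv_past: "conv \<in> sigma_sets (space P) past_events"
proof -
  define Q where "Q = sigma (space P) past_events"
  have sub: "past_events \<subseteq> Pow (space P)"
    using past_events_sub sets.sets_into_space by blast
  have sQ: "sets Q = sigma_sets (space P) past_events" "space Q = space P"
    using sub by (simp_all add: Q_def)
  have [measurable]: "\<theta> n \<in> borel_measurable Q" for n
  proof -
    have "\<theta> n \<in> borel_measurable (Fil n)"
      using \<theta>_meas[of n] unfolding measurable_restrict_space2_iff by auto
    moreover have "sets (Fil n) \<subseteq> sets Q"
      unfolding sQ past_events_def by (auto intro: sigma_sets.Basic)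
    ultimately show ?thesis
      using sQ(2) unfolding measurable_def by auto
  qed
  \<comment> \<open>Radii 1/(i+1) suffice, which makes the description countable and hence
    measurable.\<close>
  have "conv = {\<omega> \<in> space Q. \<forall>i::nat. \<exists>N::nat. \<forall>n::nat. N \<le> n \<longrightarrow> dist (\<theta> n \<omega>) \<theta>s < inverse (real (Suc i))}"
  proof -
    have "(\<lambda>n. \<theta> n \<omega>) \<longlonglongrightarrow> \<theta>s \<longleftrightarrow> (\<forall>i::nat. \<exists>N::nat. \<forall>n::nat. N \<le> n \<longrightarrow> dist (\<theta> n \<omega>) \<theta>s < inverse (real (Suc i)))" for \<omega>
    proof
      assume "(\<lambda>n. \<theta> n \<omega>) \<longlonglongrightarrow> \<theta>s"
      then show "\<forall>i::nat. \<exists>N::nat. \<forall>n::nat. N \<le> n \<longrightarrow> dist (\<theta> n \<omega>) \<theta>s < inverse (real (Suc i))"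
        unfolding lim_sequentially by simp
    next
      assume *: "\<forall>i::nat. \<exists>N::nat. \<forall>n::nat. N \<le> n \<longrightarrow> dist (\<theta> n \<omega>) \<theta>s < inverse (real (Suc i))"
      show "(\<lambda>n. \<theta> n \<omega>) \<longlonglongrightarrow> \<theta>s"
      proof (rule metric_LIMSEQ_I)
        fix r :: real assume "0 < r"
        then obtain i where "inverse (real (Suc i)) < r" using reals_Archimedean by blast
        then show "\<exists>no. \<forall>n\<ge>no. dist (\<theta> n \<omega>) \<theta>s < r"
          using * less_trans by meson
      qed
    qed
    then show ?thesis by (simp add: conv_def sQ)
  qed
  also have "\<dots> \<in> sets Q" by measurable
  finally show ?thesis by (simp add: sQ)
qed

lemma conv_event [measurable]: "conv \<in> sets P"
  using conv_past sets.sigma_sets_subset[OF past_events_sub] by blast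

end

context mlsa_local
begin

section \<open>Conditional variances of the noise and their limit\<close>

lemma cov_scaled:
  assumes "x \<in> B" "k \<ge> 1"
  shows "0 \<le> M ^ k * (a \<bullet> (cov k x *v a))" "M ^ k * (a \<bullet> (cov k x *v a)) \<le> (norm a)\<^sup>2 * CT"
proof -
  have Mk: "M ^ k > 0" using M by simp
  show "0 \<le> M ^ k * (a \<bullet> (cov k x *v a))"
    using dev_form(4)[OF assms] Mk by simp
  have "M ^ k * (a \<bullet> (cov k x *v a)) \<le> M ^ k * ((norm a)\<^sup>2 * (CT * M powr (- real k)))"
    using Mk by (intro mult_left_mono dev_form(3)[OF assms]) auto
  also have "\<dots> = (norm a)\<^sup>2 * CT * (M ^ k * M powr (- real k))" by simp
  also have "M ^ k * M powr (- real k) = 1"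
    using M by (simp add: powr_minus powr_realpow)
  finally show "M ^ k * (a \<bullet> (cov k x *v a)) \<le> (norm a)\<^sup>2 * CT" by simp
qed

text \<open>The joint limit is unpacked into one neighbourhood and one level bound, after testing
  the matrices with a fixed vector.\<close>

lemma cov_form_limit:
  assumes "\<eta> > 0"
  shows "\<exists>d>0. \<exists>k0. \<forall>x\<in>B. \<forall>k\<ge>k0. norm (x - \<theta>s) < d \<longrightarrow> \<bar>M ^ k * (a \<bullet> (cov k x *v a)) - a \<bullet> (\<Gamma> *v a)\<bar> < \<eta>"
proof -
  have lin: "linear (\<lambda>G :: real^'d^'d. a \<bullet> (G *v a))"
    by (intro linearI) (auto simp: matrix_vector_mult_add_rdistrib inner_add_right simp flip: scaleR_matrix_vector_assoc)
  have "((\<lambda>(x, k). M ^ k *\<^sub>R cov k x) \<longlongrightarrow> \<Gamma>) (joint_limit D \<theta>s)"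
    using var unfolding var_condition_def cov_def .
  then have "((\<lambda>p. a \<bullet> ((case p of (x, k) \<Rightarrow> M ^ k *\<^sub>R cov k x) *v a)) \<longlongrightarrow> a \<bullet> (\<Gamma> *v a)) (joint_limit D \<theta>s)"
    by (rule bounded_linear.tendsto[OF lin[unfolded linear_conv_bounded_linear]])
  from tendstoD[OF this assms]
  have "eventually (\<lambda>p. dist (a \<bullet> ((case p of (x, k) \<Rightarrow> M ^ k *\<^sub>R cov k x) *v a)) (a \<bullet> (\<Gamma> *v a)) < \<eta>) (joint_limit D \<theta>s)" .
  then obtain Pf Pg where ev: "eventually Pf (inf (nhds \<theta>s) (principal D))" "eventually Pg sequentially"
    and imp: "\<And>x k. Pf x \<Longrightarrow> Pg k \<Longrightarrow> dist (a \<bullet> ((M ^ k *\<^sub>R cov k x) *v a)) (a \<bullet> (\<Gamma> *v a)) < \<eta>"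
    unfolding joint_limit_def eventually_prod_filter by auto
  obtain d where d: "d > 0" "\<And>x. dist x \<theta>s < d \<Longrightarrow> x \<in> D \<Longrightarrow> Pf x"
    using ev(1) unfolding eventually_inf_principal eventually_nhds_metric by blast
  obtain k0 where k0: "\<And>k. k \<ge> k0 \<Longrightarrow> Pg k"
    using ev(2) unfolding eventually_sequentially by blast
  have "\<bar>M ^ k * (a \<bullet> (cov k x *v a)) - a \<bullet> (\<Gamma> *v a)\<bar> < \<eta>" if "x \<in> B" "k \<ge> k0" "norm (x - \<theta>s) < d" for x k
    using imp[OF d(2) k0] that B_D by (simp add: dist_norm flip: scaleR_matrix_vector_assoc)
  then show ?thesis using d(1) by blast
qed

text \<open>The scaled covariance forms lie in this closed interval, hence so does their limit. They
  are evaluated at \<open>\<theta>s\<close> itself, which the joint limit includes.\<close>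

lemma \<Gamma>_bound: "0 \<le> a \<bullet> (\<Gamma> *v a)" "a \<bullet> (\<Gamma> *v a) \<le> (norm a)\<^sup>2 * CT"
proof -
  have close: "\<exists>u. 0 \<le> u \<and> u \<le> (norm a)\<^sup>2 * CT \<and> \<bar>u - a \<bullet> (\<Gamma> *v a)\<bar> < \<eta>" if "\<eta> > 0" for \<eta>
  proof -
    obtain d k0 where "d > 0" "\<forall>x\<in>B. \<forall>k\<ge>k0. norm (x - \<theta>s) < d \<longrightarrow> \<bar>M ^ k * (a \<bullet> (cov k x *v a)) - a \<bullet> (\<Gamma> *v a)\<bar> < \<eta>"
      using cov_form_limit[OF \<open>\<eta> > 0\<close>] by blast
    then have "\<bar>M ^ Suc k0 * (a \<bullet> (cov (Suc k0) \<theta>s *v a)) - a \<bullet> (\<Gamma> *v a)\<bar> < \<eta>"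
      using \<theta>s_B by (elim ballE[of _ _ \<theta>s] allE[of _ "Suc k0"]) auto
    then show ?thesis
      using cov_scaled[OF \<theta>s_B, of "Suc k0" a] by (intro exI[of _ "M ^ Suc k0 * (a \<bullet> (cov (Suc k0) \<theta>s *v a))"]) auto
  qed
  show "0 \<le> a \<bullet> (\<Gamma> *v a)"
    using close[of "- (a \<bullet> (\<Gamma> *v a))"] by force
  show "a \<bullet> (\<Gamma> *v a) \<le> (norm a)\<^sup>2 * CT"
    using close[of "a \<bullet> (\<Gamma> *v a) - (norm a)\<^sup>2 * CT"] by force
qed

lemma \<Gamma>_sym: "transpose \<Gamma> = \<Gamma>"
proof -
  have lim: "((\<lambda>(x, k). M ^ k *\<^sub>R cov k x) \<longlongrightarrow> \<Gamma>) (joint_limit D \<theta>s)"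
    using var unfolding var_condition_def cov_def .
  \<comment> \<open>Uniqueness of limits needs a nontrivial filter; \<open>\<theta>s\<close> lies in
    D, so the filter is proper.\<close>
  have nt: "joint_limit D \<theta>s \<noteq> bot"
  proof
    assume "joint_limit D \<theta>s = bot"
    then have "eventually (\<lambda>_. False) (joint_limit D \<theta>s)" by simp
    then obtain Pf Pg where "eventually Pf (inf (nhds \<theta>s) (principal D))" "eventually Pg sequentially"
      "\<And>x k. Pf x \<Longrightarrow> Pg k \<Longrightarrow> False"
      unfolding joint_limit_def eventually_prod_filter by auto
    then show False
      using \<theta>s_D eventually_nhds_x_imp_x[of _ \<theta>s] eventually_happens'[of sequentially Pg]
      unfolding eventually_inf_principal by (metis sequentially_bot)
  qed
  have entry: "((\<lambda>p. (case p of (x, k) \<Rightarrow> M ^ k *\<^sub>R cov k x) $ i $ j) \<longlongrightarrow> \<Gamma> $ i $ j) (joint_limit D \<theta>s)" for i j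
    by (intro tendsto_vec_nth lim)
  have "\<Gamma> $ i $ j = \<Gamma> $ j $ i" for i j
  proof (rule tendsto_unique[OF nt entry])
    have "eventually (\<lambda>x. x \<in> D \<and> x \<in> B) (inf (nhds \<theta>s) (principal D))"
      unfolding eventually_inf_principal using eventually_nhds_in_open[of B \<theta>s] \<theta>s_B
      by (auto elim: eventually_mono)
    moreover have "eventually (\<lambda>k. k \<ge> (1::nat)) sequentially" by (rule eventually_ge_at_top)
    ultimately have "eventually (\<lambda>(x, k). x \<in> B \<and> k \<ge> (1::nat)) (joint_limit D \<theta>s)"
      unfolding joint_limit_def eventually_prod_filter by (intro exI[of _ "\<lambda>x. x \<in> D \<and> x \<in> B"] exI[of _ "\<lambda>k. k \<ge> 1"]) auto
    then have "eventually (\<lambda>p. (case p of (x, k) \<Rightarrow> M ^ k *\<^sub>R cov k x) $ j $ i = (case p of (x, k) \<Rightarrow> M ^ k *\<^sub>R cov k x) $ i $ j) (joint_limit D \<theta>s)"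
    proof (rule eventually_mono)
      fix p :: "(real^'d) \<times> nat" assume "case p of (x, k) \<Rightarrow> x \<in> B \<and> k \<ge> 1"
      then obtain x k where p: "p = (x, k)" "x \<in> B" "k \<ge> 1" by (cases p) auto
      show "(case p of (x, k) \<Rightarrow> M ^ k *\<^sub>R cov k x) $ j $ i = (case p of (x, k) \<Rightarrow> M ^ k *\<^sub>R cov k x) $ i $ j"
        using arg_cong[OF dev_form(5)[OF p(2,3)], of "\<lambda>G. G $ i $ j"] by (simp add: p(1) transpose_def)
    qed
    from tendsto_cong[OF this, THEN iffD1, OF entry]
    show "((\<lambda>p. (case p of (x, k) \<Rightarrow> M ^ k *\<^sub>R cov k x) $ i $ j) \<longlongrightarrow> \<Gamma> $ j $ i) (joint_limit D \<theta>s)" .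
  qed
  then show ?thesis by (simp add: transpose_def vec_eq_iff)
qed

text \<open>The relative variance is an average over the levels of rounded covariance forms. The
  error terms have separate origins: the finitely many coarse levels give 1 / s_n, parameters far
  from \<open>\<theta>s\<close> give the squared distance, rounding gives M^s_n / K_n, and all the
  rest is within \<eta>. The bound is linear in the squared distance, so its mean is controlled by
  \<open>err\<close>.\<close>

lemma step_var_ratio_bound:
  assumes "\<eta> > 0"
  shows "\<exists>K. 0 \<le> K \<and> (\<forall>n\<ge>1. \<forall>x\<in>B. \<bar>step_var a n x / vrate n - a \<bullet> (\<Gamma> *v a)\<bar> \<le>
    \<eta> + K * (1 / real (s n) + (wnorm x)\<^sup>2 + 1 / (samples n / M powr real (s n))))"
proof -
  obtain d k0 where d: "d > 0" and k0: "\<And>x k. x \<in> B \<Longrightarrow> k \<ge> k0 \<Longrightarrow> norm (x - \<theta>s) < d \<Longrightarrow>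
    \<bar>M ^ k * (a \<bullet> (cov k x *v a)) - a \<bullet> (\<Gamma> *v a)\<bar> < \<eta>"
    using cov_form_limit[OF assms, of a] by blast
  define A where "A = (norm a)\<^sup>2 * CT"
  define K where "K = A * (real k0 + 1 / d\<^sup>2 + 1)"
  have A: "0 \<le> A" using CT by (simp add: A_def)
  have bound: "\<bar>step_var a n x / vrate n - a \<bullet> (\<Gamma> *v a)\<bar> \<le>
    \<eta> + K * (1 / real (s n) + (wnorm x)\<^sup>2 + 1 / (samples n / M powr real (s n)))" if n: "n \<ge> 1" and x: "x \<in> B" for n x
  proof -
    let ?s2 = "a \<bullet> (\<Gamma> *v a)" and ?K = "samples n"
    let ?u = "\<lambda>k. M ^ k * (a \<bullet> (cov k x *v a))"
    let ?t = "\<lambda>k. ?K * M powr (- real k) / real (Nk n k)"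
    have K0: "?K > 0" by (rule samples_pos[OF n])
    have s0: "real (s n) > 0" using s1 n by force
    have u: "0 \<le> ?u k" "?u k \<le> A" if "k \<ge> 1" for k
      using cov_scaled[OF x that, of a] by (auto simp: A_def)
    have s2: "0 \<le> ?s2" "?s2 \<le> A" using \<Gamma>_bound[of a] by (auto simp: A_def)
    \<comment> \<open>\<open>?t k\<close> is the intended over the rounded sample number. They
      differ by less than one sample, which in relative terms matters most on the finest
      level.\<close>
    have t: "\<bar>1 - ?t k\<bar> \<le> M powr real (s n) / ?K" if "k \<in> {1..s n}" for k
    proof -
      have N: "real (Nk n k) > 0" using Nk_pos[OF n, of k] by simp
      let ?x = "?K * M powr (- real k)"
      have x0: "?x > 0" using K0 M by simp
      have ge: "?x \<le> real (Nk n k)" by (rule Nk_ge)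
      have lt: "real (Nk n k) < ?x + 1"
        unfolding Nk_def level_samples_def using x0 by linarith
      have "\<bar>1 - ?t k\<bar> = (real (Nk n k) - ?x) / real (Nk n k)"
        using N ge by (simp add: field_simps)
      also have "\<dots> \<le> 1 / real (Nk n k)"
        using N lt by (intro divide_right_mono) auto
      also have "\<dots> \<le> 1 / ?x"
        using x0 ge by (intro divide_left_mono mult_pos_pos[OF N]) auto
      also have "\<dots> = M powr real k / ?K"
        using K0 M by (simp add: powr_minus field_simps)
      also have "\<dots> \<le> M powr real (s n) / ?K"
        using that M K0 by (intro divide_right_mono powr_mono) auto
      finally show ?thesis .
    qed
    have ratio: "step_var a n x / vrate n = (\<Sum>k=1..s n. ?t k * ?u k) / real (s n)"
    proof -
      have "1 / real (Nk n k) * (a \<bullet> (cov k x *v a)) = ?t k * ?u k / ?K" for k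
      proof -
        have "M powr (- real k) * M ^ k = 1" using M by (simp add: powr_minus powr_realpow)
        then have "?t k * ?u k / ?K = (M powr (- real k) * M ^ k) * (1 / real (Nk n k) * (a \<bullet> (cov k x *v a)))"
          using K0 by simp
        then show ?thesis using \<open>M powr (- real k) * M ^ k = 1\<close> by simp
      qed
      then have "step_var a n x = (\<Sum>k=1..s n. ?t k * ?u k) / ?K"
        by (simp only: step_var_def sum_divide_distrib)
      then show ?thesis using K0 by (simp add: vrate_def)
    qed
    have eq: "step_var a n x / vrate n - ?s2 = (\<Sum>k=1..s n. ?t k * ?u k - ?s2) / real (s n)"
    proof -
      have "(\<Sum>k=1..m. h k) / real m - z = (\<Sum>k=1..m. h k - z) / real m" if "real m > 0" for h :: "nat \<Rightarrow> real" and m z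
        using that by (simp add: sum_subtractf diff_divide_distrib)
      from this[OF s0] show ?thesis unfolding ratio .
    qed
    have entry: "\<bar>?t k * ?u k - ?s2\<bar> \<le> (\<eta> + A * ((wnorm x)\<^sup>2 / d\<^sup>2) + A * (M powr real (s n) / ?K)) + (if k < k0 then A else 0)"
      if k: "k \<in> {1..s n}" for k
    proof -
      have split: "\<bar>y * z - e\<bar> \<le> \<bar>z - e\<bar> + \<bar>1 - y\<bar> * z" if "0 \<le> z" for y z e :: real
      proof -
        have "y * z - e = (z - e) - (1 - y) * z" by (simp add: algebra_simps)
        then have "\<bar>y * z - e\<bar> \<le> \<bar>z - e\<bar> + \<bar>(1 - y) * z\<bar>" using abs_triangle_ineq4[of "z - e" "(1 - y) * z"] by simp
        then show ?thesis using that by (simp add: abs_mult)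
      qed
      have k': "k \<ge> 1" using k by simp
      have i1: "\<bar>?t k * ?u k - ?s2\<bar> \<le> \<bar>?u k - ?s2\<bar> + \<bar>1 - ?t k\<bar> * ?u k"
        by (rule split[OF u(1)[OF k']])
      have i2: "\<bar>1 - ?t k\<bar> * ?u k \<le> (M powr real (s n) / ?K) * A"
        by (rule mult_mono[OF t[OF k] u(2)[OF k']]) (use K0 u(1)[OF k'] in auto)
      have i3: "\<bar>?u k - ?s2\<bar> \<le> \<eta> + A * ((wnorm x)\<^sup>2 / d\<^sup>2) + (if k < k0 then A else 0)"
      proof (cases "k < k0")
        case True
        have "\<bar>?u k - ?s2\<bar> \<le> A" using u[OF k'] s2 by linarith
        then show ?thesis using True A assms by (simp add: add_nonneg_nonneg add_increasing)
      next
        case False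
        show ?thesis
        proof (cases "norm (x - \<theta>s) < d")
          case True
          then have "\<bar>?u k - ?s2\<bar> \<le> \<eta>" using k0[OF x, of k] False by simp
          then show ?thesis using False A by (simp add: add_increasing2)
        next
          \<comment> \<open>Far from \<open>\<theta>s\<close> the trivial bound A is paid for by the
            squared distance, as in Chebyshev's inequality.\<close>
          case far: False
          have "\<bar>?u k - ?s2\<bar> \<le> A * 1" using u[OF k'] s2 by linarith
          also have "\<dots> \<le> A * ((wnorm x)\<^sup>2 / d\<^sup>2)"
          proof (rule mult_left_mono[OF _ A])
            have "d\<^sup>2 \<le> (wnorm x)\<^sup>2"
              using far norm_le_wnorm[of x] d by (intro power_mono) auto
            then show "1 \<le> (wnorm x)\<^sup>2 / d\<^sup>2" using d by simp
          qed
          finally show ?thesis using False assms by simp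
        qed
      qed
      show ?thesis
        using i1 i2 i3 mult.commute[of A "M powr real (s n) / ?K"] by linarith
    qed
    define h where "h k = ?t k * ?u k - ?s2" for k
    have "\<bar>\<Sum>k=1..s n. h k\<bar> \<le> (\<Sum>k=1..s n. \<bar>h k\<bar>)" by (rule sum_abs)
    also have "\<dots> \<le> (\<Sum>k=1..s n. (\<eta> + A * ((wnorm x)\<^sup>2 / d\<^sup>2) + A * (M powr real (s n) / ?K)) + (if k < k0 then A else 0))"
      unfolding h_def by (intro sum_mono entry)
    also have "\<dots> = real (s n) * (\<eta> + A * ((wnorm x)\<^sup>2 / d\<^sup>2) + A * (M powr real (s n) / ?K)) + (\<Sum>k=1..s n. if k < k0 then A else 0)"
      by (simp add: sum.distrib)
    finally have sum_le: "\<bar>\<Sum>k=1..s n. h k\<bar> \<le> \<dots>" .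
    have init: "(\<Sum>k=1..s n. if k < k0 then A else 0) \<le> real k0 * A"
    proof -
      have "(\<Sum>k=1..s n. if k < k0 then A else 0) = (\<Sum>k\<in>{1..s n} \<inter> {k. k < k0}. A)"
        using sum.inter_restrict[of "{1..s n}" "\<lambda>_. A" "{k. k < k0}"]
        by (simp only: mem_Collect_eq finite_atLeastAtMost simp_thms)
      also have "\<dots> \<le> (\<Sum>k<k0. A)"
        using A by (intro sum_mono2) auto
      finally show ?thesis by simp
    qed
    have "\<bar>\<Sum>k=1..s n. h k\<bar> \<le> real (s n) * (\<eta> + A * ((wnorm x)\<^sup>2 / d\<^sup>2) + A * (M powr real (s n) / ?K)) + real k0 * A"
      using sum_le init by linarith
    then have "\<bar>step_var a n x / vrate n - ?s2\<bar> \<le> (real (s n) * (\<eta> + A * ((wnorm x)\<^sup>2 / d\<^sup>2) + A * (M powr real (s n) / ?K)) + real k0 * A) / real (s n)"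
      unfolding eq abs_divide h_def using s0 by (simp add: divide_right_mono)
    also have "\<dots> = \<eta> + (A * (1 / d\<^sup>2) * (wnorm x)\<^sup>2 + A * 1 * (1 / (?K / M powr real (s n))) + A * real k0 * (1 / real (s n)))"
      using s0 by (simp add: add_divide_distrib)
    also have "\<dots> \<le> \<eta> + (K * (wnorm x)\<^sup>2 + K * (1 / (?K / M powr real (s n))) + K * (1 / real (s n)))"
      unfolding K_def using A K0 d s0
      by (intro add_left_mono add_mono mult_right_mono mult_left_mono) auto
    finally show ?thesis by (simp add: algebra_simps)
  qed
  have "0 \<le> K" using A by (simp add: K_def)
  then show ?thesis using bound by blast
qed

lemma err_null: "err N \<longlonglongrightarrow> 0"
proof -
  obtain p where p: "0 < p" "p < \<psi> + \<phi>" using rate_exists by blast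
  have "(\<lambda>k. real k powr - p) \<longlonglongrightarrow> 0" using p by real_asymp
  then have "(\<lambda>k. real k powr - p) \<in> o(\<lambda>_. 1 :: real)" by (intro smalloI_tendsto) auto
  with err_rate[OF p, of N] have "err N \<in> o(\<lambda>_. 1 :: real)" by (rule landau_o.big_small_trans)
  then show ?thesis using smalloD_tendsto[of "err N" sequentially "\<lambda>_. 1"] by simp
qed

lemma step_var_hat_rv: "(\<lambda>\<omega>. step_var a n (hat N k \<omega>)) \<in> borel_measurable (Fil k)"
  by (rule measurable_compose[OF hat_meas step_var_meas])

definition var_gap where "var_gap a N k = (\<integral>\<omega>. \<bar>step_var a (Suc k) (hat N k \<omega>) / vrate (Suc k) - a \<bullet> (\<Gamma> *v a)\<bar> \<partial>P)"

lemma var_gap_int: "integrable P (\<lambda>\<omega>. \<bar>step_var a (Suc k) (hat N k \<omega>) / vrate (Suc k) - a \<bullet> (\<Gamma> *v a)\<bar>)"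
proof (rule integrable_const_bound[of _ "(norm a)\<^sup>2 * CT"])
  have v: "vrate (Suc k) > 0" by (rule vrate_pos) simp
  have "0 \<le> step_var a (Suc k) (hat N k \<omega>) / vrate (Suc k)" "step_var a (Suc k) (hat N k \<omega>) / vrate (Suc k) \<le> (norm a)\<^sup>2 * CT" for \<omega>
    using step_var_nonneg[OF hat_B, of a "Suc k" N k \<omega>] step_var_le[OF hat_B, of "Suc k" a N k \<omega>] v by (auto simp: pos_divide_le_eq)
  then have "\<bar>step_var a (Suc k) (hat N k \<omega>) / vrate (Suc k) - a \<bullet> (\<Gamma> *v a)\<bar> \<le> (norm a)\<^sup>2 * CT" for \<omega>
    using \<Gamma>_bound[of a] by (smt (verit))
  then show "AE \<omega> in P. norm \<bar>step_var a (Suc k) (hat N k \<omega>) / vrate (Suc k) - a \<bullet> (\<Gamma> *v a)\<bar> \<le> (norm a)\<^sup>2 * CT"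
    by simp
  have [measurable]: "(\<lambda>\<omega>. step_var a (Suc k) (hat N k \<omega>)) \<in> borel_measurable P"
    by (rule Fil_P[OF step_var_hat_rv])
  show "(\<lambda>\<omega>. \<bar>step_var a (Suc k) (hat N k \<omega>) / vrate (Suc k) - a \<bullet> (\<Gamma> *v a)\<bar>) \<in> borel_measurable P"
    by measurable
qed

lemma var_gap_null: "var_gap a N \<longlonglongrightarrow> 0"
proof (rule LIMSEQ_I)
  fix r :: real assume r: "r > 0"
  have "r / 2 > 0" using r by simp
  from step_var_ratio_bound[OF this, of a] obtain K where K: "0 \<le> K \<and> (\<forall>n\<ge>1. \<forall>x\<in>B. \<bar>step_var a n x / vrate n - a \<bullet> (\<Gamma> *v a)\<bar> \<le>
    r / 2 + K * (1 / real (s n) + (wnorm x)\<^sup>2 + 1 / (samples n / M powr real (s n))))"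
    by (elim exE)
  let ?b = "\<lambda>k. r / 2 + K * (1 / real (s (Suc k)) + err N k + 1 / (samples (Suc k) / M powr real (s (Suc k))))"
  have le: "var_gap a N k \<le> ?b k" for k
  proof -
    have "var_gap a N k \<le> (\<integral>\<omega>. r / 2 + K * (1 / real (s (Suc k)) + (wnorm (hat N k \<omega>))\<^sup>2 + 1 / (samples (Suc k) / M powr real (s (Suc k)))) \<partial>P)"
      unfolding var_gap_def
    proof (rule integral_mono[OF var_gap_int])
      show "integrable P (\<lambda>\<omega>. r / 2 + K * (1 / real (s (Suc k)) + (wnorm (hat N k \<omega>))\<^sup>2 + 1 / (samples (Suc k) / M powr real (s (Suc k)))))"
        using wnorm_int[of N k] by auto
      fix \<omega>
      show "\<bar>step_var a (Suc k) (hat N k \<omega>) / vrate (Suc k) - a \<bullet> (\<Gamma> *v a)\<bar> \<le> r / 2 + K * (1 / real (s (Suc k)) + (wnorm (hat N k \<omega>))\<^sup>2 + 1 / (samples (Suc k) / M powr real (s (Suc k))))"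
        using K hat_B[of N k \<omega>] by auto
    qed
    also have "\<dots> = ?b k"
      using wnorm_int[of N k] by (simp add: err_def prob_space)
    finally show ?thesis .
  qed
  have "(\<lambda>k. 1 / real (s (Suc k))) \<longlonglongrightarrow> 0"
    by (rule tendsto_divide_0[OF tendsto_const filterlim_at_top_imp_at_infinity[OF filterlim_compose[OF filterlim_real_sequentially filterlim_compose[OF s_at_top filterlim_Suc]]]])
  moreover have "(\<lambda>k. 1 / (samples (Suc k) / M powr real (s (Suc k)))) \<longlonglongrightarrow> 0"
    by (rule tendsto_divide_0[OF tendsto_const filterlim_at_top_imp_at_infinity[OF filterlim_compose[OF samples_ratio_at_top filterlim_Suc]]])
  ultimately have lim: "?b \<longlonglongrightarrow> r / 2 + K * (0 + 0 + 0)"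
    by (intro tendsto_intros err_null)
  have "eventually (\<lambda>k. ?b k < r) sequentially"
    by (rule order_tendstoD(2)[OF lim]) (use r in simp)
  then obtain k0 where "\<And>k. k \<ge> k0 \<Longrightarrow> ?b k < r" unfolding eventually_sequentially by blast
  moreover have "0 \<le> var_gap a N k" for k unfolding var_gap_def by simp
  ultimately show "\<exists>no. \<forall>k\<ge>no. norm (var_gap a N k - 0) < r"
    using le by (intro exI[of _ k0]) (auto intro: le_less_trans)
qed

definition var_weight where "var_weight k = (wt k)\<^sup>2 * vrate (Suc k)"

lemma var_weight_nonneg: "0 \<le> var_weight k" by (simp add: var_weight_def vrate_nonneg)

lemma total_var_var_weight: "total_var n = (\<Sum>k=1..n. var_weight k)" by (simp add: total_var_def var_weight_def)

text \<open>Toeplitz's lemma: averages of a null sequence with weights of divergent sum tend to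
  0.\<close>

lemma weighted_null:
  assumes "u \<longlonglongrightarrow> 0"
  shows "(\<lambda>n. (\<Sum>k=1..n. var_weight k * u k) / total_var n) \<longlonglongrightarrow> 0"
proof -
  have "(\<lambda>k. var_weight k * u k) \<in> o(\<lambda>k. var_weight k * 1)"
    by (intro landau_o.small.mult_left smalloI_tendsto) (use assms in auto)
  then have "(\<lambda>k. var_weight k * u k) \<in> o(var_weight)" by simp
  then have "(\<lambda>n. \<Sum>k=1..n. var_weight k * u k) \<in> o(\<lambda>n. \<Sum>k=1..n. var_weight k)"
  proof (rule sum_smallo_sum)
    show "filterlim (\<lambda>n. \<Sum>k=1..n. var_weight k) at_top sequentially"
      using total_var_at_top unfolding total_var_var_weight[abs_def] .
  qed (rule var_weight_nonneg)
  then show ?thesis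
    unfolding total_var_var_weight by (rule smalloD_tendsto)
qed

end

context mlsa_local
begin

section \<open>Limit law of the weighted noise, jointly with past events\<close>

definition martingale where "martingale a N n \<omega> = (\<Sum>k=1..n. wt k * (a \<bullet> noise (Suc k) (hat N k \<omega>) (sample_block (Suc k) \<omega>)))"

lemma noise_comp: "(\<lambda>p. noise (Suc k) (hat N k (fst p)) (snd p)) \<in> borel_measurable (Fil k \<Otimes>\<^sub>M block_space (Suc k))"
proof -
  have "(\<lambda>p. (hat N k (fst p), snd p)) \<in> measurable (Fil k \<Otimes>\<^sub>M block_space (Suc k)) (param_space \<Otimes>\<^sub>M block_space (Suc k))"
    by (intro measurable_Pair measurable_compose[OF measurable_fst hat_meas] measurable_snd)
  from measurable_compose[OF this noise_meas[of "Suc k"]] show ?thesis by simp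
qed

lemma sample_block_Fil: "sample_block (Suc k) \<in> measurable (Fil (Suc k)) (block_space (Suc k))"
  unfolding sample_block_def[abs_def]
  by (intro measurable_restrict Fil_sample) (auto simp: past_def block_def)

lemma noise_hat_Fil: "(\<lambda>\<omega>. noise (Suc k) (hat N k \<omega>) (sample_block (Suc k) \<omega>)) \<in> borel_measurable (Fil (Suc k))"
proof -
  have id: "(\<lambda>\<omega>. \<omega>) \<in> measurable (Fil (Suc k)) (Fil k)"
    using Fil_up[of "\<lambda>\<omega>. \<omega>" k "Fil k" "Suc k"] by simp
  have "(\<lambda>\<omega>. (\<omega>, sample_block (Suc k) \<omega>)) \<in> measurable (Fil (Suc k)) (Fil k \<Otimes>\<^sub>M block_space (Suc k))"
    by (intro measurable_Pair sample_block_Fil id)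
  from measurable_compose[OF this noise_comp] show ?thesis by simp
qed

text \<open>Testing with bounded functions of the past replaces conditional expectation. Freezing
  the past leaves the characteristic function at a fixed parameter, where \<open>noise_char\<close>
  applies.\<close>

lemma conditional_char:
  assumes g: "g \<in> borel_measurable (Fil k)" and gB: "\<And>\<omega>. cmod (g \<omega>) \<le> K"
  shows "cmod (\<integral>\<omega>. g \<omega> * (cis (a \<bullet> noise (Suc k) (hat N k \<omega>) (sample_block (Suc k) \<omega>)) - of_real (exp (- step_var a (Suc k) (hat N k \<omega>) / 2))) \<partial>P)
    \<le> K * (2 * (norm a powr q * CT powr (q / 2) * vrate (Suc k) * lyapunov_sum (Suc k)))"
proof -
  let ?R = "2 * (norm a powr q * CT powr (q / 2) * vrate (Suc k) * lyapunov_sum (Suc k))"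
  let ?h = "\<lambda>p. g (fst p) * (cis (a \<bullet> noise (Suc k) (hat N k (fst p)) (snd p)) - of_real (exp (- step_var a (Suc k) (hat N k (fst p)) / 2)))"
  have K: "0 \<le> K" by (rule order_trans[OF norm_ge_zero gB[of undefined]])
  have m1: "(\<lambda>p. a \<bullet> noise (Suc k) (hat N k (fst p)) (snd p)) \<in> borel_measurable (Fil k \<Otimes>\<^sub>M block_space (Suc k))"
    by (intro borel_measurable_inner borel_measurable_const noise_comp)
  have m2: "(\<lambda>p. step_var a (Suc k) (hat N k (fst p))) \<in> borel_measurable (Fil k \<Otimes>\<^sub>M block_space (Suc k))"
    by (rule measurable_compose[OF measurable_fst step_var_hat_rv])
  have m3: "(\<lambda>p. complex_of_real (exp (- step_var a (Suc k) (hat N k (fst p)) / 2))) \<in> borel_measurable (Fil k \<Otimes>\<^sub>M block_space (Suc k))"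
    by (rule measurable_compose[OF m2, of "\<lambda>v. complex_of_real (exp (- v / 2))"])
      (intro borel_measurable_continuous_onI continuous_intros, auto)
  have m4: "(\<lambda>p. g (fst p)) \<in> borel_measurable (Fil k \<Otimes>\<^sub>M block_space (Suc k))"
    by (rule measurable_compose[OF measurable_fst g])
  have m5: "(\<lambda>p. cis (a \<bullet> noise (Suc k) (hat N k (fst p)) (snd p))) \<in> borel_measurable (Fil k \<Otimes>\<^sub>M block_space (Suc k))"
    by (rule measurable_compose[OF m1 measurable_cis])
  have hm: "?h \<in> borel_measurable (Fil k \<Otimes>\<^sub>M block_space (Suc k))"
    by (rule borel_measurable_times[OF m4 borel_measurable_diff[OF m5 m3]])
  have hB: "cmod (?h p) \<le> K * 2" for p
  proof -
    have "cmod (cis (a \<bullet> noise (Suc k) (hat N k (fst p)) (snd p)) - of_real (exp (- step_var a (Suc k) (hat N k (fst p)) / 2))) \<le>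
      1 + \<bar>exp (- step_var a (Suc k) (hat N k (fst p)) / 2)\<bar>"
      by (rule order_trans[OF norm_triangle_ineq4]) (simp only: norm_cis norm_of_real order_refl)
    also have "\<dots> \<le> 2" using step_var_nonneg[OF hat_B, of a "Suc k" N k "fst p"] by simp
    finally show ?thesis unfolding norm_mult using gB[of "fst p"] K by (intro mult_mono) auto
  qed
  have R0: "0 \<le> ?R"
    by (rule order_trans[OF norm_ge_zero noise_char[OF _ \<theta>s_B, of "Suc k" a]]) simp
  have inner_le: "cmod (\<integral>\<omega>'. ?h (\<omega>, sample_block (Suc k) \<omega>') \<partial>P) \<le> K * ?R" for \<omega>
  proof -
    define x where "x = hat N k \<omega>"
    have x: "x \<in> B" unfolding x_def by (rule hat_B)
    define z where "z \<omega>' = a \<bullet> noise (Suc k) x (sample_block (Suc k) \<omega>')" for \<omega>'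
    have zm: "z \<in> borel_measurable P"
    proof -
      have "(\<lambda>\<omega>'. summand a (Suc k) x j (sample j \<omega>')) \<in> borel_measurable P" if "j \<in> sample_idx (Suc k)" for j
        using measurable_compose[OF sample_rv summand_meas[OF that B_D[OF x]]] that sample_idx_sub[of "Suc k"] by auto
      then have "(\<lambda>\<omega>'. \<Sum>j\<in>sample_idx (Suc k). summand a (Suc k) x j (sample j \<omega>')) \<in> borel_measurable P"
        by (rule borel_measurable_sum)
      moreover have "z = (\<lambda>\<omega>'. \<Sum>j\<in>sample_idx (Suc k). summand a (Suc k) x j (sample j \<omega>'))"
        unfolding z_def by (intro ext noise_sample_block[OF _ x]) simp
      ultimately show ?thesis by simp
    qed
    have ci: "integrable P (\<lambda>\<omega>'. cis (z \<omega>'))"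
      by (rule integrable_const_bound[of _ 1]) (use measurable_compose[OF zm measurable_cis] in auto)
    define e where "e = complex_of_real (exp (- step_var a (Suc k) x / 2))"
    have "(\<integral>\<omega>'. g \<omega> * (cis (z \<omega>') - e) \<partial>P) = g \<omega> * ((\<integral>\<omega>'. cis (z \<omega>') \<partial>P) - e)"
      using ci by (simp add: prob_space)
    moreover have "cmod ((\<integral>\<omega>'. cis (z \<omega>') \<partial>P) - e) \<le> ?R"
      unfolding z_def e_def by (rule noise_char[OF _ x]) simp
    ultimately have "cmod (\<integral>\<omega>'. g \<omega> * (cis (z \<omega>') - e) \<partial>P) \<le> K * ?R"
      using mult_mono[OF gB _ K norm_ge_zero] by (simp only: norm_mult)
    then show ?thesis
      unfolding fst_conv snd_conv z_def e_def x_def .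
  qed
  have frozen: "(\<integral>\<omega>. ?h (\<omega>, sample_block (Suc k) \<omega>) \<partial>P) = (\<integral>\<omega>. (\<integral>\<omega>'. ?h (\<omega>, sample_block (Suc k) \<omega>') \<partial>P) \<partial>P)"
    by (rule integral_freeze[OF Fil_indep hm hB])
  have "cmod (\<integral>\<omega>. (\<integral>\<omega>'. ?h (\<omega>, sample_block (Suc k) \<omega>') \<partial>P) \<partial>P) \<le> (\<integral>\<omega>. cmod (\<integral>\<omega>'. ?h (\<omega>, sample_block (Suc k) \<omega>') \<partial>P) \<partial>P)"
    by (rule integral_norm_bound)
  moreover have "(\<integral>\<omega>. cmod (\<integral>\<omega>'. ?h (\<omega>, sample_block (Suc k) \<omega>') \<partial>P) \<partial>P) \<le> (\<integral>\<omega>. K * ?R \<partial>P)"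
    by (rule integral_mono'[OF _ inner_le]) (use K R0 in \<open>simp_all only: integrable_const mult_nonneg_nonneg\<close>)
  moreover have "(\<integral>\<omega>. K * ?R \<partial>P) = K * ?R" by (simp add: prob_space)
  ultimately have "cmod (\<integral>\<omega>. ?h (\<omega>, sample_block (Suc k) \<omega>) \<partial>P) \<le> K * ?R"
    unfolding frozen by linarith
  then show ?thesis unfolding fst_conv snd_conv .
qed

end

context mlsa_local
begin

definition lyapunov_decay where "lyapunov_decay j = (samples (Suc j) / M powr real (s (Suc j))) powr (- (q / 2 - 1))"

lemma lyapunov_decay_null: "lyapunov_decay \<longlonglongrightarrow> 0"
proof -
  have "filterlim (\<lambda>j. samples (Suc j) / M powr real (s (Suc j))) at_top sequentially"
    by (rule filterlim_compose[OF samples_ratio_at_top filterlim_Suc])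
  then show ?thesis
    unfolding lyapunov_decay_def[abs_def] by (rule tendsto_neg_powr[rotated]) (use q in simp)
qed

lemma var_weight_le_total_var: "j \<in> {1..n} \<Longrightarrow> var_weight j \<le> total_var n"
  unfolding total_var_var_weight by (rule member_le_sum) (auto simp: var_weight_nonneg)

lemma var_weight_pos: "j \<ge> 1 \<Longrightarrow> var_weight j > 0"
  unfolding var_weight_def wt_def using vrate_pos[of "Suc j"] by simp

lemma total_var_pos: "n \<ge> 1 \<Longrightarrow> total_var n > 0"
  using var_weight_le_total_var[of 1 n] var_weight_pos[of 1] by simp

text \<open>Put X = wt^2 / \<open>total_var\<close>. Since at least one level is sampled, wt^2 / K
  is at most the variance weight, so X \<le> K. Hence X^(q/2-1) is cancelled by the factor
  K^(-(q/2-1)) of \<open>lyapunov_sum\<close>, and a weight of total mass 1 times a null sequence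
  remains.\<close>

lemma lindeberg_term:
  assumes "j \<in> {1..n}"
  shows "(wt j / sqrt (total_var n)) powr q * vrate (Suc j) * lyapunov_sum (Suc j) \<le> var_weight j / total_var n * lyapunov_decay j"
proof -
  define K where "K = samples (Suc j)"
  define X where "X = (wt j)\<^sup>2 / total_var n"
  have K: "K > 0" unfolding K_def by (rule samples_pos) simp
  have cs: "total_var n > 0" using assms by (intro total_var_pos) auto
  have wt: "wt j > 0" using assms by (simp add: wt_def)
  have X: "X > 0" using wt cs by (simp add: X_def)
  have "X \<le> K"
  proof -
    have s: "real (s (Suc j)) \<ge> 1" using s1 by (metis Suc_eq_plus1 le_add2 of_nat_1 of_nat_le_iff)
    have "(wt j)\<^sup>2 / K \<le> var_weight j"
      unfolding var_weight_def vrate_def K_def[symmetric] using s K mult_left_mono[OF s, of "(wt j)\<^sup>2"]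
      by (simp add: divide_right_mono)
    also have "\<dots> \<le> total_var n" by (rule var_weight_le_total_var[OF assms])
    finally show ?thesis using K cs by (simp add: X_def field_simps)
  qed
  have "wt j / sqrt (total_var n) = X powr (1 / 2)"
    using wt cs by (simp add: X_def powr_half_sqrt real_sqrt_divide)
  then have "(wt j / sqrt (total_var n)) powr q = X powr (1 / 2 * q)"
    by (simp only: powr_powr)
  also have "\<dots> = X powr 1 * X powr (q / 2 - 1)"
    unfolding powr_add[symmetric] by simp
  also have "\<dots> = X * X powr (q / 2 - 1)" using X by simp
  finally have e1: "(wt j / sqrt (total_var n)) powr q = X * X powr (q / 2 - 1)" .
  have "X powr (q / 2 - 1) \<le> K powr (q / 2 - 1)"
    using \<open>X \<le> K\<close> X q by (intro powr_mono2) auto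
  then have "X powr (q / 2 - 1) * K powr (- (q / 2 - 1)) \<le> K powr (q / 2 - 1) * K powr (- (q / 2 - 1))"
    by (rule mult_right_mono) simp
  also have "\<dots> = 1" using K by (simp flip: powr_add)
  finally have le1: "X powr (q / 2 - 1) * K powr (- (q / 2 - 1)) \<le> 1" .
  have "(wt j / sqrt (total_var n)) powr q * vrate (Suc j) * lyapunov_sum (Suc j) =
    (X powr (q / 2 - 1) * K powr (- (q / 2 - 1))) * (X * vrate (Suc j) * lyapunov_decay j)"
    unfolding e1 lyapunov_sum_def lyapunov_decay_def K_def by (simp only: mult_ac)
  also have "\<dots> \<le> 1 * (X * vrate (Suc j) * lyapunov_decay j)"
    using X vrate_nonneg[of "Suc j"] by (intro mult_right_mono le1 mult_nonneg_nonneg) (auto simp: lyapunov_decay_def)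
  also have "\<dots> = var_weight j / total_var n * lyapunov_decay j"
    by (simp add: X_def var_weight_def)
  finally show ?thesis .
qed

text \<open>The factor \<kappa> is carried along because the normalisation in the theorem agrees
  with sqrt(\<open>total_var\<close>) only asymptotically.\<close>

lemma noise_clt_past:
  assumes \<kappa>: "\<kappa> \<longlonglongrightarrow> 1" and A: "A \<in> past_events"
  shows "(\<lambda>n. \<integral>\<omega>. indicator A \<omega> *\<^sub>R cis (\<kappa> n * (martingale a N n \<omega> / sqrt (total_var n))) \<partial>P) \<longlonglongrightarrow>
    prob A *\<^sub>R complex_of_real (exp (- (a \<bullet> (\<Gamma> *v a)) / 2))"
proof -
  obtain m where m: "A \<in> sets (Fil (Suc m))" using A unfolding Fil_Suc_past by blast
  obtain Kb where Kb: "\<And>n. \<bar>\<kappa> n\<bar> \<le> Kb" "Kb > 0"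
    using convergent_imp_Bseq[OF convergentI[OF \<kappa>]] unfolding Bseq_def by auto
  define A0 where "A0 = (norm a)\<^sup>2 * CT"
  have A0: "0 \<le> A0" using CT by (simp add: A0_def)
  define s2 where "s2 = a \<bullet> (\<Gamma> *v a)"
  define r where "r n j = \<kappa> n * (wt j / sqrt (total_var n))" for n j
  define \<xi> where "\<xi> n k \<omega> = (r n (Suc k) *\<^sub>R a) \<bullet> noise (Suc (Suc k)) (hat N (Suc k) \<omega>) (sample_block (Suc (Suc k)) \<omega>)" for n k \<omega>
  define v where "v n k \<omega> = step_var (r n (Suc k) *\<^sub>R a) (Suc (Suc k)) (hat N (Suc k) \<omega>)" for n k \<omega>
  define \<rho>' where "\<rho>' n k = 2 * (norm (r n (Suc k) *\<^sub>R a) powr q * CT powr (q / 2) * vrate (Suc (Suc k)) * lyapunov_sum (Suc (Suc k)))" for n k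
  have sum_\<xi>: "(\<Sum>k<n. \<xi> n k \<omega>) = \<kappa> n * (martingale a N n \<omega> / sqrt (total_var n))" for n \<omega>
    unfolding \<xi>_def r_def martingale_def
    by (simp add: sum_distrib_left sum_divide_distrib mult_ac sum.atLeast1_atMost_eq)
  have wr: "var_weight j = (wt j)\<^sup>2 * vrate (Suc j)" for j by (rule var_weight_def)
  have vr: "vrate (Suc j) > 0" for j by (rule vrate_pos) simp
  have rsq: "(r n j)\<^sup>2 = (\<kappa> n)\<^sup>2 * ((wt j)\<^sup>2 / total_var n)" for n j
    by (simp add: r_def power_mult_distrib power_divide total_var_nonneg)
  define z where "z j \<omega> = step_var a (Suc j) (hat N j \<omega>) / vrate (Suc j)" for j \<omega>
  have z: "0 \<le> z j \<omega>" "z j \<omega> \<le> A0" for j \<omega>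
    using step_var_nonneg[OF hat_B, of a "Suc j" N j \<omega>] step_var_le[OF hat_B, of "Suc j" a N j \<omega>] vr[of j]
    by (auto simp: z_def A0_def pos_divide_le_eq)
  have v_eq: "v n k \<omega> = (\<kappa> n)\<^sup>2 * (var_weight (Suc k) * z (Suc k) \<omega> / total_var n)" for n k \<omega>
    unfolding v_def step_var_scaleR rsq wr z_def using vr[of "Suc k"] by simp
  have sum_v: "(\<Sum>k<n. v n k \<omega>) = (\<kappa> n)\<^sup>2 * ((\<Sum>j=1..n. var_weight j * z j \<omega>) / total_var n)" for n \<omega>
    unfolding v_eq by (simp add: sum_distrib_left sum_divide_distrib sum.atLeast1_atMost_eq)
  have vm: "v n k \<in> borel_measurable (Fil (Suc k))" for n k
    unfolding v_def by (rule step_var_hat_rv)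
  have \<xi>m: "\<xi> n k \<in> borel_measurable (Fil (Suc (Suc k)))" for n k
    unfolding \<xi>_def by (intro borel_measurable_inner borel_measurable_const noise_hat_Fil)
  have Kb2: "(\<kappa> n)\<^sup>2 \<le> Kb\<^sup>2" for n
    using power_mono[OF Kb(1)[of n], of 2] by simp
  show ?thesis
    unfolding sum_\<xi>[symmetric] s2_def[symmetric]
  proof (rule predictable_array_clt[where Fil = "\<lambda>k. Fil (Suc k)" and v = v and C = "Kb\<^sup>2 * A0" and \<rho> = \<rho>' and m = m])
    show "subalgebra P (Fil (Suc k))" for k by (rule Fil_sub)
    show "sets (Fil (Suc j)) \<subseteq> sets (Fil (Suc k))" if "j \<le> k" for j k by (rule Fil_mono) (use that in simp)
    show "\<xi> n k \<in> borel_measurable (Fil (Suc (Suc k)))" for n k by (rule \<xi>m)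
    show "v n k \<in> borel_measurable (Fil (Suc k))" for n k by (rule vm)
    show "0 \<le> v n k \<omega>" for n k \<omega> unfolding v_def by (rule step_var_nonneg[OF hat_B])
    show "(\<Sum>k<n. v n k \<omega>) \<le> Kb\<^sup>2 * A0" for n \<omega>
    proof -
      have "(\<Sum>j=1..n. var_weight j * z j \<omega>) \<le> (\<Sum>j=1..n. var_weight j * A0)"
        using z var_weight_nonneg by (intro sum_mono mult_left_mono) auto
      also have "\<dots> = total_var n * A0" by (simp add: total_var_var_weight sum_distrib_right)
      finally have "(\<Sum>j=1..n. var_weight j * z j \<omega>) / total_var n \<le> A0"
        using A0 total_var_nonneg[of n] by (cases "total_var n = 0") (auto simp: pos_divide_le_eq mult.commute)
      then show ?thesis
        unfolding sum_v using Kb2[of n] z var_weight_nonneg total_var_nonneg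
        by (intro mult_mono) (auto intro!: divide_nonneg_nonneg sum_nonneg mult_nonneg_nonneg)
    qed
    show "cmod (\<integral>\<omega>. g \<omega> * (cis (\<xi> n k \<omega>) - of_real (exp (- v n k \<omega> / 2))) \<partial>P) \<le> B' * \<rho>' n k"
      if "g \<in> borel_measurable (Fil (Suc k))" "\<And>\<omega>. cmod (g \<omega>) \<le> B'" for n k g B'
      unfolding \<xi>_def v_def \<rho>'_def by (rule conditional_char[OF that])
    show \<rho>0: "0 \<le> \<rho>' n k" for n k
      unfolding \<rho>'_def lyapunov_sum_def using vrate_nonneg by (intro mult_nonneg_nonneg) auto
    show "(\<lambda>n. \<Sum>k<n. \<rho>' n k) \<longlonglongrightarrow> 0"
    proof (rule Lim_null_comparison)
      let ?c = "2 * (norm a powr q * CT powr (q / 2) * Kb powr q)"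
      show "(\<lambda>n. ?c * ((\<Sum>j=1..n. var_weight j * lyapunov_decay j) / total_var n)) \<longlonglongrightarrow> 0"
        using tendsto_mult_left[OF weighted_null[OF lyapunov_decay_null], of ?c] by simp
      have "(\<Sum>k<n. \<rho>' n k) \<le> ?c * ((\<Sum>j=1..n. var_weight j * lyapunov_decay j) / total_var n)" for n
      proof -
        have le: "\<rho>' n k \<le> ?c * (var_weight (Suc k) * lyapunov_decay (Suc k) / total_var n)" if "k < n" for k
        proof -
          have "norm (r n (Suc k) *\<^sub>R a) = norm a * (\<bar>\<kappa> n\<bar> * (wt (Suc k) / sqrt (total_var n)))"
            using total_var_nonneg[of n] by (simp add: r_def abs_mult wt_def)
          then have "norm (r n (Suc k) *\<^sub>R a) powr q = norm a powr q * (\<bar>\<kappa> n\<bar> powr q * (wt (Suc k) / sqrt (total_var n)) powr q)"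
            by (simp only: powr_mult)
          also have "\<dots> \<le> norm a powr q * (Kb powr q * (wt (Suc k) / sqrt (total_var n)) powr q)"
            using Kb q by (intro mult_left_mono mult_right_mono powr_mono2) auto
          finally have "\<rho>' n k \<le> 2 * ((norm a powr q * (Kb powr q * (wt (Suc k) / sqrt (total_var n)) powr q)) * CT powr (q / 2) * vrate (Suc (Suc k)) * lyapunov_sum (Suc (Suc k)))"
            unfolding \<rho>'_def lyapunov_sum_def using vrate_nonneg by (intro mult_left_mono mult_right_mono) auto
          also have "\<dots> = ?c * ((wt (Suc k) / sqrt (total_var n)) powr q * vrate (Suc (Suc k)) * lyapunov_sum (Suc (Suc k)))"
            by (simp only: mult_ac)
          also have "\<dots> \<le> ?c * (var_weight (Suc k) / total_var n * lyapunov_decay (Suc k))"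
            by (intro mult_left_mono lindeberg_term) (use that in auto)
          finally show ?thesis by simp
        qed
        have "(\<Sum>k<n. \<rho>' n k) \<le> (\<Sum>k<n. ?c * (var_weight (Suc k) * lyapunov_decay (Suc k) / total_var n))"
          by (intro sum_mono le) simp
        also have "\<dots> = ?c * ((\<Sum>j=1..n. var_weight j * lyapunov_decay j) / total_var n)"
          by (simp add: sum_distrib_left sum_divide_distrib sum.atLeast1_atMost_eq)
        finally show ?thesis .
      qed
      then show "eventually (\<lambda>n. norm (\<Sum>k<n. \<rho>' n k) \<le> ?c * ((\<Sum>j=1..n. var_weight j * lyapunov_decay j) / total_var n)) sequentially"
        using \<rho>0 by (intro always_eventually) (simp add: sum_nonneg)
    qed
    have inv0: "(\<lambda>n. wt j / sqrt (total_var n)) \<longlonglongrightarrow> 0" for j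
    proof -
      have "filterlim (\<lambda>n. sqrt (total_var n)) at_top sequentially"
        by (rule filterlim_compose[OF sqrt_at_top total_var_at_top])
      then show ?thesis
        by (intro tendsto_divide_0[OF tendsto_const] filterlim_at_top_imp_at_infinity)
    qed
    have r0: "(\<lambda>n. r n j) \<longlonglongrightarrow> 0" for j
      unfolding r_def using tendsto_mult[OF \<kappa> inv0[of j]] by simp
    show "(\<lambda>n. \<xi> n k \<omega>) \<longlonglongrightarrow> 0" for k \<omega>
      unfolding \<xi>_def inner_scaleR_left by (rule tendsto_mult_left_zero[OF r0])
    show "(\<lambda>n. v n k \<omega>) \<longlonglongrightarrow> 0" for k \<omega>
      unfolding v_def step_var_scaleR using tendsto_mult_right[OF tendsto_power[OF r0[of "Suc k"], of 2]] by simp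
    show "A \<in> sets (Fil (Suc m))" by (rule m)
    show "(\<lambda>n. \<integral>\<omega>. \<bar>(\<Sum>k<n. v n k \<omega>) - s2\<bar> \<partial>P) \<longlonglongrightarrow> 0"
    proof (rule Lim_null_comparison)
      \<comment> \<open>The first term is the weighted average of the L1 errors of the relative
        variances, the second the error of replacing \<kappa>^2 by 1.\<close>
      let ?u = "\<lambda>n. (\<kappa> n)\<^sup>2 * ((\<Sum>j=1..n. var_weight j * var_gap a N j) / total_var n) + \<bar>(\<kappa> n)\<^sup>2 - 1\<bar> * \<bar>s2\<bar>"
      have "?u \<longlonglongrightarrow> 1\<^sup>2 * 0 + \<bar>1\<^sup>2 - 1\<bar> * \<bar>s2\<bar>"
        by (intro tendsto_intros \<kappa> weighted_null var_gap_null)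
      then show "?u \<longlonglongrightarrow> 0" by simp
      show "eventually (\<lambda>n. norm (\<integral>\<omega>. \<bar>(\<Sum>k<n. v n k \<omega>) - s2\<bar> \<partial>P) \<le> ?u n) sequentially"
        using eventually_ge_at_top[of 1]
      proof eventually_elim
        case (elim n)
        have cs: "total_var n > 0" by (rule total_var_pos[OF elim])
        let ?g = "\<lambda>\<omega>. (\<kappa> n)\<^sup>2 * ((\<Sum>j=1..n. var_weight j * \<bar>z j \<omega> - s2\<bar>) / total_var n) + \<bar>(\<kappa> n)\<^sup>2 - 1\<bar> * \<bar>s2\<bar>"
        have zi: "integrable P (\<lambda>\<omega>. \<bar>z j \<omega> - s2\<bar>)" for j
          unfolding z_def s2_def by (rule var_gap_int)
        have gi: "integrable P ?g"
          by (intro Bochner_Integration.integrable_add integrable_mult_right integrable_divide Bochner_Integration.integrable_sum zi) auto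
        have pt: "\<bar>(\<Sum>k<n. v n k \<omega>) - s2\<bar> \<le> ?g \<omega>" for \<omega>
        proof -
          have "(\<Sum>j=1..n. var_weight j * z j \<omega>) = (\<Sum>j=1..n. var_weight j * (z j \<omega> - s2)) + total_var n * s2"
            by (simp add: total_var_var_weight sum_distrib_right right_diff_distrib sum_subtractf)
          then have "(\<Sum>k<n. v n k \<omega>) - s2 = (\<kappa> n)\<^sup>2 * ((\<Sum>j=1..n. var_weight j * (z j \<omega> - s2)) / total_var n) + ((\<kappa> n)\<^sup>2 - 1) * s2"
            unfolding sum_v using cs by (simp add: add_divide_distrib algebra_simps)
          then have "\<bar>(\<Sum>k<n. v n k \<omega>) - s2\<bar> \<le> \<bar>(\<kappa> n)\<^sup>2 * ((\<Sum>j=1..n. var_weight j * (z j \<omega> - s2)) / total_var n)\<bar> + \<bar>((\<kappa> n)\<^sup>2 - 1) * s2\<bar>"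
            by (simp only: abs_triangle_ineq)
          also have "\<dots> \<le> ?g \<omega>"
          proof (intro add_mono)
            have "\<bar>\<Sum>j=1..n. var_weight j * (z j \<omega> - s2)\<bar> \<le> (\<Sum>j=1..n. var_weight j * \<bar>z j \<omega> - s2\<bar>)"
              by (rule order_trans[OF sum_abs]) (simp add: abs_mult var_weight_nonneg)
            then show "\<bar>(\<kappa> n)\<^sup>2 * ((\<Sum>j=1..n. var_weight j * (z j \<omega> - s2)) / total_var n)\<bar> \<le> (\<kappa> n)\<^sup>2 * ((\<Sum>j=1..n. var_weight j * \<bar>z j \<omega> - s2\<bar>) / total_var n)"
              using cs unfolding abs_mult abs_divide by (auto intro!: mult_left_mono divide_right_mono)
            show "\<bar>((\<kappa> n)\<^sup>2 - 1) * s2\<bar> \<le> \<bar>(\<kappa> n)\<^sup>2 - 1\<bar> * \<bar>s2\<bar>" by (simp add: abs_mult)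
          qed
          finally show ?thesis .
        qed
        have "(\<integral>\<omega>. \<bar>(\<Sum>k<n. v n k \<omega>) - s2\<bar> \<partial>P) \<le> (\<integral>\<omega>. ?g \<omega> \<partial>P)"
          by (rule integral_mono'[OF gi pt order_trans[OF abs_ge_zero pt]])
        also have "(\<integral>\<omega>. ?g \<omega> \<partial>P) = ?u n"
        proof -
          have "(\<integral>\<omega>. (\<Sum>j=1..n. var_weight j * \<bar>z j \<omega> - s2\<bar>) \<partial>P) = (\<Sum>j=1..n. var_weight j * var_gap a N j)"
            using zi by (simp add: Bochner_Integration.integral_sum var_gap_def z_def s2_def)
          moreover have "integrable P (\<lambda>\<omega>. \<Sum>j=1..n. var_weight j * \<bar>z j \<omega> - s2\<bar>)"
            by (intro Bochner_Integration.integrable_sum integrable_mult_right zi)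
          ultimately show ?thesis by (simp add: prob_space)
        qed
        finally show ?case by simp
      qed
    qed
  qed
qed

lemma martingale_rv [measurable]: "martingale a N n \<in> borel_measurable P"
  unfolding martingale_def
  by (intro borel_measurable_sum borel_measurable_times borel_measurable_const borel_measurable_inner Fil_P[OF noise_hat_Fil])

text \<open>The limit is the same constant for all past events, so \<open>mixing_extension\<close>
  carries it to the convergence event.\<close>

lemma noise_clt:
  assumes \<kappa>: "\<kappa> \<longlonglongrightarrow> 1"
  shows "(\<lambda>n. \<integral>\<omega>. indicator conv \<omega> *\<^sub>R cis (\<kappa> n * (martingale a N n \<omega> / sqrt (total_var n))) \<partial>P) \<longlonglongrightarrow>
    prob conv *\<^sub>R complex_of_real (exp (- (a \<bullet> (\<Gamma> *v a)) / 2))"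
proof (rule mixing_extension[OF past_events_Int_stable past_events_sub space_past_events])
  show "(\<lambda>\<omega>. cis (\<kappa> n * (martingale a N n \<omega> / sqrt (total_var n)))) \<in> borel_measurable P" for n
    by measurable
  show "cmod (complex_of_real (exp (- (a \<bullet> (\<Gamma> *v a)) / 2))) \<le> 1"
    using \<Gamma>_bound(1)[of a] by simp
qed (use noise_clt_past[OF \<kappa>] conv_past in auto)

end

subsection \<open>Linearisation of the recursion\<close>

lemma summation_by_parts:
  fixes d y :: "nat \<Rightarrow> real"
  assumes "d 0 = 0"
  shows "(\<Sum>k=1..n. d k * (y (Suc k) - y k)) = d n * y (Suc n) - (\<Sum>k=1..n. (d k - d (k - 1)) * y k)"
  by (induction n) (auto simp: assms algebra_simps)

text \<open>The increments of k^r (k+1)^p, split by the product rule into an increment of each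
  factor. This gains a factor 1/k over the weights themselves, which is the point of summing by
  parts.\<close>

lemma weight_increment_bound:
  fixes r p :: real
  assumes p: "p > 0"
  shows "(\<lambda>k. real k powr r / real (Suc k) powr (- p) - real (k - 1) powr r / real (Suc (k - 1)) powr (- p)) \<in> O(\<lambda>k. real k powr (r + p - 1))"
proof -
  have 1: "(\<lambda>k::nat. real k powr r * ((real k + 1) powr p - real k powr p)) \<in> O(\<lambda>k. real k powr (r + p - 1))"
    using p by real_asymp
  have "(\<lambda>k::nat. real k powr r - (real k - 1) powr r) \<in> O(\<lambda>k. real k powr (r - 1))"
  \<comment> \<open>For r = 0 the difference vanishes eventually, so its leading term is no longer r
    k^(r-1).\<close>
  proof (cases r "0::real" rule: linorder_cases)
    case less then show ?thesis by real_asymp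
  next
    case equal
    have "eventually (\<lambda>k::nat. norm (real k powr r - (real k - 1) powr r) \<le> 1 * norm (real k powr (r - 1))) sequentially"
      using eventually_gt_at_top[of 1] by eventually_elim (simp add: equal)
    then show ?thesis by (rule bigoI)
  next
    case greater then show ?thesis by real_asymp
  qed
  then have "(\<lambda>k::nat. real k powr p * (real k powr r - (real k - 1) powr r)) \<in> O(\<lambda>k. real k powr p * real k powr (r - 1))"
    by (rule landau_o.big.mult_left)
  then have 2: "(\<lambda>k::nat. real k powr p * (real k powr r - (real k - 1) powr r)) \<in> O(\<lambda>k. real k powr (r + p - 1))"
    by (simp flip: powr_add add: algebra_simps)
  show ?thesis
  proof (rule landau_o.big.in_cong[THEN iffD1, OF _ sum_in_bigo(1)[OF 1 2]])
    show "eventually (\<lambda>k. real k powr r * ((real k + 1) powr p - real k powr p) + real k powr p * (real k powr r - (real k - 1) powr r) =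
      real k powr r / real (Suc k) powr (- p) - real (k - 1) powr r / real (Suc (k - 1)) powr (- p)) sequentially"
      using eventually_gt_at_top[of 1]
      by eventually_elim (simp add: powr_minus_divide of_nat_diff algebra_simps)
  qed
qed

context mlsa_local
begin

definition drift_weight where "drift_weight k = wt k / step_size (Suc k)"
text \<open>Deviation of the mean increment from the linear drift: bias plus Taylor remainder. The
  guard makes the bias bound valid for every k and changes only finitely many terms.\<close>

definition remainder where "remainder N k \<omega> = (if k1 \<le> s (Suc k) then level_mean (s (Suc k)) (hat N k \<omega>) - H *v (hat N k \<omega> - \<theta>s) else 0)"
text \<open>Everything but the noise, after the increments of the iterates have been summed by
  parts.\<close>

definition rest_term where "rest_term a N n \<omega> = (\<Sum>k=1..n. wt k * (a \<bullet> remainder N k \<omega>)) - drift_weight n * (a \<bullet> (hat N (Suc n) \<omega> - \<theta>s))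
  + (\<Sum>k=1..n. (drift_weight k - drift_weight (k - 1)) * (a \<bullet> (hat N k \<omega> - \<theta>s)))"

text \<open>Testing the recursion with a, where a . H y = -(t . y), expresses t . (\<theta>_k -
  \<theta>s) by noise, remainder and increment. The identity is exact once the path stays and the
  levels are fine enough; the finitely many earlier terms give a constant that depends on the
  path.\<close>

lemma linearised_sum:
  assumes aH: "\<And>y. a \<bullet> (H *v y) = - (t \<bullet> y)" and stay: "\<And>k. k \<ge> N \<Longrightarrow> \<theta> k \<omega> \<in> B"
  shows "\<exists>K. \<forall>n. \<bar>t \<bullet> (\<Sum>k=1..n. wt k *\<^sub>R (\<theta> k \<omega> - \<theta>s)) - martingale a N n \<omega> - rest_term a N n \<omega>\<bar> \<le> K"
proof -
  define y where "y k = a \<bullet> (hat N k \<omega> - \<theta>s)" for k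
  define D where "D k = a \<bullet> noise (Suc k) (hat N k \<omega>) (sample_block (Suc k) \<omega>)" for k
  define e where "e k = t \<bullet> (wt k *\<^sub>R (\<theta> k \<omega> - \<theta>s)) - wt k * D k - wt k * (a \<bullet> remainder N k \<omega>) + drift_weight k * (y (Suc k) - y k)" for k
  have "eventually (\<lambda>n. k1 \<le> s n) sequentially"
    using s_at_top unfolding filterlim_at_top by blast
  then obtain k2 where k2: "\<And>n. n \<ge> k2 \<Longrightarrow> k1 \<le> s n"
    unfolding eventually_sequentially by blast
  define N' where "N' = max N k2"
  have e0: "e k = 0" if "k \<ge> N'" for k
  proof -
    have k: "N \<le> k" "k1 \<le> s (Suc k)" using that k2[of "Suc k"] by (auto simp: N'_def)
    have st: "stay N (Suc k) \<omega>" using stay by (auto simp: stay_def)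
    note S = stay_Suc[OF k(1) st]
    have g: "step_size (Suc k) > 0" by (simp add: step_size_def)
    have "y (Suc k) - y k = a \<bullet> (\<theta> (Suc k) \<omega> - \<theta> k \<omega>)"
      unfolding y_def S(2,3) by (simp add: inner_diff_right)
    also have "\<dots> = step_size (Suc k) * (a \<bullet> est (Suc k) (\<theta> k \<omega>) (sample_block (Suc k) \<omega>))"
      by (subst S(4)) simp
    also have "a \<bullet> est (Suc k) (\<theta> k \<omega>) (sample_block (Suc k) \<omega>) = D k + a \<bullet> remainder N k \<omega> - t \<bullet> (\<theta> k \<omega> - \<theta>s)"
      using k unfolding D_def remainder_def noise_def S(2) by (simp add: inner_diff_right inner_add_right aH)
    finally have *: "y (Suc k) - y k = step_size (Suc k) * (D k + a \<bullet> remainder N k \<omega> - t \<bullet> (\<theta> k \<omega> - \<theta>s))" .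
    have "drift_weight k * (y (Suc k) - y k) = wt k * (D k + a \<bullet> remainder N k \<omega> - t \<bullet> (\<theta> k \<omega> - \<theta>s))"
      unfolding * drift_weight_def using g by simp
    then show ?thesis by (simp add: e_def algebra_simps)
  qed
  have dwt0: "drift_weight 0 = 0" by (simp add: drift_weight_def wt_def)
  have sum_e: "t \<bullet> (\<Sum>k=1..n. wt k *\<^sub>R (\<theta> k \<omega> - \<theta>s)) - martingale a N n \<omega> - rest_term a N n \<omega> = (\<Sum>k=1..n. e k)" for n
  proof -
    have "(\<Sum>k=1..n. e k) = t \<bullet> (\<Sum>k=1..n. wt k *\<^sub>R (\<theta> k \<omega> - \<theta>s)) - martingale a N n \<omega>
       - (\<Sum>k=1..n. wt k * (a \<bullet> remainder N k \<omega>)) + (\<Sum>k=1..n. drift_weight k * (y (Suc k) - y k))"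
      by (simp only: e_def sum.distrib sum_subtractf inner_sum_right martingale_def D_def)
    then show ?thesis unfolding summation_by_parts[of drift_weight, OF dwt0] by (simp add: rest_term_def y_def)
  qed
  \<comment> \<open>Enlarging the range to the maximum of n and N' treats short sums as well; beyond
    N' all terms vanish.\<close>
  have "\<bar>\<Sum>k=1..n. e k\<bar> \<le> (\<Sum>k=1..N'. \<bar>e k\<bar>)" for n
  proof -
    have "\<bar>\<Sum>k=1..n. e k\<bar> \<le> (\<Sum>k=1..n. \<bar>e k\<bar>)" by (rule sum_abs)
    also have "\<dots> \<le> (\<Sum>k=1..max n N'. \<bar>e k\<bar>)" by (rule sum_mono2) auto
    also have "\<dots> = (\<Sum>k=1..N'. \<bar>e k\<bar>)" by (rule sum.mono_neutral_right) (auto simp: e0)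
    finally show ?thesis .
  qed
  then show ?thesis unfolding sum_e by blast
qed

text \<open>Only second moments of the error are controlled, so powers up to 2 follow by Jensen. The
  Taylor remainder needs the power 1 + lam, hence lam \<le> 1.\<close>

lemma hat_moment:
  assumes u: "0 < u" "u \<le> 2"
  shows "integrable P (\<lambda>\<omega>. norm (hat N k \<omega> - \<theta>s) powr u)"
    "(\<integral>\<omega>. norm (hat N k \<omega> - \<theta>s) powr u \<partial>P) \<le> err N k powr (u / 2)"
proof -
  have bd: "wnorm (hat N k \<omega>) powr u \<le> (LS * \<delta>) powr u" for \<omega>
    using wnorm_le[OF hat_B] wnorm_nonneg u by (intro powr_mono2) auto
  have i: "integrable P (\<lambda>\<omega>. wnorm (hat N k \<omega>) powr u)"
    by (rule integrable_const_bound[of _ "(LS * \<delta>) powr u"]) (use bd in auto)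
  have le: "norm (hat N k \<omega> - \<theta>s) powr u \<le> wnorm (hat N k \<omega>) powr u" for \<omega>
    using norm_le_wnorm u by (intro powr_mono2) auto
  show i': "integrable P (\<lambda>\<omega>. norm (hat N k \<omega> - \<theta>s) powr u)"
    by (rule Bochner_Integration.integrable_bound[OF i]) (use le in auto)
  have sq: "(wnorm (hat N k \<omega>) powr u) powr (2 / u) = (wnorm (hat N k \<omega>))\<^sup>2" for \<omega>
    using u wnorm_nonneg by (cases "wnorm (hat N k \<omega>) = 0") (auto simp: powr_powr powr_numeral less_le)
  have "(\<integral>\<omega>. wnorm (hat N k \<omega>) powr u \<partial>P) powr (2 / u) \<le> (\<integral>\<omega>. (wnorm (hat N k \<omega>) powr u) powr (2 / u) \<partial>P)"
    by (rule power_mean(2)) (use u wnorm_int in \<open>auto simp: sq\<close>)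
  then have "(\<integral>\<omega>. wnorm (hat N k \<omega>) powr u \<partial>P) powr (2 / u) \<le> err N k"
    by (simp add: sq err_def)
  then have "((\<integral>\<omega>. wnorm (hat N k \<omega>) powr u \<partial>P) powr (2 / u)) powr (u / 2) \<le> err N k powr (u / 2)"
    using u by (intro powr_mono2) auto
  then have "(\<integral>\<omega>. wnorm (hat N k \<omega>) powr u \<partial>P) \<le> err N k powr (u / 2)"
    using u by (simp add: powr_powr)
  moreover have "(\<integral>\<omega>. norm (hat N k \<omega> - \<theta>s) powr u \<partial>P) \<le> (\<integral>\<omega>. wnorm (hat N k \<omega>) powr u \<partial>P)"
    by (rule integral_mono[OF i' i le])
  ultimately show "(\<integral>\<omega>. norm (hat N k \<omega> - \<theta>s) powr u \<partial>P) \<le> err N k powr (u / 2)" by simp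
qed

lemma hat_inner_moment:
  "integrable P (\<lambda>\<omega>. \<bar>a \<bullet> (hat N k \<omega> - \<theta>s)\<bar>)" "(\<integral>\<omega>. \<bar>a \<bullet> (hat N k \<omega> - \<theta>s)\<bar> \<partial>P) \<le> norm a * err N k powr (1 / 2)"
proof -
  have i: "integrable P (\<lambda>\<omega>. norm a * norm (hat N k \<omega> - \<theta>s))"
    using hat_moment(1)[of 1 N k] by simp
  have le: "\<bar>a \<bullet> (hat N k \<omega> - \<theta>s)\<bar> \<le> norm a * norm (hat N k \<omega> - \<theta>s)" for \<omega>
    by (rule Cauchy_Schwarz_ineq2)
  show i': "integrable P (\<lambda>\<omega>. \<bar>a \<bullet> (hat N k \<omega> - \<theta>s)\<bar>)"
    by (rule Bochner_Integration.integrable_bound[OF i]) (use le in auto)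
  have "(\<integral>\<omega>. \<bar>a \<bullet> (hat N k \<omega> - \<theta>s)\<bar> \<partial>P) \<le> (\<integral>\<omega>. norm a * norm (hat N k \<omega> - \<theta>s) \<partial>P)"
    by (rule integral_mono[OF i' i le])
  also have "\<dots> \<le> norm a * err N k powr (1 / 2)"
    using hat_moment(2)[of 1 N k] by (simp add: mult_left_mono)
  finally show "(\<integral>\<omega>. \<bar>a \<bullet> (hat N k \<omega> - \<theta>s)\<bar> \<partial>P) \<le> norm a * err N k powr (1 / 2)" .
qed

lemma remainder_le:
  "norm (remainder N k \<omega>) \<le> CB * bias (Suc k) + CL * norm (hat N k \<omega> - \<theta>s) powr (1 + lam)"
proof (cases "k1 \<le> s (Suc k)")
  case True
  have e: "remainder N k \<omega> = (level_mean (s (Suc k)) (hat N k \<omega>) - f (hat N k \<omega>)) + (f (hat N k \<omega>) - H *v (hat N k \<omega> - \<theta>s))"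
    using True by (simp add: remainder_def)
  have b: "CB * bias (Suc k) = CB * M powr (- (alphas (s (Suc k)) * real (s (Suc k))))"
    by (simp add: bias_def)
  show ?thesis unfolding e b
    by (rule order_trans[OF norm_triangle_ineq add_mono[OF bias_le[OF hat_B True] taylor(1)[OF hat_B]]])
next
  case False
  then show ?thesis using CB taylor(2) by (simp add: remainder_def bias_def)
qed

lemma remainder_rv [measurable]: "remainder N k \<in> borel_measurable P"
proof -
  have "(\<lambda>\<omega>. level_mean (s (Suc k)) (hat N k \<omega>)) \<in> borel_measurable P"
    by (rule Fil_P[OF measurable_compose[OF hat_meas level_mean_meas]]) (use s1 in auto)
  then show ?thesis unfolding remainder_def by measurable
qed

lemma remainder_moment:
  "integrable P (\<lambda>\<omega>. \<bar>a \<bullet> remainder N k \<omega>\<bar>)"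
  "(\<integral>\<omega>. \<bar>a \<bullet> remainder N k \<omega>\<bar> \<partial>P) \<le> norm a * (CB * bias (Suc k) + CL * err N k powr ((1 + lam) / 2))"
proof -
  let ?g = "\<lambda>\<omega>. norm a * (CB * bias (Suc k) + CL * norm (hat N k \<omega> - \<theta>s) powr (1 + lam))"
  have l: "0 < 1 + lam" "1 + lam \<le> 2" using lam by auto
  have le: "\<bar>a \<bullet> remainder N k \<omega>\<bar> \<le> ?g \<omega>" for \<omega>
    by (rule order_trans[OF Cauchy_Schwarz_ineq2 mult_left_mono[OF remainder_le]]) simp
  have i: "integrable P ?g"
    by (intro integrable_mult_right Bochner_Integration.integrable_add integrable_const hat_moment l)
  show i': "integrable P (\<lambda>\<omega>. \<bar>a \<bullet> remainder N k \<omega>\<bar>)"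
    by (rule Bochner_Integration.integrable_bound[OF i]) (use order_trans[OF le abs_ge_self] in auto)
  have "(\<integral>\<omega>. \<bar>a \<bullet> remainder N k \<omega>\<bar> \<partial>P) \<le> (\<integral>\<omega>. ?g \<omega> \<partial>P)"
    by (rule integral_mono[OF i' i le])
  also have "\<dots> = norm a * (CB * bias (Suc k) + CL * (\<integral>\<omega>. norm (hat N k \<omega> - \<theta>s) powr (1 + lam) \<partial>P))"
    using hat_moment(1)[OF l, of N k] by (simp add: prob_space)
  also have "\<dots> \<le> norm a * (CB * bias (Suc k) + CL * err N k powr ((1 + lam) / 2))"
    by (intro mult_left_mono add_left_mono hat_moment(2) l taylor(2)) simp
  finally show "(\<integral>\<omega>. \<bar>a \<bullet> remainder N k \<omega>\<bar> \<partial>P) \<le> norm a * (CB * bias (Suc k) + CL * err N k powr ((1 + lam) / 2))" .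
qed

lemma rest_term_rv [measurable]: "rest_term a N n \<in> borel_measurable P"
  unfolding rest_term_def by measurable

lemma rest_term_moment:
  "integrable P (\<lambda>\<omega>. \<bar>rest_term a N n \<omega>\<bar>)"
  "(\<integral>\<omega>. \<bar>rest_term a N n \<omega>\<bar> \<partial>P) \<le> norm a * (CB * (\<Sum>k=1..n. wt k * bias (Suc k)) + CL * (\<Sum>k=1..n. wt k * err N k powr ((1 + lam) / 2))
     + \<bar>drift_weight n\<bar> * err N (Suc n) powr (1 / 2) + (\<Sum>k=1..n. \<bar>drift_weight k - drift_weight (k - 1)\<bar> * err N k powr (1 / 2)))"
proof -
  let ?g = "\<lambda>\<omega>. (\<Sum>k=1..n. wt k * \<bar>a \<bullet> remainder N k \<omega>\<bar>) + \<bar>drift_weight n\<bar> * \<bar>a \<bullet> (hat N (Suc n) \<omega> - \<theta>s)\<bar>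
    + (\<Sum>k=1..n. \<bar>drift_weight k - drift_weight (k - 1)\<bar> * \<bar>a \<bullet> (hat N k \<omega> - \<theta>s)\<bar>)"
  have wt: "wt k \<ge> 0" for k by (simp add: wt_def)
  have le: "\<bar>rest_term a N n \<omega>\<bar> \<le> ?g \<omega>" for \<omega>
  proof -
    have "\<bar>\<Sum>k=1..n. wt k * (a \<bullet> remainder N k \<omega>)\<bar> \<le> (\<Sum>k=1..n. wt k * \<bar>a \<bullet> remainder N k \<omega>\<bar>)"
      by (rule order_trans[OF sum_abs]) (simp add: abs_mult wt)
    moreover have "\<bar>\<Sum>k=1..n. (drift_weight k - drift_weight (k - 1)) * (a \<bullet> (hat N k \<omega> - \<theta>s))\<bar> \<le> (\<Sum>k=1..n. \<bar>drift_weight k - drift_weight (k - 1)\<bar> * \<bar>a \<bullet> (hat N k \<omega> - \<theta>s)\<bar>)"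
      by (rule order_trans[OF sum_abs]) (simp add: abs_mult)
    ultimately show ?thesis unfolding rest_term_def using abs_mult[of "drift_weight n" "a \<bullet> (hat N (Suc n) \<omega> - \<theta>s)"] by linarith
  qed
  have i: "integrable P ?g"
    by (intro Bochner_Integration.integrable_add Bochner_Integration.integrable_sum integrable_mult_right hat_inner_moment(1) remainder_moment(1))
  show i': "integrable P (\<lambda>\<omega>. \<bar>rest_term a N n \<omega>\<bar>)"
    by (rule Bochner_Integration.integrable_bound[OF i]) (use order_trans[OF le abs_ge_self] in auto)
  have "(\<integral>\<omega>. \<bar>rest_term a N n \<omega>\<bar> \<partial>P) \<le> (\<integral>\<omega>. ?g \<omega> \<partial>P)"
    by (rule integral_mono[OF i' i le])
  also have "(\<integral>\<omega>. ?g \<omega> \<partial>P) = (\<Sum>k=1..n. wt k * (\<integral>\<omega>. \<bar>a \<bullet> remainder N k \<omega>\<bar> \<partial>P)) + \<bar>drift_weight n\<bar> * (\<integral>\<omega>. \<bar>a \<bullet> (hat N (Suc n) \<omega> - \<theta>s)\<bar> \<partial>P)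
    + (\<Sum>k=1..n. \<bar>drift_weight k - drift_weight (k - 1)\<bar> * (\<integral>\<omega>. \<bar>a \<bullet> (hat N k \<omega> - \<theta>s)\<bar> \<partial>P))"
    using hat_inner_moment(1)[of a] remainder_moment(1)[of a] by simp
  also have "\<dots> \<le> (\<Sum>k=1..n. wt k * (norm a * (CB * bias (Suc k) + CL * err N k powr ((1 + lam) / 2)))) + \<bar>drift_weight n\<bar> * (norm a * err N (Suc n) powr (1 / 2))
    + (\<Sum>k=1..n. \<bar>drift_weight k - drift_weight (k - 1)\<bar> * (norm a * err N k powr (1 / 2)))"
    by (intro add_mono sum_mono mult_left_mono hat_inner_moment(2) remainder_moment(2) wt abs_ge_zero)
  also have "\<dots> = norm a * (CB * (\<Sum>k=1..n. wt k * bias (Suc k)) + CL * (\<Sum>k=1..n. wt k * err N k powr ((1 + lam) / 2))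
     + \<bar>drift_weight n\<bar> * err N (Suc n) powr (1 / 2) + (\<Sum>k=1..n. \<bar>drift_weight k - drift_weight (k - 1)\<bar> * err N k powr (1 / 2)))"
    by (simp add: sum_distrib_left sum.distrib algebra_simps)
  finally show "(\<integral>\<omega>. \<bar>rest_term a N n \<omega>\<bar> \<partial>P) \<le> norm a * (CB * (\<Sum>k=1..n. wt k * bias (Suc k)) + CL * (\<Sum>k=1..n. wt k * err N k powr ((1 + lam) / 2))
     + \<bar>drift_weight n\<bar> * err N (Suc n) powr (1 / 2) + (\<Sum>k=1..n. \<bar>drift_weight k - drift_weight (k - 1)\<bar> * err N k powr (1 / 2)))" .
qed

lemma err_powr_rate:
  assumes p: "0 < p" "p < \<psi> + \<phi>" and u: "u > 0"
  shows "(\<lambda>k. err N k powr u) \<in> O(\<lambda>k. real k powr (- p * u))"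
proof -
  obtain C where C: "C > 0" "eventually (\<lambda>k. norm (err N k) \<le> C * norm (real k powr - p)) sequentially"
    using landau_o.bigE[OF err_rate[OF p, of N]] by blast
  have "eventually (\<lambda>k. norm (err N k powr u) \<le> C powr u * norm (real k powr (- p * u))) sequentially"
    using C(2)
  proof eventually_elim
    case (elim k)
    then have "err N k powr u \<le> (C * real k powr - p) powr u"
      using u err_nonneg by (intro powr_mono2) auto
    then show ?case using C by (simp add: powr_mult powr_powr)
  qed
  then show ?thesis by (rule bigoI)
qed

text \<open>Four terms: the bias is the borderline case treated before, and the other three lose a
  power of n for the chosen p. Convergence in mean is enough for characteristic functions.\<close>

lemma rest_term_null: "(\<lambda>n. (\<integral>\<omega>. \<bar>rest_term a N n \<omega>\<bar> \<partial>P) / sqrt (total_var n)) \<longlonglongrightarrow> 0"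
proof -
  obtain p where p: "0 < p" "2 * \<psi> + \<phi> - 1 < p" "\<phi> + 1 < p * (1 + lam)" "p < \<psi> + \<phi>"
    using rate_exists by blast
  have wtO: "wt \<in> O(\<lambda>k. real k powr \<rho>)" by (simp add: wt_def[abs_def])
  have powr_less: "(\<lambda>k::nat. real k powr x) \<in> o(\<lambda>k. real k powr y)" if "x < y" for x y :: real
    using that by real_asymp
  have l1: "(\<lambda>k. wt k * err N k powr ((1 + lam) / 2)) \<in> o(\<lambda>k. real k powr (expo - 1))"
  proof (rule landau_o.big_small_trans[OF landau_o.big.mult[OF wtO err_powr_rate[OF p(1,4), of "(1 + lam) / 2" N]]])
    show "0 < (1 + lam) / 2" using lam by simp
    \<comment> \<open>Equivalent to \<phi> + 1 < p (1 + lam): the nonlinear part of the drift is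
      negligible.\<close>
    have "\<rho> + - p * ((1 + lam) / 2) < expo - 1" using p(3) by (simp add: expo_def field_simps)
    then show "(\<lambda>k. real k powr \<rho> * real k powr (- p * ((1 + lam) / 2))) \<in> o(\<lambda>k. real k powr (expo - 1))"
      unfolding powr_add[symmetric] by (rule powr_less)
  qed
  \<comment> \<open>Equivalent to 2 \<psi> + \<phi> - 1 < p: the boundary term and the increments
    from summation by parts are negligible.\<close>
  have ex: "\<rho> + \<psi> + - p * (1 / 2) < expo" using p(2) by (simp add: expo_def field_simps)
  have e2: "(\<lambda>k. err N k powr (1 / 2)) \<in> O(\<lambda>k. real k powr (- p * (1 / 2)))"
    by (rule err_powr_rate[OF p(1,4)]) simp
  have "(\<lambda>k. drift_weight k - drift_weight (k - 1)) \<in> O(\<lambda>k. real k powr (\<rho> + \<psi> - 1))"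
    unfolding drift_weight_def wt_def step_size_def by (rule weight_increment_bound) (use \<psi> in simp)
  then have "(\<lambda>k. \<bar>drift_weight k - drift_weight (k - 1)\<bar>) \<in> O(\<lambda>k. real k powr (\<rho> + \<psi> - 1))" by simp
  from landau_o.big.mult[OF this e2]
  have l2: "(\<lambda>k. \<bar>drift_weight k - drift_weight (k - 1)\<bar> * err N k powr (1 / 2)) \<in> o(\<lambda>k. real k powr (expo - 1))"
  proof (rule landau_o.big_small_trans)
    show "(\<lambda>k. real k powr (\<rho> + \<psi> - 1) * real k powr (- p * (1 / 2))) \<in> o(\<lambda>k. real k powr (expo - 1))"
      unfolding powr_add[symmetric] by (rule powr_less) (use ex in simp)
  qed
  have "(\<lambda>n. \<bar>drift_weight n\<bar>) \<in> O(\<lambda>n. real n powr (\<rho> + \<psi>))"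
  proof -
    have "(\<lambda>n::nat. real n powr \<rho> / (real n + 1) powr (- \<psi>)) \<in> O(\<lambda>n. real n powr (\<rho> + \<psi>))" by real_asymp
    then show ?thesis by (simp add: drift_weight_def wt_def step_size_def add.commute)
  qed
  moreover have "(\<lambda>n. err N (Suc n) powr (1 / 2)) \<in> O(\<lambda>n. real n powr (- p * (1 / 2)))"
  proof -
    have "(\<lambda>n. err N (Suc n) powr (1 / 2)) \<in> O(\<lambda>n. real (Suc n) powr (- p * (1 / 2)))"
      by (rule landau_o.big.compose[OF e2 filterlim_Suc])
    also have "(\<lambda>n. real (Suc n) powr (- p * (1 / 2))) \<in> O(\<lambda>n. real n powr (- p * (1 / 2)))"
      using p(1) by real_asymp
    finally show ?thesis .
  qed
  ultimately have "(\<lambda>n. \<bar>drift_weight n\<bar> * err N (Suc n) powr (1 / 2)) \<in> O(\<lambda>n. real n powr (\<rho> + \<psi>) * real n powr (- p * (1 / 2)))"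
    by (rule landau_o.big.mult)
  then have l3: "(\<lambda>n. \<bar>drift_weight n\<bar> * err N (Suc n) powr (1 / 2)) \<in> o(\<lambda>n. real n powr expo)"
  proof (rule landau_o.big_small_trans)
    show "(\<lambda>n. real n powr (\<rho> + \<psi>) * real n powr (- p * (1 / 2))) \<in> o(\<lambda>n. real n powr expo)"
      unfolding powr_add[symmetric] by (rule powr_less[OF ex])
  qed
  have lim: "(\<lambda>n. norm a * (CB * ((\<Sum>k=1..n. wt k * bias (Suc k)) / sqrt (total_var n)) + CL * ((\<Sum>k=1..n. wt k * err N k powr ((1 + lam) / 2)) / sqrt (total_var n))
     + \<bar>drift_weight n\<bar> * err N (Suc n) powr (1 / 2) / sqrt (total_var n) + (\<Sum>k=1..n. \<bar>drift_weight k - drift_weight (k - 1)\<bar> * err N k powr (1 / 2)) / sqrt (total_var n)))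
     \<longlonglongrightarrow> norm a * (CB * 0 + CL * 0 + 0 + 0)"
    by (intro tendsto_mult tendsto_add tendsto_const bias_sum_negligible sum_negligible l1 l2 smallo_power_negligible l3)
  have z: "norm a * (CB * 0 + CL * 0 + 0 + 0) = 0" by simp
  show ?thesis
  proof (rule tendsto_sandwich[OF _ _ tendsto_const lim[unfolded z]])
    show "eventually (\<lambda>n. 0 \<le> (\<integral>\<omega>. \<bar>rest_term a N n \<omega>\<bar> \<partial>P) / sqrt (total_var n)) sequentially"
      by (intro always_eventually allI divide_nonneg_nonneg) (auto simp: total_var_nonneg)
    show "eventually (\<lambda>n. (\<integral>\<omega>. \<bar>rest_term a N n \<omega>\<bar> \<partial>P) / sqrt (total_var n) \<le> norm a * (CB * ((\<Sum>k=1..n. wt k * bias (Suc k)) / sqrt (total_var n)) + CL * ((\<Sum>k=1..n. wt k * err N k powr ((1 + lam) / 2)) / sqrt (total_var n))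
     + \<bar>drift_weight n\<bar> * err N (Suc n) powr (1 / 2) / sqrt (total_var n) + (\<Sum>k=1..n. \<bar>drift_weight k - drift_weight (k - 1)\<bar> * err N k powr (1 / 2)) / sqrt (total_var n))) sequentially"
    proof (intro always_eventually allI)
      fix n
      from divide_right_mono[OF rest_term_moment(2)[of a N n], of "sqrt (total_var n)"] total_var_nonneg
      have d: "(\<integral>\<omega>. \<bar>rest_term a N n \<omega>\<bar> \<partial>P) / sqrt (total_var n) \<le> norm a * (CB * (\<Sum>k=1..n. wt k * bias (Suc k)) + CL * (\<Sum>k=1..n. wt k * err N k powr ((1 + lam) / 2))
     + \<bar>drift_weight n\<bar> * err N (Suc n) powr (1 / 2) + (\<Sum>k=1..n. \<bar>drift_weight k - drift_weight (k - 1)\<bar> * err N k powr (1 / 2))) / sqrt (total_var n)" by simp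
      then show "(\<integral>\<omega>. \<bar>rest_term a N n \<omega>\<bar> \<partial>P) / sqrt (total_var n) \<le> norm a * (CB * ((\<Sum>k=1..n. wt k * bias (Suc k)) / sqrt (total_var n)) + CL * ((\<Sum>k=1..n. wt k * err N k powr ((1 + lam) / 2)) / sqrt (total_var n))
     + \<bar>drift_weight n\<bar> * err N (Suc n) powr (1 / 2) / sqrt (total_var n) + (\<Sum>k=1..n. \<bar>drift_weight k - drift_weight (k - 1)\<bar> * err N k powr (1 / 2)) / sqrt (total_var n))"
        by (simp only: times_divide_eq_right add_divide_distrib[symmetric])
    qed
  qed
qed

end

lemma norm_cis_diff_le: "cmod (cis x - cis y) \<le> \<bar>x - y\<bar>"
proof -
  have "cmod (cis (x - y) - 1) \<le> \<bar>x - y\<bar>"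
    using iexp_approx1[of "x - y" 0] by (simp add: cis_conv_exp)
  moreover have "cis x - cis y = cis y * (cis (x - y) - 1)"
    by (simp add: right_diff_distrib cis_mult)
  ultimately show ?thesis by (simp only: norm_mult norm_cis mult_1)
qed

lemma norm_cis_diff_le_two: "cmod (cis x - cis y) \<le> 2"
  by (rule order_trans[OF norm_triangle_ineq4]) simp

context mlsa_local
begin

section \<open>From the noise to the averaged output on the event of convergence\<close>

definition stays where "stays N = {\<omega> \<in> space P. \<forall>k\<ge>N. \<theta> k \<omega> \<in> B}"

lemma \<theta>_rv [measurable]: "\<theta> k \<in> borel_measurable P"
  by (rule Fil_P[OF \<theta>_borel[OF order_refl]])

lemma stays_event [measurable]: "stays N \<in> sets P"
proof -
  have "stays N = (\<Inter>k\<in>{N..}. \<theta> k -` B \<inter> space P)" by (auto simp: stays_def)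
  also have "\<dots> \<in> sets P"
    by (intro sets.countable_INT' measurable_sets[OF \<theta>_rv]) auto
  finally show ?thesis .
qed

lemma stays_mono: "N \<le> N' \<Longrightarrow> stays N \<subseteq> stays N'"
  unfolding stays_def by auto

lemma conv_stays: "conv \<subseteq> (\<Union>N. stays N)"
proof
  fix \<omega> assume w: "\<omega> \<in> conv"
  then have "(\<lambda>n. \<theta> n \<omega>) \<longlonglongrightarrow> \<theta>s" by (simp add: conv_def)
  then have "eventually (\<lambda>n. \<theta> n \<omega> \<in> B) sequentially"
    by (rule topological_tendstoD) (use \<delta> in auto)
  then show "\<omega> \<in> (\<Union>N. stays N)"
    using w by (auto simp: conv_def stays_def eventually_sequentially)
qed

lemma leave_null: "(\<lambda>N. prob (conv - stays N)) \<longlonglongrightarrow> 0"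
proof -
  have "(\<lambda>N. prob (conv - stays N)) \<longlonglongrightarrow> prob (\<Inter>N. conv - stays N)"
    by (rule finite_Lim_measure_decseq) (use stays_mono in \<open>auto simp: decseq_def\<close>)
  also have "(\<Inter>N. conv - stays N) = {}" using conv_stays by auto
  finally show ?thesis by simp
qed

definition weighted_sum where "weighted_sum t n \<omega> = t \<bullet> (\<Sum>k=1..n. wt k *\<^sub>R (\<theta> k \<omega> - \<theta>s))"

lemma weighted_sum_rv [measurable]: "weighted_sum t n \<in> borel_measurable P"
  unfolding weighted_sum_def by (intro borel_measurable_inner borel_measurable_const borel_measurable_sum borel_measurable_scaleR borel_measurable_diff \<theta>_rv)

text \<open>Three errors: convergent paths that are still outside the ball at some time after N,
  small by the choice of N; the rest term, small in mean; and the pathwise constant of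
  \<open>linearised_sum\<close>, which vanishes after division by the standard deviation.\<close>

lemma char_compare:
  assumes aH: "\<And>y. a \<bullet> (H *v y) = - (t \<bullet> y)" and \<kappa>: "\<kappa> \<longlonglongrightarrow> 1" and \<eta>: "\<eta> > 0"
  shows "\<exists>N. eventually (\<lambda>n. cmod ((\<integral>\<omega>. indicator conv \<omega> *\<^sub>R cis (\<kappa> n * (weighted_sum t n \<omega> / sqrt (total_var n))) \<partial>P) -
    (\<integral>\<omega>. indicator conv \<omega> *\<^sub>R cis (\<kappa> n * (martingale a N n \<omega> / sqrt (total_var n))) \<partial>P)) < \<eta>) sequentially"
proof -
  have "eventually (\<lambda>N. 2 * prob (conv - stays N) < \<eta> / 2) sequentially"
    using order_tendstoD(2)[OF leave_null, of "\<eta> / 4"] \<eta> by (simp add: mult.commute)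
  then obtain N where N: "2 * prob (conv - stays N) < \<eta> / 2"
    unfolding eventually_sequentially by blast
  define \<Delta> where "\<Delta> n \<omega> = weighted_sum t n \<omega> - martingale a N n \<omega> - rest_term a N n \<omega>" for n \<omega>
  have \<Delta>_rv [measurable]: "\<Delta> n \<in> borel_measurable P" for n
    unfolding \<Delta>_def by measurable
  \<comment> \<open>The pathwise constant has no integrable bound. Since values of
    \<open>cis\<close> differ by at most 2, truncation there makes dominated convergence
    applicable.\<close>
  define h where "h n \<omega> = min 2 (\<bar>\<kappa> n\<bar> * \<bar>\<Delta> n \<omega>\<bar> / sqrt (total_var n))" for n \<omega>
  have h_rv [measurable]: "h n \<in> borel_measurable P" for n
    unfolding h_def by measurable
  have h0: "0 \<le> h n \<omega>" "h n \<omega> \<le> 2" for n \<omega>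
    by (auto simp: h_def total_var_nonneg)
  let ?A = "\<lambda>n \<omega>. cis (\<kappa> n * (weighted_sum t n \<omega> / sqrt (total_var n)))"
  let ?M = "\<lambda>n \<omega>. cis (\<kappa> n * (martingale a N n \<omega> / sqrt (total_var n)))"
  let ?g = "\<lambda>n \<omega>. 2 * indicator (conv - stays N) \<omega> + (\<bar>\<kappa> n\<bar> / sqrt (total_var n) * \<bar>rest_term a N n \<omega>\<bar> + indicator (stays N) \<omega> * h n \<omega>)"
  have le: "norm (indicator conv \<omega> *\<^sub>R (?A n \<omega> - ?M n \<omega>)) \<le> ?g n \<omega>" for n \<omega>
  proof (cases "\<omega> \<in> stays N")
    case True
    let ?C = "cis (\<kappa> n * ((weighted_sum t n \<omega> - rest_term a N n \<omega>) / sqrt (total_var n)))"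
    have "cmod (?A n \<omega> - ?C) \<le> \<bar>\<kappa> n * (weighted_sum t n \<omega> / sqrt (total_var n)) - \<kappa> n * ((weighted_sum t n \<omega> - rest_term a N n \<omega>) / sqrt (total_var n))\<bar>"
      by (rule norm_cis_diff_le)
    also have "\<dots> = \<bar>\<kappa> n / sqrt (total_var n) * rest_term a N n \<omega>\<bar>"
      by (simp add: diff_divide_distrib algebra_simps)
    also have "\<dots> = \<bar>\<kappa> n\<bar> / sqrt (total_var n) * \<bar>rest_term a N n \<omega>\<bar>"
      by (simp add: abs_mult total_var_nonneg)
    finally have 1: "cmod (?A n \<omega> - ?C) \<le> \<bar>\<kappa> n\<bar> / sqrt (total_var n) * \<bar>rest_term a N n \<omega>\<bar>" .
    have "cmod (?C - ?M n \<omega>) \<le> \<bar>\<kappa> n * ((weighted_sum t n \<omega> - rest_term a N n \<omega>) / sqrt (total_var n)) - \<kappa> n * (martingale a N n \<omega> / sqrt (total_var n))\<bar>"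
      by (rule norm_cis_diff_le)
    also have "\<dots> = \<bar>\<kappa> n * \<Delta> n \<omega> / sqrt (total_var n)\<bar>"
      by (simp add: \<Delta>_def diff_divide_distrib add_divide_distrib algebra_simps)
    also have "\<dots> = \<bar>\<kappa> n\<bar> * \<bar>\<Delta> n \<omega>\<bar> / sqrt (total_var n)"
      by (simp add: abs_mult total_var_nonneg)
    finally have 2: "cmod (?C - ?M n \<omega>) \<le> h n \<omega>"
      unfolding h_def using norm_cis_diff_le_two by simp
    have "cmod (?A n \<omega> - ?M n \<omega>) \<le> cmod (?A n \<omega> - ?C) + cmod (?C - ?M n \<omega>)"
      using norm_triangle_ineq[of "?A n \<omega> - ?C" "?C - ?M n \<omega>"] by (simp only: diff_add_cancel add_diff_eq)
    then have "cmod (?A n \<omega> - ?M n \<omega>) \<le> \<bar>\<kappa> n\<bar> / sqrt (total_var n) * \<bar>rest_term a N n \<omega>\<bar> + h n \<omega>"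
      using 1 2 by linarith
    moreover have "norm (indicator conv \<omega> *\<^sub>R (?A n \<omega> - ?M n \<omega>)) \<le> cmod (?A n \<omega> - ?M n \<omega>)"
      by (simp add: indicator_def)
    ultimately show ?thesis using True by simp
  next
    case False
    have "norm (indicator conv \<omega> *\<^sub>R (?A n \<omega> - ?M n \<omega>)) \<le> 2 * indicator conv \<omega>"
      using norm_cis_diff_le_two by (simp add: indicator_def)
    moreover have "0 \<le> \<bar>\<kappa> n\<bar> / sqrt (total_var n) * \<bar>rest_term a N n \<omega>\<bar>"
      by (simp add: total_var_nonneg)
    moreover have "indicator (conv - stays N) \<omega> = (indicator conv \<omega> :: real)" "indicator (stays N) \<omega> = (0 :: real)"
      using False by (simp_all add: indicator_def)
    ultimately show ?thesis by simp
  qed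
  have iA: "integrable P (\<lambda>\<omega>. indicator conv \<omega> *\<^sub>R cis (\<kappa> n * (X n \<omega> / sqrt (total_var n))))" if [measurable]: "X n \<in> borel_measurable P" for X :: "nat \<Rightarrow> _ \<Rightarrow> real" and n
    by (rule integrable_const_bound[of _ 1]) (auto simp: indicator_def)
  have ih: "integrable P (\<lambda>\<omega>. indicator (stays N) \<omega> * h n \<omega>)" for n
    by (rule integrable_const_bound[of _ 2]) (use h0 in \<open>auto simp: indicator_def abs_mult\<close>)
  have ind: "integrable P (\<lambda>\<omega>. 2 * indicator (conv - stays N) \<omega> :: real)"
    by (rule integrable_const_bound[of _ 2]) (auto simp: indicator_def)
  have ig: "integrable P (?g n)" for n
    by (intro Bochner_Integration.integrable_add ih ind integrable_mult_right rest_term_moment(1))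
  have bound: "cmod ((\<integral>\<omega>. indicator conv \<omega> *\<^sub>R ?A n \<omega> \<partial>P) - (\<integral>\<omega>. indicator conv \<omega> *\<^sub>R ?M n \<omega> \<partial>P)) \<le>
     2 * prob (conv - stays N) + (\<bar>\<kappa> n\<bar> * ((\<integral>\<omega>. \<bar>rest_term a N n \<omega>\<bar> \<partial>P) / sqrt (total_var n)) + (\<integral>\<omega>. indicator (stays N) \<omega> * h n \<omega> \<partial>P))" for n
  proof -
    have i1: "integrable P (\<lambda>\<omega>. indicator conv \<omega> *\<^sub>R (?A n \<omega> - ?M n \<omega>))"
      unfolding scaleR_diff_right by (intro Bochner_Integration.integrable_diff iA) auto
    have e1: "(\<integral>\<omega>. indicator conv \<omega> *\<^sub>R ?A n \<omega> \<partial>P) - (\<integral>\<omega>. indicator conv \<omega> *\<^sub>R ?M n \<omega> \<partial>P) = (\<integral>\<omega>. indicator conv \<omega> *\<^sub>R (?A n \<omega> - ?M n \<omega>) \<partial>P)"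
      unfolding scaleR_diff_right by (rule Bochner_Integration.integral_diff[symmetric]) (rule iA, simp)+
    have e2: "(\<integral>\<omega>. ?g n \<omega> \<partial>P) = 2 * prob (conv - stays N) + (\<bar>\<kappa> n\<bar> / sqrt (total_var n) * (\<integral>\<omega>. \<bar>rest_term a N n \<omega>\<bar> \<partial>P) + (\<integral>\<omega>. indicator (stays N) \<omega> * h n \<omega> \<partial>P))"
    proof -
      have "(\<integral>\<omega>. ?g n \<omega> \<partial>P) = (\<integral>\<omega>. 2 * indicator (conv - stays N) \<omega> \<partial>P) + (\<integral>\<omega>. \<bar>\<kappa> n\<bar> / sqrt (total_var n) * \<bar>rest_term a N n \<omega>\<bar> + indicator (stays N) \<omega> * h n \<omega> \<partial>P)"
        by (intro Bochner_Integration.integral_add Bochner_Integration.integrable_add ih ind integrable_mult_right rest_term_moment(1))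
      also have "(\<integral>\<omega>. \<bar>\<kappa> n\<bar> / sqrt (total_var n) * \<bar>rest_term a N n \<omega>\<bar> + indicator (stays N) \<omega> * h n \<omega> \<partial>P) = (\<integral>\<omega>. \<bar>\<kappa> n\<bar> / sqrt (total_var n) * \<bar>rest_term a N n \<omega>\<bar> \<partial>P) + (\<integral>\<omega>. indicator (stays N) \<omega> * h n \<omega> \<partial>P)"
        by (intro Bochner_Integration.integral_add ih integrable_mult_right rest_term_moment(1))
      finally show ?thesis by simp
    qed
    show ?thesis unfolding e1
      using norm_integral_le[OF i1 ig[of n] le] unfolding e2 by (simp add: field_simps)
  qed
  have hlim: "(\<lambda>n. \<integral>\<omega>. indicator (stays N) \<omega> * h n \<omega> \<partial>P) \<longlonglongrightarrow> (\<integral>\<omega>. 0 \<partial>P)"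
  proof (rule integral_dominated_convergence[where w="\<lambda>_. 2"])
    show "AE \<omega> in P. (\<lambda>n. indicator (stays N) \<omega> * h n \<omega>) \<longlonglongrightarrow> 0"
    proof (intro AE_I2)
      fix \<omega>
      show "(\<lambda>n. indicator (stays N) \<omega> * h n \<omega>) \<longlonglongrightarrow> 0"
      proof (cases "\<omega> \<in> stays N")
        case True
        then obtain K where K: "\<And>n. \<bar>\<Delta> n \<omega>\<bar> \<le> K"
          using linearised_sum[OF aH, of N \<omega>] unfolding \<Delta>_def weighted_sum_def stays_def by auto
        have "filterlim (\<lambda>n. sqrt (total_var n)) at_top sequentially"
          by (rule filterlim_compose[OF sqrt_at_top total_var_at_top])
        then have klim: "(\<lambda>n. \<bar>\<kappa> n\<bar> * K / sqrt (total_var n)) \<longlonglongrightarrow> 0"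
          by (intro tendsto_divide_0[OF tendsto_mult[OF tendsto_rabs[OF \<kappa>] tendsto_const]] filterlim_at_top_imp_at_infinity)
        have "(\<lambda>n. h n \<omega>) \<longlonglongrightarrow> 0"
        proof (rule tendsto_sandwich[OF _ _ tendsto_const klim])
          show "eventually (\<lambda>n. 0 \<le> h n \<omega>) sequentially" using h0 by simp
          show "eventually (\<lambda>n. h n \<omega> \<le> \<bar>\<kappa> n\<bar> * K / sqrt (total_var n)) sequentially"
            unfolding h_def
            by (intro always_eventually allI min.coboundedI2 divide_right_mono mult_left_mono K) (auto simp: total_var_nonneg)
        qed
        then show ?thesis using True by simp
      qed simp
    qed
    show "AE \<omega> in P. norm (indicator (stays N) \<omega> * h n \<omega>) \<le> 2" for n
      using h0 by (auto simp: indicator_def)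
  qed auto
  have "(\<lambda>n. \<bar>\<kappa> n\<bar> * ((\<integral>\<omega>. \<bar>rest_term a N n \<omega>\<bar> \<partial>P) / sqrt (total_var n)) + (\<integral>\<omega>. indicator (stays N) \<omega> * h n \<omega> \<partial>P)) \<longlonglongrightarrow> \<bar>1\<bar> * 0 + (\<integral>\<omega>. 0 \<partial>P)"
    by (intro tendsto_add tendsto_mult tendsto_rabs \<kappa> rest_term_null hlim)
  then have "eventually (\<lambda>n. \<bar>\<kappa> n\<bar> * ((\<integral>\<omega>. \<bar>rest_term a N n \<omega>\<bar> \<partial>P) / sqrt (total_var n)) + (\<integral>\<omega>. indicator (stays N) \<omega> * h n \<omega> \<partial>P) < \<eta> / 2) sequentially"
    using \<eta> by (intro order_tendstoD(2)) auto
  then have "eventually (\<lambda>n. cmod ((\<integral>\<omega>. indicator conv \<omega> *\<^sub>R ?A n \<omega> \<partial>P) - (\<integral>\<omega>. indicator conv \<omega> *\<^sub>R ?M n \<omega> \<partial>P)) < \<eta>) sequentially"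
  proof eventually_elim
    case (elim n)
    then show ?case using bound[of n] N by linarith
  qed
  then show ?thesis by blast
qed

text \<open>The time N depends on the tolerance, but the limit of the noise does not depend on
  N.\<close>

lemma weighted_sum_char:
  assumes aH: "\<And>y. a \<bullet> (H *v y) = - (t \<bullet> y)" and \<kappa>: "\<kappa> \<longlonglongrightarrow> 1"
  shows "(\<lambda>n. \<integral>\<omega>. indicator conv \<omega> *\<^sub>R cis (\<kappa> n * (weighted_sum t n \<omega> / sqrt (total_var n))) \<partial>P) \<longlonglongrightarrow>
    prob conv *\<^sub>R complex_of_real (exp (- (a \<bullet> (\<Gamma> *v a)) / 2))"
proof (rule metric_LIMSEQ_I)
  fix r :: real assume r: "r > 0"
  let ?L = "prob conv *\<^sub>R complex_of_real (exp (- (a \<bullet> (\<Gamma> *v a)) / 2))"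
  have r2: "r / 2 > 0" using r by simp
  obtain N where N: "eventually (\<lambda>n. cmod ((\<integral>\<omega>. indicator conv \<omega> *\<^sub>R cis (\<kappa> n * (weighted_sum t n \<omega> / sqrt (total_var n))) \<partial>P) -
    (\<integral>\<omega>. indicator conv \<omega> *\<^sub>R cis (\<kappa> n * (martingale a N n \<omega> / sqrt (total_var n))) \<partial>P)) < r / 2) sequentially"
    using char_compare[OF aH \<kappa> r2] by (elim exE)
  have M: "eventually (\<lambda>n. dist (\<integral>\<omega>. indicator conv \<omega> *\<^sub>R cis (\<kappa> n * (martingale a N n \<omega> / sqrt (total_var n))) \<partial>P) ?L < r / 2) sequentially"
    by (rule tendstoD[OF noise_clt[OF \<kappa>] r2])
  have "eventually (\<lambda>n. dist (\<integral>\<omega>. indicator conv \<omega> *\<^sub>R cis (\<kappa> n * (weighted_sum t n \<omega> / sqrt (total_var n))) \<partial>P) ?L < r) sequentially"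
    using N M
  proof eventually_elim
    case (elim n)
    show ?case
      by (rule dist_triangle_half_l[OF elim(1)[folded dist_norm] dist_commute_lessI[OF elim(2)]])
  qed
  then show "\<exists>no. \<forall>n\<ge>no. dist (\<integral>\<omega>. indicator conv \<omega> *\<^sub>R cis (\<kappa> n * (weighted_sum t n \<omega> / sqrt (total_var n))) \<partial>P) ?L < r"
    unfolding eventually_sequentially .
qed

text \<open>The Lyapunov inequality forces H x = 0 only for x = 0.\<close>

lemma H_inverse: "matrix_inv H ** H = mat 1" "H ** matrix_inv H = mat 1"
proof -
  have "x = 0" if "H *v x = 0" for x
  proof -
    have "0 \<le> - c * (norm (S *v x))\<^sup>2" using S_lyap[of x] that by simp
    then have "c * (norm (S *v x))\<^sup>2 \<le> 0" by simp
    then have "norm (S *v x) = 0" using c by (simp add: mult_le_0_iff)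
    then show "x = 0" using S_ge[of x] by simp
  qed
  then have "invertible H"
    by (simp add: invertible_left_inverse matrix_left_invertible_ker)
  then have "\<exists>A. H ** A = mat 1 \<and> A ** H = mat 1"
    unfolding invertible_def .
  then have "H ** matrix_inv H = mat 1 \<and> matrix_inv H ** H = mat 1"
    unfolding matrix_inv_def by (rule someI_ex)
  then show "matrix_inv H ** H = mat 1" "H ** matrix_inv H = mat 1"
    by simp_all
qed

lemma scaled_output:
  assumes n: "n \<ge> 1"
  shows "t \<bullet> ((1 / eps_diff M \<alpha> \<kappa>K \<phi> \<rho> n) *\<^sub>R (averaged_output wt \<theta> n \<omega> - \<theta>s)) =
    sqrt (total_var n) / (eps_diff M \<alpha> \<kappa>K \<phi> \<rho> n * (\<Sum>k=1..n. wt k)) * (weighted_sum t n \<omega> / sqrt (total_var n))"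
proof -
  let ?W = "\<Sum>k=1..n. wt k"
  have "?W > 0" by (rule sum_pos) (use n in \<open>auto simp: wt_def\<close>)
  then have "\<theta>s = (1 / ?W) *\<^sub>R (\<Sum>k=1..n. wt k *\<^sub>R \<theta>s)"
    by (simp flip: scaleR_sum_left)
  then have "averaged_output wt \<theta> n \<omega> - \<theta>s = (1 / ?W) *\<^sub>R (\<Sum>k=1..n. wt k *\<^sub>R (\<theta> k \<omega> - \<theta>s))"
    unfolding averaged_output_def by (simp add: scaleR_diff_right sum_subtractf)
  then have "t \<bullet> ((1 / eps_diff M \<alpha> \<kappa>K \<phi> \<rho> n) *\<^sub>R (averaged_output wt \<theta> n \<omega> - \<theta>s)) = 1 / eps_diff M \<alpha> \<kappa>K \<phi> \<rho> n * (1 / ?W * weighted_sum t n \<omega>)"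
    by (simp only: inner_scaleR_right weighted_sum_def)
  also have "\<dots> = sqrt (total_var n) / (eps_diff M \<alpha> \<kappa>K \<phi> \<rho> n * ?W) * (weighted_sum t n \<omega> / sqrt (total_var n))"
    using total_var_pos[OF n] by simp
  finally show ?thesis .
qed

text \<open>By the characteristic function criterion it suffices to test with each t. The vector a =
  -H^(-T) t is the one required by the linearisation, and a . \<Gamma> a is the quadratic form of
  the limit covariance at t.\<close>

lemma central_limit:
  "conv_in_law_on P conv (\<lambda>n \<omega>. (1 / eps_diff M \<alpha> \<kappa>K \<phi> \<rho> n) *\<^sub>R (averaged_output wt \<theta> n \<omega> - \<theta>s))
     (gaussian 0 (matrix_inv H ** \<Gamma> ** transpose (matrix_inv H)))"
proof (rule conv_in_law_onI_char[OF prob_space_axioms conv_event _ prob_space_gaussian sets_gaussian])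
  let ?X = "\<lambda>n \<omega>. (1 / eps_diff M \<alpha> \<kappa>K \<phi> \<rho> n) *\<^sub>R (averaged_output wt \<theta> n \<omega> - \<theta>s)"
  let ?\<Sigma> = "matrix_inv H ** \<Gamma> ** transpose (matrix_inv H)"
  show "?X n \<in> borel_measurable P" for n
    unfolding averaged_output_def by measurable
  fix t
  define a where "a = - (transpose (matrix_inv H) *v t)"
  have a': "a \<bullet> z = - (t \<bullet> (matrix_inv H *v z))" for z
    unfolding a_def inner_minus_left inner_commute[of "transpose (matrix_inv H) *v t" z] inner_transpose_mult by (simp only: inner_commute)
  have aH: "a \<bullet> (H *v y) = - (t \<bullet> y)" for y
    unfolding a' matrix_vector_mul_assoc H_inverse by simp
  obtain A :: "real^'d^'d" where A: "A ** transpose A = \<Gamma>"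
    using psd_factor[OF \<Gamma>_sym \<Gamma>_bound(1)] by (elim exE)
  have "(matrix_inv H ** A) ** transpose (matrix_inv H ** A) = ?\<Sigma>"
    unfolding matrix_transpose_mul A[symmetric] by (simp only: matrix_mul_assoc)
  then have fac: "\<exists>A :: real^'d^'d. A ** transpose A = ?\<Sigma>" by (rule exI)
  have quad: "t \<bullet> (?\<Sigma> *v t) = a \<bullet> (\<Gamma> *v a)"
  proof -
    have "a \<bullet> (\<Gamma> *v a) = - (t \<bullet> (matrix_inv H *v (\<Gamma> *v a)))" by (rule a')
    also have "\<dots> = t \<bullet> (matrix_inv H *v (\<Gamma> *v (transpose (matrix_inv H) *v t)))"
      by (simp add: a_def linear_neg[OF matrix_vector_mul_linear])
    finally show ?thesis by (simp only: matrix_vector_mul_assoc matrix_mul_assoc)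
  qed
  have lim: "(\<lambda>n. \<integral>\<omega>. indicator conv \<omega> *\<^sub>R cis (sqrt (total_var n) / (eps_diff M \<alpha> \<kappa>K \<phi> \<rho> n * (\<Sum>k=1..n. wt k)) * (weighted_sum t n \<omega> / sqrt (total_var n))) \<partial>P) \<longlonglongrightarrow>
    prob conv *\<^sub>R complex_of_real (exp (- (a \<bullet> (\<Gamma> *v a)) / 2))"
    by (rule weighted_sum_char[OF aH normalisation])
  show "(\<lambda>n. \<integral>\<omega>. indicator conv \<omega> *\<^sub>R cis (t \<bullet> ?X n \<omega>) \<partial>P) \<longlonglongrightarrow> prob conv *\<^sub>R (\<integral>x. cis (t \<bullet> x) \<partial>gaussian 0 ?\<Sigma>)"
    unfolding gaussian_char[OF fac] quad
  proof (rule Lim_transform_eventually[OF lim])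
    show "eventually (\<lambda>n. (\<integral>\<omega>. indicator conv \<omega> *\<^sub>R cis (sqrt (total_var n) / (eps_diff M \<alpha> \<kappa>K \<phi> \<rho> n * (\<Sum>k=1..n. wt k)) * (weighted_sum t n \<omega> / sqrt (total_var n))) \<partial>P)
      = (\<integral>\<omega>. indicator conv \<omega> *\<^sub>R cis (t \<bullet> ?X n \<omega>) \<partial>P)) sequentially"
      using eventually_ge_at_top[of 1]
    proof eventually_elim
      case (elim n)
      show ?case by (simp only: scaled_output[OF elim])
    qed
  qed
qed

end

subsection \<open>Cost\<close>

context mlsa_params
begin

text \<open>Rounding adds at most one sample, so the relative excess on level k is at most M^k /
  K_n.\<close>

lemma level_samples_ratio:
  assumes m: "m \<ge> 1" and k: "k \<le> s m"
  shows "0 \<le> real (level_samples M k (samples m)) * M powr real k / samples m - 1"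
    "real (level_samples M k (samples m)) * M powr real k / samples m - 1 \<le> M powr real (s m) / samples m"
proof -
  let ?N = "real (level_samples M k (samples m))"
  have K: "samples m > 0" by (rule samples_pos[OF m])
  have Mk: "M powr real k > 0" using M by simp
  have x: "samples m * M powr (- real k) \<ge> 0" using K by simp
  have lo: "samples m * M powr (- real k) \<le> ?N" unfolding level_samples_def by linarith
  have hi: "?N \<le> samples m * M powr (- real k) + 1" using x unfolding level_samples_def by linarith
  have e: "samples m * M powr (- real k) * M powr real k = samples m"
    using M by (simp add: powr_minus field_simps)
  have "samples m \<le> ?N * M powr real k"
    using mult_right_mono[OF lo, of "M powr real k"] Mk unfolding e by simp
  then show "0 \<le> ?N * M powr real k / samples m - 1"
    using K by (simp add: pos_le_divide_eq)
  have "?N * M powr real k \<le> samples m + M powr real k"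
    using mult_right_mono[OF hi, of "M powr real k"] Mk e by (simp add: distrib_right)
  moreover have "M powr real k \<le> M powr real (s m)"
    using M k by (intro powr_mono) auto
  ultimately have "?N * M powr real k \<le> samples m + M powr real (s m)" by linarith
  then have "?N * M powr real k / samples m \<le> (samples m + M powr real (s m)) / samples m"
    using K by (intro divide_right_mono) auto
  then show "?N * M powr real k / samples m - 1 \<le> M powr real (s m) / samples m"
    using K by (simp add: add_divide_distrib)
qed

text \<open>Proved for a deterministic path. Each level costs about \<kappa>C K_m, and the average
  over the s_m levels has three errors: the coarse levels, bounded by the uniform cost bound and few
  in number; the rounding; and the distance to the joint limit.\<close>

lemma step_cost_ratio:
  fixes x :: "nat \<Rightarrow> real^'d"
  assumes C: "cost_functions D C \<theta>s M \<kappa>C" and \<kappa>C: "\<kappa>C > 0"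
    and xD: "\<And>n. x n \<in> D" and x: "x \<longlonglongrightarrow> \<theta>s"
  shows "(\<lambda>m. (\<Sum>k=1..s m. real (level_samples M k (samples m)) * C k (x (m - 1))) / (samples m * real (s m))) \<longlonglongrightarrow> \<kappa>C"
proof (rule LIMSEQ_I)
  fix r :: real assume r: "r > 0"
  obtain V CC where V: "open V" "\<theta>s \<in> V" and CC: "\<And>\<theta> k. \<theta> \<in> V \<inter> D \<Longrightarrow> k \<ge> 1 \<Longrightarrow> C k \<theta> \<le> CC * M ^ k"
    using C unfolding cost_functions_def by blast
  have Cpos: "\<And>\<theta> k. \<theta> \<in> D \<Longrightarrow> k \<ge> 1 \<Longrightarrow> C k \<theta> > 0"
    using C unfolding cost_functions_def by blast
  have lim: "((\<lambda>(\<theta>, k). M powr (- real k) * C k \<theta>) \<longlongrightarrow> \<kappa>C) (inf (nhds \<theta>s) (principal D) \<times>\<^sub>F sequentially)"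
    using C unfolding cost_functions_def joint_limit_def by blast
  have "eventually (\<lambda>p. dist (case p of (\<theta>, k) \<Rightarrow> M powr (- real k) * C k \<theta>) \<kappa>C < r / 4) (inf (nhds \<theta>s) (principal D) \<times>\<^sub>F sequentially)"
    by (rule tendstoD[OF lim]) (use r in simp)
  then obtain Pf Pg where Pf: "eventually Pf (inf (nhds \<theta>s) (principal D))" and Pg: "eventually Pg sequentially"
    and PP: "\<And>y k. Pf y \<Longrightarrow> Pg k \<Longrightarrow> dist (M powr (- real k) * C k y) \<kappa>C < r / 4"
    unfolding eventually_prod_filter by auto
  obtain k0 where k0: "\<And>k. k \<ge> k0 \<Longrightarrow> Pg k" using Pg unfolding eventually_sequentially by blast
  have x': "filterlim (\<lambda>m. x (m - 1)) (inf (nhds \<theta>s) (principal D)) sequentially"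
    unfolding filterlim_inf filterlim_principal
  proof
    show "filterlim (\<lambda>m. x (m - 1)) (nhds \<theta>s) sequentially"
      by (rule filterlim_compose[OF x filterlim_minus_const_nat_at_top])
  qed (simp add: xD)
  have e1: "eventually (\<lambda>m. Pf (x (m - 1))) sequentially"
    by (rule eventually_compose_filterlim[OF Pf x'])
  have "eventually (\<lambda>y. y \<in> V) (inf (nhds \<theta>s) (principal D))"
    unfolding eventually_inf_principal using eventually_nhds_in_open[OF V] by eventually_elim simp
  then have e2: "eventually (\<lambda>m. x (m - 1) \<in> V) sequentially"
    by (rule eventually_compose_filterlim[OF _ x'])
  \<comment> \<open>The constant of the definition may a priori have any sign; its positive part is
    used in products.\<close>
  define CM where "CM = max CC 0"
  have s_lim: "filterlim (\<lambda>m. real (s m)) at_top sequentially"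
    by (rule filterlim_compose[OF filterlim_real_sequentially s_at_top])
  have "(\<lambda>m. real k0 * (CM + \<kappa>C) / real (s m)) \<longlonglongrightarrow> 0"
    by (intro tendsto_divide_0[OF tendsto_const] filterlim_at_top_imp_at_infinity s_lim)
  then have e3: "eventually (\<lambda>m. real k0 * (CM + \<kappa>C) / real (s m) < r / 4) sequentially"
    by (rule order_tendstoD(2)) (use r in simp)
  have "(\<lambda>m. CM / (samples m / M powr real (s m))) \<longlonglongrightarrow> 0"
    by (intro tendsto_divide_0[OF tendsto_const] filterlim_at_top_imp_at_infinity samples_ratio_at_top)
  then have e4: "eventually (\<lambda>m. CM / (samples m / M powr real (s m)) < r / 4) sequentially"
    by (rule order_tendstoD(2)) (use r in simp)
  have "eventually (\<lambda>m. norm ((\<Sum>k=1..s m. real (level_samples M k (samples m)) * C k (x (m - 1))) / (samples m * real (s m)) - \<kappa>C) < r) sequentially"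
    using e1 e2 e3 e4 eventually_ge_at_top[of 1]
  proof eventually_elim
    case (elim m)
    note m = elim(5)
    have K: "samples m > 0" by (rule samples_pos[OF m])
    have sm: "real (s m) > 0" using s1 m by force
    define c where "c k = M powr (- real k) * C k (x (m - 1))" for k
    define z where "z k = real (level_samples M k (samples m)) * M powr real k / samples m" for k
    have c0: "0 \<le> c k" "c k \<le> CM" if "k \<ge> 1" for k
    proof -
      show "0 \<le> c k" unfolding c_def using Cpos[OF xD that] by (simp add: less_imp_le)
      have "c k \<le> M powr (- real k) * (CC * M ^ k)"
        unfolding c_def using CC[OF _ that, of "x (m - 1)"] elim(2) xD by (intro mult_left_mono) auto
      also have "\<dots> = CC" using M by (simp add: powr_minus powr_realpow field_simps)
      finally show "c k \<le> CM" by (simp add: CM_def)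
    qed
    have level_term: "real (level_samples M k (samples m)) * C k (x (m - 1)) = samples m * (z k * c k)" for k
      using K M by (simp add: z_def c_def powr_minus field_simps)
    have tb: "\<bar>z k * c k - \<kappa>C\<bar> \<le> r / 4 + CM / (samples m / M powr real (s m)) + (if k < k0 then CM + \<kappa>C else 0)"
      if "k \<in> {1..s m}" for k
    proof -
      have k: "k \<ge> 1" "k \<le> s m" using that by auto
      have z0: "0 \<le> z k - 1" "z k - 1 \<le> M powr real (s m) / samples m"
        unfolding z_def by (rule level_samples_ratio[OF m k(2)])+
      have "(z k - 1) * c k \<le> M powr real (s m) / samples m * CM"
        by (rule mult_mono[OF z0(2) c0(2)[OF k(1)]]) (use c0[OF k(1)] K in auto)
      moreover have "M powr real (s m) / samples m * CM = CM / (samples m / M powr real (s m))" by simp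
      moreover have "0 \<le> (z k - 1) * c k" using z0(1) c0(1)[OF k(1)] by simp
      moreover have "z k * c k - \<kappa>C = (z k - 1) * c k + (c k - \<kappa>C)" by (simp add: algebra_simps)
      moreover have "\<bar>c k - \<kappa>C\<bar> \<le> r / 4 + (if k < k0 then CM + \<kappa>C else 0)"
      proof (cases "k < k0")
        case True then show ?thesis using c0[OF k(1)] r \<kappa>C by auto
      next
        case False
        then show ?thesis using PP[OF elim(1) k0, of k] by (simp add: c_def dist_real_def)
      qed
      ultimately show ?thesis by linarith
    qed
    have "(\<Sum>k=1..s m. real (level_samples M k (samples m)) * C k (x (m - 1))) / (samples m * real (s m)) - \<kappa>C =
      (\<Sum>k=1..s m. z k * c k - \<kappa>C) / real (s m)"
      unfolding level_term using K sm by (simp add: sum_distrib_left[symmetric] sum_subtractf diff_divide_distrib)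
    moreover have "\<bar>\<Sum>k=1..s m. z k * c k - \<kappa>C\<bar> \<le> (\<Sum>k=1..s m. r / 4 + CM / (samples m / M powr real (s m)) + (if k < k0 then CM + \<kappa>C else 0))"
      by (rule order_trans[OF sum_abs sum_mono]) (rule tb)
    moreover have "(\<Sum>k=1..s m. r / 4 + CM / (samples m / M powr real (s m)) + (if k < k0 then CM + \<kappa>C else 0)) \<le>
      real (s m) * (r / 4 + CM / (samples m / M powr real (s m))) + real k0 * (CM + \<kappa>C)"
    proof -
      have "(\<Sum>k=1..s m. (if k < k0 then CM + \<kappa>C else 0)) = (\<Sum>k\<in>{1..s m} \<inter> {k. k < k0}. CM + \<kappa>C)"
        by (simp add: sum.If_cases)
      also have "\<dots> = real (card ({1..s m} \<inter> {k. k < k0})) * (CM + \<kappa>C)" by simp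
      also have "\<dots> \<le> real k0 * (CM + \<kappa>C)"
      proof (rule mult_right_mono)
        have "card ({1..s m} \<inter> {k. k < k0}) \<le> card {..<k0}" by (rule card_mono) auto
        then show "real (card ({1..s m} \<inter> {k. k < k0})) \<le> real k0" by simp
        show "0 \<le> CM + \<kappa>C" using \<kappa>C by (simp add: CM_def)
      qed
      finally have f: "(\<Sum>k=1..s m. (if k < k0 then CM + \<kappa>C else 0)) \<le> real k0 * (CM + \<kappa>C)" .
      show ?thesis unfolding sum.distrib[of "\<lambda>_. r / 4 + CM / (samples m / M powr real (s m))"]
        using f by simp
    qed
    ultimately have "\<bar>(\<Sum>k=1..s m. real (level_samples M k (samples m)) * C k (x (m - 1))) / (samples m * real (s m)) - \<kappa>C\<bar> \<le>
      (real (s m) * (r / 4 + CM / (samples m / M powr real (s m))) + real k0 * (CM + \<kappa>C)) / real (s m)"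
      using sm by (simp add: divide_right_mono)
    also have "\<dots> = r / 4 + CM / (samples m / M powr real (s m)) + real k0 * (CM + \<kappa>C) / real (s m)"
      using sm by (simp add: add_divide_distrib)
    also have "\<dots> < r" using elim(3,4) r by linarith
    finally show ?case by simp
  qed
  then show "\<exists>no. \<forall>n\<ge>no. norm ((\<Sum>k=1..s n. real (level_samples M k (samples n)) * C k (x (n - 1))) / (samples n * real (s n)) - \<kappa>C) < r"
    unfolding eventually_sequentially .
qed

text \<open>The costs of the steps are equivalent to \<kappa>C K_m s_m, whose sums diverge, so the
  equivalence passes to the accumulated cost.\<close>

lemma eps_cost_path:
  fixes \<theta> :: "nat \<Rightarrow> 'w \<Rightarrow> real^'d"
  assumes C: "cost_functions D C \<theta>s M \<kappa>C" and \<kappa>C: "\<kappa>C > 0"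
    and D: "\<And>n. \<theta> n \<omega> \<in> D" and lim: "(\<lambda>n. \<theta> n \<omega>) \<longlonglongrightarrow> \<theta>s"
  shows "eps_diff M \<alpha> \<kappa>K \<phi> \<rho> \<sim>[sequentially]
    (\<lambda>n. sqrt \<kappa>C / (2 * \<alpha>) * (((\<rho> + 1) / (\<phi> + 1)) / sqrt (2 * ((\<rho> + 1) / (\<phi> + 1)) - 1))
      * (log M (algorithm_cost C M samples s \<theta> n \<omega>) / sqrt (algorithm_cost C M samples s \<theta> n \<omega>)))"
proof (rule eps_in_terms_of_cost[OF \<kappa>C])
  let ?u = "\<lambda>m. \<Sum>k=1..s m. real (level_samples M k (samples m)) * C k (\<theta> (m - 1) \<omega>)"
  let ?g = "\<lambda>m. \<kappa>C * (samples m * real (s m))"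
  have "(\<lambda>m. ?u m / (samples m * real (s m)) / \<kappa>C) \<longlonglongrightarrow> \<kappa>C / \<kappa>C"
    using step_cost_ratio[OF C \<kappa>C, of "\<lambda>n. \<theta> n \<omega>", OF D lim] \<kappa>C by (intro tendsto_divide tendsto_const) auto
  then have u: "?u \<sim>[sequentially] ?g"
    using \<kappa>C by (intro asymp_equivI') (simp add: mult.commute mult.assoc)
  have c: "\<kappa>K * (\<phi> + 1) / (2 * \<alpha> * ln M) > 0" "\<phi> + 1 > 0" using \<kappa>K \<phi>_pos \<alpha> lnM by auto
  then have "filterlim (\<lambda>n. \<kappa>K * (\<phi> + 1) / (2 * \<alpha> * ln M) * real n powr (\<phi> + 1) * ln (real n)) at_top sequentially"
    by (simp only: mult.assoc) real_asymp
  then have "filterlim (\<lambda>n. \<Sum>m=1..n. samples m * real (s m)) at_top sequentially"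
    by (rule asymp_equiv_at_top_transfer[OF asymp_equiv_symI[OF cost_sum_equiv]])
  then have "filterlim (\<lambda>n. \<kappa>C * (\<Sum>m=1..n. samples m * real (s m))) at_top sequentially"
    using \<kappa>C by (intro filterlim_tendsto_pos_mult_at_top[OF tendsto_const])
  then have G: "filterlim (\<lambda>n. \<Sum>m=1..n. ?g m) at_top sequentially"
    by (simp only: sum_distrib_left)
  have g0: "0 \<le> ?g m" if "m \<ge> 1" for m
    using samples_pos[OF that] \<kappa>C by simp
  have "(\<lambda>n. \<Sum>m=1..n. ?u m) \<sim>[sequentially] (\<lambda>n. \<Sum>m=1..n. ?g m)"
    by (rule sum_asymp_equiv_sum[OF u g0 G])
  then show "(\<lambda>n. algorithm_cost C M samples s \<theta> n \<omega>) \<sim>[sequentially] (\<lambda>n. \<kappa>C * (\<Sum>m=1..n. samples m * real (s m)))"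
    by (simp only: algorithm_cost_def sum_distrib_left)
qed

end

subsection \<open>Main theorem\<close>

lemma eventually_within_ball:
  fixes x :: "'a::metric_space"
  assumes "eventually Q (at x within D)"
  shows "\<exists>d>0. \<forall>y\<in>ball x d \<inter> D. y \<noteq> x \<longrightarrow> Q y"
  using assms unfolding eventually_at by (force simp: dist_commute)

lemma eventually_joint_limit:
  fixes \<theta>s :: "real^'d"
  assumes "eventually Q (joint_limit D \<theta>s)"
  shows "\<exists>d>0. \<exists>k1. \<forall>x\<in>ball \<theta>s d \<inter> D. \<forall>k\<ge>k1. Q (x, k)"
proof -
  obtain Pf Pg where Pf: "eventually Pf (inf (nhds \<theta>s) (principal D))" and Pg: "eventually Pg sequentially"
    and PP: "\<And>y k. Pf y \<Longrightarrow> Pg k \<Longrightarrow> Q (y, k)"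
    using assms unfolding joint_limit_def eventually_prod_filter by auto
  obtain k1 where k1: "\<And>k. k \<ge> k1 \<Longrightarrow> Pg k" using Pg unfolding eventually_sequentially by blast
  obtain d where d: "d > 0" "\<And>x. dist x \<theta>s < d \<Longrightarrow> x \<in> D \<Longrightarrow> Pf x"
    using Pf unfolding eventually_inf_principal eventually_nhds_metric by blast
  show ?thesis
    using d k1 PP by (intro exI[of _ d] conjI exI[of _ k1]) (auto simp: dist_commute)
qed

text \<open>A moment condition of order above 3 is lowered to order 3 by the power mean inequality;
  the normalised form with exponent 2/q is preserved.\<close>

lemma (in mlsa) tail_local:
  assumes "tail_condition P U D Fk \<theta>s M"
  shows "\<exists>q CT d. 2 < q \<and> q \<le> 3 \<and> CT > 0 \<and> d > 0 \<and> (\<forall>x\<in>ball \<theta>s d \<inter> D. \<forall>k\<ge>1.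
    integrable P (\<lambda>\<omega>. norm (dev k x (U \<omega>)) powr q) \<and>
    (\<integral>\<omega>. norm (dev k x (U \<omega>)) powr q \<partial>P) \<le> (CT * M powr (- real k)) powr (q / 2))"
proof -
  obtain q0 V CT0 where q0: "q0 > 2" and V: "open V" "\<theta>s \<in> V"
    and i: "\<And>x k. x \<in> V \<inter> D \<Longrightarrow> k \<ge> 1 \<Longrightarrow> integrable P (\<lambda>\<omega>. norm (dev k x (U \<omega>)) powr q0)"
    and le: "\<And>x k. x \<in> V \<inter> D \<Longrightarrow> k \<ge> 1 \<Longrightarrow> (\<integral>\<omega>. norm (dev k x (U \<omega>)) powr q0 \<partial>P) powr (2 / q0) \<le> CT0 * M powr (- real k)"
    using assms unfolding tail_condition_def Let_def dev_def by blast
  obtain d where d: "d > 0" "ball \<theta>s d \<subseteq> V" using V unfolding open_contains_ball by blast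
  define q where "q = min q0 3"
  have q: "2 < q" "q \<le> 3" "q \<le> q0" using q0 by (auto simp: q_def)
  define CT where "CT = max CT0 1"
  have *: "integrable P (\<lambda>\<omega>. norm (dev k x (U \<omega>)) powr q) \<and>
    (\<integral>\<omega>. norm (dev k x (U \<omega>)) powr q \<partial>P) \<le> (CT * M powr (- real k)) powr (q / 2)"
    if x: "x \<in> V \<inter> D" and k: "k \<ge> 1" for x k
  proof -
    have xD: "x \<in> D" using x by simp
    let ?Z = "\<lambda>\<omega>. norm (dev k x (U \<omega>)) powr q"
    have [measurable]: "(\<lambda>\<omega>. dev k x (U \<omega>)) \<in> borel_measurable P" by (rule dev_comp[OF k xD U])
    have Zr: "?Z \<omega> powr (q0 / q) = norm (dev k x (U \<omega>)) powr q0" for \<omega>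
      using q by (simp add: powr_powr)
    have r1: "1 \<le> q0 / q" using q by simp
    have Zi: "integrable P (\<lambda>\<omega>. ?Z \<omega> powr (q0 / q))" unfolding Zr by (rule i[OF x k])
    have Zm: "?Z \<in> borel_measurable P" by measurable
    have "integrable P ?Z" by (rule power_mean(1)[OF Zm powr_ge_zero r1 Zi])
    moreover have "(\<integral>\<omega>. ?Z \<omega> \<partial>P) \<le> (CT * M powr (- real k)) powr (q / 2)"
    proof -
      have pm: "(\<integral>\<omega>. ?Z \<omega> \<partial>P) powr (q0 / q) \<le> (\<integral>\<omega>. norm (dev k x (U \<omega>)) powr q0 \<partial>P)"
        using power_mean(2)[OF Zm powr_ge_zero r1 Zi] unfolding Zr .
      have Z0: "0 \<le> (\<integral>\<omega>. ?Z \<omega> \<partial>P)" by simp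
      have "((\<integral>\<omega>. ?Z \<omega> \<partial>P) powr (q0 / q)) powr (2 / q0) \<le> (\<integral>\<omega>. norm (dev k x (U \<omega>)) powr q0 \<partial>P) powr (2 / q0)"
        by (rule powr_mono2[OF _ powr_ge_zero pm]) (use q0 in simp)
      also note le[OF x k]
      also have "CT0 * M powr (- real k) \<le> CT * M powr (- real k)"
        by (rule mult_right_mono) (auto simp: CT_def)
      finally have "(\<integral>\<omega>. ?Z \<omega> \<partial>P) powr (2 / q) \<le> CT * M powr (- real k)"
        using q q0 by (simp add: powr_powr)
      then have "((\<integral>\<omega>. ?Z \<omega> \<partial>P) powr (2 / q)) powr (q / 2) \<le> (CT * M powr (- real k)) powr (q / 2)"
        using q by (intro powr_mono2) auto
      then show ?thesis using q Z0 by (simp add: powr_powr)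
    qed
    ultimately show ?thesis by blast
  qed
  show ?thesis
    using q(1,2) d * by (intro exI[of _ q] exI[of _ CT] exI[of _ d]) (auto simp: CT_def)
qed

text \<open>Each hypothesis holds on some ball; the smallest of the five radii serves them
  all.\<close>

lemma (in mlsa) local_constants:
  assumes zero: "contracting_zero D f H \<theta>s"
    and taylor: "(\<lambda>x. norm (f x - H *v (x - \<theta>s))) \<in> O[at \<theta>s within D](\<lambda>x. norm (x - \<theta>s) powr (1 + lam))"
    and tail: "tail_condition P U D Fk \<theta>s M" and var: "var_condition P U D Fk \<theta>s M \<Gamma>"
    and bias: "bias_condition P U D F Fk \<theta>s M \<alpha> alphas"
  shows "\<exists>\<delta> c LS q CT CB CL S k1.
    mlsa_local lam M \<alpha> \<phi> \<rho> \<psi> \<kappa>K alphas s P \<U> U UU D Proj F Fk \<theta>s \<theta>0 H \<Gamma> \<delta> c LS q CT CB CL S k1"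
proof -
  obtain S :: "real^'d^'d" and c where c: "c > 0" and S: "\<And>x. norm x \<le> norm (S *v x)"
    "\<And>x. (S *v x) \<bullet> (S *v (H *v x)) \<le> - c * (norm (S *v x))\<^sup>2"
    using lyapunov_matrix[of H] zero unfolding contracting_zero_def by blast
  obtain LS where LS: "LS > 0" "\<And>x. norm (S *v x) \<le> LS * norm x"
    using linear_bounded_pos[OF matrix_vector_mul_linear, of S] by auto
  obtain q CT d2 where q: "2 < q" "q \<le> 3" "CT > 0" "d2 > 0" and
    tl: "\<And>x k. x \<in> ball \<theta>s d2 \<inter> D \<Longrightarrow> k \<ge> 1 \<Longrightarrow> integrable P (\<lambda>\<omega>. norm (dev k x (U \<omega>)) powr q)"
    "\<And>x k. x \<in> ball \<theta>s d2 \<inter> D \<Longrightarrow> k \<ge> 1 \<Longrightarrow> (\<integral>\<omega>. norm (dev k x (U \<omega>)) powr q \<partial>P) \<le> (CT * M powr (- real k)) powr (q / 2)"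
    using tail_local[OF tail] by blast
  obtain d1 where d1: "d1 > 0" "ball \<theta>s d1 \<subseteq> interior D"
    using \<theta>s open_interior[of D] unfolding open_contains_ball by blast
  \<comment> \<open>The filter at \<open>\<theta>s\<close> within D excludes
    \<open>\<theta>s\<close>, so the two Taylor bounds are supplied there by hand.\<close>
  have f0: "f \<theta>s - H *v (\<theta>s - \<theta>s) = 0" using zero by (simp add: contracting_zero_def)
  obtain CL where CL: "CL > 0" and evT: "eventually (\<lambda>x. norm (norm (f x - H *v (x - \<theta>s))) \<le> CL * norm (norm (x - \<theta>s) powr (1 + lam))) (at \<theta>s within D)"
    using landau_o.bigE[OF taylor] by blast
  obtain d3 where d3: "d3 > 0" and t3: "\<And>x. x \<in> ball \<theta>s d3 \<inter> D \<Longrightarrow> x \<noteq> \<theta>s \<Longrightarrow> norm (f x - H *v (x - \<theta>s)) \<le> CL * norm (x - \<theta>s) powr (1 + lam)"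
    using eventually_within_ball[OF evT] by auto
  have "c / (4 * LS) > 0" using c LS by simp
  moreover have "(\<lambda>x. norm (f x - H *v (x - \<theta>s))) \<in> o[at \<theta>s within D](\<lambda>x. norm (x - \<theta>s))"
    using zero by (simp add: contracting_zero_def)
  ultimately have evS: "eventually (\<lambda>x. norm (norm (f x - H *v (x - \<theta>s))) \<le> c / (4 * LS) * norm (norm (x - \<theta>s))) (at \<theta>s within D)"
    by (intro landau_o.smallD)
  obtain d4 where d4: "d4 > 0" and t4: "\<And>x. x \<in> ball \<theta>s d4 \<inter> D \<Longrightarrow> x \<noteq> \<theta>s \<Longrightarrow> norm (f x - H *v (x - \<theta>s)) \<le> c / (4 * LS) * norm (x - \<theta>s)"
    using eventually_within_ball[OF evS] by auto
  obtain n :: nat where n: "Limsup (joint_limit D \<theta>s) (\<lambda>(\<theta>, k). ereal (M powr (alphas k * real k) * norm (level_mean k \<theta> - f \<theta>))) < ereal (real n)"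
    using bias less_PInf_Ex_of_nat unfolding bias_condition_def by auto
  obtain d5 k1 where d5: "d5 > 0" and b5: "\<And>x k. x \<in> ball \<theta>s d5 \<inter> D \<Longrightarrow> k \<ge> k1 \<Longrightarrow> M powr (alphas k * real k) * norm (level_mean k x - f x) < real n"
    using eventually_joint_limit[OF Limsup_lessD[OF n]] unfolding case_prod_conv less_ereal.simps by blast
  define \<delta> where "\<delta> = Min {d1, d2, d3, d4, d5}"
  have \<delta>: "\<delta> > 0" using d1 q d3 d4 d5 by (simp add: \<delta>_def)
  have le: "\<delta> \<le> d1" "\<delta> \<le> d2" "\<delta> \<le> d3" "\<delta> \<le> d4" "\<delta> \<le> d5" by (simp_all add: \<delta>_def)
  have int: "ball \<theta>s \<delta> \<subseteq> interior D" using subset_ball[OF le(1)] d1 by blast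
  have sub: "x \<in> ball \<theta>s d \<inter> D" if "x \<in> ball \<theta>s \<delta>" "\<delta> \<le> d" for x d
    using that int interior_subset[of D] by auto
  \<comment> \<open>Adding 1 to the bound of the upper limit makes the bias constant visibly
    positive.\<close>
  have "mlsa_local lam M \<alpha> \<phi> \<rho> \<psi> \<kappa>K alphas s P \<U> U UU D Proj F Fk \<theta>s \<theta>0 H \<Gamma> \<delta> c LS q CT (real n + 1) CL S k1"
  proof unfold_locales
    fix x assume x: "x \<in> ball \<theta>s \<delta>"
    show "norm (f x - H *v (x - \<theta>s)) \<le> CL * norm (x - \<theta>s) powr (1 + lam)"
      using t3[OF sub[OF x le(3)]] f0 by (cases "x = \<theta>s") auto
    show "norm (f x - H *v (x - \<theta>s)) \<le> c / (4 * LS) * norm (x - \<theta>s)"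
      using t4[OF sub[OF x le(4)]] f0 by (cases "x = \<theta>s") auto
    fix k
    show "norm (level_mean k x - f x) \<le> (real n + 1) * M powr - (alphas k * real k)" if "k1 \<le> k"
    proof -
      have Mp: "M powr (alphas k * real k) > 0" using M by simp
      have "M powr (alphas k * real k) * norm (level_mean k x - f x) \<le> real n + 1"
        using b5[OF sub[OF x le(5)] that] by linarith
      then show ?thesis using Mp by (simp add: powr_minus field_simps)
    qed
    assume k: "1 \<le> k"
    show "integrable P (\<lambda>\<omega>. norm (dev k x (U \<omega>)) powr q)" by (rule tl(1)[OF sub[OF x le(2)] k])
    show "(\<integral>\<omega>. norm (dev k x (U \<omega>)) powr q \<partial>P) \<le> (CT * M powr - real k) powr (q / 2)" by (rule tl(2)[OF sub[OF x le(2)] k])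
  qed (use \<delta> int c S LS q CL var in \<open>auto\<close>)
  then show ?thesis by blast
qed

lemma (in mlsa_local) central_limit_iterates:
  "conv_in_law_on P {\<omega> \<in> space P. (\<lambda>n. iterate Proj Fk M step_size samples s \<theta>0 UU n \<omega>) \<longlonglongrightarrow> \<theta>s}
     (\<lambda>n \<omega>. (1 / eps_diff M \<alpha> \<kappa>K \<phi> \<rho> n) *\<^sub>R (averaged_output wt (iterate Proj Fk M step_size samples s \<theta>0 UU) n \<omega> - \<theta>s))
     (gaussian 0 (matrix_inv H ** \<Gamma> ** transpose (matrix_inv H)))"
  using central_limit unfolding conv_def \<theta>_def .

lemma (in mlsa) eps_cost_iterates:
  assumes "cost_functions D C \<theta>s M \<kappa>C" "\<kappa>C > 0" "(\<lambda>n. iterate Proj Fk M step_size samples s \<theta>0 UU n \<omega>) \<longlonglongrightarrow> \<theta>s"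
  shows "eps_diff M \<alpha> \<kappa>K \<phi> \<rho> \<sim>[sequentially]
    (\<lambda>n. sqrt \<kappa>C / (2 * \<alpha>) * (((\<rho> + 1) / (\<phi> + 1)) / sqrt (2 * ((\<rho> + 1) / (\<phi> + 1)) - 1))
      * (log M (algorithm_cost C M samples s (iterate Proj Fk M step_size samples s \<theta>0 UU) n \<omega>) / sqrt (algorithm_cost C M samples s (iterate Proj Fk M step_size samples s \<theta>0 UU) n \<omega>)))"
  by (rule eps_cost_path[where \<theta> = "iterate Proj Fk M step_size samples s \<theta>0 UU", OF assms(1,2) \<theta>_D[unfolded \<theta>_def] assms(3)])

theorem theorem1p11:
  fixes P :: "'w measure" and \<U> :: "'u measure"
    and U :: "'w \<Rightarrow> 'u" and UU :: "nat \<Rightarrow> nat \<Rightarrow> nat \<Rightarrow> 'w \<Rightarrow> 'u"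
    and D :: "(real^'d) set" and Proj :: "real^'d \<Rightarrow> real^'d"
    and F :: "real^'d \<Rightarrow> 'u \<Rightarrow> real^'d" and Fk :: "nat \<Rightarrow> real^'d \<Rightarrow> 'u \<Rightarrow> real^'d"
    and f :: "real^'d \<Rightarrow> real^'d"
    and \<theta>s \<theta>0 :: "real^'d" and H \<Gamma> :: "real^'d^'d"
    and lam M \<alpha> \<phi> \<rho> \<psi> \<kappa>K :: real
    and alphas \<gamma> K b \<epsilon> :: "nat \<Rightarrow> real" and s :: "nat \<Rightarrow> nat"
    and \<theta> \<theta>bar :: "nat \<Rightarrow> 'w \<Rightarrow> real^'d" and conv :: "'w set"
  defines "f \<equiv> mean_field P U F"
    and "\<gamma> \<equiv> (\<lambda>n. real n powr (- \<psi>))"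
    and "K \<equiv> (\<lambda>n. \<kappa>K * (\<phi> + 1) * real n powr \<phi>)"
    and "b \<equiv> (\<lambda>n. real n powr \<rho>)"
    and "\<theta> \<equiv> iterate Proj Fk M \<gamma> K s \<theta>0 UU"
    and "\<theta>bar \<equiv> averaged_output b \<theta>"
    and "\<epsilon> \<equiv> eps_diff M \<alpha> \<kappa>K \<phi> \<rho>"
    and "conv \<equiv> {\<omega> \<in> space P. (\<lambda>n. \<theta> n \<omega>) \<longlonglongrightarrow> \<theta>s}"
  assumes "prob_space P" and "U \<in> measurable P \<U>"
    and "closed D"
    and "param_measurable D \<U> F" and "\<forall>x\<in>D. integrable P (\<lambda>\<omega>. F x (U \<omega>))"
    and "Proj \<in> borel_measurable borel"
    and "\<forall>x. Proj x \<in> D" and "\<forall>x\<in>D. Proj x = x" and "\<forall>x. x \<notin> D \<longrightarrow> Proj x \<in> frontier D"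
    and "prob_space.indep_vars P (\<lambda>_. \<U>) (\<lambda>(n, k, l). UU n k l) ({1..} \<times> {1..} \<times> {1..})"
    and "\<forall>n\<ge>1. \<forall>k\<ge>1. \<forall>l\<ge>1. distr P \<U> (UU n k l) = distr P \<U> U"
    and "contracting_zero D f H \<theta>s"
    and "0 < lam" and "lam \<le> 1"
    and "(\<lambda>x. norm (f x - H *v (x - \<theta>s))) \<in> O[at \<theta>s within D](\<lambda>x. norm (x - \<theta>s) powr (1 + lam))"
    and "M > 1" and "\<alpha> > 1 / 2" and "\<Gamma> \<noteq> 0"
    and "approximations P \<U> U D F Fk \<theta>s M \<alpha> \<Gamma>"
    and "1 / (2 * \<alpha> - 1) < \<phi>" and "\<phi> + 1 < 2 * (\<rho> + 1)"
    and "max (1 - lam / (lam + 1) * (\<phi> + 1)) 0 < \<psi>" and "\<psi> < 1"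
    and "bias_condition P U D F Fk \<theta>s M \<alpha> alphas"
    and "\<forall>n\<ge>1. s n \<ge> 1" and "mono_on {1..} s"
    and "(\<lambda>n. M powr (- alphas (s n) * real (s n)))
           \<in> o(\<lambda>n. real n powr (- (\<phi> + 1) / 2) * sqrt (ln (real n)))"
    and "(\<lambda>n. \<alpha> * real (s n)) \<sim>[sequentially] (\<lambda>n. log M (real n powr ((\<phi> + 1) / 2)))"
    and "\<kappa>K > 0" and "\<theta>0 \<in> D"
  shows "conv_in_law_on P conv
           (\<lambda>n \<omega>. (1 / \<epsilon> n) *\<^sub>R (\<theta>bar n \<omega> - \<theta>s))
           (gaussian 0 (matrix_inv H ** \<Gamma> ** transpose (matrix_inv H)))
       \<and> (\<forall>C \<kappa>C. \<kappa>C > 0 \<and> cost_functions D C \<theta>s M \<kappa>C \<longrightarrow>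
           (AE \<omega> in P. \<omega> \<in> conv \<longrightarrow>
              \<epsilon> \<sim>[sequentially]
              (\<lambda>n. sqrt \<kappa>C / (2 * \<alpha>)
                   * (((\<rho> + 1) / (\<phi> + 1)) / sqrt (2 * ((\<rho> + 1) / (\<phi> + 1)) - 1))
                   * (log M (algorithm_cost C M K s \<theta> n \<omega>) / sqrt (algorithm_cost C M K s \<theta> n \<omega>)))))"
proof -
  interpret prob_space P by fact
  have app: "\<forall>k\<ge>1. param_measurable D \<U> (Fk k) \<and> (\<forall>\<theta>\<in>D. integrable P (\<lambda>\<omega>. Fk k \<theta> (U \<omega>)))"
    "var_condition P U D Fk \<theta>s M \<Gamma>" "tail_condition P U D Fk \<theta>s M"
    using \<open>approximations P \<U> U D F Fk \<theta>s M \<alpha> \<Gamma>\<close> unfolding approximations_def by blast+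
  have \<theta>s: "\<theta>s \<in> interior D"
    using \<open>contracting_zero D f H \<theta>s\<close> by (simp add: contracting_zero_def)
  interpret A: mlsa lam M \<alpha> \<phi> \<rho> \<psi> \<kappa>K alphas s P \<U> U UU D Proj F Fk \<theta>s \<theta>0 H \<Gamma>
  proof unfold_locales
    show "Proj x \<in> D" for x using \<open>\<forall>x. Proj x \<in> D\<close> by blast
    show "Proj x = x" if "x \<in> D" for x using \<open>\<forall>x\<in>D. Proj x = x\<close> that by blast
    show "Proj x \<in> frontier D" if "x \<notin> D" for x using \<open>\<forall>x. x \<notin> D \<longrightarrow> Proj x \<in> frontier D\<close> that by blast
    show "distr P \<U> (UU n k l) = distr P \<U> U" if "n \<ge> 1" "k \<ge> 1" "l \<ge> 1" for n k l
      using \<open>\<forall>n\<ge>1. \<forall>k\<ge>1. \<forall>l\<ge>1. distr P \<U> (UU n k l) = distr P \<U> U\<close> that by blast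
    show "param_measurable D \<U> (Fk k)" if "k \<ge> 1" for k using app(1) that by blast
    show "integrable P (\<lambda>\<omega>. Fk k x (U \<omega>))" if "k \<ge> 1" "x \<in> D" for k x using app(1) that by blast
  qed fact+
  have \<gamma>: "\<gamma> = A.step_size" by (simp add: \<gamma>_def A.step_size_def[abs_def])
  have K: "K = A.samples" by (simp add: K_def A.samples_def[abs_def])
  have b: "b = A.wt" by (simp add: b_def A.wt_def[abs_def])
  obtain \<delta> c LS q CT CB CL S k1 where loc:
    "mlsa_local lam M \<alpha> \<phi> \<rho> \<psi> \<kappa>K alphas s P \<U> U UU D Proj F Fk \<theta>s \<theta>0 H \<Gamma> \<delta> c LS q CT CB CL S k1"
    using A.local_constants[OF \<open>contracting_zero D f H \<theta>s\<close>[unfolded f_def]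
      \<open>(\<lambda>x. norm (f x - H *v (x - \<theta>s))) \<in> O[at \<theta>s within D](\<lambda>x. norm (x - \<theta>s) powr (1 + lam))\<close>[unfolded f_def]
      app(3,2) \<open>bias_condition P U D F Fk \<theta>s M \<alpha> alphas\<close>] by (elim exE)
  have "conv_in_law_on P conv (\<lambda>n \<omega>. (1 / \<epsilon> n) *\<^sub>R (\<theta>bar n \<omega> - \<theta>s))
    (gaussian 0 (matrix_inv H ** \<Gamma> ** transpose (matrix_inv H)))"
    unfolding \<epsilon>_def \<theta>bar_def conv_def \<theta>_def \<gamma> K b
    by (rule mlsa_local.central_limit_iterates[OF loc])
  \<comment> \<open>The cost statement holds for every path in the event, which is stronger than
    almost surely.\<close>
  moreover have "\<epsilon> \<sim>[sequentially] (\<lambda>n. sqrt \<kappa>C / (2 * \<alpha>)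
      * (((\<rho> + 1) / (\<phi> + 1)) / sqrt (2 * ((\<rho> + 1) / (\<phi> + 1)) - 1))
      * (log M (algorithm_cost C M K s \<theta> n \<omega>) / sqrt (algorithm_cost C M K s \<theta> n \<omega>)))"
    if "\<kappa>C > 0" "cost_functions D C \<theta>s M \<kappa>C" "\<omega> \<in> conv" for C \<kappa>C \<omega>
    using A.eps_cost_iterates[OF that(2,1)] that(3)
    unfolding \<epsilon>_def conv_def \<theta>_def \<gamma> K by simp
  ultimately show ?thesis by blast
qed

end
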